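(* Assume set replacement. Let \(\mathcal V\) be a univalent universe. Then the ordinal \(\mathrm{Ord}_{\mathcal V}\) of ordinals in \(\mathcal V\) has suprema of families indexed by types in \(\mathcal V\): for every \(I:\mathcal V\) and \(\alpha:I\to\mathrm{Ord}_{\mathcal V}\) there is \(\hat\alpha:\mathrm{Ord}_{\mathcal V}\) with \(\alpha_i\preceq\hat\alpha\) for all \(i\), and \(\hat\alpha\preceq\beta\) for every \(\beta:\mathrm{Ord}_{\mathcal V}\) with \(\alpha_i\preceq\beta\) for all \(i:I\).
   Context: Work in univalent foundations (intensional Martin-Löf type theory with universes, function and propositional extensionality, propositional truncations in each universe). An ordinal is a type with a proposition-valued, transitive, extensional and (inductively) well-founded relation \(\prec\). \(\mathrm{Ord}_{\mathcal V}\) is the type of ordinals whose carrier is in \(\mathcal V\). For \(y:\beta\), \(\beta\downarrow y\) is the ordinal of elements \(b\prec y\). A simulation \(f:\alpha\to\beta\) is a map preserving \(\prec\) such that whenever \(y\prec f(x)\) there is \(x'\prec x\) with \(f(x')=y\). Write \(\alpha\preceq\beta\) if there is a simulation \(\alpha\to\beta\). Set replacement: for all universes \(\mathcal U,\mathcal V\), the image \(\Sigma_{y:Y}\exists_{x:X}(f(x)=y)\) of any map \(f:X\to Y\) with \(X\) equivalent to a type in \(\mathcal U\) and \(Y\) a set whose identity types are equivalent to types in \(\mathcal V\) is equivalent to a type in \(\mathcal U\sqcup\mathcal V\). *)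

theory Defs
  imports Main
begin

text \<open>
  Univalent foundations are not an extension of HOL: its types carry proof-relevant identity types,
  and univalence contradicts reading them as HOL sets or HOL types. The object theory is
  therefore formalised as a formal system, and an internal statement is asserted by asserting that
  its type is inhabited by a closed term of that system.

  The system is intensional Martin-Loef type theory with a non-cumulative sequence of universes
  \<open>Univ 0, Univ 1, \<dots>\<close> (Russell style; every type is a term of some universe), dependent products and
  sums, identity types, empty and unit types (a copy in each universe), binary sums, natural
  numbers, the inductive accessibility predicate, and propositional truncations in each universe.
  Function extensionality, propositional extensionality, univalence and set replacement are not
  built in.
\<close>


section \<open>Raw terms\<close>

text \<open>
  Variables are de Bruijn indices. \<open>Pi A B\<close>, \<open>Sig A B\<close> and \<open>Lam A b\<close> bind one variable in their
  second argument; nothing else binds. Motives and branches of eliminators are functions of the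
  object theory. \<open>Post A\<close> is a postulated element of a closed type \<open>A\<close>.
\<close>

datatype tm =
    Var nat
  | Univ nat
  | Pi tm tm | Lam tm tm | App tm tm
  | Sig tm tm | Pair tm tm | IndSig tm tm tm
  | Eq tm tm tm | Refl tm | IndEq tm tm tm tm
  | Empty nat | IndEmpty tm tm
  | Unit nat | Star | IndUnit tm tm tm
  | Sum tm tm | Inl tm | Inr tm | IndSum tm tm tm tm
  | Nat | Zero | Succ tm | IndNat tm tm tm tm
  | Acc tm tm tm | AccI tm tm | IndAcc tm tm tm tm tm tm
  | Trunc tm | TrI tm | TrEq tm tm | RecTr tm tm tm tm
  | Post tm

primrec ren :: "(nat \<Rightarrow> nat) \<Rightarrow> tm \<Rightarrow> tm" where
  "ren r (Var n) = Var (r n)"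
| "ren r (Univ i) = Univ i"
| "ren r (Pi A B) = Pi (ren r A) (ren (case_nat 0 (\<lambda>n. Suc (r n))) B)"
| "ren r (Lam A b) = Lam (ren r A) (ren (case_nat 0 (\<lambda>n. Suc (r n))) b)"
| "ren r (App f a) = App (ren r f) (ren r a)"
| "ren r (Sig A B) = Sig (ren r A) (ren (case_nat 0 (\<lambda>n. Suc (r n))) B)"
| "ren r (Pair a b) = Pair (ren r a) (ren r b)"
| "ren r (IndSig C g p) = IndSig (ren r C) (ren r g) (ren r p)"
| "ren r (Eq A a b) = Eq (ren r A) (ren r a) (ren r b)"
| "ren r (Refl a) = Refl (ren r a)"
| "ren r (IndEq C c b p) = IndEq (ren r C) (ren r c) (ren r b) (ren r p)"
| "ren r (Empty i) = Empty i"
| "ren r (IndEmpty C e) = IndEmpty (ren r C) (ren r e)"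
| "ren r (Unit i) = Unit i"
| "ren r Star = Star"
| "ren r (IndUnit C c u) = IndUnit (ren r C) (ren r c) (ren r u)"
| "ren r (Sum A B) = Sum (ren r A) (ren r B)"
| "ren r (Inl a) = Inl (ren r a)"
| "ren r (Inr b) = Inr (ren r b)"
| "ren r (IndSum C f g s) = IndSum (ren r C) (ren r f) (ren r g) (ren r s)"
| "ren r Nat = Nat"
| "ren r Zero = Zero"
| "ren r (Succ n) = Succ (ren r n)"
| "ren r (IndNat C z s n) = IndNat (ren r C) (ren r z) (ren r s) (ren r n)"
| "ren r (Acc A R a) = Acc (ren r A) (ren r R) (ren r a)"
| "ren r (AccI a h) = AccI (ren r a) (ren r h)"
| "ren r (IndAcc A R C s a p) =
     IndAcc (ren r A) (ren r R) (ren r C) (ren r s) (ren r a) (ren r p)"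
| "ren r (Trunc A) = Trunc (ren r A)"
| "ren r (TrI a) = TrI (ren r a)"
| "ren r (TrEq x y) = TrEq (ren r x) (ren r y)"
| "ren r (RecTr B q f x) = RecTr (ren r B) (ren r q) (ren r f) (ren r x)"
| "ren r (Post A) = Post A"

abbreviation lift :: "tm \<Rightarrow> tm" where
  "lift \<equiv> ren Suc"

primrec sub :: "(nat \<Rightarrow> tm) \<Rightarrow> tm \<Rightarrow> tm" where
  "sub s (Var n) = s n"
| "sub s (Univ i) = Univ i"
| "sub s (Pi A B) = Pi (sub s A) (sub (case_nat (Var 0) (\<lambda>n. lift (s n))) B)"
| "sub s (Lam A b) = Lam (sub s A) (sub (case_nat (Var 0) (\<lambda>n. lift (s n))) b)"
| "sub s (App f a) = App (sub s f) (sub s a)"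
| "sub s (Sig A B) = Sig (sub s A) (sub (case_nat (Var 0) (\<lambda>n. lift (s n))) B)"
| "sub s (Pair a b) = Pair (sub s a) (sub s b)"
| "sub s (IndSig C g p) = IndSig (sub s C) (sub s g) (sub s p)"
| "sub s (Eq A a b) = Eq (sub s A) (sub s a) (sub s b)"
| "sub s (Refl a) = Refl (sub s a)"
| "sub s (IndEq C c b p) = IndEq (sub s C) (sub s c) (sub s b) (sub s p)"
| "sub s (Empty i) = Empty i"
| "sub s (IndEmpty C e) = IndEmpty (sub s C) (sub s e)"
| "sub s (Unit i) = Unit i"
| "sub s Star = Star"
| "sub s (IndUnit C c u) = IndUnit (sub s C) (sub s c) (sub s u)"
| "sub s (Sum A B) = Sum (sub s A) (sub s B)"
| "sub s (Inl a) = Inl (sub s a)"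
| "sub s (Inr b) = Inr (sub s b)"
| "sub s (IndSum C f g t) = IndSum (sub s C) (sub s f) (sub s g) (sub s t)"
| "sub s Nat = Nat"
| "sub s Zero = Zero"
| "sub s (Succ n) = Succ (sub s n)"
| "sub s (IndNat C z t n) = IndNat (sub s C) (sub s z) (sub s t) (sub s n)"
| "sub s (Acc A R a) = Acc (sub s A) (sub s R) (sub s a)"
| "sub s (AccI a h) = AccI (sub s a) (sub s h)"
| "sub s (IndAcc A R C t a p) =
     IndAcc (sub s A) (sub s R) (sub s C) (sub s t) (sub s a) (sub s p)"
| "sub s (Trunc A) = Trunc (sub s A)"
| "sub s (TrI a) = TrI (sub s a)"
| "sub s (TrEq x y) = TrEq (sub s x) (sub s y)"
| "sub s (RecTr B q f x) = RecTr (sub s B) (sub s q) (sub s f) (sub s x)"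
| "sub s (Post A) = Post A"

abbreviation inst :: "tm \<Rightarrow> tm \<Rightarrow> tm" where
  "inst B a \<equiv> sub (case_nat a Var) B"

abbreviation Arr :: "tm \<Rightarrow> tm \<Rightarrow> tm" where
  "Arr A B \<equiv> Pi A (lift B)"

abbreviation App2 :: "tm \<Rightarrow> tm \<Rightarrow> tm \<Rightarrow> tm" where
  "App2 f a b \<equiv> App (App f a) b"

abbreviation App3 :: "tm \<Rightarrow> tm \<Rightarrow> tm \<Rightarrow> tm \<Rightarrow> tm" where
  "App3 f a b c \<equiv> App (App2 f a b) c"


section \<open>Judgemental equality\<close>

text \<open>
  The congruence generated by the computation rules and by eta for functions, on raw terms. The
  conversion rule of the typing judgement uses it only between well-formed types. Truncations have
  no judgemental computation rule, and there is no judgemental eta for sums.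
\<close>

inductive conv :: "tm \<Rightarrow> tm \<Rightarrow> bool"  (infix \<open>\<cong>\<close> 50) where
  conv_refl: "a \<cong> a"
| conv_sym: "a \<cong> b \<Longrightarrow> b \<cong> a"
| conv_trans: "a \<cong> b \<Longrightarrow> b \<cong> c \<Longrightarrow> a \<cong> c"

| beta: "App (Lam A b) a \<cong> inst b a"
| eta: "Lam A (App (lift f) (Var 0)) \<cong> f"
| comp_Sig: "IndSig C g (Pair a b) \<cong> App2 g a b"
| comp_Eq: "IndEq C c b (Refl a) \<cong> c"
| comp_Unit: "IndUnit C c Star \<cong> c"
| comp_Inl: "IndSum C f g (Inl a) \<cong> App f a"
| comp_Inr: "IndSum C f g (Inr b) \<cong> App g b"
| comp_Zero: "IndNat C z s Zero \<cong> z"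
| comp_Succ: "IndNat C z s (Succ n) \<cong> App2 s n (IndNat C z s n)"
| comp_Acc: "IndAcc A R C s a (AccI a' h) \<cong>
    App3 s a' h
      (Lam A (Lam (App2 (lift R) (Var 0) (lift a'))
        (IndAcc (lift (lift A)) (lift (lift R)) (lift (lift C)) (lift (lift s))
          (Var 1) (App2 (lift (lift h)) (Var 1) (Var 0)))))"

| cong_Pi: "A \<cong> A' \<Longrightarrow> B \<cong> B' \<Longrightarrow> Pi A B \<cong> Pi A' B'"
| cong_Lam: "A \<cong> A' \<Longrightarrow> b \<cong> b' \<Longrightarrow> Lam A b \<cong> Lam A' b'"
| cong_App: "f \<cong> f' \<Longrightarrow> a \<cong> a' \<Longrightarrow> App f a \<cong> App f' a'"
| cong_Sig: "A \<cong> A' \<Longrightarrow> B \<cong> B' \<Longrightarrow> Sig A B \<cong> Sig A' B'"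
| cong_Pair: "a \<cong> a' \<Longrightarrow> b \<cong> b' \<Longrightarrow> Pair a b \<cong> Pair a' b'"
| cong_IndSig: "C \<cong> C' \<Longrightarrow> g \<cong> g' \<Longrightarrow> p \<cong> p' \<Longrightarrow> IndSig C g p \<cong> IndSig C' g' p'"
| cong_Eq: "A \<cong> A' \<Longrightarrow> a \<cong> a' \<Longrightarrow> b \<cong> b' \<Longrightarrow> Eq A a b \<cong> Eq A' a' b'"
| cong_Refl: "a \<cong> a' \<Longrightarrow> Refl a \<cong> Refl a'"
| cong_IndEq: "C \<cong> C' \<Longrightarrow> c \<cong> c' \<Longrightarrow> b \<cong> b' \<Longrightarrow> p \<cong> p' \<Longrightarrow>
    IndEq C c b p \<cong> IndEq C' c' b' p'"
| cong_IndEmpty: "C \<cong> C' \<Longrightarrow> e \<cong> e' \<Longrightarrow> IndEmpty C e \<cong> IndEmpty C' e'"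
| cong_IndUnit: "C \<cong> C' \<Longrightarrow> c \<cong> c' \<Longrightarrow> u \<cong> u' \<Longrightarrow> IndUnit C c u \<cong> IndUnit C' c' u'"
| cong_Sum: "A \<cong> A' \<Longrightarrow> B \<cong> B' \<Longrightarrow> Sum A B \<cong> Sum A' B'"
| cong_Inl: "a \<cong> a' \<Longrightarrow> Inl a \<cong> Inl a'"
| cong_Inr: "b \<cong> b' \<Longrightarrow> Inr b \<cong> Inr b'"
| cong_IndSum: "C \<cong> C' \<Longrightarrow> f \<cong> f' \<Longrightarrow> g \<cong> g' \<Longrightarrow> s \<cong> s' \<Longrightarrow>
    IndSum C f g s \<cong> IndSum C' f' g' s'"
| cong_Succ: "n \<cong> n' \<Longrightarrow> Succ n \<cong> Succ n'"
| cong_IndNat: "C \<cong> C' \<Longrightarrow> z \<cong> z' \<Longrightarrow> s \<cong> s' \<Longrightarrow> n \<cong> n' \<Longrightarrow>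
    IndNat C z s n \<cong> IndNat C' z' s' n'"
| cong_Acc: "A \<cong> A' \<Longrightarrow> R \<cong> R' \<Longrightarrow> a \<cong> a' \<Longrightarrow> Acc A R a \<cong> Acc A' R' a'"
| cong_AccI: "a \<cong> a' \<Longrightarrow> h \<cong> h' \<Longrightarrow> AccI a h \<cong> AccI a' h'"
| cong_IndAcc: "A \<cong> A' \<Longrightarrow> R \<cong> R' \<Longrightarrow> C \<cong> C' \<Longrightarrow> s \<cong> s' \<Longrightarrow> a \<cong> a' \<Longrightarrow> p \<cong> p' \<Longrightarrow>
    IndAcc A R C s a p \<cong> IndAcc A' R' C' s' a' p'"
| cong_Trunc: "A \<cong> A' \<Longrightarrow> Trunc A \<cong> Trunc A'"
| cong_TrI: "a \<cong> a' \<Longrightarrow> TrI a \<cong> TrI a'"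
| cong_TrEq: "x \<cong> x' \<Longrightarrow> y \<cong> y' \<Longrightarrow> TrEq x y \<cong> TrEq x' y'"
| cong_RecTr: "B \<cong> B' \<Longrightarrow> q \<cong> q' \<Longrightarrow> f \<cong> f' \<Longrightarrow> x \<cong> x' \<Longrightarrow>
    RecTr B q f x \<cong> RecTr B' q' f' x'"


section \<open>Contexts and typing\<close>

text \<open>
  A context lists the types of the variables, index 0 first. \<open>\<langle>\<A>\<rangle> \<Gamma> \<turnstile> t \<^bold>: A\<close> is typing in the
  extension of the basic theory by a postulated element of each type in \<open>\<A>\<close>. In \<open>Acc A R a\<close>, the
  predecessors of \<open>a\<close> are the \<open>b\<close> with an element of \<open>R b a\<close>. Truncations eliminate into
  propositions of every universe.
\<close>

inductive
  ctx :: "tm set \<Rightarrow> tm list \<Rightarrow> bool"  (\<open>\<langle>_\<rangle> \<turnstile> _\<close> [0, 50] 50) and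
  typing :: "tm set \<Rightarrow> tm list \<Rightarrow> tm \<Rightarrow> tm \<Rightarrow> bool"  (\<open>\<langle>_\<rangle> _ \<turnstile> _ \<^bold>: _\<close> [0, 51, 51, 51] 50)
  for \<A> :: "tm set" where
  ctx_Nil: "\<langle>\<A>\<rangle> \<turnstile> []"
| ctx_Cons: "\<langle>\<A>\<rangle> \<turnstile> \<Gamma> \<Longrightarrow> \<langle>\<A>\<rangle> \<Gamma> \<turnstile> A \<^bold>: Univ i \<Longrightarrow> \<langle>\<A>\<rangle> \<turnstile> A # \<Gamma>"

| ty_Var: "\<langle>\<A>\<rangle> \<turnstile> \<Gamma> \<Longrightarrow> n < length \<Gamma> \<Longrightarrow> \<langle>\<A>\<rangle> \<Gamma> \<turnstile> Var n \<^bold>: ren (\<lambda>k. Suc n + k) (\<Gamma> ! n)"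
| ty_conv: "\<langle>\<A>\<rangle> \<Gamma> \<turnstile> t \<^bold>: A \<Longrightarrow> A \<cong> B \<Longrightarrow> \<langle>\<A>\<rangle> \<Gamma> \<turnstile> B \<^bold>: Univ i \<Longrightarrow> \<langle>\<A>\<rangle> \<Gamma> \<turnstile> t \<^bold>: B"
| ty_Post: "\<langle>\<A>\<rangle> \<turnstile> \<Gamma> \<Longrightarrow> A \<in> \<A> \<Longrightarrow> \<langle>\<A>\<rangle> [] \<turnstile> A \<^bold>: Univ i \<Longrightarrow> \<langle>\<A>\<rangle> \<Gamma> \<turnstile> Post A \<^bold>: A"

| ty_Univ: "\<langle>\<A>\<rangle> \<turnstile> \<Gamma> \<Longrightarrow> \<langle>\<A>\<rangle> \<Gamma> \<turnstile> Univ i \<^bold>: Univ (Suc i)"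

| ty_Pi: "\<langle>\<A>\<rangle> \<Gamma> \<turnstile> A \<^bold>: Univ i \<Longrightarrow> \<langle>\<A>\<rangle> (A # \<Gamma>) \<turnstile> B \<^bold>: Univ j \<Longrightarrow>
    \<langle>\<A>\<rangle> \<Gamma> \<turnstile> Pi A B \<^bold>: Univ (max i j)"
| ty_Lam: "\<langle>\<A>\<rangle> \<Gamma> \<turnstile> A \<^bold>: Univ i \<Longrightarrow> \<langle>\<A>\<rangle> (A # \<Gamma>) \<turnstile> b \<^bold>: B \<Longrightarrow> \<langle>\<A>\<rangle> \<Gamma> \<turnstile> Lam A b \<^bold>: Pi A B"
| ty_App: "\<langle>\<A>\<rangle> \<Gamma> \<turnstile> f \<^bold>: Pi A B \<Longrightarrow> \<langle>\<A>\<rangle> \<Gamma> \<turnstile> a \<^bold>: A \<Longrightarrow> \<langle>\<A>\<rangle> \<Gamma> \<turnstile> App f a \<^bold>: inst B a"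

| ty_Sig: "\<langle>\<A>\<rangle> \<Gamma> \<turnstile> A \<^bold>: Univ i \<Longrightarrow> \<langle>\<A>\<rangle> (A # \<Gamma>) \<turnstile> B \<^bold>: Univ j \<Longrightarrow>
    \<langle>\<A>\<rangle> \<Gamma> \<turnstile> Sig A B \<^bold>: Univ (max i j)"
| ty_Pair: "\<langle>\<A>\<rangle> (A # \<Gamma>) \<turnstile> B \<^bold>: Univ j \<Longrightarrow> \<langle>\<A>\<rangle> \<Gamma> \<turnstile> a \<^bold>: A \<Longrightarrow> \<langle>\<A>\<rangle> \<Gamma> \<turnstile> b \<^bold>: inst B a \<Longrightarrow>
    \<langle>\<A>\<rangle> \<Gamma> \<turnstile> Pair a b \<^bold>: Sig A B"
| ty_IndSig: "\<langle>\<A>\<rangle> \<Gamma> \<turnstile> C \<^bold>: Arr (Sig A B) (Univ k) \<Longrightarrow>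
    \<langle>\<A>\<rangle> \<Gamma> \<turnstile> g \<^bold>: Pi A (Pi B (App (lift (lift C)) (Pair (Var 1) (Var 0)))) \<Longrightarrow>
    \<langle>\<A>\<rangle> \<Gamma> \<turnstile> p \<^bold>: Sig A B \<Longrightarrow>
    \<langle>\<A>\<rangle> \<Gamma> \<turnstile> IndSig C g p \<^bold>: App C p"

| ty_Eq: "\<langle>\<A>\<rangle> \<Gamma> \<turnstile> A \<^bold>: Univ i \<Longrightarrow> \<langle>\<A>\<rangle> \<Gamma> \<turnstile> a \<^bold>: A \<Longrightarrow> \<langle>\<A>\<rangle> \<Gamma> \<turnstile> b \<^bold>: A \<Longrightarrow>
    \<langle>\<A>\<rangle> \<Gamma> \<turnstile> Eq A a b \<^bold>: Univ i"
| ty_Refl: "\<langle>\<A>\<rangle> \<Gamma> \<turnstile> a \<^bold>: A \<Longrightarrow> \<langle>\<A>\<rangle> \<Gamma> \<turnstile> Refl a \<^bold>: Eq A a a"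
| ty_IndEq: "\<langle>\<A>\<rangle> \<Gamma> \<turnstile> C \<^bold>: Pi A (Arr (Eq (lift A) (lift a) (Var 0)) (Univ k)) \<Longrightarrow>
    \<langle>\<A>\<rangle> \<Gamma> \<turnstile> c \<^bold>: App2 C a (Refl a) \<Longrightarrow>
    \<langle>\<A>\<rangle> \<Gamma> \<turnstile> b \<^bold>: A \<Longrightarrow> \<langle>\<A>\<rangle> \<Gamma> \<turnstile> p \<^bold>: Eq A a b \<Longrightarrow>
    \<langle>\<A>\<rangle> \<Gamma> \<turnstile> IndEq C c b p \<^bold>: App2 C b p"

| ty_Empty: "\<langle>\<A>\<rangle> \<turnstile> \<Gamma> \<Longrightarrow> \<langle>\<A>\<rangle> \<Gamma> \<turnstile> Empty i \<^bold>: Univ i"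
| ty_IndEmpty: "\<langle>\<A>\<rangle> \<Gamma> \<turnstile> C \<^bold>: Arr (Empty i) (Univ k) \<Longrightarrow> \<langle>\<A>\<rangle> \<Gamma> \<turnstile> e \<^bold>: Empty i \<Longrightarrow>
    \<langle>\<A>\<rangle> \<Gamma> \<turnstile> IndEmpty C e \<^bold>: App C e"

| ty_Unit: "\<langle>\<A>\<rangle> \<turnstile> \<Gamma> \<Longrightarrow> \<langle>\<A>\<rangle> \<Gamma> \<turnstile> Unit i \<^bold>: Univ i"
| ty_Star: "\<langle>\<A>\<rangle> \<turnstile> \<Gamma> \<Longrightarrow> \<langle>\<A>\<rangle> \<Gamma> \<turnstile> Star \<^bold>: Unit i"
| ty_IndUnit: "\<langle>\<A>\<rangle> \<Gamma> \<turnstile> C \<^bold>: Arr (Unit i) (Univ k) \<Longrightarrow> \<langle>\<A>\<rangle> \<Gamma> \<turnstile> c \<^bold>: App C Star \<Longrightarrow>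
    \<langle>\<A>\<rangle> \<Gamma> \<turnstile> u \<^bold>: Unit i \<Longrightarrow>
    \<langle>\<A>\<rangle> \<Gamma> \<turnstile> IndUnit C c u \<^bold>: App C u"

| ty_Sum: "\<langle>\<A>\<rangle> \<Gamma> \<turnstile> A \<^bold>: Univ i \<Longrightarrow> \<langle>\<A>\<rangle> \<Gamma> \<turnstile> B \<^bold>: Univ j \<Longrightarrow> \<langle>\<A>\<rangle> \<Gamma> \<turnstile> Sum A B \<^bold>: Univ (max i j)"
| ty_Inl: "\<langle>\<A>\<rangle> \<Gamma> \<turnstile> B \<^bold>: Univ j \<Longrightarrow> \<langle>\<A>\<rangle> \<Gamma> \<turnstile> a \<^bold>: A \<Longrightarrow> \<langle>\<A>\<rangle> \<Gamma> \<turnstile> Inl a \<^bold>: Sum A B"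
| ty_Inr: "\<langle>\<A>\<rangle> \<Gamma> \<turnstile> A \<^bold>: Univ i \<Longrightarrow> \<langle>\<A>\<rangle> \<Gamma> \<turnstile> b \<^bold>: B \<Longrightarrow> \<langle>\<A>\<rangle> \<Gamma> \<turnstile> Inr b \<^bold>: Sum A B"
| ty_IndSum: "\<langle>\<A>\<rangle> \<Gamma> \<turnstile> C \<^bold>: Arr (Sum A B) (Univ k) \<Longrightarrow>
    \<langle>\<A>\<rangle> \<Gamma> \<turnstile> f \<^bold>: Pi A (App (lift C) (Inl (Var 0))) \<Longrightarrow>
    \<langle>\<A>\<rangle> \<Gamma> \<turnstile> g \<^bold>: Pi B (App (lift C) (Inr (Var 0))) \<Longrightarrow>
    \<langle>\<A>\<rangle> \<Gamma> \<turnstile> s \<^bold>: Sum A B \<Longrightarrow>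
    \<langle>\<A>\<rangle> \<Gamma> \<turnstile> IndSum C f g s \<^bold>: App C s"

| ty_Nat: "\<langle>\<A>\<rangle> \<turnstile> \<Gamma> \<Longrightarrow> \<langle>\<A>\<rangle> \<Gamma> \<turnstile> Nat \<^bold>: Univ 0"
| ty_Zero: "\<langle>\<A>\<rangle> \<turnstile> \<Gamma> \<Longrightarrow> \<langle>\<A>\<rangle> \<Gamma> \<turnstile> Zero \<^bold>: Nat"
| ty_Succ: "\<langle>\<A>\<rangle> \<Gamma> \<turnstile> n \<^bold>: Nat \<Longrightarrow> \<langle>\<A>\<rangle> \<Gamma> \<turnstile> Succ n \<^bold>: Nat"
| ty_IndNat: "\<langle>\<A>\<rangle> \<Gamma> \<turnstile> C \<^bold>: Arr Nat (Univ k) \<Longrightarrow> \<langle>\<A>\<rangle> \<Gamma> \<turnstile> z \<^bold>: App C Zero \<Longrightarrow>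
    \<langle>\<A>\<rangle> \<Gamma> \<turnstile> s \<^bold>: Pi Nat (Arr (App (lift C) (Var 0)) (App (lift C) (Succ (Var 0)))) \<Longrightarrow>
    \<langle>\<A>\<rangle> \<Gamma> \<turnstile> n \<^bold>: Nat \<Longrightarrow>
    \<langle>\<A>\<rangle> \<Gamma> \<turnstile> IndNat C z s n \<^bold>: App C n"

| ty_Acc: "\<langle>\<A>\<rangle> \<Gamma> \<turnstile> A \<^bold>: Univ i \<Longrightarrow> \<langle>\<A>\<rangle> \<Gamma> \<turnstile> R \<^bold>: Arr A (Arr A (Univ j)) \<Longrightarrow> \<langle>\<A>\<rangle> \<Gamma> \<turnstile> a \<^bold>: A \<Longrightarrow>
    \<langle>\<A>\<rangle> \<Gamma> \<turnstile> Acc A R a \<^bold>: Univ (max i j)"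
| ty_AccI: "\<langle>\<A>\<rangle> \<Gamma> \<turnstile> R \<^bold>: Arr A (Arr A (Univ j)) \<Longrightarrow> \<langle>\<A>\<rangle> \<Gamma> \<turnstile> a \<^bold>: A \<Longrightarrow>
    \<langle>\<A>\<rangle> \<Gamma> \<turnstile> h \<^bold>: Pi A (Arr (App2 (lift R) (Var 0) (lift a)) (Acc (lift A) (lift R) (Var 0))) \<Longrightarrow>
    \<langle>\<A>\<rangle> \<Gamma> \<turnstile> AccI a h \<^bold>: Acc A R a"
| ty_IndAcc: "\<langle>\<A>\<rangle> \<Gamma> \<turnstile> C \<^bold>: Pi A (Arr (Acc (lift A) (lift R) (Var 0)) (Univ k)) \<Longrightarrow>
    \<langle>\<A>\<rangle> \<Gamma> \<turnstile> s \<^bold>: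
      Pi A
       (Pi (Pi (lift A)
             (Arr (App2 (lift (lift R)) (Var 0) (Var 1))
                  (Acc (lift (lift A)) (lift (lift R)) (Var 0))))
         (Arr (Pi (lift (lift A))
                (Pi (App2 (lift (lift (lift R))) (Var 0) (Var 2))
                  (App2 (lift (lift (lift (lift C)))) (Var 1) (App2 (Var 2) (Var 1) (Var 0)))))
              (App2 (lift (lift C)) (Var 1) (AccI (Var 1) (Var 0))))) \<Longrightarrow>
    \<langle>\<A>\<rangle> \<Gamma> \<turnstile> a \<^bold>: A \<Longrightarrow> \<langle>\<A>\<rangle> \<Gamma> \<turnstile> p \<^bold>: Acc A R a \<Longrightarrow>
    \<langle>\<A>\<rangle> \<Gamma> \<turnstile> IndAcc A R C s a p \<^bold>: App2 C a p"

| ty_Trunc: "\<langle>\<A>\<rangle> \<Gamma> \<turnstile> A \<^bold>: Univ i \<Longrightarrow> \<langle>\<A>\<rangle> \<Gamma> \<turnstile> Trunc A \<^bold>: Univ i"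
| ty_TrI: "\<langle>\<A>\<rangle> \<Gamma> \<turnstile> a \<^bold>: A \<Longrightarrow> \<langle>\<A>\<rangle> \<Gamma> \<turnstile> TrI a \<^bold>: Trunc A"
| ty_TrEq: "\<langle>\<A>\<rangle> \<Gamma> \<turnstile> x \<^bold>: Trunc A \<Longrightarrow> \<langle>\<A>\<rangle> \<Gamma> \<turnstile> y \<^bold>: Trunc A \<Longrightarrow>
    \<langle>\<A>\<rangle> \<Gamma> \<turnstile> TrEq x y \<^bold>: Eq (Trunc A) x y"
| ty_RecTr: "\<langle>\<A>\<rangle> \<Gamma> \<turnstile> B \<^bold>: Univ j \<Longrightarrow>
    \<langle>\<A>\<rangle> \<Gamma> \<turnstile> q \<^bold>: Pi B (Pi (lift B) (Eq (lift (lift B)) (Var 1) (Var 0))) \<Longrightarrow>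
    \<langle>\<A>\<rangle> \<Gamma> \<turnstile> f \<^bold>: Arr A B \<Longrightarrow> \<langle>\<A>\<rangle> \<Gamma> \<turnstile> x \<^bold>: Trunc A \<Longrightarrow>
    \<langle>\<A>\<rangle> \<Gamma> \<turnstile> RecTr B q f x \<^bold>: B"


section \<open>Named syntax for terms\<close>

text \<open>
  Internal definitions are written with named variables. An \<open>expr\<close> is a term as a function of the
  number of variables bound around it; a bound variable is represented by its binding depth, from
  which its de Bruijn index at the place of use is computed. \<open>closed e\<close> is the closed term
  denoted by \<open>e\<close>.
\<close>

type_synonym expr = "nat \<Rightarrow> tm"

definition closed :: "expr \<Rightarrow> tm" where
  "closed e = e 0"

definition bound :: "nat \<Rightarrow> expr" where
  "bound d = (\<lambda>n. Var (n - Suc d))"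

definition ePi :: "expr \<Rightarrow> (expr \<Rightarrow> expr) \<Rightarrow> expr" where
  "ePi A B = (\<lambda>n. Pi (A n) (B (bound n) (Suc n)))"

definition eSig :: "expr \<Rightarrow> (expr \<Rightarrow> expr) \<Rightarrow> expr" where
  "eSig A B = (\<lambda>n. Sig (A n) (B (bound n) (Suc n)))"

definition eLam :: "expr \<Rightarrow> (expr \<Rightarrow> expr) \<Rightarrow> expr" where
  "eLam A b = (\<lambda>n. Lam (A n) (b (bound n) (Suc n)))"

syntax
  "_ePi" :: "idt \<Rightarrow> expr \<Rightarrow> expr \<Rightarrow> expr"  (\<open>(3\<Pi> _\<in>_./ _)\<close> [0, 51, 10] 10)
  "_eSig" :: "idt \<Rightarrow> expr \<Rightarrow> expr \<Rightarrow> expr"  (\<open>(3\<Sigma> _\<in>_./ _)\<close> [0, 51, 10] 10)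
  "_eLam" :: "idt \<Rightarrow> expr \<Rightarrow> expr \<Rightarrow> expr"  (\<open>(3\<Lambda> _\<in>_./ _)\<close> [0, 51, 10] 10)
translations
  "\<Pi> x\<in>A. B" == "CONST ePi A (\<lambda>x. B)"
  "\<Sigma> x\<in>A. B" == "CONST eSig A (\<lambda>x. B)"
  "\<Lambda> x\<in>A. b" == "CONST eLam A (\<lambda>x. b)"

definition eU :: "nat \<Rightarrow> expr"  (\<open>\<U>\<close>) where
  "\<U> i = (\<lambda>n. Univ i)"

definition eApp :: "expr \<Rightarrow> expr \<Rightarrow> expr"  (infixl \<open>\<cdot>\<close> 80) where
  "f \<cdot> a = (\<lambda>n. App (f n) (a n))"

definition eArr :: "expr \<Rightarrow> expr \<Rightarrow> expr"  (infixr \<open>\<rightarrow>\<close> 55) where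
  "A \<rightarrow> B = (\<Pi> x\<in>A. B)"

definition eProd :: "expr \<Rightarrow> expr \<Rightarrow> expr"  (infixr \<open>\<otimes>\<close> 60) where
  "A \<otimes> B = (\<Sigma> x\<in>A. B)"

definition ePair :: "expr \<Rightarrow> expr \<Rightarrow> expr" where
  "ePair a b = (\<lambda>n. Pair (a n) (b n))"

definition eIndSig :: "expr \<Rightarrow> expr \<Rightarrow> expr \<Rightarrow> expr" where
  "eIndSig C g p = (\<lambda>n. IndSig (C n) (g n) (p n))"

definition eEq :: "expr \<Rightarrow> expr \<Rightarrow> expr \<Rightarrow> expr"  (\<open>(_ =\<^bsub>_\<^esub> _)\<close> [66, 0, 66] 65) where
  "(a =\<^bsub>A\<^esub> b) = (\<lambda>n. Eq (A n) (a n) (b n))"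

definition eRefl :: "expr \<Rightarrow> expr" where
  "eRefl a = (\<lambda>n. Refl (a n))"

definition eIndEq :: "expr \<Rightarrow> expr \<Rightarrow> expr \<Rightarrow> expr \<Rightarrow> expr" where
  "eIndEq C c b p = (\<lambda>n. IndEq (C n) (c n) (b n) (p n))"

definition eAcc :: "expr \<Rightarrow> expr \<Rightarrow> expr \<Rightarrow> expr" where
  "eAcc A R a = (\<lambda>n. Acc (A n) (R n) (a n))"

definition eTrunc :: "expr \<Rightarrow> expr"  (\<open>\<parallel>_\<parallel>\<close>) where
  "\<parallel>A\<parallel> = (\<lambda>n. Trunc (A n))"

definition proj1 :: "expr \<Rightarrow> (expr \<Rightarrow> expr) \<Rightarrow> expr \<Rightarrow> expr" where
  "proj1 A B p = eIndSig (\<Lambda> z\<in>(\<Sigma> x\<in>A. B x). A) (\<Lambda> x\<in>A. \<Lambda> y\<in>B x. x) p"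

definition proj2 :: "expr \<Rightarrow> (expr \<Rightarrow> expr) \<Rightarrow> expr \<Rightarrow> expr" where
  "proj2 A B p =
     eIndSig (\<Lambda> z\<in>(\<Sigma> x\<in>A. B x). B (proj1 A B z)) (\<Lambda> x\<in>A. \<Lambda> y\<in>B x. y) p"


section \<open>Propositions, sets, equivalences\<close>

definition isProp :: "expr \<Rightarrow> expr" where
  "isProp A = (\<Pi> x\<in>A. \<Pi> y\<in>A. x =\<^bsub>A\<^esub> y)"

definition isSet :: "expr \<Rightarrow> expr" where
  "isSet A = (\<Pi> x\<in>A. \<Pi> y\<in>A. isProp (x =\<^bsub>A\<^esub> y))"

text \<open>A map is an equivalence if it has a section and a retraction.\<close>
definition isEquiv :: "expr \<Rightarrow> expr \<Rightarrow> expr \<Rightarrow> expr" where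
  "isEquiv A B f =
     (\<Sigma> g\<in>B \<rightarrow> A. \<Pi> y\<in>B. f \<cdot> (g \<cdot> y) =\<^bsub>B\<^esub> y) \<otimes>
     (\<Sigma> h\<in>B \<rightarrow> A. \<Pi> x\<in>A. h \<cdot> (f \<cdot> x) =\<^bsub>A\<^esub> x)"

definition Equiv :: "expr \<Rightarrow> expr \<Rightarrow> expr"  (infix \<open>\<simeq>\<close> 65) where
  "A \<simeq> B = (\<Sigma> f\<in>A \<rightarrow> B. isEquiv A B f)"

definition idEquiv :: "expr \<Rightarrow> expr" where
  "idEquiv A = ePair (\<Lambda> x\<in>A. x)
     (ePair (ePair (\<Lambda> x\<in>A. x) (\<Lambda> x\<in>A. eRefl x)) (ePair (\<Lambda> x\<in>A. x) (\<Lambda> x\<in>A. eRefl x)))"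


section \<open>Extensionality and univalence\<close>

definition happly :: "expr \<Rightarrow> expr \<Rightarrow> expr \<Rightarrow> expr \<Rightarrow> expr" where
  "happly A B f g = (\<Lambda> p\<in>(f =\<^bsub>\<Pi> x\<in>A. B \<cdot> x\<^esub> g). \<Lambda> x\<in>A.
     eIndEq (\<Lambda> h\<in>(\<Pi> x\<in>A. B \<cdot> x). \<Lambda> q\<in>(f =\<^bsub>\<Pi> x\<in>A. B \<cdot> x\<^esub> h). f \<cdot> x =\<^bsub>B \<cdot> x\<^esub> h \<cdot> x)
       (eRefl (f \<cdot> x)) g p)"

definition funext :: "nat \<Rightarrow> nat \<Rightarrow> expr" where
  "funext i j = (\<Pi> A\<in>\<U> i. \<Pi> B\<in>A \<rightarrow> \<U> j. \<Pi> f\<in>(\<Pi> x\<in>A. B \<cdot> x). \<Pi> g\<in>(\<Pi> x\<in>A. B \<cdot> x).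
     isEquiv (f =\<^bsub>\<Pi> x\<in>A. B \<cdot> x\<^esub> g) (\<Pi> x\<in>A. f \<cdot> x =\<^bsub>B \<cdot> x\<^esub> g \<cdot> x) (happly A B f g))"

definition propext :: "nat \<Rightarrow> expr" where
  "propext i = (\<Pi> P\<in>\<U> i. \<Pi> Q\<in>\<U> i.
     isProp P \<rightarrow> isProp Q \<rightarrow> (P \<rightarrow> Q) \<rightarrow> (Q \<rightarrow> P) \<rightarrow> (P =\<^bsub>\<U> i\<^esub> Q))"

definition idtoeqv :: "nat \<Rightarrow> expr \<Rightarrow> expr \<Rightarrow> expr" where
  "idtoeqv i A B = (\<Lambda> p\<in>(A =\<^bsub>\<U> i\<^esub> B).
     eIndEq (\<Lambda> Y\<in>\<U> i. \<Lambda> q\<in>(A =\<^bsub>\<U> i\<^esub> Y). A \<simeq> Y) (idEquiv A) B p)"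

definition univalent :: "nat \<Rightarrow> expr" where
  "univalent i = (\<Pi> A\<in>\<U> i. \<Pi> B\<in>\<U> i. isEquiv (A =\<^bsub>\<U> i\<^esub> B) (A \<simeq> B) (idtoeqv i A B))"


section \<open>Set replacement\<close>

definition small :: "nat \<Rightarrow> expr \<Rightarrow> expr" where
  "small u X = (\<Sigma> Y\<in>\<U> u. Y \<simeq> X)"

definition locally_small :: "nat \<Rightarrow> expr \<Rightarrow> expr" where
  "locally_small u X = (\<Pi> x\<in>X. \<Pi> y\<in>X. small u (x =\<^bsub>X\<^esub> y))"

definition image :: "expr \<Rightarrow> expr \<Rightarrow> expr \<Rightarrow> expr" where
  "image X Y f = (\<Sigma> y\<in>Y. \<parallel>\<Sigma> x\<in>X. f \<cdot> x =\<^bsub>Y\<^esub> y\<parallel>)"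

text \<open>
  The instance for the universes \<open>u\<close> and \<open>v\<close> of the principle; \<open>X\<close> and \<open>Y\<close> themselves live in
  arbitrary universes \<open>k\<close> and \<open>l\<close>.
\<close>
definition set_replacement :: "nat \<Rightarrow> nat \<Rightarrow> nat \<Rightarrow> nat \<Rightarrow> expr" where
  "set_replacement u v k l = (\<Pi> X\<in>\<U> k. \<Pi> Y\<in>\<U> l. \<Pi> f\<in>X \<rightarrow> Y.
     small u X \<rightarrow> isSet Y \<rightarrow> locally_small v Y \<rightarrow> small (max u v) (image X Y f))"


section \<open>Ordinals\<close>

definition prop_valued :: "expr \<Rightarrow> expr \<Rightarrow> expr" where
  "prop_valued X R = (\<Pi> x\<in>X. \<Pi> y\<in>X. isProp (R \<cdot> x \<cdot> y))"

definition transitive :: "expr \<Rightarrow> expr \<Rightarrow> expr" where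
  "transitive X R = (\<Pi> x\<in>X. \<Pi> y\<in>X. \<Pi> z\<in>X. R \<cdot> x \<cdot> y \<rightarrow> R \<cdot> y \<cdot> z \<rightarrow> R \<cdot> x \<cdot> z)"

definition extensional :: "expr \<Rightarrow> expr \<Rightarrow> expr" where
  "extensional X R = (\<Pi> x\<in>X. \<Pi> y\<in>X.
     (\<Pi> z\<in>X. (R \<cdot> z \<cdot> x \<rightarrow> R \<cdot> z \<cdot> y) \<otimes> (R \<cdot> z \<cdot> y \<rightarrow> R \<cdot> z \<cdot> x)) \<rightarrow> (x =\<^bsub>X\<^esub> y))"

definition well_founded :: "expr \<Rightarrow> expr \<Rightarrow> expr" where
  "well_founded X R = (\<Pi> x\<in>X. eAcc X R x)"

definition is_ordinal :: "expr \<Rightarrow> expr \<Rightarrow> expr" where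
  "is_ordinal X R = prop_valued X R \<otimes> transitive X R \<otimes> extensional X R \<otimes> well_founded X R"

definition ordinal_structure :: "nat \<Rightarrow> expr \<Rightarrow> expr" where
  "ordinal_structure i X = (\<Sigma> R\<in>X \<rightarrow> X \<rightarrow> \<U> i. is_ordinal X R)"

definition Ord :: "nat \<Rightarrow> expr" where
  "Ord i = (\<Sigma> X\<in>\<U> i. ordinal_structure i X)"

definition carrier :: "nat \<Rightarrow> expr \<Rightarrow> expr" where
  "carrier i \<alpha> = proj1 (\<U> i) (ordinal_structure i) \<alpha>"

definition ord_rel :: "nat \<Rightarrow> expr \<Rightarrow> expr" where
  "ord_rel i \<alpha> =
     proj1 (carrier i \<alpha> \<rightarrow> carrier i \<alpha> \<rightarrow> \<U> i) (is_ordinal (carrier i \<alpha>))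
       (proj2 (\<U> i) (ordinal_structure i) \<alpha>)"

definition is_simulation :: "nat \<Rightarrow> expr \<Rightarrow> expr \<Rightarrow> expr \<Rightarrow> expr" where
  "is_simulation i \<alpha> \<beta> f =
     (\<Pi> x\<in>carrier i \<alpha>. \<Pi> x'\<in>carrier i \<alpha>.
        ord_rel i \<alpha> \<cdot> x \<cdot> x' \<rightarrow> ord_rel i \<beta> \<cdot> (f \<cdot> x) \<cdot> (f \<cdot> x')) \<otimes>
     (\<Pi> x\<in>carrier i \<alpha>. \<Pi> y\<in>carrier i \<beta>. ord_rel i \<beta> \<cdot> y \<cdot> (f \<cdot> x) \<rightarrow>
        (\<Sigma> x'\<in>carrier i \<alpha>. ord_rel i \<alpha> \<cdot> x' \<cdot> x \<otimes> (f \<cdot> x' =\<^bsub>carrier i \<beta>\<^esub> y)))"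

definition ord_le :: "nat \<Rightarrow> expr \<Rightarrow> expr \<Rightarrow> expr" where
  "ord_le i \<alpha> \<beta> = (\<Sigma> f\<in>carrier i \<alpha> \<rightarrow> carrier i \<beta>. is_simulation i \<alpha> \<beta> f)"

definition Ord_has_small_suprema :: "nat \<Rightarrow> expr" where
  "Ord_has_small_suprema i = (\<Pi> I\<in>\<U> i. \<Pi> \<alpha>\<in>I \<rightarrow> Ord i. \<Sigma> s\<in>Ord i.
     (\<Pi> j\<in>I. ord_le i (\<alpha> \<cdot> j) s) \<otimes>
     (\<Pi> \<beta>\<in>Ord i. (\<Pi> j\<in>I. ord_le i (\<alpha> \<cdot> j) \<beta>) \<rightarrow> ord_le i s \<beta>))"


section \<open>Inhabitation\<close>

definition inhabited :: "tm set \<Rightarrow> expr \<Rightarrow> bool"  (\<open>\<langle>_\<rangle> \<tturnstile> _\<close> [0, 51] 50) where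
  "\<langle>\<A>\<rangle> \<tturnstile> e \<longleftrightarrow> (\<exists>t. \<langle>\<A>\<rangle> [] \<turnstile> t \<^bold>: closed e)"

end

theory Submission
  imports Defs
begin

text \<open>
  A statement of the object theory is proved by a closed term of its type. The term is given piece by
  piece, and its typing is decided by a type checker for the object theory, which is proved sound and
  evaluated by rewriting.

  The supremum of ordinals \<open>X i\<close> is built as follows. By recursion on accessibility, \<open>E i x j y\<close>
  says that every predecessor of \<open>x\<close> in \<open>X i\<close> is related to a predecessor of \<open>y\<close> in \<open>X j\<close>, and
  conversely; so it says that the initial segments below \<open>x\<close> and \<open>y\<close> are isomorphic. Send a point \<open>x\<close>
  to the set of all points \<open>y\<close> that are related to a predecessor of \<open>x\<close>. The image of this map into
  subsets of \<open>\<Sigma>i. X i\<close> is small by set replacement, since subsets form a locally small set, and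
  membership induces an order on it that makes it an ordinal. It is the least upper bound because
  simulations out of the \<open>X i\<close> into an ordinal agree on related points.
\<close>

section \<open>Renaming, substitution and typing\<close>

text \<open>Two constraints shape the terms. A lemma used in a later derivation is a variable of the
  checked context, so it never unfolds: whatever has to compute is written out inline, and a
  construction with several components (quotient, bisimilarity, supremum) is handed on in
  continuation form, as an element of every \<open>C\<close> that can be reached from its
  components. Its user works over abstract components, for which conversion is cheap. Second, a
  simulation must return its predecessor in a plain \<open>\<Sigma>\<close>, whereas classes have
  representatives only up to truncation. The gap closes because the maps involved are injective into
  sets: the type of such predecessors is then a proposition, and truncated data may be eliminated
  into it. Where truncated existence is only going to be eliminated, it is phrased as elimination
  into all propositions of \<open>\<U> v\<close>. Subsets are a suitable target for the map because
  equality of two subsets is coded by a proposition in \<open>\<U> v\<close>, although their type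
  lives in \<open>\<U> (Suc v)\<close>.\<close>

abbreviation up :: "(nat \<Rightarrow> nat) \<Rightarrow> nat \<Rightarrow> nat" where
  "up r \<equiv> case_nat 0 (\<lambda>n. Suc (r n))"

abbreviation ups :: "(nat \<Rightarrow> tm) \<Rightarrow> nat \<Rightarrow> tm" where
  "ups s \<equiv> case_nat (Var 0) (\<lambda>n. lift (s n))"

lemma up_comp: "(\<lambda>n. up r (up q n)) = up (\<lambda>n. r (q n))"
  by (auto simp: fun_eq_iff split: nat.split)

lemma ups_up: "(\<lambda>n. ups s (up r n)) = ups (\<lambda>n. s (r n))"
  by (auto simp: fun_eq_iff split: nat.split)

lemma ren_ren: "ren r (ren q t) = ren (\<lambda>n. r (q n)) t"
  by (induction t arbitrary: r q) (simp_all add: up_comp)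

lemma up_ups: "(\<lambda>n. ren (up r) (ups s n)) = ups (\<lambda>n. ren r (s n))"
  by (auto simp: fun_eq_iff ren_ren split: nat.split)

lemma sub_ren: "sub s (ren r t) = sub (\<lambda>n. s (r n)) t"
  by (induction t arbitrary: r s) (simp_all add: ups_up)

lemma ren_sub: "ren r (sub s t) = sub (\<lambda>n. ren r (s n)) t"
  by (induction t arbitrary: r s) (simp_all add: up_ups)

lemma ups_ups: "(\<lambda>n. sub (ups s) (ups q n)) = ups (\<lambda>n. sub s (q n))"
  by (auto simp: fun_eq_iff ren_sub sub_ren split: nat.split)

lemma sub_sub: "sub s (sub q t) = sub (\<lambda>n. sub s (q n)) t"
  by (induction t arbitrary: s q) (simp_all add: ups_ups)

lemma ups_Var: "case_nat (Var 0) (\<lambda>n. Var (Suc n)) = Var"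
  by (auto simp: fun_eq_iff split: nat.split)

lemma sub_Var: "sub (\<lambda>n. Var n) t = t"
  by (induction t) (simp_all add: ups_Var)

lemma ups_Var_ren: "case_nat (Var 0) (\<lambda>n. Var (Suc (r n))) = (\<lambda>n. Var (up r n))"
  by (auto simp: fun_eq_iff split: nat.split)

lemma ren_eq_sub: "ren r t = sub (\<lambda>n. Var (r n)) t"
  by (induction t arbitrary: r) (simp_all add: ups_Var_ren)

lemma ren_id: "ren (\<lambda>n. n) t = t"
  by (simp add: ren_eq_sub sub_Var)

lemma sub_inst: "sub s (inst b a) = inst (sub (ups s) b) (sub s a)"
  by (simp add: sub_sub sub_ren sub_Var nat.case_distrib[of "sub s"] nat.case_distrib[of "sub (case_nat (sub s a) Var)"] cong: nat.case_cong)

lemma inst_lift: "inst (lift B) a = B"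
  by (simp add: sub_ren sub_Var)

lemma sub_ups_lift: "sub (ups s) (lift t) = lift (sub s t)"
  by (simp add: sub_ren ren_sub)

lemma ren_up_lift: "ren (up r) (lift t) = lift (ren r t)"
  by (simp add: ren_ren)

lemma ren_inst: "ren r (inst b a) = inst (ren (up r) b) (ren r a)"
proof -
  have "(\<lambda>n. ren r (case_nat a Var n)) = (\<lambda>n. case_nat (ren r a) Var (up r n))"
    by (auto simp: fun_eq_iff split: nat.split)
  then show ?thesis by (simp add: ren_sub sub_ren)
qed

text \<open>Only \<open>beta\<close>, \<open>eta\<close> and \<open>comp_Acc\<close> mention
  \<open>inst\<close> or \<open>lift\<close>, so only they need a commutation law; the other rules
  are closed under substitution as they stand.\<close>

lemma conv_sub: "a \<cong> b \<Longrightarrow> sub s a \<cong> sub s b"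
proof (induction arbitrary: s rule: conv.induct)
  case (conv_sym a b) then show ?case by (blast intro: conv.conv_sym)
next
  case (conv_trans a b c) then show ?case by (blast intro: conv.conv_trans)
next
  case (beta A b a) then show ?case using conv.beta by (simp add: sub_inst)
next
  case (eta A f) then show ?case using conv.eta by (simp add: sub_ups_lift)
next
  case (comp_Acc A R C s a a' h)
  then show ?case using conv.comp_Acc[of "sub s A" "sub s R" "sub s C" "sub s sa" "sub s a" "sub s a'" "sub s h" for sa]
    by (simp add: sub_ups_lift)
qed (auto intro: conv.intros)

lemma conv_ren: "a \<cong> b \<Longrightarrow> ren r a \<cong> ren r b"
  by (simp add: ren_eq_sub conv_sub)

lemma conv_inst: "a \<cong> b \<Longrightarrow> inst a c \<cong> inst b c"
  by (rule conv_sub)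

text \<open>The eta rule introduces an abstraction with an arbitrary annotation \<open>A\<close>;
  contracting the beta redex below it leaves \<open>Lam A b\<close>. So conversion does not see
  annotations, and a comparison of two abstractions may look at the bodies alone.\<close>

lemma Lam_annotation: "Lam A b \<cong> Lam B b"
proof -
  have "Lam A (App (lift (Lam B b)) (Var 0)) \<cong> Lam B b" by (rule conv.eta)
  moreover have "App (lift (Lam B b)) (Var 0) \<cong> b"
  proof -
    have "App (lift (Lam B b)) (Var 0) \<cong> inst (ren (up Suc) b) (Var 0)"
      by simp (rule conv.beta)
    moreover have "inst (ren (up Suc) b) (Var 0) = b"
    proof -
      have "(\<lambda>n. case_nat (Var 0) Var (up Suc n)) = Var"
        by (auto simp: fun_eq_iff split: nat.split)
      then show ?thesis by (simp add: sub_ren sub_Var)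
    qed
    ultimately show ?thesis by simp
  qed
  ultimately show ?thesis
    by (meson conv.conv_refl conv.conv_sym conv.conv_trans conv.cong_Lam)
qed

lemma cong_LamD: "b \<cong> b' \<Longrightarrow> Lam A b \<cong> Lam A' b'"
  by (meson Lam_annotation conv.conv_refl conv.conv_trans conv.cong_Lam)

lemma typing_ctx: "\<langle>\<A>\<rangle> \<Gamma> \<turnstile> t \<^bold>: A \<Longrightarrow> \<langle>\<A>\<rangle> \<turnstile> \<Gamma>"
  by (induction rule: ctx_typing.inducts(2)[where ?P1.0="\<lambda>_. True"]) auto

section \<open>Scoping: closed terms are fixed by renaming and substitution\<close>

primrec scoped :: "nat \<Rightarrow> tm \<Rightarrow> bool" where
  "scoped n (Var k) = (k < n)"
| "scoped n (Univ i) = True"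
| "scoped n (Pi A B) = (scoped n A \<and> scoped (Suc n) B)"
| "scoped n (Lam A B) = (scoped n A \<and> scoped (Suc n) B)"
| "scoped n (Sig A B) = (scoped n A \<and> scoped (Suc n) B)"
| "scoped n (App a b) = (scoped n a \<and> scoped n b)"
| "scoped n (Pair a b) = (scoped n a \<and> scoped n b)"
| "scoped n (IndSig a b c) = (scoped n a \<and> scoped n b \<and> scoped n c)"
| "scoped n (Eq a b c) = (scoped n a \<and> scoped n b \<and> scoped n c)"
| "scoped n (Refl a) = (scoped n a)"
| "scoped n (IndEq a b c d) = (scoped n a \<and> scoped n b \<and> scoped n c \<and> scoped n d)"
| "scoped n (IndEmpty a b) = (scoped n a \<and> scoped n b)"
| "scoped n (IndUnit a b c) = (scoped n a \<and> scoped n b \<and> scoped n c)"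
| "scoped n (Sum a b) = (scoped n a \<and> scoped n b)"
| "scoped n (Inl a) = (scoped n a)"
| "scoped n (Inr a) = (scoped n a)"
| "scoped n (IndSum a b c d) = (scoped n a \<and> scoped n b \<and> scoped n c \<and> scoped n d)"
| "scoped n Nat = (True)"
| "scoped n Zero = (True)"
| "scoped n Star = (True)"
| "scoped n (Succ a) = (scoped n a)"
| "scoped n (IndNat a b c d) = (scoped n a \<and> scoped n b \<and> scoped n c \<and> scoped n d)"
| "scoped n (Acc a b c) = (scoped n a \<and> scoped n b \<and> scoped n c)"
| "scoped n (AccI a b) = (scoped n a \<and> scoped n b)"
| "scoped n (IndAcc a b c d e f) = (scoped n a \<and> scoped n b \<and> scoped n c \<and> scoped n d \<and> scoped n e \<and> scoped n f)"
| "scoped n (Trunc a) = (scoped n a)"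
| "scoped n (TrI a) = (scoped n a)"
| "scoped n (TrEq a b) = (scoped n a \<and> scoped n b)"
| "scoped n (RecTr a b c d) = (scoped n a \<and> scoped n b \<and> scoped n c \<and> scoped n d)"
| "scoped n (Empty i) = True"
| "scoped n (Unit i) = True"
| "scoped n (Post A) = True"

lemma scoped_sub_cong: "scoped n t \<Longrightarrow> (\<forall>k<n. s k = s' k) \<Longrightarrow> sub s t = sub s' t"
proof (induction t arbitrary: n s s')
  case (Pi A B)
  have "sub (ups s) B = sub (ups s') B"
    using Pi.prems by (intro Pi.IH(2)[of "Suc n"]) (auto split: nat.split)
  with Pi show ?case by auto
next
  case (Lam A B)
  have "sub (ups s) B = sub (ups s') B"
    using Lam.prems by (intro Lam.IH(2)[of "Suc n"]) (auto split: nat.split)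
  with Lam show ?case by auto
next
  case (Sig A B)
  have "sub (ups s) B = sub (ups s') B"
    using Sig.prems by (intro Sig.IH(2)[of "Suc n"]) (auto split: nat.split)
  with Sig show ?case by auto
qed (simp; metis)+

lemma scoped_ren: "scoped n t \<Longrightarrow> (\<forall>k<n. r k < m) \<Longrightarrow> scoped m (ren r t)"
proof (induction t arbitrary: n m r)
  case (Pi A B)
  have "scoped (Suc m) (ren (up r) B)"
    using Pi.prems by (intro Pi.IH(2)[of "Suc n"]) (auto split: nat.split)
  with Pi show ?case by auto
next
  case (Lam A B)
  have "scoped (Suc m) (ren (up r) B)"
    using Lam.prems by (intro Lam.IH(2)[of "Suc n"]) (auto split: nat.split)
  with Lam show ?case by auto
next
  case (Sig A B)
  have "scoped (Suc m) (ren (up r) B)"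
    using Sig.prems by (intro Sig.IH(2)[of "Suc n"]) (auto split: nat.split)
  with Sig show ?case by auto
qed (simp; metis)+

lemma scoped_sub: "scoped n t \<Longrightarrow> (\<forall>k<n. scoped m (s k)) \<Longrightarrow> scoped m (sub s t)"
proof (induction t arbitrary: n m s)
  case (Pi A B)
  have "scoped (Suc m) (sub (ups s) B)"
    using Pi.prems by (intro Pi.IH(2)[of "Suc n"]) (auto split: nat.split intro: scoped_ren)
  with Pi show ?case by auto
next
  case (Lam A B)
  have "scoped (Suc m) (sub (ups s) B)"
    using Lam.prems by (intro Lam.IH(2)[of "Suc n"]) (auto split: nat.split intro: scoped_ren)
  with Lam show ?case by auto
next
  case (Sig A B)
  have "scoped (Suc m) (sub (ups s) B)"
    using Sig.prems by (intro Sig.IH(2)[of "Suc n"]) (auto split: nat.split intro: scoped_ren)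
  with Sig show ?case by auto
qed (simp; metis)+

lemma scoped_inst: "scoped (Suc n) B \<Longrightarrow> scoped n a \<Longrightarrow> scoped n (inst B a)"
  by (rule scoped_sub[of "Suc n"]) (auto split: nat.split)

text \<open>Context entries are measured after weakening to the full context, which is the form in
  which \<open>ty_Var\<close> returns them.\<close>

lemma typing_scoped:
  "\<langle>\<A>\<rangle> \<turnstile> \<Gamma> \<Longrightarrow> \<forall>n<length \<Gamma>. scoped (length \<Gamma>) (ren (\<lambda>k. Suc n + k) (\<Gamma> ! n))"
  "\<langle>\<A>\<rangle> \<Gamma> \<turnstile> t \<^bold>: T \<Longrightarrow>
     (\<forall>n<length \<Gamma>. scoped (length \<Gamma>) (ren (\<lambda>k. Suc n + k) (\<Gamma> ! n))) \<and> scoped (length \<Gamma>) t \<and> scoped (length \<Gamma>) T"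
proof (induction rule: ctx_typing.inducts)
  case (ctx_Cons \<Gamma> A i)
  have "scoped (Suc (length \<Gamma>)) (lift (ren (\<lambda>k. Suc n + k) (\<Gamma> ! n)))" if "n < length \<Gamma>" for n
    using that ctx_Cons by (auto intro: scoped_ren)
  then show ?case using ctx_Cons scoped_ren[of "length \<Gamma>" A Suc "Suc (length \<Gamma>)"]
    by (auto simp: ren_ren nth_Cons split: nat.split)
next
  \<comment> \<open>The type of a postulate is typed in the empty context, hence closed, hence
    scoped in every context.\<close>
  case (ty_Post \<Gamma> A i)
  then show ?case using scoped_ren[of 0 A "\<lambda>k. k" "length \<Gamma>"] by (simp add: ren_id)
qed (auto intro: scoped_inst)

lemma scoped_0_sub: "scoped 0 t \<Longrightarrow> sub s t = t"
  using scoped_sub_cong[of 0 t s Var] by (simp add: sub_Var)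

lemma closed_sub: "\<langle>\<A>\<rangle> [] \<turnstile> t \<^bold>: A \<Longrightarrow> sub s t = t"
  using typing_scoped(2) scoped_0_sub by fastforce

lemma closed_ren: "\<langle>\<A>\<rangle> [] \<turnstile> t \<^bold>: A \<Longrightarrow> ren r t = t"
  by (simp add: ren_eq_sub closed_sub)

section \<open>Typing is preserved by renaming\<close>

definition ctx_ren :: "tm list \<Rightarrow> (nat \<Rightarrow> nat) \<Rightarrow> tm list \<Rightarrow> bool" where
  "ctx_ren \<Delta> r \<Gamma> \<longleftrightarrow> (\<forall>n<length \<Gamma>. r n < length \<Delta> \<and>
     ren (\<lambda>k. Suc (r n) + k) (\<Delta> ! r n) = ren r (ren (\<lambda>k. Suc n + k) (\<Gamma> ! n)))"

lemma ctx_ren_up: "ctx_ren \<Delta> r \<Gamma> \<Longrightarrow> ctx_ren (ren r A # \<Delta>) (up r) (A # \<Gamma>)"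
  unfolding ctx_ren_def
proof (intro allI impI)
  fix n
  assume *: "\<forall>n<length \<Gamma>. r n < length \<Delta> \<and>
     ren (\<lambda>k. Suc (r n) + k) (\<Delta> ! r n) = ren r (ren (\<lambda>k. Suc n + k) (\<Gamma> ! n))"
    and n: "n < length (A # \<Gamma>)"
  show "up r n < length (ren r A # \<Delta>) \<and>
    ren (\<lambda>k. Suc (up r n) + k) ((ren r A # \<Delta>) ! up r n) = ren (up r) (ren (\<lambda>k. Suc n + k) ((A # \<Gamma>) ! n))"
  proof (cases n)
    case 0
    then show ?thesis by (simp add: ren_ren)
  next
    case (Suc m)
    then have "r m < length \<Delta>" and
      e: "lift (ren (\<lambda>k. Suc (r m) + k) (\<Delta> ! r m)) = lift (ren r (ren (\<lambda>k. Suc m + k) (\<Gamma> ! m)))"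
      using * n by auto
    with Suc show ?thesis using e by (simp add: ren_ren)
  qed
qed

lemma ctx_ren_Suc: "ctx_ren (A # \<Gamma>) Suc \<Gamma>"
  by (simp add: ctx_ren_def ren_ren)

definition ren_ok :: "tm set \<Rightarrow> tm list \<Rightarrow> tm \<Rightarrow> tm \<Rightarrow> bool" where
  "ren_ok \<A> \<Gamma> t T \<longleftrightarrow> (\<forall>\<Delta> r. \<langle>\<A>\<rangle> \<turnstile> \<Delta> \<longrightarrow> ctx_ren \<Delta> r \<Gamma> \<longrightarrow> \<langle>\<A>\<rangle> \<Delta> \<turnstile> ren r t \<^bold>: ren r T)"

definition head_ren_ok :: "tm set \<Rightarrow> tm list \<Rightarrow> bool" where
  "head_ren_ok \<A> \<Gamma> \<longleftrightarrow> (case \<Gamma> of [] \<Rightarrow> True | A # \<Gamma>' \<Rightarrow> \<exists>i. ren_ok \<A> \<Gamma>' A (Univ i))"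

lemma ren_ok_binder:
  assumes "ren_ok \<A> \<Gamma> A (Univ i)" "ren_ok \<A> (A # \<Gamma>) B T" "\<langle>\<A>\<rangle> \<turnstile> \<Delta>" "ctx_ren \<Delta> r \<Gamma>"
  shows "\<langle>\<A>\<rangle> \<Delta> \<turnstile> ren r A \<^bold>: Univ i \<and> \<langle>\<A>\<rangle> ren r A # \<Delta> \<turnstile> ren (up r) B \<^bold>: ren (up r) T"
proof -
  have A: "\<langle>\<A>\<rangle> \<Delta> \<turnstile> ren r A \<^bold>: Univ i" using assms by (simp add: ren_ok_def)
  have "\<langle>\<A>\<rangle> \<turnstile> ren r A # \<Delta>" using A assms(3) by (rule ctx_typing.ctx_Cons[rotated])
  then show ?thesis using A assms(2) ctx_ren_up[OF assms(4)] by (simp add: ren_ok_def)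
qed

text \<open>The first component provides the type of the last variable, which rules with a premise in an
  extended context need not mention.\<close>
lemma typing_ren_strong:
  "\<langle>\<A>\<rangle> \<turnstile> \<Gamma> \<Longrightarrow> head_ren_ok \<A> \<Gamma>"
  "\<langle>\<A>\<rangle> \<Gamma> \<turnstile> t \<^bold>: T \<Longrightarrow> head_ren_ok \<A> \<Gamma> \<and> ren_ok \<A> \<Gamma> t T"
proof (induction rule: ctx_typing.inducts)
  case (ty_Var \<Gamma> n)
  have "\<langle>\<A>\<rangle> \<Delta> \<turnstile> ren r (Var n) \<^bold>: ren r (ren (\<lambda>k. Suc n + k) (\<Gamma> ! n))"
    if "\<langle>\<A>\<rangle> \<turnstile> \<Delta>" "ctx_ren \<Delta> r \<Gamma>" for \<Delta> r
  proof -
    have "r n < length \<Delta>"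
      and e: "ren (\<lambda>k. Suc (r n) + k) (\<Delta> ! r n) = ren r (ren (\<lambda>k. Suc n + k) (\<Gamma> ! n))"
      using that ty_Var by (auto simp: ctx_ren_def)
    then show ?thesis using ctx_typing.ty_Var[OF that(1), of "r n"] unfolding e by simp
  qed
  with ty_Var show ?case by (simp add: ren_ok_def)
next
  case (ty_conv \<Gamma> t A B i)
  then show ?case unfolding ren_ok_def by (metis conv_ren ctx_typing.ty_conv ren.simps(2))
next
  case (ty_Post \<Gamma> A i)
  then show ?case by (simp add: ren_ok_def closed_ren ctx_typing.ty_Post)
next
  case (ty_App \<Gamma> f A B a)
  then show ?case unfolding ren_ok_def by (metis ren_inst ctx_typing.ty_App ren.simps(3,5))
next
  case (ty_Pair A \<Gamma> B j a b)
  \<comment> \<open>\<open>ty_Pair\<close> is the one rule that extends the context by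
    \<open>A\<close> without a premise typing \<open>A\<close>; the level comes from the head of the
    extended context.\<close>
  obtain i where "ren_ok \<A> \<Gamma> A (Univ i)" using ty_Pair(2) by (auto simp: head_ren_ok_def)
  then have "\<langle>\<A>\<rangle> ren r A # \<Delta> \<turnstile> ren (up r) B \<^bold>: Univ j" if "\<langle>\<A>\<rangle> \<turnstile> \<Delta>" "ctx_ren \<Delta> r \<Gamma>" for \<Delta> r
    using ren_ok_binder[of \<A> \<Gamma> A i B "Univ j" \<Delta> r] that ty_Pair(2) by simp
  then show ?case using ty_Pair by (simp add: ren_ok_def ren_inst) (blast intro: ctx_typing.ty_Pair)
next
  case (ty_Pi \<Gamma> A i B j)
  have "ren_ok \<A> \<Gamma> (Pi A B) (Univ (max i j))"
    unfolding ren_ok_def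
  proof (intro allI impI)
    fix \<Delta> r assume "\<langle>\<A>\<rangle> \<turnstile> \<Delta>" "ctx_ren \<Delta> r \<Gamma>"
    then show "\<langle>\<A>\<rangle> \<Delta> \<turnstile> ren r (Pi A B) \<^bold>: ren r (Univ (max i j))"
      using ren_ok_binder[of \<A> \<Gamma> A i B "Univ j" \<Delta> r] ty_Pi(2,4) by (auto intro: ctx_typing.ty_Pi)
  qed
  with ty_Pi show ?case by blast
next
  case (ty_Sig \<Gamma> A i B j)
  have "ren_ok \<A> \<Gamma> (Sig A B) (Univ (max i j))"
    unfolding ren_ok_def
  proof (intro allI impI)
    fix \<Delta> r assume "\<langle>\<A>\<rangle> \<turnstile> \<Delta>" "ctx_ren \<Delta> r \<Gamma>"
    then show "\<langle>\<A>\<rangle> \<Delta> \<turnstile> ren r (Sig A B) \<^bold>: ren r (Univ (max i j))"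
      using ren_ok_binder[of \<A> \<Gamma> A i B "Univ j" \<Delta> r] ty_Sig(2,4) by (auto intro: ctx_typing.ty_Sig)
  qed
  with ty_Sig show ?case by blast
next
  case (ty_Lam \<Gamma> A i b B)
  have "ren_ok \<A> \<Gamma> (Lam A b) (Pi A B)"
    unfolding ren_ok_def
  proof (intro allI impI)
    fix \<Delta> r assume "\<langle>\<A>\<rangle> \<turnstile> \<Delta>" "ctx_ren \<Delta> r \<Gamma>"
    then show "\<langle>\<A>\<rangle> \<Delta> \<turnstile> ren r (Lam A b) \<^bold>: ren r (Pi A B)"
      using ren_ok_binder[of \<A> \<Gamma> A i b B \<Delta> r] ty_Lam(2,4) by (auto intro: ctx_typing.ty_Lam)
  qed
  with ty_Lam show ?case by blast
next
  case ty_Univ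
  then show ?case by (simp add: ren_ok_def ren_up_lift ctx_typing.ty_Univ)
next
  case ty_Eq
  then show ?case by (simp add: ren_ok_def ren_up_lift; blast intro: ctx_typing.ty_Eq[simplified])
next
  case ty_Refl
  then show ?case by (simp add: ren_ok_def ren_up_lift ctx_typing.ty_Refl)
next
  case ty_Empty
  then show ?case by (simp add: ren_ok_def ren_up_lift ctx_typing.ty_Empty)
next
  case ty_Unit
  then show ?case by (simp add: ren_ok_def ren_up_lift ctx_typing.ty_Unit)
next
  case ty_Star
  then show ?case by (simp add: ren_ok_def ren_up_lift ctx_typing.ty_Star)
next
  case ty_Sum
  then show ?case by (simp add: ren_ok_def ren_up_lift ctx_typing.ty_Sum)
next
  case ty_Inl
  then show ?case by (simp add: ren_ok_def ren_up_lift; blast intro: ctx_typing.ty_Inl[simplified])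
next
  case ty_Inr
  then show ?case by (simp add: ren_ok_def ren_up_lift; blast intro: ctx_typing.ty_Inr[simplified])
next
  case ty_Nat
  then show ?case by (simp add: ren_ok_def ren_up_lift ctx_typing.ty_Nat)
next
  case ty_Zero
  then show ?case by (simp add: ren_ok_def ren_up_lift ctx_typing.ty_Zero)
next
  case ty_Succ
  then show ?case by (simp add: ren_ok_def ren_up_lift ctx_typing.ty_Succ)
next
  case ty_Acc
  then show ?case by (simp add: ren_ok_def ren_up_lift; blast intro: ctx_typing.ty_Acc[simplified])
next
  case ty_Trunc
  then show ?case by (simp add: ren_ok_def ren_up_lift ctx_typing.ty_Trunc)
next
  case ty_TrI
  then show ?case by (simp add: ren_ok_def ren_up_lift; blast intro: ctx_typing.ty_TrI[simplified])
next
  case ty_TrEq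
  then show ?case by (simp add: ren_ok_def ren_up_lift; blast intro: ctx_typing.ty_TrEq[simplified])
next
  case ty_IndSig
  then show ?case by (simp add: ren_ok_def ren_up_lift; blast intro: ctx_typing.ty_IndSig[simplified])
next
  case ty_IndEq
  then show ?case by (simp add: ren_ok_def ren_up_lift; blast intro: ctx_typing.ty_IndEq[simplified])
next
  case ty_IndEmpty
  then show ?case by (simp add: ren_ok_def ren_up_lift; blast intro: ctx_typing.ty_IndEmpty[simplified])
next
  case ty_IndUnit
  then show ?case by (simp add: ren_ok_def ren_up_lift; blast intro: ctx_typing.ty_IndUnit[simplified])
next
  case ty_IndSum
  then show ?case by (simp add: ren_ok_def ren_up_lift; blast intro: ctx_typing.ty_IndSum[simplified])
next
  case ty_IndNat
  then show ?case by (simp add: ren_ok_def ren_up_lift; blast intro: ctx_typing.ty_IndNat[simplified])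
next
  case ty_AccI
  then show ?case by (simp add: ren_ok_def ren_up_lift; blast intro: ctx_typing.ty_AccI[simplified])
next
  case (ty_IndAcc \<Gamma> C A R k t a p)
  \<comment> \<open>The level \<open>k\<close> of the motive does not occur in the conclusion of the
    rule, so it has to be instantiated before rewriting.\<close>
  then show ?case by (simp add: ren_ok_def ren_up_lift numeral_2_eq_2 ctx_typing.ty_IndAcc[where k=k, simplified, unfolded numeral_2_eq_2])
next
  case ty_RecTr
  then show ?case by (simp add: ren_ok_def ren_up_lift; blast intro: ctx_typing.ty_RecTr[simplified])
next
  case ctx_Nil
  then show ?case by (simp add: head_ren_ok_def)
next
  case ctx_Cons
  then show ?case by (auto simp add: head_ren_ok_def)
qed

lemma typing_ren: "\<langle>\<A>\<rangle> \<Gamma> \<turnstile> t \<^bold>: T \<Longrightarrow> \<langle>\<A>\<rangle> \<turnstile> \<Delta> \<Longrightarrow> ctx_ren \<Delta> r \<Gamma> \<Longrightarrow> \<langle>\<A>\<rangle> \<Delta> \<turnstile> ren r t \<^bold>: ren r T"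
  using typing_ren_strong(2) by (simp add: ren_ok_def)

lemma weakening: "\<langle>\<A>\<rangle> \<Gamma> \<turnstile> t \<^bold>: T \<Longrightarrow> \<langle>\<A>\<rangle> \<turnstile> A # \<Gamma> \<Longrightarrow> \<langle>\<A>\<rangle> A # \<Gamma> \<turnstile> lift t \<^bold>: lift T"
  by (rule typing_ren[OF _ _ ctx_ren_Suc])

section \<open>Typing is preserved by substitution\<close>

definition ctx_sub :: "tm set \<Rightarrow> tm list \<Rightarrow> (nat \<Rightarrow> tm) \<Rightarrow> tm list \<Rightarrow> bool" where
  "ctx_sub \<A> \<Delta> s \<Gamma> \<longleftrightarrow>
     (\<forall>n<length \<Gamma>. \<langle>\<A>\<rangle> \<Delta> \<turnstile> s n \<^bold>: sub s (ren (\<lambda>k. Suc n + k) (\<Gamma> ! n)))"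

text \<open>Passing a binder lifts the substituted terms. Weakening is available for this because
  renaming was treated first, without reference to substitution.\<close>

lemma ctx_sub_ups:
  assumes "ctx_sub \<A> \<Delta> s \<Gamma>" "\<langle>\<A>\<rangle> \<turnstile> sub s A # \<Delta>"
  shows "ctx_sub \<A> (sub s A # \<Delta>) (ups s) (A # \<Gamma>)"
  unfolding ctx_sub_def
proof (intro allI impI)
  fix n assume n: "n < length (A # \<Gamma>)"
  show "\<langle>\<A>\<rangle> sub s A # \<Delta> \<turnstile> ups s n \<^bold>: sub (ups s) (ren (\<lambda>k. Suc n + k) ((A # \<Gamma>) ! n))"
  proof (cases n)
    case 0
    then show ?thesis using ctx_typing.ty_Var[OF assms(2), of 0] by (simp add: sub_ren ren_sub)
  next
    case (Suc m)
    then have "\<langle>\<A>\<rangle> sub s A # \<Delta> \<turnstile> lift (s m) \<^bold>: lift (sub s (ren (\<lambda>k. Suc m + k) (\<Gamma> ! m)))"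
      using n assms by (intro weakening) (auto simp: ctx_sub_def)
    then show ?thesis using Suc by (simp add: sub_ren ren_sub)
  qed
qed

definition sub_ok :: "tm set \<Rightarrow> tm list \<Rightarrow> tm \<Rightarrow> tm \<Rightarrow> bool" where
  "sub_ok \<A> \<Gamma> t T \<longleftrightarrow> (\<forall>\<Delta> s. \<langle>\<A>\<rangle> \<turnstile> \<Delta> \<longrightarrow> ctx_sub \<A> \<Delta> s \<Gamma> \<longrightarrow> \<langle>\<A>\<rangle> \<Delta> \<turnstile> sub s t \<^bold>: sub s T)"

definition head_sub_ok :: "tm set \<Rightarrow> tm list \<Rightarrow> bool" where
  "head_sub_ok \<A> \<Gamma> \<longleftrightarrow> (case \<Gamma> of [] \<Rightarrow> True | A # \<Gamma>' \<Rightarrow> \<exists>i. sub_ok \<A> \<Gamma>' A (Univ i))"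

lemma sub_ok_binder:
  assumes "sub_ok \<A> \<Gamma> A (Univ i)" "sub_ok \<A> (A # \<Gamma>) B T" "\<langle>\<A>\<rangle> \<turnstile> \<Delta>" "ctx_sub \<A> \<Delta> s \<Gamma>"
  shows "\<langle>\<A>\<rangle> \<Delta> \<turnstile> sub s A \<^bold>: Univ i \<and> \<langle>\<A>\<rangle> sub s A # \<Delta> \<turnstile> sub (ups s) B \<^bold>: sub (ups s) T"
proof -
  have A: "\<langle>\<A>\<rangle> \<Delta> \<turnstile> sub s A \<^bold>: Univ i" using assms by (simp add: sub_ok_def)
  have "\<langle>\<A>\<rangle> \<turnstile> sub s A # \<Delta>" using A assms(3) by (rule ctx_typing.ctx_Cons[rotated])
  then show ?thesis using A assms(2) ctx_sub_ups[OF assms(4)] by (simp add: sub_ok_def)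
qed

lemma typing_sub_strong:
  "\<langle>\<A>\<rangle> \<turnstile> \<Gamma> \<Longrightarrow> head_sub_ok \<A> \<Gamma>"
  "\<langle>\<A>\<rangle> \<Gamma> \<turnstile> t \<^bold>: T \<Longrightarrow> head_sub_ok \<A> \<Gamma> \<and> sub_ok \<A> \<Gamma> t T"
proof (induction rule: ctx_typing.inducts)
  case (ty_Var \<Gamma> n)
  then show ?case by (simp add: sub_ok_def ctx_sub_def)
next
  case (ty_conv \<Gamma> t A B i)
  then show ?case unfolding sub_ok_def by (metis conv_sub ctx_typing.ty_conv sub.simps(2))
next
  case (ty_Post \<Gamma> A i)
  then show ?case by (simp add: sub_ok_def closed_sub ctx_typing.ty_Post)
next
  case (ty_App \<Gamma> f A B a)
  then show ?case unfolding sub_ok_def by (metis sub_inst ctx_typing.ty_App sub.simps(3,5))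
next
  case (ty_Pair A \<Gamma> B j a b)
  obtain i where "sub_ok \<A> \<Gamma> A (Univ i)" using ty_Pair(2) by (auto simp: head_sub_ok_def)
  then have "\<langle>\<A>\<rangle> sub s A # \<Delta> \<turnstile> sub (ups s) B \<^bold>: Univ j" if "\<langle>\<A>\<rangle> \<turnstile> \<Delta>" "ctx_sub \<A> \<Delta> s \<Gamma>" for \<Delta> s
    using sub_ok_binder[of \<A> \<Gamma> A i B "Univ j" \<Delta> s] that ty_Pair(2) by simp
  then show ?case using ty_Pair by (simp add: sub_ok_def sub_inst) (blast intro: ctx_typing.ty_Pair)
next
  case (ty_Pi \<Gamma> A i B j)
  have "sub_ok \<A> \<Gamma> (Pi A B) (Univ (max i j))"
    unfolding sub_ok_def
  proof (intro allI impI)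
    fix \<Delta> s assume "\<langle>\<A>\<rangle> \<turnstile> \<Delta>" "ctx_sub \<A> \<Delta> s \<Gamma>"
    then show "\<langle>\<A>\<rangle> \<Delta> \<turnstile> sub s (Pi A B) \<^bold>: sub s (Univ (max i j))"
      using sub_ok_binder[of \<A> \<Gamma> A i B "Univ j" \<Delta> s] ty_Pi(2,4) by (auto intro: ctx_typing.ty_Pi)
  qed
  with ty_Pi show ?case by blast
next
  case (ty_Sig \<Gamma> A i B j)
  have "sub_ok \<A> \<Gamma> (Sig A B) (Univ (max i j))"
    unfolding sub_ok_def
  proof (intro allI impI)
    fix \<Delta> s assume "\<langle>\<A>\<rangle> \<turnstile> \<Delta>" "ctx_sub \<A> \<Delta> s \<Gamma>"
    then show "\<langle>\<A>\<rangle> \<Delta> \<turnstile> sub s (Sig A B) \<^bold>: sub s (Univ (max i j))"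
      using sub_ok_binder[of \<A> \<Gamma> A i B "Univ j" \<Delta> s] ty_Sig(2,4) by (auto intro: ctx_typing.ty_Sig)
  qed
  with ty_Sig show ?case by blast
next
  case (ty_Lam \<Gamma> A i b B)
  have "sub_ok \<A> \<Gamma> (Lam A b) (Pi A B)"
    unfolding sub_ok_def
  proof (intro allI impI)
    fix \<Delta> s assume "\<langle>\<A>\<rangle> \<turnstile> \<Delta>" "ctx_sub \<A> \<Delta> s \<Gamma>"
    then show "\<langle>\<A>\<rangle> \<Delta> \<turnstile> sub s (Lam A b) \<^bold>: sub s (Pi A B)"
      using sub_ok_binder[of \<A> \<Gamma> A i b B \<Delta> s] ty_Lam(2,4) by (auto intro: ctx_typing.ty_Lam)
  qed
  with ty_Lam show ?case by blast
next
  case ty_Univ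
  then show ?case by (simp add: sub_ok_def sub_ups_lift ctx_typing.ty_Univ)
next
  case ty_Eq
  then show ?case by (simp add: sub_ok_def sub_ups_lift; blast intro: ctx_typing.ty_Eq[simplified])
next
  case ty_Refl
  then show ?case by (simp add: sub_ok_def sub_ups_lift ctx_typing.ty_Refl)
next
  case ty_Empty
  then show ?case by (simp add: sub_ok_def sub_ups_lift ctx_typing.ty_Empty)
next
  case ty_Unit
  then show ?case by (simp add: sub_ok_def sub_ups_lift ctx_typing.ty_Unit)
next
  case ty_Star
  then show ?case by (simp add: sub_ok_def sub_ups_lift ctx_typing.ty_Star)
next
  case ty_Sum
  then show ?case by (simp add: sub_ok_def sub_ups_lift ctx_typing.ty_Sum)
next
  case ty_Inl
  then show ?case by (simp add: sub_ok_def sub_ups_lift; blast intro: ctx_typing.ty_Inl[simplified])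
next
  case ty_Inr
  then show ?case by (simp add: sub_ok_def sub_ups_lift; blast intro: ctx_typing.ty_Inr[simplified])
next
  case ty_Nat
  then show ?case by (simp add: sub_ok_def sub_ups_lift ctx_typing.ty_Nat)
next
  case ty_Zero
  then show ?case by (simp add: sub_ok_def sub_ups_lift ctx_typing.ty_Zero)
next
  case ty_Succ
  then show ?case by (simp add: sub_ok_def sub_ups_lift ctx_typing.ty_Succ)
next
  case ty_Acc
  then show ?case by (simp add: sub_ok_def sub_ups_lift; blast intro: ctx_typing.ty_Acc[simplified])
next
  case ty_Trunc
  then show ?case by (simp add: sub_ok_def sub_ups_lift ctx_typing.ty_Trunc)
next
  case ty_TrI
  then show ?case by (simp add: sub_ok_def sub_ups_lift; blast intro: ctx_typing.ty_TrI[simplified])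
next
  case ty_TrEq
  then show ?case by (simp add: sub_ok_def sub_ups_lift; blast intro: ctx_typing.ty_TrEq[simplified])
next
  case ty_IndSig
  then show ?case by (simp add: sub_ok_def sub_ups_lift; blast intro: ctx_typing.ty_IndSig[simplified])
next
  case ty_IndEq
  then show ?case by (simp add: sub_ok_def sub_ups_lift; blast intro: ctx_typing.ty_IndEq[simplified])
next
  case ty_IndEmpty
  then show ?case by (simp add: sub_ok_def sub_ups_lift; blast intro: ctx_typing.ty_IndEmpty[simplified])
next
  case ty_IndUnit
  then show ?case by (simp add: sub_ok_def sub_ups_lift; blast intro: ctx_typing.ty_IndUnit[simplified])
next
  case ty_IndSum
  then show ?case by (simp add: sub_ok_def sub_ups_lift; blast intro: ctx_typing.ty_IndSum[simplified])
next
  case ty_IndNat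
  then show ?case by (simp add: sub_ok_def sub_ups_lift; blast intro: ctx_typing.ty_IndNat[simplified])
next
  case ty_AccI
  then show ?case by (simp add: sub_ok_def sub_ups_lift; blast intro: ctx_typing.ty_AccI[simplified])
next
  case (ty_IndAcc \<Gamma> C A R k t a p)
  then show ?case by (simp add: sub_ok_def sub_ups_lift numeral_2_eq_2 ctx_typing.ty_IndAcc[where k=k, simplified, unfolded numeral_2_eq_2])
next
  case ty_RecTr
  then show ?case by (simp add: sub_ok_def sub_ups_lift; blast intro: ctx_typing.ty_RecTr[simplified])
next
  case ctx_Nil
  then show ?case by (simp add: head_sub_ok_def)
next
  case ctx_Cons
  then show ?case by (auto simp add: head_sub_ok_def)
qed

lemma typing_sub: "\<langle>\<A>\<rangle> \<Gamma> \<turnstile> t \<^bold>: T \<Longrightarrow> \<langle>\<A>\<rangle> \<turnstile> \<Delta> \<Longrightarrow> ctx_sub \<A> \<Delta> s \<Gamma> \<Longrightarrow> \<langle>\<A>\<rangle> \<Delta> \<turnstile> sub s t \<^bold>: sub s T"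
  using typing_sub_strong(2) by (simp add: sub_ok_def)

section \<open>Context entries, instances and inversion\<close>

lemma ctx_lookup: "\<langle>\<A>\<rangle> \<turnstile> \<Gamma> \<Longrightarrow> n < length \<Gamma> \<Longrightarrow> \<exists>i. \<langle>\<A>\<rangle> \<Gamma> \<turnstile> ren (\<lambda>k. Suc n + k) (\<Gamma> ! n) \<^bold>: Univ i"
proof (induction arbitrary: n rule: ctx_typing.inducts(1)[where ?P2.0="\<lambda>_ _ _. True"])
  case (ctx_Cons \<Gamma> A i)
  then have c: "\<langle>\<A>\<rangle> \<turnstile> A # \<Gamma>" by (blast intro: ctx_typing.ctx_Cons)
  show ?case
  proof (cases n)
    case 0
    then show ?thesis using weakening[OF ctx_Cons.hyps(2) c] by auto
  next
    case (Suc m)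
    then obtain j where "\<langle>\<A>\<rangle> \<Gamma> \<turnstile> ren (\<lambda>k. Suc m + k) (\<Gamma> ! m) \<^bold>: Univ j"
      using ctx_Cons by auto
    from weakening[OF this c] show ?thesis using Suc by (auto simp: ren_ren)
  qed
qed auto

lemma ctx_ConsD: "\<langle>\<A>\<rangle> \<turnstile> A # \<Gamma> \<Longrightarrow> \<langle>\<A>\<rangle> \<turnstile> \<Gamma> \<and> (\<exists>i. \<langle>\<A>\<rangle> \<Gamma> \<turnstile> A \<^bold>: Univ i)"
  by (cases rule: ctx.cases) auto

lemma typing_ConsD: "\<langle>\<A>\<rangle> A # \<Gamma> \<turnstile> t \<^bold>: B \<Longrightarrow> \<langle>\<A>\<rangle> \<turnstile> \<Gamma> \<and> (\<exists>i. \<langle>\<A>\<rangle> \<Gamma> \<turnstile> A \<^bold>: Univ i)"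
  using typing_ctx ctx_ConsD by blast

lemma ctx_sub_inst:
  assumes "\<langle>\<A>\<rangle> \<Gamma> \<turnstile> a \<^bold>: A"
  shows "ctx_sub \<A> \<Gamma> (case_nat a Var) (A # \<Gamma>)"
proof -
  have "\<langle>\<A>\<rangle> \<Gamma> \<turnstile> Var n \<^bold>: sub (\<lambda>k. Var (Suc (n + k))) (\<Gamma> ! n)" if "n < length \<Gamma>" for n
    using ctx_typing.ty_Var[OF typing_ctx[OF assms] that] by (simp add: ren_eq_sub)
  then show ?thesis using assms
    by (auto simp: ctx_sub_def sub_ren sub_Var nth_Cons split: nat.split)
qed

lemma typing_inst: "\<langle>\<A>\<rangle> A # \<Gamma> \<turnstile> b \<^bold>: B \<Longrightarrow> \<langle>\<A>\<rangle> \<Gamma> \<turnstile> a \<^bold>: A \<Longrightarrow> \<langle>\<A>\<rangle> \<Gamma> \<turnstile> inst b a \<^bold>: inst B a"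
  using typing_sub ctx_sub_inst typing_ctx by metis

text \<open>The identity is a well-typed substitution between the two contexts: over
  \<open>A'\<close> the last variable has type \<open>lift A\<close> by the conversion rule.\<close>

lemma ctx_conv:
  assumes b: "\<langle>\<A>\<rangle> A # \<Gamma> \<turnstile> b \<^bold>: B" and A': "\<langle>\<A>\<rangle> \<Gamma> \<turnstile> A' \<^bold>: Univ i" and c: "A \<cong> A'"
  shows "\<langle>\<A>\<rangle> A' # \<Gamma> \<turnstile> b \<^bold>: B"
proof -
  from b obtain j where A: "\<langle>\<A>\<rangle> \<Gamma> \<turnstile> A \<^bold>: Univ j" and G: "\<langle>\<A>\<rangle> \<turnstile> \<Gamma>" using typing_ConsD by blast
  have G': "\<langle>\<A>\<rangle> \<turnstile> A' # \<Gamma>" using A' G by (rule ctx_typing.ctx_Cons[rotated])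
  have 0: "\<langle>\<A>\<rangle> A' # \<Gamma> \<turnstile> Var 0 \<^bold>: lift A"
    using ctx_typing.ty_Var[OF G', of 0] weakening[OF A G'] conv_ren[OF conv.conv_sym[OF c], of Suc]
    by (auto intro: ctx_typing.ty_conv)
  have "\<langle>\<A>\<rangle> A' # \<Gamma> \<turnstile> Var (Suc m) \<^bold>: ren (\<lambda>k. Suc (Suc m) + k) (\<Gamma> ! m)" if "m < length \<Gamma>" for m
    using ctx_typing.ty_Var[OF G', of "Suc m"] that by simp
  with 0 have "ctx_sub \<A> (A' # \<Gamma>) Var (A # \<Gamma>)"
    by (auto simp: ctx_sub_def sub_Var nth_Cons split: nat.split)
  from typing_sub[OF b G' this] show ?thesis by (simp add: sub_Var)
qed

text \<open>The components are read off a derivation for the type itself. \<open>ty_conv\<close>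
  changes only the type of a term, so the induction passes through it, and no injectivity of
  \<open>Pi\<close> under conversion, which would call for a confluence argument, is
  involved.\<close>

lemma typing_Pi_inv: "\<langle>\<A>\<rangle> \<Gamma> \<turnstile> Pi A B \<^bold>: K \<Longrightarrow> (\<exists>i. \<langle>\<A>\<rangle> \<Gamma> \<turnstile> A \<^bold>: Univ i) \<and> (\<exists>j. \<langle>\<A>\<rangle> A # \<Gamma> \<turnstile> B \<^bold>: Univ j)"
  by (induction \<Gamma> "Pi A B" K rule: ctx_typing.inducts(2)[where ?P1.0="\<lambda>_. True"]) auto

lemma typing_Sig_inv: "\<langle>\<A>\<rangle> \<Gamma> \<turnstile> Sig A B \<^bold>: K \<Longrightarrow> (\<exists>i. \<langle>\<A>\<rangle> \<Gamma> \<turnstile> A \<^bold>: Univ i) \<and> (\<exists>j. \<langle>\<A>\<rangle> A # \<Gamma> \<turnstile> B \<^bold>: Univ j)"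
  by (induction \<Gamma> "Sig A B" K rule: ctx_typing.inducts(2)[where ?P1.0="\<lambda>_. True"]) auto

lemma typing_Eq_inv: "\<langle>\<A>\<rangle> \<Gamma> \<turnstile> Eq A a b \<^bold>: K \<Longrightarrow> (\<exists>i. \<langle>\<A>\<rangle> \<Gamma> \<turnstile> A \<^bold>: Univ i) \<and> \<langle>\<A>\<rangle> \<Gamma> \<turnstile> a \<^bold>: A \<and> \<langle>\<A>\<rangle> \<Gamma> \<turnstile> b \<^bold>: A"
  by (induction \<Gamma> "Eq A a b" K rule: ctx_typing.inducts(2)[where ?P1.0="\<lambda>_. True"]) auto

lemma typing_Trunc_inv: "\<langle>\<A>\<rangle> \<Gamma> \<turnstile> Trunc A \<^bold>: K \<Longrightarrow> \<exists>i. \<langle>\<A>\<rangle> \<Gamma> \<turnstile> A \<^bold>: Univ i"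
  by (induction \<Gamma> "Trunc A" K rule: ctx_typing.inducts(2)[where ?P1.0="\<lambda>_. True"]) auto

lemma typing_Acc_inv: "\<langle>\<A>\<rangle> \<Gamma> \<turnstile> Acc A R a \<^bold>: K \<Longrightarrow>
   (\<exists>i. \<langle>\<A>\<rangle> \<Gamma> \<turnstile> A \<^bold>: Univ i) \<and> (\<exists>j. \<langle>\<A>\<rangle> \<Gamma> \<turnstile> R \<^bold>: Arr A (Arr A (Univ j))) \<and> \<langle>\<A>\<rangle> \<Gamma> \<turnstile> a \<^bold>: A"
  by (induction \<Gamma> "Acc A R a" K rule: ctx_typing.inducts(2)[where ?P1.0="\<lambda>_. True"]) auto

section \<open>A type checker\<close>

text \<open>A copy of the natural numbers, so that the simplifier can be kept from visiting the arguments of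
  its constructor.\<close>
datatype fuel = Empty_Fuel | Fuel fuel

section \<open>Weak head evaluation and the conversion test\<close>

definition whnf_App :: "(tm \<Rightarrow> tm) \<Rightarrow> tm \<Rightarrow> tm \<Rightarrow> tm" where
  "whnf_App W f a = (case f of Lam A b \<Rightarrow> W (inst b a) | _ \<Rightarrow> App f a)"

definition whnf_IndSig :: "(tm \<Rightarrow> tm) \<Rightarrow> tm \<Rightarrow> tm \<Rightarrow> tm \<Rightarrow> tm" where
  "whnf_IndSig W C g p = (case p of Pair a b \<Rightarrow> W (App2 g a b) | _ \<Rightarrow> IndSig C g p)"

definition whnf_IndEq :: "(tm \<Rightarrow> tm) \<Rightarrow> tm \<Rightarrow> tm \<Rightarrow> tm \<Rightarrow> tm \<Rightarrow> tm" where
  "whnf_IndEq W C c b p = (case p of Refl a \<Rightarrow> W c | _ \<Rightarrow> IndEq C c b p)"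

definition whnf_IndAcc :: "(tm \<Rightarrow> tm) \<Rightarrow> tm \<Rightarrow> tm \<Rightarrow> tm \<Rightarrow> tm \<Rightarrow> tm \<Rightarrow> tm \<Rightarrow> tm" where
  "whnf_IndAcc W A R C s a p = (case p of AccI a' h \<Rightarrow>
      W (App3 s a' h
        (Lam A (Lam (App2 (lift R) (Var 0) (lift a'))
          (IndAcc (lift (lift A)) (lift (lift R)) (lift (lift C)) (lift (lift s))
            (Var 1) (App2 (lift (lift h)) (Var 1) (Var 0))))))
    | _ \<Rightarrow> IndAcc A R C s a p)"

text \<open>\<open>W\<close> is the evaluator with one unit of fuel less. Only the eliminators whose
  computation the derivations rely on are reduced; any other term is returned unchanged, which is
  harmless because the result need only be convertible to the input.\<close>

definition whnf_step :: "(tm \<Rightarrow> tm) \<Rightarrow> tm \<Rightarrow> tm" where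
  "whnf_step W t = (case t of
      App f a \<Rightarrow> whnf_App W (W f) a
    | IndSig C g p \<Rightarrow> whnf_IndSig W C g (W p)
    | IndEq C c b p \<Rightarrow> whnf_IndEq W C c b (W p)
    | IndAcc A R C s a p \<Rightarrow> whnf_IndAcc W A R C s a (W p)
    | _ \<Rightarrow> t)"

primrec whnf :: "fuel \<Rightarrow> tm \<Rightarrow> tm" where
  "whnf Empty_Fuel t = t"
| "whnf (Fuel n) t = whnf_step (whnf n) t"

lemma whnf_step_conv: "(\<And>t. t \<cong> W t) \<Longrightarrow> t \<cong> whnf_step W t"
proof -
  assume W: "\<And>t. t \<cong> W t"
  have tr: "a \<cong> b \<Longrightarrow> b \<cong> W b" for a b using W .
  show ?thesis
  proof (cases t)
    case (App f a)
    have 1: "App f a \<cong> App (W f) a" by (intro conv.cong_App W conv.conv_refl)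
    have 2: "App g a \<cong> whnf_App W g a" for g
      using conv.conv_trans[OF conv.beta W] by (auto simp: whnf_App_def intro: conv.conv_refl split: tm.split)
    show ?thesis using App conv.conv_trans[OF 1 2] by (simp add: whnf_step_def)
  next
    case (IndSig C g p)
    have 1: "IndSig C g p \<cong> IndSig C g (W p)" by (intro conv.cong_IndSig W conv.conv_refl)
    have 2: "IndSig C g q \<cong> whnf_IndSig W C g q" for q
      using conv.conv_trans[OF conv.comp_Sig W] by (auto simp: whnf_IndSig_def intro: conv.conv_refl split: tm.split)
    show ?thesis using IndSig conv.conv_trans[OF 1 2] by (simp add: whnf_step_def)
  next
    case (IndEq C c b p)
    have 1: "IndEq C c b p \<cong> IndEq C c b (W p)" by (intro conv.cong_IndEq W conv.conv_refl)
    have 2: "IndEq C c b q \<cong> whnf_IndEq W C c b q" for q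
      using conv.conv_trans[OF conv.comp_Eq W] by (auto simp: whnf_IndEq_def intro: conv.conv_refl split: tm.split)
    show ?thesis using IndEq conv.conv_trans[OF 1 2] by (simp add: whnf_step_def)
  next
    case (IndAcc A R C s a p)
    have 1: "IndAcc A R C s a p \<cong> IndAcc A R C s a (W p)" by (intro conv.cong_IndAcc W conv.conv_refl)
    have 2: "IndAcc A R C s a q \<cong> whnf_IndAcc W A R C s a q" for q
      using conv.conv_trans[OF conv.comp_Acc W] unfolding whnf_IndAcc_def
      by (cases q) (auto intro: conv.conv_refl)
    show ?thesis using IndAcc conv.conv_trans[OF 1 2] by (simp add: whnf_step_def)
  qed (auto simp: whnf_step_def intro: conv.conv_refl)
qed

text \<open>This is all that is claimed of \<open>whnf\<close>. The result need not be normal, so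
  exhausted fuel can make a check fail but cannot make it unsound.\<close>

lemma whnf_conv: "t \<cong> whnf n t"
  by (induction n arbitrary: t) (auto intro: conv.conv_refl whnf_step_conv)

text \<open>The first argument bounds the depth of the comparison by which the simplifier decides conversion.\<close>
definition conv_by :: "fuel \<Rightarrow> tm \<Rightarrow> tm \<Rightarrow> bool" where
  "conv_by n t u \<longleftrightarrow> t \<cong> u"

text \<open>Meant for two terms that are already weak head normal. Arguments go back to
  \<open>E\<close>, which evaluates them again; the head of an application and the scrutinee of a
  stuck \<open>IndSig\<close>, \<open>IndEq\<close> or \<open>IndAcc\<close> are normal already, so
  there the recursion stays in \<open>conv_nf\<close>. Nested conditionals make the evaluation stop
  at the first mismatch, and abstractions are compared without their annotations.\<close>

primrec conv_nf :: "(tm \<Rightarrow> tm \<Rightarrow> bool) \<Rightarrow> tm \<Rightarrow> tm \<Rightarrow> bool" where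
  "conv_nf E (Var n) u = (case u of Var m \<Rightarrow> n = m | _ \<Rightarrow> False)"
| "conv_nf E (Univ i) u = (case u of Univ j \<Rightarrow> i = j | _ \<Rightarrow> False)"
| "conv_nf E (Pi A B) u = (case u of Pi A' B' \<Rightarrow> (if E A A' then E B B' else False) | _ \<Rightarrow> False)"
| "conv_nf E (Lam A b) u = (case u of Lam A' b' \<Rightarrow> E b b' | _ \<Rightarrow> False)"
| "conv_nf E (App f a) u =
    (case u of App f' a' \<Rightarrow> (if conv_nf E f f' then E a a' else False) | _ \<Rightarrow> False)"
| "conv_nf E (Sig A B) u = (case u of Sig A' B' \<Rightarrow> (if E A A' then E B B' else False) | _ \<Rightarrow> False)"
| "conv_nf E (Pair a b) u = (case u of Pair a' b' \<Rightarrow> (if E a a' then E b b' else False) | _ \<Rightarrow> False)"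
| "conv_nf E (IndSig C g p) u = (case u of IndSig C' g' p' \<Rightarrow>
    (if E C C' then if E g g' then conv_nf E p p' else False else False) | _ \<Rightarrow> False)"
| "conv_nf E (Eq A a b) u = (case u of Eq A' a' b' \<Rightarrow>
    (if E A A' then if E a a' then E b b' else False else False) | _ \<Rightarrow> False)"
| "conv_nf E (Refl a) u = (case u of Refl a' \<Rightarrow> E a a' | _ \<Rightarrow> False)"
| "conv_nf E (IndEq C c b p) u = (case u of IndEq C' c' b' p' \<Rightarrow>
    (if E C C' then if E c c' then if E b b' then conv_nf E p p' else False else False else False)
    | _ \<Rightarrow> False)"
| "conv_nf E (Empty i) u = False"
| "conv_nf E (IndEmpty C e) u = False"
| "conv_nf E (Unit i) u = False"
| "conv_nf E Star u = False"
| "conv_nf E (IndUnit C c p) u = False"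
| "conv_nf E (Sum A B) u = False"
| "conv_nf E (Inl a) u = False"
| "conv_nf E (Inr b) u = False"
| "conv_nf E (IndSum C f g p) u = False"
| "conv_nf E Nat u = False"
| "conv_nf E Zero u = False"
| "conv_nf E (Succ n) u = False"
| "conv_nf E (IndNat C z s n) u = False"
| "conv_nf E (Acc A R a) u = (case u of Acc A' R' a' \<Rightarrow>
    (if E A A' then if E R R' then E a a' else False else False) | _ \<Rightarrow> False)"
| "conv_nf E (AccI a h) u = (case u of AccI a' h' \<Rightarrow> (if E a a' then E h h' else False) | _ \<Rightarrow> False)"
| "conv_nf E (IndAcc A R C s a p) u = (case u of IndAcc A' R' C' s' a' p' \<Rightarrow>
    (if E A A' then if E R R' then if E C C' then if E s s' then if E a a' then conv_nf E p p'
     else False else False else False else False else False) | _ \<Rightarrow> False)"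
| "conv_nf E (Trunc A) u = (case u of Trunc A' \<Rightarrow> E A A' | _ \<Rightarrow> False)"
| "conv_nf E (TrI a) u = (case u of TrI a' \<Rightarrow> E a a' | _ \<Rightarrow> False)"
| "conv_nf E (TrEq x y) u = (case u of TrEq x' y' \<Rightarrow> (if E x x' then E y y' else False) | _ \<Rightarrow> False)"
| "conv_nf E (RecTr B q f x) u = (case u of RecTr B' q' f' x' \<Rightarrow>
    (if E B B' then if E q q' then if E f f' then E x x' else False else False else False)
    | _ \<Rightarrow> False)"
| "conv_nf E (Post A) u = False"

lemma conv_nf_sound: "(\<And>a b. E a b \<Longrightarrow> a \<cong> b) \<Longrightarrow> conv_nf E t u \<Longrightarrow> t \<cong> u"
  by (induction t arbitrary: u; simp split: tm.splits if_splits)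
     (auto intro: conv.intros cong_LamD)

lemma conv_by_refl: "conv_by n t t"
  by (simp add: conv_by_def conv.conv_refl)

text \<open>An implication only: a failed comparison refutes nothing and merely leaves the goal
  open. Each use consumes fuel, so the comparison cannot be unfolded forever.\<close>

lemma conv_by_step: "conv_nf (conv_by n) (whnf n t) (whnf n u) \<Longrightarrow> conv_by (Fuel n) t u"
  using conv_nf_sound[of "conv_by n" "whnf n t" "whnf n u"] whnf_conv
  unfolding conv_by_def by (meson conv.conv_sym conv.conv_trans)

section \<open>The bidirectional checker\<close>

primrec lookup :: "tm list \<Rightarrow> nat \<Rightarrow> (nat \<Rightarrow> nat) \<Rightarrow> tm option" where
  "lookup [] n f = None"
| "lookup (A # \<Gamma>) n f = (case n of 0 \<Rightarrow> Some (ren f A) | Suc m \<Rightarrow> lookup \<Gamma> m (\<lambda>k. Suc (f k)))"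

text \<open>The last argument is \<open>None\<close> to infer a type and \<open>Some T\<close> to
  check against \<open>T\<close>. In the second mode a successful result is to be \<open>T\<close>
  itself, not merely a convertible type.\<close>

type_synonym checker = "tm list \<Rightarrow> tm \<Rightarrow> tm option \<Rightarrow> tm option"

text \<open>The continuation receives the level once it is known, so that the rest is evaluated only
  after success.\<close>

definition univ_of :: "checker \<Rightarrow> fuel \<Rightarrow> tm list \<Rightarrow> tm \<Rightarrow> (nat \<Rightarrow> 'a option) \<Rightarrow> 'a option" where
  "univ_of R n \<Gamma> A k = Option.bind (R \<Gamma> A None) (\<lambda>K. case whnf n K of Univ i \<Rightarrow> k i | _ \<Rightarrow> None)"

definition is_type :: "checker \<Rightarrow> fuel \<Rightarrow> tm list \<Rightarrow> tm \<Rightarrow> bool" where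
  "is_type R n \<Gamma> A \<longleftrightarrow> univ_of R n \<Gamma> A (\<lambda>i. Some i) \<noteq> None"

definition canonical :: "tm \<Rightarrow> bool" where
  "canonical T = (case T of App f a \<Rightarrow> False | IndSig C g p \<Rightarrow> False | IndEq C c b p \<Rightarrow> False
    | IndAcc A R C s a p \<Rightarrow> False | _ \<Rightarrow> True)"

text \<open>Subject reduction is not available, so a weak head normal form is checked again.\<close>
definition recheck :: "checker \<Rightarrow> fuel \<Rightarrow> tm list \<Rightarrow> tm \<Rightarrow> tm option" where
  "recheck R n \<Gamma> T = univ_of R n \<Gamma> T (\<lambda>i. Some T)"

definition expose :: "checker \<Rightarrow> fuel \<Rightarrow> tm list \<Rightarrow> tm \<Rightarrow> tm option" where
  "expose R n \<Gamma> T = (if canonical T then Some T else recheck R n \<Gamma> (whnf n T))"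

text \<open>Stated through equality and conversion outright; evaluation uses only the sufficient
  conditions \<open>domain_ok_refl\<close> and \<open>domain_ok_step\<close>. The first spares the
  rechecking of an annotation that is repeated literally.\<close>

definition domain_ok :: "checker \<Rightarrow> fuel \<Rightarrow> tm list \<Rightarrow> tm \<Rightarrow> tm \<Rightarrow> bool" where
  "domain_ok R n \<Gamma> D A \<longleftrightarrow> D = A \<or> is_type R n \<Gamma> D \<and> D \<cong> A"

definition answer :: "fuel \<Rightarrow> tm \<Rightarrow> tm option \<Rightarrow> tm option" where
  "answer n S M = (case M of None \<Rightarrow> Some S | Some T \<Rightarrow> (if conv_by n S T then Some T else None))"

text \<open>\<open>ty_Acc\<close> needs the universe of the relation, which occurs nowhere in the
  term. It is read off the evaluated type \<open>K\<close>, and \<open>K\<close> as a whole is then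
  compared with the relation type so obtained.\<close>

definition rel_level :: "fuel \<Rightarrow> tm \<Rightarrow> tm \<Rightarrow> (nat \<Rightarrow> tm option) \<Rightarrow> tm option" where
  "rel_level n A K k =
    (case whnf n K of Pi D K1 \<Rightarrow> (case whnf n K1 of Pi D' K2 \<Rightarrow> (case whnf n K2 of Univ j \<Rightarrow>
       (if conv_by n K (Arr A (Arr A (Univ j))) then k j else None) | _ \<Rightarrow> None) | _ \<Rightarrow> None) | _ \<Rightarrow> None)"

abbreviation inst2 :: "tm \<Rightarrow> tm \<Rightarrow> tm \<Rightarrow> tm" where
  "inst2 c a p \<equiv> sub (case_nat p (case_nat a Var)) c"

text \<open>The branch type demanded by \<open>ty_IndSig\<close> with the motive already applied:
  the body \<open>c\<close> is instantiated at the generic pair, so that no beta redex enters the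
  types.\<close>

definition sig_step :: "tm \<Rightarrow> tm \<Rightarrow> tm \<Rightarrow> tm" where
  "sig_step A B c = Pi A (Pi B (sub (case_nat (Pair (Var 1) (Var 0)) (\<lambda>n. Var (Suc (Suc n)))) c))"

definition down_ty :: "tm \<Rightarrow> tm \<Rightarrow> tm \<Rightarrow> tm" where
  "down_ty A R a = Pi A (Arr (App2 (lift R) (Var 0) (lift a)) (Acc (lift A) (lift R) (Var 0)))"

text \<open>The step type of \<open>ty_IndAcc\<close> with the body \<open>c\<close> of the motive
  substituted, as in \<open>sig_step\<close>; \<open>acc_step_raw\<close> is the unreduced form in
  which the rule states it. The checker compares the two in each instance instead of relying on a
  general proof of their conversion.\<close>

definition acc_step :: "tm \<Rightarrow> tm \<Rightarrow> tm \<Rightarrow> tm" where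
  "acc_step A R c = Pi A (Pi (down_ty (lift A) (lift R) (Var 0))
    (Pi (Pi (lift (lift A)) (Pi (App2 (lift (lift (lift R))) (Var 0) (Var 2))
          (sub (case_nat (App2 (Var 2) (Var 1) (Var 0)) (case_nat (Var 1) (\<lambda>n. Var (Suc (Suc (Suc (Suc n))))))) c)))
      (sub (case_nat (AccI (Var 2) (Var 1)) (case_nat (Var 2) (\<lambda>n. Var (Suc (Suc (Suc n)))))) c)))"

definition acc_step_raw :: "tm \<Rightarrow> tm \<Rightarrow> tm \<Rightarrow> tm" where
  "acc_step_raw A R C = Pi A
       (Pi (Pi (lift A)
             (Arr (App2 (lift (lift R)) (Var 0) (Var 1))
                  (Acc (lift (lift A)) (lift (lift R)) (Var 0))))
         (Arr (Pi (lift (lift A))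
                (Pi (App2 (lift (lift (lift R))) (Var 0) (Var 2))
                  (App2 (lift (lift (lift (lift C)))) (Var 1) (App2 (Var 2) (Var 1) (Var 0)))))
              (App2 (lift (lift C)) (Var 1) (AccI (Var 1) (Var 0)))))"

text \<open>\<open>Pair\<close>, \<open>AccI\<close> and \<open>TrI\<close> are accepted only
  against a given type, since the term does not determine it. Motives must be literal abstractions,
  whose bodies are then instantiated directly. Constructors outside the fragment needed here are
  rejected.\<close>

primrec check_step :: "checker \<Rightarrow> fuel \<Rightarrow> tm list \<Rightarrow> tm option \<Rightarrow> tm \<Rightarrow> tm option" where
  "check_step R n \<Gamma> M (Var k) = Option.bind (lookup \<Gamma> k Suc) (\<lambda>S. answer n S M)"
| "check_step R n \<Gamma> M (Univ i) = answer n (Univ (Suc i)) M"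
| "check_step R n \<Gamma> M (Pi A B) = univ_of R n \<Gamma> A (\<lambda>i. univ_of R n (A # \<Gamma>) B (\<lambda>j.
     answer n (Univ (max i j)) M))"
| "check_step R n \<Gamma> M (Lam A b) = (case M of
      None \<Rightarrow> univ_of R n \<Gamma> A (\<lambda>i. Option.bind (R (A # \<Gamma>) b None) (\<lambda>B. Some (Pi A B)))
    | Some T \<Rightarrow> Option.bind (expose R n \<Gamma> T) (\<lambda>F. case F of
        Pi A' B' \<Rightarrow> (if domain_ok R n \<Gamma> A A'
          then Option.bind (R (A # \<Gamma>) b (Some B')) (\<lambda>_. Some T) else None)
      | _ \<Rightarrow> None))"
| "check_step R n \<Gamma> M (App f a) = Option.bind (R \<Gamma> f None) (\<lambda>F. Option.bind (expose R n \<Gamma> F) (\<lambda>F.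
     case F of Pi A B \<Rightarrow> Option.bind (R \<Gamma> a (Some A)) (\<lambda>_. answer n (inst B a) M) | _ \<Rightarrow> None))"
| "check_step R n \<Gamma> M (Sig A B) = univ_of R n \<Gamma> A (\<lambda>i. univ_of R n (A # \<Gamma>) B (\<lambda>j.
     answer n (Univ (max i j)) M))"
| "check_step R n \<Gamma> M (Pair a b) = (case M of None \<Rightarrow> None | Some T \<Rightarrow>
     Option.bind (expose R n \<Gamma> T) (\<lambda>F. case F of
        Sig A B \<Rightarrow> Option.bind (R \<Gamma> a (Some A)) (\<lambda>_. Option.bind (R \<Gamma> b (Some (inst B a))) (\<lambda>_. Some T))
      | _ \<Rightarrow> None))"
| "check_step R n \<Gamma> M (IndSig C g p) = Option.bind (R \<Gamma> p None) (\<lambda>P. Option.bind (expose R n \<Gamma> P) (\<lambda>P.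
     case P of Sig A B \<Rightarrow> (case C of Lam D c \<Rightarrow>
       (if domain_ok R n \<Gamma> D (Sig A B) then univ_of R n (D # \<Gamma>) c (\<lambda>k.
          Option.bind (R \<Gamma> g (Some (sig_step A B c))) (\<lambda>_. answer n (inst c p) M)) else None)
       | _ \<Rightarrow> None) | _ \<Rightarrow> None))"
| "check_step R n \<Gamma> M (Eq A a b) = univ_of R n \<Gamma> A (\<lambda>i. Option.bind (R \<Gamma> a (Some A)) (\<lambda>_.
     Option.bind (R \<Gamma> b (Some A)) (\<lambda>_. answer n (Univ i) M)))"
| "check_step R n \<Gamma> M (Refl a) = (case M of
      None \<Rightarrow> Option.bind (R \<Gamma> a None) (\<lambda>A. Some (Eq A a a))
    | Some T \<Rightarrow> Option.bind (expose R n \<Gamma> T) (\<lambda>F. case F of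
        Eq A x y \<Rightarrow> Option.bind (R \<Gamma> a (Some A)) (\<lambda>_.
          if conv_by n a x then if conv_by n a y then Some T else None else None)
      | _ \<Rightarrow> None))"
| "check_step R n \<Gamma> M (IndEq C t b p) = Option.bind (R \<Gamma> p None) (\<lambda>P. Option.bind (expose R n \<Gamma> P) (\<lambda>P.
     case P of Eq A a b' \<Rightarrow> (case C of Lam D C' \<Rightarrow> (case C' of Lam E c \<Rightarrow>
       (if domain_ok R n \<Gamma> D A then if domain_ok R n (D # \<Gamma>) E (Eq (lift A) (lift a) (Var 0)) then
          univ_of R n (E # D # \<Gamma>) c (\<lambda>k. Option.bind (R \<Gamma> t (Some (inst2 c a (Refl a)))) (\<lambda>_.
            Option.bind (R \<Gamma> b (Some A)) (\<lambda>_. if conv_by n b b' then answer n (inst2 c b p) M else None)))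
        else None else None)
       | _ \<Rightarrow> None) | _ \<Rightarrow> None) | _ \<Rightarrow> None))"
| "check_step R n \<Gamma> M (Empty i) = None"
| "check_step R n \<Gamma> M (IndEmpty C e) = None"
| "check_step R n \<Gamma> M (Unit i) = None"
| "check_step R n \<Gamma> M Star = None"
| "check_step R n \<Gamma> M (IndUnit C c p) = None"
| "check_step R n \<Gamma> M (Sum A B) = None"
| "check_step R n \<Gamma> M (Inl a) = None"
| "check_step R n \<Gamma> M (Inr b) = None"
| "check_step R n \<Gamma> M (IndSum C f g p) = None"
| "check_step R n \<Gamma> M Nat = None"
| "check_step R n \<Gamma> M Zero = None"
| "check_step R n \<Gamma> M (Succ k) = None"
| "check_step R n \<Gamma> M (IndNat C z s k) = None"
| "check_step R n \<Gamma> M (Acc A S a) = univ_of R n \<Gamma> A (\<lambda>i. Option.bind (R \<Gamma> S None) (\<lambda>K.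
     rel_level n A K (\<lambda>j. Option.bind (R \<Gamma> a (Some A)) (\<lambda>_. answer n (Univ (max i j)) M))))"
| "check_step R n \<Gamma> M (AccI a h) = (case M of None \<Rightarrow> None | Some T \<Rightarrow>
     Option.bind (expose R n \<Gamma> T) (\<lambda>F. case F of
        Acc A S a' \<Rightarrow> Option.bind (R \<Gamma> a (Some A)) (\<lambda>_. if conv_by n a a' then
          univ_of R n \<Gamma> (down_ty A S a) (\<lambda>_. Option.bind (R \<Gamma> h (Some (down_ty A S a))) (\<lambda>_. Some T)) else None)
      | _ \<Rightarrow> None))"
| "check_step R n \<Gamma> M (IndAcc A S C s a p) = univ_of R n \<Gamma> A (\<lambda>i. Option.bind (R \<Gamma> S None) (\<lambda>K.
     rel_level n A K (\<lambda>j. Option.bind (R \<Gamma> a (Some A)) (\<lambda>_. Option.bind (R \<Gamma> p (Some (Acc A S a))) (\<lambda>_.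
       case C of Lam D C' \<Rightarrow> (case C' of Lam E c \<Rightarrow>
         (if domain_ok R n \<Gamma> D A then if domain_ok R n (D # \<Gamma>) E (Acc (lift A) (lift S) (Var 0)) then
            univ_of R n (E # D # \<Gamma>) c (\<lambda>k. univ_of R n \<Gamma> (acc_step A S c) (\<lambda>_.
              univ_of R n \<Gamma> (acc_step_raw A S C) (\<lambda>_. if conv_by n (acc_step A S c) (acc_step_raw A S C) then
                Option.bind (R \<Gamma> s (Some (acc_step A S c))) (\<lambda>_. answer n (inst2 c a p) M) else None)))
          else None else None)
       | _ \<Rightarrow> None) | _ \<Rightarrow> None)))))"
| "check_step R n \<Gamma> M (Trunc A) = univ_of R n \<Gamma> A (\<lambda>i. answer n (Univ i) M)"
| "check_step R n \<Gamma> M (TrI a) = (case M of None \<Rightarrow> None | Some T \<Rightarrow>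
     Option.bind (expose R n \<Gamma> T) (\<lambda>F. case F of
        Trunc A \<Rightarrow> Option.bind (R \<Gamma> a (Some A)) (\<lambda>_. Some T) | _ \<Rightarrow> None))"
| "check_step R n \<Gamma> M (TrEq x y) = Option.bind (R \<Gamma> x None) (\<lambda>X. Option.bind (expose R n \<Gamma> X) (\<lambda>X.
     case X of Trunc A \<Rightarrow> Option.bind (R \<Gamma> y (Some (Trunc A))) (\<lambda>_. answer n (Eq (Trunc A) x y) M) | _ \<Rightarrow> None))"
| "check_step R n \<Gamma> M (RecTr B q f x) = univ_of R n \<Gamma> B (\<lambda>j. Option.bind (R \<Gamma> x None) (\<lambda>X.
     Option.bind (expose R n \<Gamma> X) (\<lambda>X. case X of
        Trunc A \<Rightarrow> Option.bind (R \<Gamma> q (Some (Pi B (Pi (lift B) (Eq (lift (lift B)) (Var 1) (Var 0)))))) (\<lambda>_.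
          Option.bind (R \<Gamma> f (Some (Arr A B))) (\<lambda>_. answer n B M))
      | _ \<Rightarrow> None)))"
| "check_step R n \<Gamma> M (Post A) = None"

primrec check :: "fuel \<Rightarrow> tm list \<Rightarrow> tm \<Rightarrow> tm option \<Rightarrow> tm option" where
  "check Empty_Fuel \<Gamma> t M = None"
| "check (Fuel n) \<Gamma> t M = check_step (check n) n \<Gamma> M t"

lemma case_Some:
  "(case t of Univ i \<Rightarrow> kUniv i | _ \<Rightarrow> None) = Some x \<longleftrightarrow> (\<exists>i. t = Univ i \<and> kUniv i = Some x)"
  "(case t of Pi A B \<Rightarrow> kPi A B | _ \<Rightarrow> None) = Some x \<longleftrightarrow> (\<exists>A B. t = Pi A B \<and> kPi A B = Some x)"
  "(case t of Lam A B \<Rightarrow> kLam A B | _ \<Rightarrow> None) = Some x \<longleftrightarrow> (\<exists>A B. t = Lam A B \<and> kLam A B = Some x)"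
  "(case t of Sig A B \<Rightarrow> kSig A B | _ \<Rightarrow> None) = Some x \<longleftrightarrow> (\<exists>A B. t = Sig A B \<and> kSig A B = Some x)"
  "(case t of Eq A a b \<Rightarrow> kEq A a b | _ \<Rightarrow> None) = Some x \<longleftrightarrow> (\<exists>A a b. t = Eq A a b \<and> kEq A a b = Some x)"
  "(case t of Acc A R a \<Rightarrow> kAcc A R a | _ \<Rightarrow> None) = Some x \<longleftrightarrow> (\<exists>A R a. t = Acc A R a \<and> kAcc A R a = Some x)"
  "(case t of Trunc A \<Rightarrow> kTrunc A | _ \<Rightarrow> None) = Some x \<longleftrightarrow> (\<exists>A. t = Trunc A \<and> kTrunc A = Some x)"
  by (cases t; simp)+

lemma if_Some: "(if b then k else None) = Some x \<longleftrightarrow> b \<and> k = Some x"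
  by simp

text \<open>Generalised over the weakening \<open>m\<close> accumulated so far; the checker starts
  with \<open>m = 0\<close>.\<close>

lemma lookup_Some:
  "lookup \<Gamma> n (\<lambda>k. Suc (m + k)) = Some A \<Longrightarrow> n < length \<Gamma> \<and> A = ren (\<lambda>k. Suc (m + n + k)) (\<Gamma> ! n)"
proof (induction \<Gamma> arbitrary: n m)
  case (Cons B \<Gamma>)
  show ?case
  proof (cases n)
    case (Suc k)
    then have "lookup \<Gamma> k (\<lambda>j. Suc (Suc m + j)) = Some A" using Cons.prems by simp
    from Cons.IH[OF this] Suc show ?thesis by simp
  qed (use Cons.prems in simp)
qed simp

section \<open>Soundness of the checker\<close>

definition typed :: "tm set \<Rightarrow> tm list \<Rightarrow> tm \<Rightarrow> bool" where
  "typed \<A> \<Gamma> T \<longleftrightarrow> (\<exists>i. \<langle>\<A>\<rangle> \<Gamma> \<turnstile> T \<^bold>: Univ i)"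

text \<open>Expected types are assumed well formed and returned types are shown to be, so every case
  has to establish that a type is well formed before passing it down as an expectation.\<close>

definition sound :: "tm set \<Rightarrow> checker \<Rightarrow> bool" where
  "sound \<A> R \<longleftrightarrow> (\<forall>\<Gamma> t M T. \<langle>\<A>\<rangle> \<turnstile> \<Gamma> \<longrightarrow> (\<forall>T'. M = Some T' \<longrightarrow> typed \<A> \<Gamma> T') \<longrightarrow> R \<Gamma> t M = Some T \<longrightarrow>
     \<langle>\<A>\<rangle> \<Gamma> \<turnstile> t \<^bold>: T \<and> typed \<A> \<Gamma> T \<and> (\<forall>T'. M = Some T' \<longrightarrow> T = T'))"

lemma typedI: "\<langle>\<A>\<rangle> \<Gamma> \<turnstile> T \<^bold>: Univ i \<Longrightarrow> typed \<A> \<Gamma> T"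
  by (auto simp: typed_def)

lemma typed_ctx: "typed \<A> \<Gamma> T \<Longrightarrow> \<langle>\<A>\<rangle> \<turnstile> T # \<Gamma>"
  using typing_ctx ctx_typing.ctx_Cons by (fastforce simp: typed_def)

lemma typed_conv: "\<langle>\<A>\<rangle> \<Gamma> \<turnstile> t \<^bold>: A \<Longrightarrow> A \<cong> B \<Longrightarrow> typed \<A> \<Gamma> B \<Longrightarrow> \<langle>\<A>\<rangle> \<Gamma> \<turnstile> t \<^bold>: B"
  by (auto simp: typed_def intro: ctx_typing.ty_conv)

lemma typed_Univ: "\<langle>\<A>\<rangle> \<turnstile> \<Gamma> \<Longrightarrow> typed \<A> \<Gamma> (Univ i)"
  by (auto simp: typed_def intro: ctx_typing.ty_Univ)

lemma typed_Pi: "typed \<A> \<Gamma> A \<Longrightarrow> typed \<A> (A # \<Gamma>) B \<Longrightarrow> typed \<A> \<Gamma> (Pi A B)"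
  by (auto simp: typed_def intro: ctx_typing.ty_Pi)

lemma typed_Eq: "typed \<A> \<Gamma> A \<Longrightarrow> \<langle>\<A>\<rangle> \<Gamma> \<turnstile> a \<^bold>: A \<Longrightarrow> \<langle>\<A>\<rangle> \<Gamma> \<turnstile> b \<^bold>: A \<Longrightarrow> typed \<A> \<Gamma> (Eq A a b)"
  by (auto simp: typed_def intro: ctx_typing.ty_Eq)

lemma typed_lift: "typed \<A> \<Gamma> A \<Longrightarrow> typed \<A> \<Gamma> B \<Longrightarrow> typed \<A> (B # \<Gamma>) (lift A)"
  using weakening typed_ctx by (fastforce simp: typed_def)

lemma typed_inst: "typed \<A> (A # \<Gamma>) B \<Longrightarrow> \<langle>\<A>\<rangle> \<Gamma> \<turnstile> a \<^bold>: A \<Longrightarrow> typed \<A> \<Gamma> (inst B a)"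
  using typing_inst by (fastforce simp: typed_def)

lemma typed_Var0: "typed \<A> \<Gamma> A \<Longrightarrow> \<langle>\<A>\<rangle> A # \<Gamma> \<turnstile> Var 0 \<^bold>: lift A"
  using ctx_typing.ty_Var[OF typed_ctx, of \<A> \<Gamma> A 0] by simp

lemma typing_inst2:
  assumes "\<langle>\<A>\<rangle> E # D # \<Gamma> \<turnstile> c \<^bold>: C" "\<langle>\<A>\<rangle> \<Gamma> \<turnstile> a \<^bold>: D" "\<langle>\<A>\<rangle> \<Gamma> \<turnstile> p \<^bold>: inst E a"
  shows "\<langle>\<A>\<rangle> \<Gamma> \<turnstile> inst2 c a p \<^bold>: inst2 C a p"
proof (rule typing_sub[OF assms(1)])
  show "\<langle>\<A>\<rangle> \<turnstile> \<Gamma>" using assms(2) typing_ctx by blast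
  have *: "ctx_sub \<A> \<Gamma> (case_nat a Var) (D # \<Gamma>)" using assms(2) by (rule ctx_sub_inst)
  have "\<langle>\<A>\<rangle> \<Gamma> \<turnstile> case_nat a Var n \<^bold>: sub (case_nat p (case_nat a Var)) (ren (\<lambda>k. Suc (Suc n) + k) ((D # \<Gamma>) ! n))"
    if "n < length (D # \<Gamma>)" for n
    using * that by (auto simp: ctx_sub_def sub_ren)
  then show "ctx_sub \<A> \<Gamma> (case_nat p (case_nat a Var)) (E # D # \<Gamma>)"
    using assms(3) by (auto simp: ctx_sub_def nth_Cons sub_ren split: nat.split)
qed

lemma inst2_conv: "App2 (Lam D (Lam E c)) a p \<cong> inst2 c a p"
proof -
  have "(\<lambda>n. sub (case_nat p Var) (ups (case_nat a Var) n)) = case_nat p (case_nat a Var)"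
    by (auto simp: fun_eq_iff sub_ren sub_Var split: nat.split)
  then have e: "inst (sub (ups (case_nat a Var)) c) p = inst2 c a p"
    by (simp add: sub_sub)
  have "App (Lam D (Lam E c)) a \<cong> Lam (inst E a) (sub (ups (case_nat a Var)) c)"
    using conv.beta[of D "Lam E c" a] by simp
  then have "App2 (Lam D (Lam E c)) a p \<cong> App (Lam (inst E a) (sub (ups (case_nat a Var)) c)) p"
    by (intro conv.cong_App conv.conv_refl)
  with conv.beta[of "inst E a" "sub (ups (case_nat a Var)) c" p] show ?thesis
    unfolding e by (blast intro: conv.conv_trans)
qed

context
  fixes \<A> :: "tm set" and R :: checker
  assumes sound: "sound \<A> R"
begin

lemma inferD:
  assumes "R \<Gamma> t None = Some T" "\<langle>\<A>\<rangle> \<turnstile> \<Gamma>"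
  shows "\<langle>\<A>\<rangle> \<Gamma> \<turnstile> t \<^bold>: T" "typed \<A> \<Gamma> T"
proof -
  have "\<langle>\<A>\<rangle> \<Gamma> \<turnstile> t \<^bold>: T \<and> typed \<A> \<Gamma> T \<and> (\<forall>T'. None = Some T' \<longrightarrow> T = T')"
    using sound assms unfolding sound_def by blast
  then show "\<langle>\<A>\<rangle> \<Gamma> \<turnstile> t \<^bold>: T" "typed \<A> \<Gamma> T" by auto
qed

lemma checkD:
  assumes "R \<Gamma> t (Some A) = Some T" "typed \<A> \<Gamma> A"
  shows "\<langle>\<A>\<rangle> \<Gamma> \<turnstile> t \<^bold>: A"
proof -
  have "\<langle>\<A>\<rangle> \<Gamma> \<turnstile> t \<^bold>: T \<and> typed \<A> \<Gamma> T \<and> (\<forall>T'. Some A = Some T' \<longrightarrow> T = T')"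
    using sound assms typing_ctx unfolding sound_def typed_def by blast
  then show ?thesis by auto
qed

lemma univ_ofD:
  assumes "univ_of R n \<Gamma> A k = Some x" "\<langle>\<A>\<rangle> \<turnstile> \<Gamma>"
  obtains i where "\<langle>\<A>\<rangle> \<Gamma> \<turnstile> A \<^bold>: Univ i" "typed \<A> \<Gamma> A" "k i = Some x"
proof -
  obtain K i where "R \<Gamma> A None = Some K" "whnf n K = Univ i" and k: "k i = Some x"
    using assms(1) by (auto simp: univ_of_def bind_eq_Some_conv case_Some)
  then have "\<langle>\<A>\<rangle> \<Gamma> \<turnstile> A \<^bold>: Univ i"
    using inferD(1)[of \<Gamma> A K] assms(2) whnf_conv[of K n] typed_conv typed_Univ by metis
  with k that show thesis by (blast intro: typedI)
qed

lemma is_typeD: "is_type R n \<Gamma> A \<Longrightarrow> \<langle>\<A>\<rangle> \<turnstile> \<Gamma> \<Longrightarrow> typed \<A> \<Gamma> A"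
  by (auto simp: is_type_def elim: univ_ofD)

lemma exposeD: "expose R n \<Gamma> T = Some F \<Longrightarrow> typed \<A> \<Gamma> T \<Longrightarrow> typed \<A> \<Gamma> F \<and> T \<cong> F"
  using whnf_conv typing_ctx
  by (fastforce simp: expose_def recheck_def typed_def intro: conv.conv_refl split: if_splits elim: univ_ofD)

lemma domain_okD: "domain_ok R n \<Gamma> D A \<Longrightarrow> typed \<A> \<Gamma> A \<Longrightarrow> typed \<A> \<Gamma> D \<and> D \<cong> A"
  using typing_ctx by (fastforce simp: domain_ok_def typed_def intro: conv.conv_refl dest: is_typeD[unfolded typed_def])

lemma rel_levelD:
  assumes "rel_level n A K k = Some x"
  obtains j where "K \<cong> Arr A (Arr A (Univ j))" "k j = Some x"
  using assms by (auto simp: rel_level_def case_Some if_Some conv_by_def)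

end

lemma answerD:
  assumes "answer n S M = Some T" "\<langle>\<A>\<rangle> \<Gamma> \<turnstile> t \<^bold>: S" "typed \<A> \<Gamma> S" "\<forall>T'. M = Some T' \<longrightarrow> typed \<A> \<Gamma> T'"
  shows "\<langle>\<A>\<rangle> \<Gamma> \<turnstile> t \<^bold>: T \<and> typed \<A> \<Gamma> T \<and> (\<forall>T'. M = Some T' \<longrightarrow> T = T')"
  using assms by (auto simp: answer_def conv_by_def intro: typed_conv split: option.splits if_splits)

lemma typed_PiD: "typed \<A> \<Gamma> (Pi A B) \<Longrightarrow> typed \<A> \<Gamma> A \<and> typed \<A> (A # \<Gamma>) B"
  unfolding typed_def using typing_Pi_inv by blast

lemma typed_SigD: "typed \<A> \<Gamma> (Sig A B) \<Longrightarrow> typed \<A> \<Gamma> A \<and> typed \<A> (A # \<Gamma>) B"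
  unfolding typed_def using typing_Sig_inv by blast

lemma typed_EqD: "typed \<A> \<Gamma> (Eq A a b) \<Longrightarrow> typed \<A> \<Gamma> A \<and> \<langle>\<A>\<rangle> \<Gamma> \<turnstile> a \<^bold>: A \<and> \<langle>\<A>\<rangle> \<Gamma> \<turnstile> b \<^bold>: A"
  unfolding typed_def using typing_Eq_inv by blast

lemma typed_TruncD: "typed \<A> \<Gamma> (Trunc A) \<Longrightarrow> typed \<A> \<Gamma> A"
  unfolding typed_def using typing_Trunc_inv by blast

lemma typed_AccD: "typed \<A> \<Gamma> (Acc A R a) \<Longrightarrow>
    typed \<A> \<Gamma> A \<and> (\<exists>j. \<langle>\<A>\<rangle> \<Gamma> \<turnstile> R \<^bold>: Arr A (Arr A (Univ j))) \<and> \<langle>\<A>\<rangle> \<Gamma> \<turnstile> a \<^bold>: A"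
  unfolding typed_def using typing_Acc_inv by blast

text \<open>Both forms of the branch type are well formed because the generic pair \<open>?P\<close>
  inhabits the twice weakened \<open>Sig A B\<close>, and they differ by one beta step. This lets
  \<open>ty_conv\<close> pass from the type that is checked to the one in the rule.\<close>

lemma sig_step_typed:
  assumes S: "typed \<A> \<Gamma> (Sig A B)" and C: "\<langle>\<A>\<rangle> \<Gamma> \<turnstile> Lam D c \<^bold>: Arr (Sig A B) (Univ k)"
    and c: "\<langle>\<A>\<rangle> Sig A B # \<Gamma> \<turnstile> c \<^bold>: Univ k"
  shows "typed \<A> \<Gamma> (sig_step A B c)"
    and "typed \<A> \<Gamma> (Pi A (Pi B (App (lift (lift (Lam D c))) (Pair (Var 1) (Var 0)))))"
    and "sig_step A B c \<cong> Pi A (Pi B (App (lift (lift (Lam D c))) (Pair (Var 1) (Var 0))))"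
proof -
  let ?P = "Pair (Var 1) (Var 0)"
  let ?c2 = "ren (up (\<lambda>n. Suc (Suc n))) c"
  have A: "typed \<A> \<Gamma> A" and B: "typed \<A> (A # \<Gamma>) B"
    using S typing_Sig_inv by (auto simp: typed_def)
  have G: "\<langle>\<A>\<rangle> \<turnstile> B # A # \<Gamma>" using B by (rule typed_ctx)
  have r: "ctx_ren (B # A # \<Gamma>) (\<lambda>n. Suc (Suc n)) \<Gamma>"
    by (simp add: ctx_ren_def ren_ren)
  have S2: "\<langle>\<A>\<rangle> B # A # \<Gamma> \<turnstile> ren (\<lambda>n. Suc (Suc n)) (Sig A B) \<^bold>: Univ i" if "\<langle>\<A>\<rangle> \<Gamma> \<turnstile> Sig A B \<^bold>: Univ i" for i
    using typing_ren[OF that G r] by simp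
  then obtain i where S2: "\<langle>\<A>\<rangle> B # A # \<Gamma> \<turnstile> Sig (ren (\<lambda>n. Suc (Suc n)) A) (ren (up (\<lambda>n. Suc (Suc n))) B) \<^bold>: Univ i"
    using S by (auto simp: typed_def)
  \<comment> \<open>When the first component of the generic pair is \<open>Var 1\<close>, the second
    is expected in \<open>lift B\<close>, which is the type of \<open>Var 0\<close>.\<close>
  have i: "inst (ren (up (\<lambda>n. Suc (Suc n))) B) (Var 1) = lift B"
  proof -
    have "(\<lambda>n. case_nat (Var 1) Var (up (\<lambda>n. Suc (Suc n)) n)) = (\<lambda>n. Var (Suc n))"
      by (auto simp: fun_eq_iff split: nat.split)
    then show ?thesis unfolding ren_eq_sub[of Suc] sub_ren by (simp only:)
  qed
  have V1: "\<langle>\<A>\<rangle> B # A # \<Gamma> \<turnstile> Var 1 \<^bold>: ren (\<lambda>n. Suc (Suc n)) A"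
    using ctx_typing.ty_Var[OF G, of 1] by simp
  have V0: "\<langle>\<A>\<rangle> B # A # \<Gamma> \<turnstile> Var 0 \<^bold>: inst (ren (up (\<lambda>n. Suc (Suc n))) B) (Var 1)"
    using ctx_typing.ty_Var[OF G, of 0] i by simp
  obtain j where "\<langle>\<A>\<rangle> ren (\<lambda>n. Suc (Suc n)) A # B # A # \<Gamma> \<turnstile> ren (up (\<lambda>n. Suc (Suc n))) B \<^bold>: Univ j"
    using typing_Sig_inv[OF S2] by auto
  from ctx_typing.ty_Pair[OF this V1 V0]
  have P: "\<langle>\<A>\<rangle> B # A # \<Gamma> \<turnstile> ?P \<^bold>: ren (\<lambda>n. Suc (Suc n)) (Sig A B)" by simp
  have C2: "\<langle>\<A>\<rangle> B # A # \<Gamma> \<turnstile> lift (lift (Lam D c)) \<^bold>: Arr (ren (\<lambda>n. Suc (Suc n)) (Sig A B)) (Univ k)"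
    using typing_ren[OF C G r] by (simp add: ren_ren up_comp)
  have "\<langle>\<A>\<rangle> B # A # \<Gamma> \<turnstile> App (lift (lift (Lam D c))) ?P \<^bold>: Univ k"
    using ctx_typing.ty_App[OF C2 P] by simp
  then show "typed \<A> \<Gamma> (Pi A (Pi B (App (lift (lift (Lam D c))) ?P)))"
    using typed_Pi[OF A typed_Pi[OF B typedI]] by blast
  have e: "inst ?c2 ?P = sub (case_nat ?P (\<lambda>n. Var (Suc (Suc n)))) c"
  proof -
    have "(\<lambda>n. case_nat ?P Var (up (\<lambda>n. Suc (Suc n)) n)) = case_nat ?P (\<lambda>n. Var (Suc (Suc n)))"
      by (auto simp: fun_eq_iff split: nat.split)
    then show ?thesis unfolding sub_ren by (simp only:)
  qed
  have "\<langle>\<A>\<rangle> ren (\<lambda>n. Suc (Suc n)) (Sig A B) # B # A # \<Gamma> \<turnstile> ?c2 \<^bold>: Univ k"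
    using typing_ren[OF c typed_ctx ctx_ren_up[OF r]] S2 by (simp add: typed_def) blast
  from typing_inst[OF this P] have "\<langle>\<A>\<rangle> B # A # \<Gamma> \<turnstile> sub (case_nat ?P (\<lambda>n. Var (Suc (Suc n)))) c \<^bold>: Univ k"
    using e by simp
  then show "typed \<A> \<Gamma> (sig_step A B c)"
    unfolding sig_step_def using typed_Pi[OF A typed_Pi[OF B typedI]] by blast
  have l: "lift (lift (Lam D c)) = Lam (lift (lift D)) ?c2"
    by (simp add: ren_ren up_comp)
  have "App (lift (lift (Lam D c))) ?P \<cong> sub (case_nat ?P (\<lambda>n. Var (Suc (Suc n)))) c"
    unfolding l e[symmetric] by (rule conv.beta)
  then show "sig_step A B c \<cong> Pi A (Pi B (App (lift (lift (Lam D c))) ?P))"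
    unfolding sig_step_def by (rule conv.cong_Pi[OF conv.conv_refl conv.cong_Pi[OF conv.conv_refl conv.conv_sym]])
qed

definition good :: "tm set \<Rightarrow> tm list \<Rightarrow> tm option \<Rightarrow> tm \<Rightarrow> tm \<Rightarrow> bool" where
  "good \<A> \<Gamma> M t T \<longleftrightarrow> \<langle>\<A>\<rangle> \<Gamma> \<turnstile> t \<^bold>: T \<and> typed \<A> \<Gamma> T \<and> (\<forall>T'. M = Some T' \<longrightarrow> T = T')"

context
  fixes \<A> :: "tm set" and R :: checker and n :: fuel and \<Gamma> :: "tm list" and M :: "tm option"
  assumes sound: "sound \<A> R" and G: "\<langle>\<A>\<rangle> \<turnstile> \<Gamma>" and M: "\<forall>T'. M = Some T' \<longrightarrow> typed \<A> \<Gamma> T'"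
begin

lemma answer_good: "answer n S M = Some T \<Longrightarrow> \<langle>\<A>\<rangle> \<Gamma> \<turnstile> t \<^bold>: S \<Longrightarrow> typed \<A> \<Gamma> S \<Longrightarrow> good \<A> \<Gamma> M t T"
  unfolding good_def using answerD M by blast

lemmas bindD = bind_eq_Some_conv case_Some if_Some
lemmas inferR = inferD[OF sound _ G]
lemmas checkR = checkD[OF sound]
lemmas univR = univ_ofD[OF sound _ G]

lemma check_Var: "check_step R n \<Gamma> M (Var k) = Some T \<Longrightarrow> good \<A> \<Gamma> M (Var k) T"
proof -
  assume "check_step R n \<Gamma> M (Var k) = Some T"
  then obtain S where l: "lookup \<Gamma> k Suc = Some S" and a: "answer n S M = Some T"
    by (auto simp: bindD)
  have "k < length \<Gamma>" and S: "S = ren (\<lambda>j. Suc k + j) (\<Gamma> ! k)" using lookup_Some[of \<Gamma> k 0 S] l by auto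
  then show "good \<A> \<Gamma> M (Var k) T"
    using answer_good[OF a] ctx_typing.ty_Var[OF G] ctx_lookup[OF G] by (auto simp: typed_def)
qed

lemma check_Univ: "check_step R n \<Gamma> M (Univ i) = Some T \<Longrightarrow> good \<A> \<Gamma> M (Univ i) T"
  using answer_good typed_Univ[OF G] ctx_typing.ty_Univ[OF G] by simp

lemma check_Pi:
  assumes "check_step R n \<Gamma> M (Pi A B) = Some T"
  shows "good \<A> \<Gamma> M (Pi A B) T"
proof -
  obtain i where A: "\<langle>\<A>\<rangle> \<Gamma> \<turnstile> A \<^bold>: Univ i"
    and r: "univ_of R n (A # \<Gamma>) B (\<lambda>j. answer n (Univ (max i j)) M) = Some T"
    using assms by (auto elim!: univR)
  obtain j where B: "\<langle>\<A>\<rangle> A # \<Gamma> \<turnstile> B \<^bold>: Univ j" and T: "answer n (Univ (max i j)) M = Some T"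
    using univ_ofD[OF sound r typed_ctx[OF typedI[OF A]]] .
  show ?thesis using answer_good[OF T ctx_typing.ty_Pi[OF A B] typed_Univ[OF G]] .
qed

lemma check_Sig:
  assumes "check_step R n \<Gamma> M (Sig A B) = Some T"
  shows "good \<A> \<Gamma> M (Sig A B) T"
proof -
  obtain i where A: "\<langle>\<A>\<rangle> \<Gamma> \<turnstile> A \<^bold>: Univ i"
    and r: "univ_of R n (A # \<Gamma>) B (\<lambda>j. answer n (Univ (max i j)) M) = Some T"
    using assms by (auto elim!: univR)
  obtain j where B: "\<langle>\<A>\<rangle> A # \<Gamma> \<turnstile> B \<^bold>: Univ j" and T: "answer n (Univ (max i j)) M = Some T"
    using univ_ofD[OF sound r typed_ctx[OF typedI[OF A]]] .
  show ?thesis using answer_good[OF T ctx_typing.ty_Sig[OF A B] typed_Univ[OF G]] .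
qed

lemma check_Lam: assumes "check_step R n \<Gamma> M (Lam A b) = Some T" shows "good \<A> \<Gamma> M (Lam A b) T"
proof (cases M)
  case None
  obtain B where A: "typed \<A> \<Gamma> A" and B: "R (A # \<Gamma>) b None = Some B" and T: "T = Pi A B"
    using assms None by (auto simp: bindD elim!: univR)
  from inferD[OF sound B typed_ctx[OF A]] A None T show ?thesis
    by (auto simp: good_def typed_def intro: ctx_typing.intros)
next
  case (Some T')
  then obtain F A' B' T2 where F: "expose R n \<Gamma> T' = Some F" "F = Pi A' B'"
    and d: "domain_ok R n \<Gamma> A A'" and b: "R (A # \<Gamma>) b (Some B') = Some T2" and T: "T = T'"
    using assms by (auto simp: bindD)
  have T': "typed \<A> \<Gamma> T'" using M Some by blast
  with exposeD[OF sound F(1)] F(2) have P: "typed \<A> \<Gamma> (Pi A' B')" and c: "T' \<cong> Pi A' B'" by auto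
  then have A': "typed \<A> \<Gamma> A'" and B': "typed \<A> (A' # \<Gamma>) B'" using typed_PiD by blast+
  from domain_okD[OF sound d A'] have A: "typed \<A> \<Gamma> A" and AA': "A \<cong> A'" by auto
  \<comment> \<open>The codomain comes with the expected domain \<open>A'\<close>, but the body is
    checked over the annotation \<open>A\<close>.\<close>
  have B: "typed \<A> (A # \<Gamma>) B'"
    using B' A ctx_conv[OF _ _ conv.conv_sym[OF AA']] unfolding typed_def by blast
  from checkR[OF b B] have "\<langle>\<A>\<rangle> A # \<Gamma> \<turnstile> b \<^bold>: B'" .
  with A have "\<langle>\<A>\<rangle> \<Gamma> \<turnstile> Lam A b \<^bold>: Pi A B'" by (auto simp: typed_def intro: ctx_typing.ty_Lam)
  moreover have "Pi A B' \<cong> T'"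
    using c AA' by (meson conv.cong_Pi conv.conv_refl conv.conv_sym conv.conv_trans)
  ultimately show ?thesis using T T' Some typed_conv by (auto simp: good_def)
qed

lemma check_App: assumes "check_step R n \<Gamma> M (App f a) = Some T" shows "good \<A> \<Gamma> M (App f a) T"
proof -
  obtain F A B T2 where f: "R \<Gamma> f None = Some F" and F: "expose R n \<Gamma> F = Some (Pi A B)"
    and a: "R \<Gamma> a (Some A) = Some T2" and T: "answer n (inst B a) M = Some T"
    using assms by (auto simp: bindD)
  from inferR[OF f] have f: "\<langle>\<A>\<rangle> \<Gamma> \<turnstile> f \<^bold>: F" and "typed \<A> \<Gamma> F" by auto
  with exposeD[OF sound F] have P: "typed \<A> \<Gamma> (Pi A B)" and c: "F \<cong> Pi A B" by auto
  then have A: "typed \<A> \<Gamma> A" and B: "typed \<A> (A # \<Gamma>) B" using typed_PiD by blast+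
  from checkR[OF a A] have a: "\<langle>\<A>\<rangle> \<Gamma> \<turnstile> a \<^bold>: A" .
  show ?thesis
    using answer_good[OF T ctx_typing.ty_App[OF typed_conv[OF f c P] a] typed_inst[OF B a]] .
qed

lemma check_Pair: assumes "check_step R n \<Gamma> M (Pair a b) = Some T" shows "good \<A> \<Gamma> M (Pair a b) T"
proof -
  obtain A B T2 T3 where M': "M = Some T" and F: "expose R n \<Gamma> T = Some (Sig A B)"
    and a: "R \<Gamma> a (Some A) = Some T2" and b: "R \<Gamma> b (Some (inst B a)) = Some T3"
    using assms by (cases M) (auto simp: bindD)
  have T: "typed \<A> \<Gamma> T" using M M' by blast
  with exposeD[OF sound F] have P: "typed \<A> \<Gamma> (Sig A B)" and c: "T \<cong> Sig A B" by auto
  then have A: "typed \<A> \<Gamma> A" and B: "typed \<A> (A # \<Gamma>) B" using typed_SigD by blast+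
  from checkR[OF a A] have a: "\<langle>\<A>\<rangle> \<Gamma> \<turnstile> a \<^bold>: A" .
  from checkR[OF b typed_inst[OF B a]] have b: "\<langle>\<A>\<rangle> \<Gamma> \<turnstile> b \<^bold>: inst B a" .
  have "\<langle>\<A>\<rangle> \<Gamma> \<turnstile> Pair a b \<^bold>: Sig A B" using B a b by (auto simp: typed_def intro: ctx_typing.ty_Pair)
  then show ?thesis using typed_conv conv.conv_sym[OF c] T M' by (auto simp: good_def)
qed

lemma check_IndSig: assumes "check_step R n \<Gamma> M (IndSig C g p) = Some T" shows "good \<A> \<Gamma> M (IndSig C g p) T"
proof -
  obtain P A B D c where p: "R \<Gamma> p None = Some P" and F: "expose R n \<Gamma> P = Some (Sig A B)"
    and C: "C = Lam D c" and d: "domain_ok R n \<Gamma> D (Sig A B)"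
    and r: "univ_of R n (D # \<Gamma>) c (\<lambda>k. Option.bind (R \<Gamma> g (Some (sig_step A B c))) (\<lambda>_. answer n (inst c p) M)) = Some T"
    using assms by (auto simp: bindD)
  from inferR[OF p] have p: "\<langle>\<A>\<rangle> \<Gamma> \<turnstile> p \<^bold>: P" and "typed \<A> \<Gamma> P" by auto
  with exposeD[OF sound F] have S: "typed \<A> \<Gamma> (Sig A B)" and cP: "P \<cong> Sig A B" by auto
  from domain_okD[OF sound d S] have D: "typed \<A> \<Gamma> D" and cD: "D \<cong> Sig A B" by auto
  obtain k T2 where c: "\<langle>\<A>\<rangle> D # \<Gamma> \<turnstile> c \<^bold>: Univ k" and g: "R \<Gamma> g (Some (sig_step A B c)) = Some T2"
    and T: "answer n (inst c p) M = Some T"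
    using r by (auto simp: bindD elim!: univ_ofD[OF sound _ typed_ctx[OF D]])
  have p: "\<langle>\<A>\<rangle> \<Gamma> \<turnstile> p \<^bold>: Sig A B" using typed_conv[OF p cP S] .
  have c': "\<langle>\<A>\<rangle> Sig A B # \<Gamma> \<turnstile> c \<^bold>: Univ k"
    using ctx_conv[OF c _ cD] S by (auto simp: typed_def)
  have "\<langle>\<A>\<rangle> \<Gamma> \<turnstile> C \<^bold>: Pi D (Univ k)" using C c D by (auto simp: typed_def intro: ctx_typing.ty_Lam)
  then have C': "\<langle>\<A>\<rangle> \<Gamma> \<turnstile> C \<^bold>: Arr (Sig A B) (Univ k)"
    using typed_conv[OF _ conv.cong_Pi[OF cD conv.conv_refl]] typed_Pi[OF S typed_Univ[OF typed_ctx[OF S]]] by simp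
  note st = sig_step_typed[OF S C'[unfolded C] c']
  have "\<langle>\<A>\<rangle> \<Gamma> \<turnstile> g \<^bold>: Pi A (Pi B (App (lift (lift C)) (Pair (Var 1) (Var 0))))"
    using typed_conv[OF checkR[OF g st(1)] st(3) st(2)] unfolding C .
  from ctx_typing.ty_IndSig[OF C' this p] have "\<langle>\<A>\<rangle> \<Gamma> \<turnstile> IndSig C g p \<^bold>: App C p" .
  moreover have i: "typed \<A> \<Gamma> (inst c p)" using typed_inst[OF typedI[OF c'] p] .
  ultimately have "\<langle>\<A>\<rangle> \<Gamma> \<turnstile> IndSig C g p \<^bold>: inst c p" using typed_conv conv.beta C by blast
  then show ?thesis using answer_good[OF T] i by blast
qed

lemma check_Eq: assumes "check_step R n \<Gamma> M (Eq A a b) = Some T" shows "good \<A> \<Gamma> M (Eq A a b) T"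
proof -
  obtain i T2 T3 where A: "\<langle>\<A>\<rangle> \<Gamma> \<turnstile> A \<^bold>: Univ i" and a: "R \<Gamma> a (Some A) = Some T2"
    and b: "R \<Gamma> b (Some A) = Some T3" and T: "answer n (Univ i) M = Some T"
    using assms by (auto simp: bindD elim!: univR)
  show ?thesis
    using answer_good[OF T ctx_typing.ty_Eq[OF A checkR[OF a typedI[OF A]] checkR[OF b typedI[OF A]]] typed_Univ[OF G]] .
qed

lemma check_Refl: assumes "check_step R n \<Gamma> M (Refl a) = Some T" shows "good \<A> \<Gamma> M (Refl a) T"
proof (cases M)
  case None
  then obtain A where "R \<Gamma> a None = Some A" and T: "T = Eq A a a" using assms by (auto simp: bindD)
  from inferR[OF this(1)] T None show ?thesis
    by (auto simp: good_def intro: ctx_typing.ty_Refl typed_Eq)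
next
  case (Some T')
  then obtain A x y T2 where F: "expose R n \<Gamma> T' = Some (Eq A x y)" and a: "R \<Gamma> a (Some A) = Some T2"
    and c: "a \<cong> x" "a \<cong> y" and T: "T = T'"
    using assms by (auto simp: bindD conv_by_def split: if_splits)
  have T': "typed \<A> \<Gamma> T'" using M Some by blast
  with exposeD[OF sound F] have E: "typed \<A> \<Gamma> (Eq A x y)" and cT: "T' \<cong> Eq A x y" by auto
  then have A: "typed \<A> \<Gamma> A" using typed_EqD by blast+
  have "\<langle>\<A>\<rangle> \<Gamma> \<turnstile> Refl a \<^bold>: Eq A a a" using checkR[OF a A] by (rule ctx_typing.ty_Refl)
  moreover have "Eq A a a \<cong> T'" using c cT by (meson conv.cong_Eq conv.conv_refl conv.conv_sym conv.conv_trans)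
  ultimately show ?thesis using T T' Some typed_conv by (auto simp: good_def)
qed

lemma check_IndEq: assumes "check_step R n \<Gamma> M (IndEq C t b p) = Some T" shows "good \<A> \<Gamma> M (IndEq C t b p) T"
proof -
  obtain P A a b' D E c where p: "R \<Gamma> p None = Some P" and F: "expose R n \<Gamma> P = Some (Eq A a b')"
    and C: "C = Lam D (Lam E c)" and dD: "domain_ok R n \<Gamma> D A"
    and dE: "domain_ok R n (D # \<Gamma>) E (Eq (lift A) (lift a) (Var 0))"
    and r: "univ_of R n (E # D # \<Gamma>) c (\<lambda>k. Option.bind (R \<Gamma> t (Some (inst2 c a (Refl a)))) (\<lambda>_.
            Option.bind (R \<Gamma> b (Some A)) (\<lambda>_. if conv_by n b b' then answer n (inst2 c b p) M else None))) = Some T"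
    using assms by (auto simp: bindD)
  from inferR[OF p] have p: "\<langle>\<A>\<rangle> \<Gamma> \<turnstile> p \<^bold>: P" and "typed \<A> \<Gamma> P" by auto
  with exposeD[OF sound F] have Q: "typed \<A> \<Gamma> (Eq A a b')" and cP: "P \<cong> Eq A a b'" by auto
  then have A: "typed \<A> \<Gamma> A" and a: "\<langle>\<A>\<rangle> \<Gamma> \<turnstile> a \<^bold>: A" using typed_EqD by blast+
  from domain_okD[OF sound dD A] have D: "typed \<A> \<Gamma> D" and cD: "D \<cong> A" by auto
  \<comment> \<open>Needed twice: for \<open>D\<close>, to validate the second annotation
    \<open>E\<close>, and for \<open>A\<close>, to type the motive in the form that the rule
    prescribes.\<close>
  have Eq: "typed \<A> (X # \<Gamma>) (Eq (lift A) (lift a) (Var 0))" if X: "typed \<A> \<Gamma> X" "X \<cong> A" for X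
  proof (rule typed_Eq)
    show lA: "typed \<A> (X # \<Gamma>) (lift A)" using typed_lift A X(1) .
    show "\<langle>\<A>\<rangle> X # \<Gamma> \<turnstile> lift a \<^bold>: lift A" using weakening[OF a typed_ctx[OF X(1)]] .
    show "\<langle>\<A>\<rangle> X # \<Gamma> \<turnstile> Var 0 \<^bold>: lift A" using typed_conv[OF typed_Var0[OF X(1)] conv_ren[OF X(2)] lA] .
  qed
  from domain_okD[OF sound dE Eq[OF D cD]] have E: "typed \<A> (D # \<Gamma>) E"
    and cE: "E \<cong> Eq (lift A) (lift a) (Var 0)" by auto
  obtain k T2 T3 where c: "\<langle>\<A>\<rangle> E # D # \<Gamma> \<turnstile> c \<^bold>: Univ k" and t: "R \<Gamma> t (Some (inst2 c a (Refl a))) = Some T2"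
    and b: "R \<Gamma> b (Some A) = Some T3" and cb: "b \<cong> b'" and T: "answer n (inst2 c b p) M = Some T"
    using r by (auto simp: bindD conv_by_def split: if_splits elim!: univ_ofD[OF sound _ typed_ctx[OF E]])
  have C1: "\<langle>\<A>\<rangle> \<Gamma> \<turnstile> C \<^bold>: Pi D (Pi E (Univ k))"
    using C c D E by (auto simp: typed_def intro: ctx_typing.ty_Lam)
  have C': "\<langle>\<A>\<rangle> \<Gamma> \<turnstile> C \<^bold>: Pi A (Arr (Eq (lift A) (lift a) (Var 0)) (Univ k))"
    using typed_conv[OF C1 conv.cong_Pi[OF cD conv.cong_Pi[OF cE conv.conv_refl]]]
      typed_Pi[OF A typed_Pi[OF Eq[OF A conv.conv_refl] typed_Univ[OF typed_ctx[OF Eq[OF A conv.conv_refl]]]]]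
    by simp
  have b: "\<langle>\<A>\<rangle> \<Gamma> \<turnstile> b \<^bold>: A" using checkR[OF b A] .
  have Eb: "typed \<A> \<Gamma> (Eq A a b)" using typed_Eq[OF A a b] .
  \<comment> \<open>The type inferred for \<open>p\<close> ends in \<open>b'\<close>; the stated
    endpoint \<open>b\<close> is only convertible to it.\<close>
  have p: "\<langle>\<A>\<rangle> \<Gamma> \<turnstile> p \<^bold>: Eq A a b"
    using typed_conv[OF p _ Eb] cP cb by (meson conv.cong_Eq conv.conv_refl conv.conv_sym conv.conv_trans)
  have mot: "\<langle>\<A>\<rangle> \<Gamma> \<turnstile> App2 C x q \<^bold>: Univ k" "typed \<A> \<Gamma> (inst2 c x q)"
    if x: "\<langle>\<A>\<rangle> \<Gamma> \<turnstile> x \<^bold>: A" and q: "\<langle>\<A>\<rangle> \<Gamma> \<turnstile> q \<^bold>: Eq A a x" for x q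
  proof -
    have "\<langle>\<A>\<rangle> \<Gamma> \<turnstile> App C x \<^bold>: Pi (Eq A a x) (Univ k)"
      using ctx_typing.ty_App[OF C' x] by (simp add: inst_lift)
    from ctx_typing.ty_App[OF this q] show "\<langle>\<A>\<rangle> \<Gamma> \<turnstile> App2 C x q \<^bold>: Univ k" by simp
    have x': "\<langle>\<A>\<rangle> \<Gamma> \<turnstile> x \<^bold>: D" using typed_conv[OF x conv.conv_sym[OF cD] D] .
    have "Eq A a x \<cong> inst E x"
      using conv_inst[OF conv.conv_sym[OF cE], of x] by (simp add: inst_lift)
    then have "\<langle>\<A>\<rangle> \<Gamma> \<turnstile> q \<^bold>: inst E x" using typed_conv[OF q] typed_inst[OF E x'] by blast
    from typing_inst2[OF c x' this] show "typed \<A> \<Gamma> (inst2 c x q)" by (simp add: typedI)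
  qed
  have ra: "\<langle>\<A>\<rangle> \<Gamma> \<turnstile> Refl a \<^bold>: Eq A a a" using a by (rule ctx_typing.ty_Refl)
  have "\<langle>\<A>\<rangle> \<Gamma> \<turnstile> t \<^bold>: App2 C a (Refl a)"
    using typed_conv[OF checkR[OF t mot(2)[OF a ra]] _ typedI[OF mot(1)[OF a ra]]] inst2_conv C
    by (blast intro: conv.conv_sym)
  from ctx_typing.ty_IndEq[OF C' this b p] have "\<langle>\<A>\<rangle> \<Gamma> \<turnstile> IndEq C t b p \<^bold>: inst2 c b p"
    using typed_conv[OF _ _ mot(2)[OF b p]] inst2_conv C by blast
  then show ?thesis using answer_good[OF T] mot(2)[OF b p] by blast
qed

lemma rel_typed:
  assumes "typed \<A> \<Gamma> A" shows "typed \<A> \<Gamma> (Arr A (Arr A (Univ j)))"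
  using assms typed_lift[OF assms assms] typed_Univ typed_ctx by (auto intro!: typed_Pi)

lemma check_Acc: assumes "check_step R n \<Gamma> M (Acc A S a) = Some T" shows "good \<A> \<Gamma> M (Acc A S a) T"
proof -
  obtain i K j T2 where A: "\<langle>\<A>\<rangle> \<Gamma> \<turnstile> A \<^bold>: Univ i" and S: "R \<Gamma> S None = Some K"
    and K: "K \<cong> Arr A (Arr A (Univ j))" and a: "R \<Gamma> a (Some A) = Some T2"
    and T: "answer n (Univ (max i j)) M = Some T"
    using assms by (auto simp: bindD elim!: univR rel_levelD[OF sound])
  have S: "\<langle>\<A>\<rangle> \<Gamma> \<turnstile> S \<^bold>: Arr A (Arr A (Univ j))"
    using typed_conv[OF inferR(1)[OF S] K rel_typed[OF typedI[OF A]]] .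
  show ?thesis
    using answer_good[OF T ctx_typing.ty_Acc[OF A S checkR[OF a typedI[OF A]]] typed_Univ[OF G]] .
qed

lemma check_AccI: assumes "check_step R n \<Gamma> M (AccI a h) = Some T" shows "good \<A> \<Gamma> M (AccI a h) T"
proof -
  obtain A S a' T2 T3 where M': "M = Some T" and F: "expose R n \<Gamma> T = Some (Acc A S a')"
    and a: "R \<Gamma> a (Some A) = Some T2" and ca: "a \<cong> a'" and d: "typed \<A> \<Gamma> (down_ty A S a)"
    and h: "R \<Gamma> h (Some (down_ty A S a)) = Some T3"
    using assms by (cases M) (auto simp: bindD conv_by_def split: if_splits elim!: univR)
  have T: "typed \<A> \<Gamma> T" using M M' by blast
  with exposeD[OF sound F] have P: "typed \<A> \<Gamma> (Acc A S a')" and c: "T \<cong> Acc A S a'" by auto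
  then obtain j where A: "typed \<A> \<Gamma> A" and S: "\<langle>\<A>\<rangle> \<Gamma> \<turnstile> S \<^bold>: Arr A (Arr A (Univ j))"
    using typed_AccD by blast+
  have "\<langle>\<A>\<rangle> \<Gamma> \<turnstile> AccI a h \<^bold>: Acc A S a"
    using ctx_typing.ty_AccI[OF S checkR[OF a A] checkR[OF h d, unfolded down_ty_def]] .
  moreover have "Acc A S a \<cong> T" using ca c by (meson conv.cong_Acc conv.conv_refl conv.conv_sym conv.conv_trans)
  ultimately show ?thesis using T M' typed_conv by (auto simp: good_def)
qed

lemma check_IndAcc: assumes "check_step R n \<Gamma> M (IndAcc A S C s a p) = Some T" shows "good \<A> \<Gamma> M (IndAcc A S C s a p) T"
proof -
  obtain i K j T2 T3 D E c where A: "\<langle>\<A>\<rangle> \<Gamma> \<turnstile> A \<^bold>: Univ i" and S: "R \<Gamma> S None = Some K"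
    and K: "K \<cong> Arr A (Arr A (Univ j))" and a: "R \<Gamma> a (Some A) = Some T2" and p: "R \<Gamma> p (Some (Acc A S a)) = Some T3"
    and C: "C = Lam D (Lam E c)" and dD: "domain_ok R n \<Gamma> D A"
    and dE: "domain_ok R n (D # \<Gamma>) E (Acc (lift A) (lift S) (Var 0))"
    and r: "univ_of R n (E # D # \<Gamma>) c (\<lambda>k. univ_of R n \<Gamma> (acc_step A S c) (\<lambda>_.
              univ_of R n \<Gamma> (acc_step_raw A S C) (\<lambda>_. if conv_by n (acc_step A S c) (acc_step_raw A S C) then
                Option.bind (R \<Gamma> s (Some (acc_step A S c))) (\<lambda>_. answer n (inst2 c a p) M) else None))) = Some T"
    using assms by (auto simp: bindD elim!: univR rel_levelD[OF sound])
  have tA: "typed \<A> \<Gamma> A" using A by (rule typedI)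
  have S: "\<langle>\<A>\<rangle> \<Gamma> \<turnstile> S \<^bold>: Arr A (Arr A (Univ j))"
    using typed_conv[OF inferR(1)[OF S] K rel_typed[OF tA]] .
  have a: "\<langle>\<A>\<rangle> \<Gamma> \<turnstile> a \<^bold>: A" using checkR[OF a tA] .
  have p: "\<langle>\<A>\<rangle> \<Gamma> \<turnstile> p \<^bold>: Acc A S a" using checkR[OF p typedI[OF ctx_typing.ty_Acc[OF A S a]]] .
  from domain_okD[OF sound dD tA] have D: "typed \<A> \<Gamma> D" and cD: "D \<cong> A" by auto
  have Ac: "typed \<A> (X # \<Gamma>) (Acc (lift A) (lift S) (Var 0))" if X: "typed \<A> \<Gamma> X" "X \<cong> A" for X
  proof (rule typedI[OF ctx_typing.ty_Acc])
    show "\<langle>\<A>\<rangle> X # \<Gamma> \<turnstile> lift A \<^bold>: Univ i" using weakening[OF A typed_ctx[OF X(1)]] by simp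
    show "\<langle>\<A>\<rangle> X # \<Gamma> \<turnstile> lift S \<^bold>: Arr (lift A) (Arr (lift A) (Univ j))"
      using weakening[OF S typed_ctx[OF X(1)]] by (simp add: ren_up_lift)
    show "\<langle>\<A>\<rangle> X # \<Gamma> \<turnstile> Var 0 \<^bold>: lift A"
      using typed_conv[OF typed_Var0[OF X(1)] conv_ren[OF X(2)] typed_lift[OF tA X(1)]] .
  qed
  from domain_okD[OF sound dE Ac[OF D cD]] have E: "typed \<A> (D # \<Gamma>) E"
    and cE: "E \<cong> Acc (lift A) (lift S) (Var 0)" by auto
  obtain k T4 where c: "\<langle>\<A>\<rangle> E # D # \<Gamma> \<turnstile> c \<^bold>: Univ k" and st: "typed \<A> \<Gamma> (acc_step A S c)"
    and raw: "typed \<A> \<Gamma> (acc_step_raw A S C)" and cs: "acc_step A S c \<cong> acc_step_raw A S C"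
    and s: "R \<Gamma> s (Some (acc_step A S c)) = Some T4" and T: "answer n (inst2 c a p) M = Some T"
    using r by (auto simp: bindD conv_by_def split: if_splits elim!: univR univ_ofD[OF sound _ typed_ctx[OF E]])
  have C1: "\<langle>\<A>\<rangle> \<Gamma> \<turnstile> C \<^bold>: Pi D (Pi E (Univ k))"
    using C c D E by (auto simp: typed_def intro: ctx_typing.ty_Lam)
  have C': "\<langle>\<A>\<rangle> \<Gamma> \<turnstile> C \<^bold>: Pi A (Arr (Acc (lift A) (lift S) (Var 0)) (Univ k))"
    using typed_conv[OF C1 conv.cong_Pi[OF cD conv.cong_Pi[OF cE conv.conv_refl]]]
      typed_Pi[OF tA typed_Pi[OF Ac[OF tA conv.conv_refl] typed_Univ[OF typed_ctx[OF Ac[OF tA conv.conv_refl]]]]]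
    by simp
  have "\<langle>\<A>\<rangle> \<Gamma> \<turnstile> s \<^bold>: acc_step_raw A S C" using typed_conv[OF checkR[OF s st] cs raw] .
  from ctx_typing.ty_IndAcc[OF C' this[unfolded acc_step_raw_def] a p]
  have I: "\<langle>\<A>\<rangle> \<Gamma> \<turnstile> IndAcc A S C s a p \<^bold>: App2 C a p" .
  have a': "\<langle>\<A>\<rangle> \<Gamma> \<turnstile> a \<^bold>: D" using typed_conv[OF a conv.conv_sym[OF cD] D] .
  have "Acc A S a \<cong> inst E a"
    using conv_inst[OF conv.conv_sym[OF cE], of a] by (simp add: inst_lift)
  then have "\<langle>\<A>\<rangle> \<Gamma> \<turnstile> p \<^bold>: inst E a" using typed_conv[OF p] typed_inst[OF E a'] by blast
  from typing_inst2[OF c a' this] have i: "typed \<A> \<Gamma> (inst2 c a p)" by (simp add: typedI)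
  then have "\<langle>\<A>\<rangle> \<Gamma> \<turnstile> IndAcc A S C s a p \<^bold>: inst2 c a p"
    using typed_conv[OF I] inst2_conv C by blast
  then show ?thesis using answer_good[OF T] i by blast
qed

lemma check_Trunc: "check_step R n \<Gamma> M (Trunc A) = Some T \<Longrightarrow> good \<A> \<Gamma> M (Trunc A) T"
  using typed_Univ[OF G] by (auto elim!: univR intro: answer_good ctx_typing.ty_Trunc)

lemma check_TrI: assumes "check_step R n \<Gamma> M (TrI a) = Some T" shows "good \<A> \<Gamma> M (TrI a) T"
proof -
  obtain A T2 where M': "M = Some T" and F: "expose R n \<Gamma> T = Some (Trunc A)" and a: "R \<Gamma> a (Some A) = Some T2"
    using assms by (cases M) (auto simp: bindD)
  have T: "typed \<A> \<Gamma> T" using M M' by blast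
  with exposeD[OF sound F] have P: "typed \<A> \<Gamma> (Trunc A)" and c: "T \<cong> Trunc A" by auto
  then have A: "typed \<A> \<Gamma> A" using typed_TruncD by blast+
  show ?thesis
    using typed_conv[OF ctx_typing.ty_TrI[OF checkR[OF a A]] conv.conv_sym[OF c] T] T M' by (auto simp: good_def)
qed

lemma check_TrEq: assumes "check_step R n \<Gamma> M (TrEq x y) = Some T" shows "good \<A> \<Gamma> M (TrEq x y) T"
proof -
  obtain X A T2 where x: "R \<Gamma> x None = Some X" and F: "expose R n \<Gamma> X = Some (Trunc A)"
    and y: "R \<Gamma> y (Some (Trunc A)) = Some T2" and T: "answer n (Eq (Trunc A) x y) M = Some T"
    using assms by (auto simp: bindD)
  from inferR[OF x] have x: "\<langle>\<A>\<rangle> \<Gamma> \<turnstile> x \<^bold>: X" and "typed \<A> \<Gamma> X" by auto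
  with exposeD[OF sound F] have P: "typed \<A> \<Gamma> (Trunc A)" and c: "X \<cong> Trunc A" by auto
  have x: "\<langle>\<A>\<rangle> \<Gamma> \<turnstile> x \<^bold>: Trunc A" using typed_conv[OF x c P] .
  have y: "\<langle>\<A>\<rangle> \<Gamma> \<turnstile> y \<^bold>: Trunc A" using checkR[OF y P] .
  show ?thesis using answer_good[OF T ctx_typing.ty_TrEq[OF x y] typed_Eq[OF P x y]] .
qed

lemma check_RecTr: assumes "check_step R n \<Gamma> M (RecTr B q f x) = Some T" shows "good \<A> \<Gamma> M (RecTr B q f x) T"
proof -
  let ?Q = "Pi B (Pi (lift B) (Eq (lift (lift B)) (Var 1) (Var 0)))"
  obtain j X A T2 T3 where B: "\<langle>\<A>\<rangle> \<Gamma> \<turnstile> B \<^bold>: Univ j" and x: "R \<Gamma> x None = Some X" and F: "expose R n \<Gamma> X = Some (Trunc A)"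
    and q: "R \<Gamma> q (Some ?Q) = Some T2"
    and f: "R \<Gamma> f (Some (Arr A B)) = Some T3" and T: "answer n B M = Some T"
    using assms by (auto simp: bindD elim!: univR)
  from inferR[OF x] have x: "\<langle>\<A>\<rangle> \<Gamma> \<turnstile> x \<^bold>: X" and "typed \<A> \<Gamma> X" by auto
  with exposeD[OF sound F] have P: "typed \<A> \<Gamma> (Trunc A)" and c: "X \<cong> Trunc A" by auto
  then have A: "typed \<A> \<Gamma> A" using typed_TruncD by blast+
  have tB: "typed \<A> \<Gamma> B" using B by (rule typedI)
  have lB: "typed \<A> (B # \<Gamma>) (lift B)" using typed_lift[OF tB tB] .
  have G2: "\<langle>\<A>\<rangle> \<turnstile> lift B # B # \<Gamma>" using lB by (rule typed_ctx)
  have V: "\<langle>\<A>\<rangle> lift B # B # \<Gamma> \<turnstile> Var 1 \<^bold>: lift (lift B)"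
    using ctx_typing.ty_Var[OF G2, of 1] by (simp add: ren_ren)
  have "typed \<A> (lift B # B # \<Gamma>) (Eq (lift (lift B)) (Var 1) (Var 0))"
    using typed_Eq[OF typed_lift[OF lB lB] V typed_Var0[OF lB]] .
  then have Q: "typed \<A> \<Gamma> ?Q" using tB lB by (intro typed_Pi)
  have ar: "typed \<A> \<Gamma> (Arr A B)" using typed_Pi[OF A typed_lift[OF tB A]] .
  show ?thesis
    using answer_good[OF T ctx_typing.ty_RecTr[OF B checkR[OF q Q] checkR[OF f ar] typed_conv[OF x c P]] tB] .
qed

lemma check_step_good:
  assumes "check_step R n \<Gamma> M t = Some T"
  shows "good \<A> \<Gamma> M t T"
proof (cases t)
  case Var
  then show ?thesis using assms check_Var by blast
next
  case Univ
  then show ?thesis using assms check_Univ by blast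
next
  case Pi
  then show ?thesis using assms check_Pi by blast
next
  case Lam
  then show ?thesis using assms check_Lam by blast
next
  case App
  then show ?thesis using assms check_App by blast
next
  case Sig
  then show ?thesis using assms check_Sig by blast
next
  case Pair
  then show ?thesis using assms check_Pair by blast
next
  case IndSig
  then show ?thesis using assms check_IndSig by blast
next
  case Eq
  then show ?thesis using assms check_Eq by blast
next
  case Refl
  then show ?thesis using assms check_Refl by blast
next
  case IndEq
  then show ?thesis using assms check_IndEq by blast
next
  case Acc
  then show ?thesis using assms check_Acc by blast
next
  case AccI
  then show ?thesis using assms check_AccI by blast
next
  case IndAcc
  then show ?thesis using assms check_IndAcc by blast
next
  case Trunc
  then show ?thesis using assms check_Trunc by blast
next
  case TrI
  then show ?thesis using assms check_TrI by blast
next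
  case TrEq
  then show ?thesis using assms check_TrEq by blast
next
  case RecTr
  then show ?thesis using assms check_RecTr by blast
qed (use assms in simp_all)

end

lemma check_sound: "sound \<A> (check n)"
proof (induction n)
  case (Fuel n)
  show ?case
    unfolding sound_def
  proof (intro allI impI)
    fix \<Gamma> t M T
    assume "\<langle>\<A>\<rangle> \<turnstile> \<Gamma>" "\<forall>T'. M = Some T' \<longrightarrow> typed \<A> \<Gamma> T'" "check (Fuel n) \<Gamma> t M = Some T"
    from check_step_good[OF Fuel this(1,2) this(3)[unfolded check.simps]]
    show "\<langle>\<A>\<rangle> \<Gamma> \<turnstile> t \<^bold>: T \<and> typed \<A> \<Gamma> T \<and> (\<forall>T'. M = Some T' \<longrightarrow> T = T')"
      by (simp add: good_def)
  qed
qed (simp add: sound_def)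

section \<open>Checked derivations\<close>

text \<open>Well-formedness of \<open>T\<close> is included because \<open>T\<close> will serve as a
  context entry of later derivations, and validity of the type of a typed term is not proved in
  general.\<close>

definition holds :: "tm set \<Rightarrow> tm list \<Rightarrow> tm \<Rightarrow> bool"  (\<open>\<langle>_\<rangle> _ \<tturnstile> _\<close> [0, 51, 51] 50) where
  "\<langle>\<A>\<rangle> \<Gamma> \<tturnstile> T \<longleftrightarrow> (\<exists>t. \<langle>\<A>\<rangle> \<Gamma> \<turnstile> t \<^bold>: T) \<and> typed \<A> \<Gamma> T"

text \<open>Recursive rather than \<open>n + k\<close>, so that rewriting turns a concrete weakening
  into successors.\<close>

primrec shift :: "nat \<Rightarrow> nat \<Rightarrow> nat" where
  "shift 0 = (\<lambda>k. k)"
| "shift (Suc n) = (\<lambda>k. Suc (shift n k))"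

lemma shift_eq: "shift n k = n + k"
  by (induction n) auto

lemma holds_closed: "\<langle>\<A>\<rangle> [] \<tturnstile> T \<Longrightarrow> \<langle>\<A>\<rangle> \<turnstile> \<Gamma> \<Longrightarrow> \<langle>\<A>\<rangle> \<Gamma> \<tturnstile> T"
proof -
  assume T: "\<langle>\<A>\<rangle> [] \<tturnstile> T" and G: "\<langle>\<A>\<rangle> \<turnstile> \<Gamma>"
  have "\<langle>\<A>\<rangle> \<Gamma> \<turnstile> t \<^bold>: A" if "\<langle>\<A>\<rangle> [] \<turnstile> t \<^bold>: A" for t A
    using typing_ren[OF that G, of "\<lambda>k. k"] by (simp add: ctx_ren_def ren_id)
  with T show ?thesis unfolding holds_def typed_def by blast
qed

lemma ctx_ren_shift: "ctx_ren (\<Xi> @ \<Gamma>) (shift (length \<Xi>)) \<Gamma>"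
  by (auto simp: ctx_ren_def shift_eq ren_ren nth_append add.assoc)

lemma holds_weaken: "\<langle>\<A>\<rangle> \<Gamma> \<tturnstile> T \<Longrightarrow> \<langle>\<A>\<rangle> \<turnstile> \<Xi> @ \<Gamma> \<Longrightarrow> \<langle>\<A>\<rangle> \<Xi> @ \<Gamma> \<tturnstile> ren (shift (length \<Xi>)) T"
  using typing_ren[OF _ _ ctx_ren_shift] unfolding holds_def typed_def by (metis ren.simps(2))

lemma holds_Pi: "\<langle>\<A>\<rangle> A # \<Gamma> \<tturnstile> B \<Longrightarrow> \<langle>\<A>\<rangle> \<Gamma> \<tturnstile> Pi A B"
  unfolding holds_def typed_def using typing_ConsD by (meson ctx_typing.ty_Lam ctx_typing.ty_Pi)

lemma holds_cut:
  assumes "\<langle>\<A>\<rangle> \<Gamma> \<tturnstile> H" "\<langle>\<A>\<rangle> H # \<Gamma> \<turnstile> t \<^bold>: lift T"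
  shows "\<exists>t. \<langle>\<A>\<rangle> \<Gamma> \<turnstile> t \<^bold>: T"
  using assms typing_inst[of \<A> H \<Gamma> t "lift T"] by (auto simp: holds_def inst_lift)

text \<open>All hypotheses are types over the same \<open>\<Gamma>\<close>; each must be weakened
  past those added before it, and \<open>k\<close> counts them.\<close>

primrec hyps :: "nat \<Rightarrow> tm list \<Rightarrow> tm list \<Rightarrow> tm list" where
  "hyps k [] \<Gamma> = \<Gamma>"
| "hyps k (H # Hs) \<Gamma> = hyps (Suc k) Hs (ren (shift k) H # \<Gamma>)"

definition check_ok :: "fuel \<Rightarrow> tm list \<Rightarrow> tm list \<Rightarrow> tm \<Rightarrow> tm \<Rightarrow> bool" where
  "check_ok n \<Gamma> Hs t T \<longleftrightarrow> (if is_type (check n) n \<Gamma> T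
     then check n (hyps 0 Hs \<Gamma>) t (Some (ren (shift (length Hs)) T)) \<noteq> None else False)"

lemma hyps_discharge:
  assumes "\<forall>H\<in>set Hs. \<langle>\<A>\<rangle> \<Gamma> \<tturnstile> H" "\<langle>\<A>\<rangle> \<turnstile> \<Xi> @ \<Gamma>"
  shows "\<langle>\<A>\<rangle> \<turnstile> hyps (length \<Xi>) Hs (\<Xi> @ \<Gamma>) \<and>
    ((\<exists>t. \<langle>\<A>\<rangle> hyps (length \<Xi>) Hs (\<Xi> @ \<Gamma>) \<turnstile> t \<^bold>: ren (shift (length Hs)) T) \<longrightarrow> (\<exists>t. \<langle>\<A>\<rangle> \<Xi> @ \<Gamma> \<turnstile> t \<^bold>: T))"
  using assms
proof (induction Hs arbitrary: \<Xi> T)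
  case Nil
  then show ?case by (simp add: ren_id)
next
  case (Cons H Hs)
  have H: "\<langle>\<A>\<rangle> \<Xi> @ \<Gamma> \<tturnstile> ren (shift (length \<Xi>)) H" using Cons.prems by (auto intro: holds_weaken)
  then have "\<langle>\<A>\<rangle> \<turnstile> (ren (shift (length \<Xi>)) H # \<Xi>) @ \<Gamma>" using typed_ctx by (auto simp: holds_def)
  from Cons.IH[OF _ this, of "lift T"] Cons.prems(1) show ?case
    using holds_cut[OF H] by (auto simp: ren_ren shift_eq)
qed

text \<open>While \<open>t\<close> is checked, the lemmas \<open>Hs\<close> are fresh variables;
  witnesses are substituted for them only afterwards. Their terms are never traversed or evaluated,
  so the cost of a derivation does not depend on how its lemmas were proved.\<close>

lemma holds_check:
  assumes "\<langle>\<A>\<rangle> \<turnstile> \<Gamma>" "list_all (holds \<A> \<Gamma>) Hs" "check_ok n \<Gamma> Hs t T"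
  shows "\<langle>\<A>\<rangle> \<Gamma> \<tturnstile> T"
proof -
  have T: "typed \<A> \<Gamma> T" and c: "check n (hyps 0 Hs \<Gamma>) t (Some (ren (shift (length Hs)) T)) \<noteq> None"
    using assms(3) is_typeD[OF check_sound _ assms(1)] by (auto simp: check_ok_def split: if_splits)
  have H: "\<forall>H\<in>set Hs. \<langle>\<A>\<rangle> \<Gamma> \<tturnstile> H" using assms(2) by (simp add: list_all_iff)
  note d = hyps_discharge[of Hs \<A> \<Gamma> "[]", OF H, simplified, OF assms(1)]
  have "typed \<A> (hyps 0 Hs \<Gamma>) (ren (shift (length Hs)) T)"
  proof -
    \<comment> \<open>\<open>hyps\<close> only prepends, one entry per hypothesis, so the weakened
      goal is well formed by renaming.\<close>
    have "\<exists>\<Xi>. hyps k Hs \<Delta> = \<Xi> @ \<Delta> \<and> length \<Xi> = length Hs" for k \<Delta>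
    proof (induction Hs arbitrary: k \<Delta>)
      case (Cons H Hs)
      from Cons.IH[of "Suc k" "ren (shift k) H # \<Delta>"] show ?case by force
    qed simp
    then obtain \<Xi> where "hyps 0 Hs \<Gamma> = \<Xi> @ \<Gamma>" "length \<Xi> = length Hs" by blast
    with T d show ?thesis using typing_ren[OF _ _ ctx_ren_shift[of \<Xi> \<Gamma>]] unfolding typed_def
      by (metis ren.simps(2))
  qed
  then have "\<langle>\<A>\<rangle> hyps 0 Hs \<Gamma> \<turnstile> t \<^bold>: ren (shift (length Hs)) T" using checkD[OF check_sound] c by blast
  with d T show ?thesis unfolding holds_def by blast
qed

lemma ctx_extend: "\<langle>\<A>\<rangle> \<turnstile> \<Gamma> \<Longrightarrow> is_type (check n) n \<Gamma> T \<Longrightarrow> \<langle>\<A>\<rangle> \<turnstile> T # \<Gamma>"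
  using is_typeD[OF check_sound] typed_ctx by blast

section \<open>Conversion of instances\<close>

text \<open>Complements \<open>conv_sub\<close>: here the term is fixed and the substituted terms
  vary up to conversion.\<close>

lemma conv_sub_cong: "(\<And>n. s n \<cong> s' n) \<Longrightarrow> sub s t \<cong> sub s' t"
proof (induction t arbitrary: s s')
  case (Pi A B)
  have "ups s n \<cong> ups s' n" for n using Pi.prems by (auto intro: conv.conv_refl conv_ren split: nat.split)
  with Pi show ?case by (auto intro!: conv.cong_Pi)
next
  case (Lam A b)
  have "ups s n \<cong> ups s' n" for n using Lam.prems by (auto intro: conv.conv_refl conv_ren split: nat.split)
  with Lam show ?case by (auto intro!: conv.cong_Lam)
next
  case (Sig A B)
  have "ups s n \<cong> ups s' n" for n using Sig.prems by (auto intro: conv.conv_refl conv_ren split: nat.split)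
  with Sig show ?case by (auto intro!: conv.cong_Sig)
qed (simp_all add: conv.conv_refl conv.cong_App conv.cong_Pair conv.cong_IndSig conv.cong_Eq conv.cong_Refl
    conv.cong_IndEq conv.cong_IndEmpty conv.cong_IndUnit conv.cong_Sum conv.cong_Inl conv.cong_Inr
    conv.cong_IndSum conv.cong_Succ conv.cong_IndNat conv.cong_Acc conv.cong_AccI conv.cong_IndAcc
    conv.cong_Trunc conv.cong_TrI conv.cong_TrEq conv.cong_RecTr)

lemma check_typing:
  "\<langle>\<A>\<rangle> \<turnstile> \<Gamma> \<Longrightarrow> check_ok n \<Gamma> [] t T \<Longrightarrow> \<langle>\<A>\<rangle> \<Gamma> \<turnstile> t \<^bold>: T"
  using is_typeD[OF check_sound] checkD[OF check_sound] by (fastforce simp: check_ok_def ren_id split: if_splits)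

lemma typed_Sig: "typed \<A> \<Gamma> A \<Longrightarrow> typed \<A> (A # \<Gamma>) B \<Longrightarrow> typed \<A> \<Gamma> (Sig A B)"
  by (auto simp: typed_def intro: ctx_typing.ty_Sig)

lemma ctx_sub_snoc:
  assumes "ctx_sub \<A> \<Delta> s \<Gamma>" "\<langle>\<A>\<rangle> \<Delta> \<turnstile> a \<^bold>: sub s A"
  shows "ctx_sub \<A> \<Delta> (case_nat a s) (A # \<Gamma>)"
  using assms by (auto simp: ctx_sub_def nth_Cons sub_ren split: nat.split)

lemma ctx_sub_Nil: "ctx_sub \<A> \<Delta> s []"
  by (simp add: ctx_sub_def)

text \<open>An \<open>expr\<close> may depend on the depth in an arbitrary way. A stable one
  behaves, from depth \<open>n\<close> on, like a fixed term that is merely weakened whenever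
  another variable is bound. This is what makes a named construction a substitution instance of a
  single open term.\<close>

definition stable :: "expr \<Rightarrow> nat \<Rightarrow> bool" where
  "stable e n \<longleftrightarrow> (\<forall>m\<ge>n. e (Suc m) = lift (e m))"

lemma stableD: "stable e n \<Longrightarrow> n \<le> m \<Longrightarrow> e (Suc m) = lift (e m)"
  by (simp add: stable_def)

lemma stable_le: "stable e n \<Longrightarrow> n \<le> m \<Longrightarrow> stable e m"
  by (simp add: stable_def)

lemma stable_bound: "m < n \<Longrightarrow> stable (bound m) n"
  by (auto simp: stable_def bound_def)

lemma stable_App: "stable a n \<Longrightarrow> stable b n \<Longrightarrow> stable (a \<cdot> b) n"
  by (simp add: stable_def eApp_def)

lemma lift_inst_scoped: "scoped (Suc 0) t \<Longrightarrow> lift (inst t a) = inst t (lift a)"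
  unfolding ren_sub by (rule scoped_sub_cong) auto

lemma lift_inst2_scoped: "scoped (Suc (Suc 0)) t \<Longrightarrow> lift (inst2 t a b) = inst2 t (lift a) (lift b)"
  unfolding ren_sub by (rule scoped_sub_cong) (auto simp: less_Suc_eq)

text \<open>These compute the de Bruijn indices of variables bound just above a symbolic depth
  \<open>n\<close>.\<close>

lemma Suc_minus:
  "n - n = (0::nat)" "Suc n - n = Suc 0" "Suc (Suc n) - n = Suc (Suc 0)" "Suc (Suc (Suc n)) - n = Suc (Suc (Suc 0))"
  "Suc (Suc (Suc (Suc n))) - n = Suc (Suc (Suc (Suc 0)))"
  "Suc (Suc (Suc (Suc (Suc n)))) - n = Suc (Suc (Suc (Suc (Suc 0))))"
  "Suc (Suc (Suc (Suc (Suc (Suc n))))) - n = Suc (Suc (Suc (Suc (Suc (Suc 0)))))"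
  "Suc (Suc (Suc (Suc (Suc (Suc (Suc n)))))) - n = Suc (Suc (Suc (Suc (Suc (Suc (Suc 0))))))"
  "Suc (Suc (Suc (Suc (Suc (Suc (Suc (Suc n))))))) - n = Suc (Suc (Suc (Suc (Suc (Suc (Suc (Suc 0)))))))"
  "Suc (Suc (Suc (Suc (Suc (Suc (Suc (Suc (Suc n)))))))) - n = Suc (Suc (Suc (Suc (Suc (Suc (Suc (Suc (Suc 0))))))))"
  "Suc (Suc (Suc (Suc (Suc (Suc (Suc (Suc (Suc (Suc n))))))))) - n = Suc (Suc (Suc (Suc (Suc (Suc (Suc (Suc (Suc (Suc 0)))))))))"
  by simp_all

text \<open>The conversion rule applies because the required type is an instance of a context entry
  and is therefore well formed.\<close>

lemma ctx_sub_step: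
  assumes "\<langle>\<A>\<rangle> \<turnstile> A # \<Gamma>" "ctx_sub \<A> \<Delta> s \<Gamma>" "\<langle>\<A>\<rangle> \<Delta> \<turnstile> a \<^bold>: A'" "A' \<cong> sub s A"
  shows "ctx_sub \<A> \<Delta> (case_nat a s) (A # \<Gamma>)"
proof -
  obtain i where "\<langle>\<A>\<rangle> \<Gamma> \<turnstile> A \<^bold>: Univ i" using assms(1) ctx_ConsD by blast
  then have "typed \<A> \<Delta> (sub s A)"
    using typing_sub[OF _ typing_ctx[OF assms(3)] assms(2)] by (fastforce simp: typed_def)
  then show ?thesis using ctx_sub_snoc[OF assms(2)] typed_conv[OF assms(3,4)] by blast
qed

text \<open>The left function is the branch of \<open>proj1\<close>; together with
  \<open>comp_Sig\<close> this computes the first projection of a pair, and \<open>App2_snd\<close>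
  the second.\<close>

lemma App2_fst: "App2 (Lam A (Lam B (Var 1))) a b \<cong> a"
proof -
  have "App (Lam A (Lam B (Var 1))) a \<cong> Lam (inst B a) (lift a)"
    using conv.beta[of A "Lam B (Var 1)" a] by simp
  then have "App2 (Lam A (Lam B (Var 1))) a b \<cong> App (Lam (inst B a) (lift a)) b"
    by (intro conv.cong_App conv.conv_refl)
  with conv.beta[of "inst B a" "lift a" b] show ?thesis
    unfolding inst_lift by (blast intro: conv.conv_trans)
qed

lemma App2_snd: "App2 (Lam A (Lam B (Var 0))) a b \<cong> b"
proof -
  have "App (Lam A (Lam B (Var 0))) a \<cong> Lam (inst B a) (Var 0)"
    using conv.beta[of A "Lam B (Var 0)" a] by simp
  then have "App2 (Lam A (Lam B (Var 0))) a b \<cong> App (Lam (inst B a) (Var 0)) b"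
    by (intro conv.cong_App conv.conv_refl)
  with conv.beta[of "inst B a" "Var 0" b] show ?thesis
    by (auto intro: conv.conv_trans)
qed

lemma App3_triple: "App3 (Lam A (Lam B (Lam C (Pair (Var 2) (Pair (Var 1) (Var 0)))))) a b c \<cong> Pair a (Pair b c)"
proof -
  let ?C = "sub (ups (case_nat a Var)) (sub (ups (ups (case_nat a Var))) C)"
  have "App (Lam A (Lam B (Lam C (Pair (Var 2) (Pair (Var 1) (Var 0)))))) a \<cong>
      Lam (inst B a) (Lam (sub (ups (case_nat a Var)) C) (Pair (lift (lift a)) (Pair (Var 1) (Var 0))))"
    using conv.beta[of A "Lam B (Lam C (Pair (Var 2) (Pair (Var 1) (Var 0))))" a] by (simp add: numeral_2_eq_2)
  moreover have "App (Lam (inst B a) (Lam (sub (ups (case_nat a Var)) C) (Pair (lift (lift a)) (Pair (Var 1) (Var 0))))) b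
      \<cong> Lam (inst (sub (ups (case_nat a Var)) C) b) (Pair (lift a) (Pair (lift b) (Var 0)))"
    using conv.beta[of "inst B a" "Lam (sub (ups (case_nat a Var)) C) (Pair (lift (lift a)) (Pair (Var 1) (Var 0)))" b]
    by (simp add: sub_ups_lift inst_lift)
  moreover have "App (Lam (inst (sub (ups (case_nat a Var)) C) b) (Pair (lift a) (Pair (lift b) (Var 0)))) c
      \<cong> Pair a (Pair b c)"
    using conv.beta[of "inst (sub (ups (case_nat a Var)) C) b" "Pair (lift a) (Pair (lift b) (Var 0))" c]
    by (simp add: inst_lift)
  ultimately show ?thesis by (meson conv.cong_App conv.conv_refl conv.conv_trans)
qed

lemma sub_scoped: "scoped k t \<Longrightarrow> (\<And>n. n < k \<Longrightarrow> sub s (q n) = q' n) \<Longrightarrow> sub s (sub q t) = sub q' t"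
  unfolding sub_sub by (rule scoped_sub_cong) auto

lemma exists_Lam:
  assumes "typed \<A> \<Gamma> (Pi A B)" "typed \<A> (A # \<Gamma>) B \<Longrightarrow> \<exists>t. \<langle>\<A>\<rangle> A # \<Gamma> \<turnstile> t \<^bold>: B"
  shows "\<exists>t. \<langle>\<A>\<rangle> \<Gamma> \<turnstile> t \<^bold>: Pi A B"
  using assms typed_PiD[OF assms(1)] by (auto simp: typed_def intro: ctx_typing.ty_Lam)

lemma exists_id:
  assumes "typed \<A> \<Gamma> (Pi A B)" "lift A \<cong> B"
  shows "\<exists>t. \<langle>\<A>\<rangle> \<Gamma> \<turnstile> t \<^bold>: Pi A B"
proof (rule exists_Lam[OF assms(1)])
  assume B: "typed \<A> (A # \<Gamma>) B"
  have "\<langle>\<A>\<rangle> A # \<Gamma> \<turnstile> Var 0 \<^bold>: lift A"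
    using ctx_typing.ty_Var[of \<A> "A # \<Gamma>" 0] typed_PiD[OF assms(1)] typed_ctx by simp
  then show "\<exists>t. \<langle>\<A>\<rangle> A # \<Gamma> \<turnstile> t \<^bold>: B"
    using typed_conv[OF _ assms(2) B] by blast
qed

lemma ctx_sub_exists:
  assumes "\<langle>\<A>\<rangle> \<turnstile> A # \<Gamma>" "\<langle>\<A>\<rangle> \<turnstile> \<Delta>" "ctx_sub \<A> \<Delta> s \<Gamma>" "typed \<A> \<Delta> (sub s A) \<Longrightarrow> \<exists>a. \<langle>\<A>\<rangle> \<Delta> \<turnstile> a \<^bold>: sub s A"
  obtains a where "ctx_sub \<A> \<Delta> (case_nat a s) (A # \<Gamma>)"
proof -
  obtain i where "\<langle>\<A>\<rangle> \<Gamma> \<turnstile> A \<^bold>: Univ i" using assms(1) ctx_ConsD by blast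
  then have "typed \<A> \<Delta> (sub s A)"
    using typing_sub[OF _ assms(2,3)] by (fastforce simp: typed_def)
  then show thesis using assms(4) ctx_sub_snoc[OF assms(3)] that by blast
qed

text \<open>The five arguments are those of the transfer principles in \<open>Ords_ctx\<close>: a
  carrier, a relation, a proof, an ordinal and a simulation. At the actual ordinals these principles
  return the simulation unchanged.\<close>

lemma exists_id5:
  assumes "typed \<A> \<Gamma> (Pi A (Pi B (Pi C (Pi D (Pi S T)))))" "lift S \<cong> T"
  shows "\<exists>t. \<langle>\<A>\<rangle> \<Gamma> \<turnstile> t \<^bold>: Pi A (Pi B (Pi C (Pi D (Pi S T))))"
  by (rule exists_Lam[OF assms(1) exists_Lam[OF _ exists_Lam[OF _ exists_Lam[OF _ exists_id[OF _ assms(2)]]]]])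

section \<open>Evaluation of the checker by rewriting\<close>

named_theorems expr_eval
named_theorems check_eval
named_theorems check_cong

definition ten :: "fuel \<Rightarrow> fuel" where
  "ten n = Fuel (Fuel (Fuel (Fuel (Fuel (Fuel (Fuel (Fuel (Fuel (Fuel n)))))))))"

definition full :: fuel where
  "full = ten (ten (ten (ten (ten (ten (ten (ten (ten (ten (ten (ten (ten (ten (ten Empty_Fuel))))))))))))))"

definition eAccI :: "expr \<Rightarrow> expr \<Rightarrow> expr" where
  "eAccI a h = (\<lambda>n. AccI (a n) (h n))"

definition eIndAcc :: "expr \<Rightarrow> expr \<Rightarrow> expr \<Rightarrow> expr \<Rightarrow> expr \<Rightarrow> expr \<Rightarrow> expr" where
  "eIndAcc A R C s a p = (\<lambda>n. IndAcc (A n) (R n) (C n) (s n) (a n) (p n))"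

definition eTrI :: "expr \<Rightarrow> expr" where
  "eTrI a = (\<lambda>n. TrI (a n))"

definition eTrEq :: "expr \<Rightarrow> expr \<Rightarrow> expr" where
  "eTrEq x y = (\<lambda>n. TrEq (x n) (y n))"

definition eRecTr :: "expr \<Rightarrow> expr \<Rightarrow> expr \<Rightarrow> expr \<Rightarrow> expr" where
  "eRecTr B q f x = (\<lambda>n. RecTr (B n) (q n) (f n) (x n))"

lemma expr_apply [expr_eval]:
  "ePi A B n = Pi (A n) (B (bound n) (Suc n))"
  "eSig A B n = Sig (A n) (B (bound n) (Suc n))"
  "eLam A B n = Lam (A n) (B (bound n) (Suc n))"
  "\<U> i n = Univ i"
  "(a \<cdot> b) n = App (a n) (b n)"
  "ePair a b n = Pair (a n) (b n)"
  "eIndSig a b c n = IndSig (a n) (b n) (c n)"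
  "(a =\<^bsub>A\<^esub> b) n = Eq (A n) (a n) (b n)"
  "eRefl a n = Refl (a n)"
  "eIndEq a b c d n = IndEq (a n) (b n) (c n) (d n)"
  "eAcc a b c n = Acc (a n) (b n) (c n)"
  "eAccI a b n = AccI (a n) (b n)"
  "eIndAcc a b c d e f n = IndAcc (a n) (b n) (c n) (d n) (e n) (f n)"
  "\<parallel>A\<parallel> n = Trunc (A n)"
  "eTrI a n = TrI (a n)"
  "eTrEq a b n = TrEq (a n) (b n)"
  "eRecTr a b c d n = RecTr (a n) (b n) (c n) (d n)"
  "bound m n = Var (n - Suc m)"
  by (simp_all add: ePi_def eSig_def eLam_def eU_def eApp_def ePair_def eIndSig_def eEq_def eRefl_def
      eIndEq_def eAcc_def eAccI_def eIndAcc_def eTrunc_def eTrI_def eTrEq_def eRecTr_def bound_def)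

lemmas [expr_eval] = eArr_def eProd_def proj1_def proj2_def isProp_def isSet_def isEquiv_def Equiv_def
  idEquiv_def happly_def funext_def propext_def small_def locally_small_def image_def
  set_replacement_def prop_valued_def transitive_def extensional_def well_founded_def is_ordinal_def

lemmas nat_eval [expr_eval, check_eval] = diff_Suc_Suc minus_nat.diff_0 diff_0_eq_0 numeral_eq_Suc
  pred_numeral_simps BitM.simps numeral_One One_nat_def

lemmas [expr_eval] = hyps.simps append.simps shift.simps ren.simps nat.case list.size(3) length_Cons

text \<open>These congruences fix the order of evaluation: a scrutinee is evaluated before its
  continuation, in a substitution instance only the term is rewritten and not the substitution, and
  \<open>Fuel_cong\<close> and \<open>Cons_cong\<close> forbid rewriting inside fuel and contexts
  altogether.\<close>

lemma bind_cong_weak: "x = y \<Longrightarrow> Option.bind x f = Option.bind y f" by simp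
lemma univ_of_cong: "A = B \<Longrightarrow> univ_of R n \<Gamma> A k = univ_of R n \<Gamma> B k" by simp
lemma rel_level_cong: "K = L \<Longrightarrow> rel_level n A K k = rel_level n A L k" by simp
lemma sub_cong: "t = u \<Longrightarrow> sub s t = sub s u" by simp
lemma ren_cong: "t = u \<Longrightarrow> ren r t = ren r u" by simp
lemma Fuel_cong: "Fuel n = Fuel n" by simp
lemma Cons_cong: "x # xs = x # xs" by simp

lemmas [check_cong] = bind_cong_weak univ_of_cong rel_level_cong sub_cong ren_cong Fuel_cong Cons_cong
  if_weak_cong nat.case_cong_weak option.case_cong_weak tm.case_cong_weak

lemma domain_ok_refl: "domain_ok R n \<Gamma> A A = True" by (simp add: domain_ok_def)

lemma domain_ok_step: "is_type R n \<Gamma> D \<Longrightarrow> conv_by n D A \<Longrightarrow> domain_ok R n \<Gamma> D A = True"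
  by (simp add: domain_ok_def conv_by_def)

lemma conv_by_eval: "conv_nf (conv_by n) (whnf n t) (whnf n u) \<Longrightarrow> conv_by (Fuel n) t u = True"
  by (simp add: conv_by_step)

lemma conv_by_refl_eval: "conv_by n t t = True"
  by (simp add: conv_by_refl)

text \<open>Universe levels stay symbolic during evaluation; these rules resolve equal and
  neighbouring ones.\<close>

lemma max_eval: "max (n::nat) n = n" "max n (Suc n) = Suc n" "max (Suc n) n = Suc n"
  by simp_all

text \<open>Entry \<open>k\<close> is checked over the entries behind it, since a context lists its
  most recent variable first.\<close>

definition ctx_ok :: "fuel \<Rightarrow> tm list \<Rightarrow> tm list \<Rightarrow> bool" where
  "ctx_ok n \<Xi> \<Gamma> \<longleftrightarrow> (\<forall>k<length \<Xi>. is_type (check n) n (drop (Suc k) \<Xi> @ \<Gamma>) (\<Xi> ! k))"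

lemma ctx_ok_eval: "ctx_ok n [] \<Gamma> = True"
  "ctx_ok n (A # \<Xi>) \<Gamma> = (if is_type (check n) n (\<Xi> @ \<Gamma>) A then ctx_ok n \<Xi> \<Gamma> else False)"
  by (auto simp: ctx_ok_def nth_Cons split: nat.split)

lemma ctx_okD: "\<langle>\<A>\<rangle> \<turnstile> \<Gamma> \<Longrightarrow> ctx_ok n \<Xi> \<Gamma> \<Longrightarrow> \<langle>\<A>\<rangle> \<turnstile> \<Xi> @ \<Gamma>"
  by (induction \<Xi>) (auto simp: ctx_ok_eval intro: ctx_extend split: if_splits)

lemmas [check_eval] = check.simps check_step.simps whnf.simps whnf_step_def whnf_App_def whnf_IndSig_def whnf_IndEq_def
  whnf_IndAcc_def conv_nf.simps lookup.simps univ_of_def is_type_def canonical_def recheck_def expose_def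
  answer_def rel_level_def sig_step_def down_ty_def acc_step_def acc_step_raw_def check_ok_def hyps.simps
  domain_ok_refl domain_ok_step conv_by_eval conv_by_refl_eval max_eval full_def ten_def
  sub.simps ren.simps nat.case tm.case option.case Option.bind.simps option.distinct not_False_eq_True
  not_True_eq_False if_True if_False simp_thms(6) append.simps ctx_ok_eval
  shift.simps list.size(3) length_Cons

lemma list_all_Nil: "list_all (holds \<A> \<Gamma>) []" by simp
lemma list_all_ConsI: "\<langle>\<A>\<rangle> \<Gamma> \<tturnstile> H \<Longrightarrow> list_all (holds \<A> \<Gamma>) Hs \<Longrightarrow> list_all (holds \<A> \<Gamma>) (H # Hs)" by simp

lemma holds_weaken_by:
  assumes "\<langle>\<A>\<rangle> \<Gamma> \<tturnstile> T" "\<langle>\<A>\<rangle> \<turnstile> \<Delta>" "drop n \<Delta> = \<Gamma>" "n \<le> length \<Delta>"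
  shows "\<langle>\<A>\<rangle> \<Delta> \<tturnstile> ren (shift n) T"
  using holds_weaken[of \<A> \<Gamma> T "take n \<Delta>"] assms append_take_drop_id[of n \<Delta>] by simp

text \<open>\<open>inhabited\<close> provides a term but not the well-formedness of its type; the
  checker supplies the latter.\<close>

lemma holds_inhabited: "\<langle>\<A>\<rangle> \<tturnstile> e \<Longrightarrow> is_type (check n) n [] (e 0) \<Longrightarrow> \<langle>\<A>\<rangle> [] \<tturnstile> e 0"
  using is_typeD[OF check_sound _ ctx_Nil] by (auto simp: holds_def inhabited_def closed_def)

section \<open>Paths, projections and shorthand for the statements\<close>

definition [expr_eval]: "path_ind A a C c b p = eIndEq (\<Lambda> y\<in>A. \<Lambda> q\<in>a =\<^bsub>A\<^esub> y. C y q) c b p"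

definition [expr_eval]: "transport A a P c b p = path_ind A a (\<lambda>y q. P y) c b p"

definition [expr_eval]: "inv_path A a b p = transport A a (\<lambda>y. y =\<^bsub>A\<^esub> a) (eRefl a) b p"

definition [expr_eval]: "comp_path A a b c p q = transport A b (\<lambda>y. a =\<^bsub>A\<^esub> y) p c q"

definition [expr_eval]: "ap_path A B f a b p = transport A a (\<lambda>y. f a =\<^bsub>B\<^esub> f y) (eRefl (f a)) b p"

definition [expr_eval]: "sig_elim A B C g p = eIndSig (\<Lambda> z\<in>(\<Sigma> x\<in>A. B x). C z) (\<Lambda> x\<in>A. \<Lambda> y\<in>B x. g x
    y) p"

definition [expr_eval]: "fst_of A B p = proj1 A (\<lambda>x. B) p"

definition [expr_eval]: "snd_of A B p = proj2 A (\<lambda>x. B) p"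

text \<open>Decodes \<open>e\<close> and corrects it by the inverse of the decoded reflexivity code.
  The code of a reflexivity path then decodes to an inverse followed by the path itself, which is
  trivial; so decoding retracts encoding whatever \<open>d\<close> does on the diagonal.\<close>

definition [expr_eval]: "code_to_path Y d r y y' e = comp_path Y y y y' (inv_path Y y y (d \<cdot> y \<cdot> y \<cdot>
    (r \<cdot> y))) (d \<cdot> y \<cdot> y' \<cdot> e)"

definition [expr_eval]: "path_to_code Y E r y y' p = transport Y y (\<lambda>z. E \<cdot> y \<cdot> z) (r \<cdot> y) y' p"

definition [expr_eval]: "left_inverse_path A a b p = path_ind A a (\<lambda>y q. eRefl y =\<^bsub>y =\<^bsub>A\<^esub> y\<^esub>
    comp_path A y a y (inv_path A a y q) q) (eRefl (eRefl a)) b p"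

definition [expr_eval]: "code_retraction Y E d r y y' p = path_ind Y y (\<lambda>z q. q =\<^bsub>y =\<^bsub>Y\<^esub> z\<^esub>
    code_to_path Y d r y z (path_to_code Y E r y z q)) (left_inverse_path Y y y (d \<cdot> y \<cdot> y \<cdot> (r \<cdot>
    y))) y' p"

definition [expr_eval]: "preds_acc X R x = (\<Pi> y\<in>X. R \<cdot> y \<cdot> x \<rightarrow> eAcc X R y)"

text \<open>The checker does not infer the type of a pair, so a redex records it.\<close>
definition [expr_eval]: "annotate A a = (\<Lambda> x\<in>A. x) \<cdot> a"

text \<open>In the \<open>quot_\<close> notions \<open>S\<close> is a type of points,
  \<open>L\<close> a relation on it, \<open>Z\<close> the quotient, \<open>q\<close> the class map,
  and \<open>m \<cdot> z\<close> the subset of \<open>S\<close> for which the class \<open>z\<close>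
  stands.\<close>

definition [expr_eval]: "quot_elim S L Z q m = (\<Pi> s\<in>S. \<Pi> t\<in>S. m \<cdot> (q \<cdot> s) \<cdot> t \<rightarrow> L \<cdot> s \<cdot> t)"

definition [expr_eval]: "quot_intro S L Z q m = (\<Pi> s\<in>S. \<Pi> t\<in>S. L \<cdot> s \<cdot> t \<rightarrow> m \<cdot> (q \<cdot> s) \<cdot> t)"

definition [expr_eval]: "quot_ext S Z m = (\<Pi> z\<in>Z. \<Pi> w\<in>Z. (\<Pi> t\<in>S. m \<cdot> z \<cdot> t \<rightarrow> m \<cdot> w \<cdot> t) \<rightarrow> (\<Pi> t\<in>S. m
    \<cdot> w \<cdot> t \<rightarrow> m \<cdot> z \<cdot> t) \<rightarrow> z =\<^bsub>Z\<^esub> w)"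

definition [expr_eval]: "quot_prop S Z m = (\<Pi> z\<in>Z. \<Pi> t\<in>S. isProp (m \<cdot> z \<cdot> t))"

definition [expr_eval]: "BelowEq X R x y = (\<Pi> z\<in>X. (R \<cdot> z \<cdot> x \<rightarrow> R \<cdot> z \<cdot> y) \<otimes> (R \<cdot> z \<cdot> y \<rightarrow> R \<cdot> z \<cdot>
    x))"

definition [expr_eval]: "Preserves A S B T f = (\<Pi> x\<in>A. \<Pi> x'\<in>A. S \<cdot> x \<cdot> x' \<rightarrow> T \<cdot> (f \<cdot> x) \<cdot> (f \<cdot> x'))"

definition [expr_eval]: "Lifts A S B T f = (\<Pi> x\<in>A. \<Pi> y\<in>B. T \<cdot> y \<cdot> (f \<cdot> x) \<rightarrow> (\<Sigma> x'\<in>A. S \<cdot> x' \<cdot> x \<otimes> f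
    \<cdot> x' =\<^bsub>B\<^esub> y))"

definition [expr_eval]: "IsSim A S B T f = Preserves A S B T f \<otimes> Lifts A S B T f"

definition [expr_eval]: "Sim A S B T = (\<Sigma> f\<in>A \<rightarrow> B. IsSim A S B T f)"

definition [expr_eval]: "ord_prop X S p = fst_of (prop_valued X S) (transitive X S \<otimes> extensional X S
    \<otimes> well_founded X S) p"

definition [expr_eval]: "ord_trans X S p = fst_of (transitive X S) (extensional X S \<otimes> well_founded X
    S) (snd_of (prop_valued X S) (transitive X S \<otimes> extensional X S \<otimes> well_founded X S) p)"

definition [expr_eval]: "ord_ext_wf X S p = snd_of (transitive X S) (extensional X S \<otimes> well_founded
    X S) (snd_of (prop_valued X S) (transitive X S \<otimes> extensional X S \<otimes> well_founded X S) p)"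

definition [expr_eval]: "ord_ext X S p = fst_of (extensional X S) (well_founded X S) (ord_ext_wf X S
    p)"

definition [expr_eval]: "ord_wf X S p = snd_of (extensional X S) (well_founded X S) (ord_ext_wf X S
    p)"

section \<open>Propositions, sets and small quotients\<close>

text \<open>The principles are taken at every level because subsets of a type in
  \<open>\<U> v\<close> live one level up.\<close>

locale extensional_type_theory =
  fixes \<A> :: "tm set" and v :: nat
  assumes funext: "\<And>i j. \<langle>\<A>\<rangle> \<tturnstile> funext i j"
    and propext: "\<And>i. \<langle>\<A>\<rangle> \<tturnstile> propext i"
    and set_replacement: "\<And>u w k l. \<langle>\<A>\<rangle> \<tturnstile> set_replacement u w k l"
begin

lemma funext_holds: "\<langle>\<A>\<rangle> [] \<tturnstile> funext i j 0"
  by (rule holds_inhabited[OF funext, of full])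
    (simp only: expr_eval, simp only: check_eval cong: check_cong)

lemma propext_holds: "\<langle>\<A>\<rangle> [] \<tturnstile> propext i 0"
  by (rule holds_inhabited[OF propext, of full])
    (simp only: expr_eval, simp only: check_eval cong: check_cong)

lemma set_replacement_holds: "\<langle>\<A>\<rangle> [] \<tturnstile> set_replacement u w k l 0"
  by (rule holds_inhabited[OF set_replacement, of full])
    (simp only: expr_eval, simp only: check_eval cong: check_cong)

section \<open>Equality in function and \<open>\<Sigma>\<close> types, and types that are
  propositions\<close>

text \<open>
  A lemma \<open>l\<close> of the object theory has the type \<open>l_T\<close> and the term \<open>l_p\<close>, whose arguments stand for
  the lemmas that it uses.
\<close>

definition [expr_eval]: "fun_eq_T i j = (\<Pi> A\<in>\<U> i. \<Pi> B\<in>A \<rightarrow> \<U> j. \<Pi> f\<in>(\<Pi> x\<in>A. B \<cdot> x). \<Pi> g\<in>(\<Pi> x\<in>A. B \<cdot>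
    x). (\<Pi> x\<in>A. f \<cdot> x =\<^bsub>B \<cdot> x\<^esub> g \<cdot> x) \<rightarrow> f =\<^bsub>\<Pi> x\<in>A. B \<cdot> x\<^esub> g)"

definition [expr_eval]: "fun_eq_p i j fx = (\<Lambda> A\<in>\<U> i. \<Lambda> B\<in>A \<rightarrow> \<U> j. \<Lambda> f\<in>(\<Pi> x\<in>A. B \<cdot> x). \<Lambda> g\<in>(\<Pi> x\<in>A. B
    \<cdot> x). proj1 ((\<Pi> x\<in>A. f \<cdot> x =\<^bsub>B \<cdot> x\<^esub> g \<cdot> x) \<rightarrow> f =\<^bsub>\<Pi> x\<in>A. B \<cdot> x\<^esub> g) (\<lambda>k. \<Pi> y\<in>(\<Pi> x\<in>A. f \<cdot> x =\<^bsub>B \<cdot>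
    x\<^esub> g \<cdot> x). happly A B f g \<cdot> (k \<cdot> y) =\<^bsub>\<Pi> x\<in>A. f \<cdot> x =\<^bsub>B \<cdot> x\<^esub> g \<cdot> x\<^esub> y) (fst_of (\<Sigma> k\<in>(\<Pi> x\<in>A. f \<cdot> x
    =\<^bsub>B \<cdot> x\<^esub> g \<cdot> x) \<rightarrow> f =\<^bsub>\<Pi> x\<in>A. B \<cdot> x\<^esub> g. \<Pi> y\<in>(\<Pi> x\<in>A. f \<cdot> x =\<^bsub>B \<cdot> x\<^esub> g \<cdot> x). happly A B f g \<cdot> (k \<cdot>
    y) =\<^bsub>\<Pi> x\<in>A. f \<cdot> x =\<^bsub>B \<cdot> x\<^esub> g \<cdot> x\<^esub> y) (\<Sigma> h\<in>(\<Pi> x\<in>A. f \<cdot> x =\<^bsub>B \<cdot> x\<^esub> g \<cdot> x) \<rightarrow> f =\<^bsub>\<Pi> x\<in>A. B \<cdot> x\<^esub> g. \<Pi>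
    x\<in>f =\<^bsub>\<Pi> x\<in>A. B \<cdot> x\<^esub> g. h \<cdot> (happly A B f g \<cdot> x) =\<^bsub>f =\<^bsub>\<Pi> x\<in>A. B \<cdot> x\<^esub> g\<^esub> x) (fx \<cdot> A \<cdot> B \<cdot> f \<cdot>
    g)))"

lemma fun_eq: "\<langle>\<A>\<rangle> [] \<tturnstile> fun_eq_T i j 0"
  by (rule holds_check[OF ctx_Nil list_all_ConsI[OF funext_holds[of i j] list_all_Nil], of full
    "fun_eq_p i j (bound 0) 1"]) (simp only: expr_eval, simp only: check_eval cong: check_cong)

definition [expr_eval]: "sig_eq_T i j = (\<Pi> A\<in>\<U> i. \<Pi> B\<in>A \<rightarrow> \<U> j. (\<Pi> a\<in>A. isProp (B \<cdot> a)) \<rightarrow> (\<Pi> w\<in>(\<Sigma>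
    a\<in>A. B \<cdot> a). \<Pi> w'\<in>(\<Sigma> a\<in>A. B \<cdot> a). proj1 A (\<lambda>a. B \<cdot> a) w =\<^bsub>A\<^esub> proj1 A (\<lambda>a. B \<cdot> a) w' \<rightarrow> w =\<^bsub>\<Sigma> a\<in>A.
    B \<cdot> a\<^esub> w'))"

text \<open>The second component is generalised before the path induction on \<open>e\<close>, since
  its type moves with the endpoint \<open>y\<close>. Over a fixed endpoint the fibre is a
  proposition, and a second path induction finishes.\<close>

definition [expr_eval]: "sig_eq_p i j = (\<Lambda> A\<in>\<U> i. \<Lambda> B\<in>A \<rightarrow> \<U> j. \<Lambda> pB\<in>(\<Pi> a\<in>A. isProp (B \<cdot> a)). \<Lambda> w\<in>(\<Sigma>
    a\<in>A. B \<cdot> a). sig_elim A (\<lambda>a. B \<cdot> a) (\<lambda>w. \<Pi> w'\<in>(\<Sigma> a\<in>A. B \<cdot> a). proj1 A (\<lambda>a. B \<cdot> a) w =\<^bsub>A\<^esub> proj1 A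
    (\<lambda>a. B \<cdot> a) w' \<rightarrow> w =\<^bsub>\<Sigma> a\<in>A. B \<cdot> a\<^esub> w') (\<lambda>a b. \<Lambda> w'\<in>(\<Sigma> a\<in>A. B \<cdot> a). sig_elim A (\<lambda>a. B \<cdot> a) (\<lambda>w'.
    a =\<^bsub>A\<^esub> proj1 A (\<lambda>a. B \<cdot> a) w' \<rightarrow> ePair a b =\<^bsub>\<Sigma> a\<in>A. B \<cdot> a\<^esub> w') (\<lambda>a' b'. \<Lambda> e\<in>a =\<^bsub>A\<^esub> a'. path_ind A
    a (\<lambda>y q. \<Pi> c\<in>B \<cdot> y. ePair a b =\<^bsub>\<Sigma> a\<in>A. B \<cdot> a\<^esub> ePair y c) (\<Lambda> c\<in>B \<cdot> a. path_ind (B \<cdot> a) b (\<lambda>y q.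
    ePair a b =\<^bsub>\<Sigma> a\<in>A. B \<cdot> a\<^esub> ePair a y) (eRefl (ePair a b)) c (pB \<cdot> a \<cdot> b \<cdot> c)) a' e \<cdot> b') w') w)"

lemma sig_eq: "\<langle>\<A>\<rangle> [] \<tturnstile> sig_eq_T i j 0"
  by (rule holds_check[OF ctx_Nil list_all_Nil, of full "sig_eq_p i j 0"])
    (simp only: expr_eval, simp only: check_eval cong: check_cong)

definition [expr_eval]: "code_isSet_T k j = (\<Pi> Y\<in>\<U> k. \<Pi> E\<in>Y \<rightarrow> Y \<rightarrow> \<U> j. (\<Pi> y\<in>Y. \<Pi> y'\<in>Y. isProp (E \<cdot> y
    \<cdot> y')) \<rightarrow> (\<Pi> y\<in>Y. E \<cdot> y \<cdot> y) \<rightarrow> (\<Pi> y\<in>Y. \<Pi> y'\<in>Y. E \<cdot> y \<cdot> y' \<rightarrow> y =\<^bsub>Y\<^esub> y') \<rightarrow> isSet Y)"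

text \<open>A criterion in the style of Hedberg: decoding retracts encoding and codes are
  propositions, so parallel paths have equal codes and are equal.\<close>

definition [expr_eval]: "code_isSet_p k j = (\<Lambda> Y\<in>\<U> k. \<Lambda> E\<in>Y \<rightarrow> Y \<rightarrow> \<U> j. \<Lambda> pE\<in>(\<Pi> y\<in>Y. \<Pi> y'\<in>Y. isProp
    (E \<cdot> y \<cdot> y')). \<Lambda> r\<in>(\<Pi> y\<in>Y. E \<cdot> y \<cdot> y). \<Lambda> id\<in>(\<Pi> y\<in>Y. \<Pi> y'\<in>Y. E \<cdot> y \<cdot> y' \<rightarrow> y =\<^bsub>Y\<^esub> y'). \<Lambda> y\<in>Y. \<Lambda>
    y'\<in>Y. \<Lambda> p\<in>y =\<^bsub>Y\<^esub> y'. \<Lambda> q\<in>y =\<^bsub>Y\<^esub> y'. comp_path (y =\<^bsub>Y\<^esub> y') p (code_to_path Y id r y y'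
    (path_to_code Y E r y y' q)) q (comp_path (y =\<^bsub>Y\<^esub> y') p (code_to_path Y id r y y' (path_to_code
    Y E r y y' p)) (code_to_path Y id r y y' (path_to_code Y E r y y' q)) (code_retraction Y E id r
    y y' p) (ap_path (E \<cdot> y \<cdot> y') (y =\<^bsub>Y\<^esub> y') (\<lambda>e. code_to_path Y id r y y' e) (path_to_code Y E r y
    y' p) (path_to_code Y E r y y' q) (pE \<cdot> y \<cdot> y' \<cdot> path_to_code Y E r y y' p \<cdot> path_to_code Y E r
    y y' q))) (inv_path (y =\<^bsub>Y\<^esub> y') q (code_to_path Y id r y y' (path_to_code Y E r y y' q))
    (code_retraction Y E id r y y' q)))"

lemma code_isSet: "\<langle>\<A>\<rangle> [] \<tturnstile> code_isSet_T k j 0"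
  by (rule holds_check[OF ctx_Nil list_all_Nil, of full "code_isSet_p k j 0"])
    (simp only: expr_eval, simp only: check_eval cong: check_cong)

definition [expr_eval]: "code_locally_small_T k j = (\<Pi> Y\<in>\<U> k. \<Pi> E\<in>Y \<rightarrow> Y \<rightarrow> \<U> j. (\<Pi> y\<in>Y. \<Pi> y'\<in>Y.
    isProp (E \<cdot> y \<cdot> y')) \<rightarrow> (\<Pi> y\<in>Y. E \<cdot> y \<cdot> y) \<rightarrow> (\<Pi> y\<in>Y. \<Pi> y'\<in>Y. E \<cdot> y \<cdot> y' \<rightarrow> y =\<^bsub>Y\<^esub> y') \<rightarrow>
    locally_small j Y)"

text \<open>The codes are themselves the small copies of the identity types. One composite is the
  identity by \<open>code_retraction\<close>, the other because codes form a proposition.\<close>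

definition [expr_eval]: "code_locally_small_p k j = (\<Lambda> Y\<in>\<U> k. \<Lambda> E\<in>Y \<rightarrow> Y \<rightarrow> \<U> j. \<Lambda> pE\<in>(\<Pi> y\<in>Y. \<Pi> y'\<in>Y.
    isProp (E \<cdot> y \<cdot> y')). \<Lambda> r\<in>(\<Pi> y\<in>Y. E \<cdot> y \<cdot> y). \<Lambda> id\<in>(\<Pi> y\<in>Y. \<Pi> y'\<in>Y. E \<cdot> y \<cdot> y' \<rightarrow> y =\<^bsub>Y\<^esub> y'). \<Lambda>
    y\<in>Y. \<Lambda> y'\<in>Y. ePair (E \<cdot> y \<cdot> y') (ePair (\<Lambda> e\<in>E \<cdot> y \<cdot> y'. code_to_path Y id r y y' e) (ePair
    (ePair (\<Lambda> p\<in>y =\<^bsub>Y\<^esub> y'. path_to_code Y E r y y' p) (\<Lambda> p\<in>y =\<^bsub>Y\<^esub> y'. inv_path (y =\<^bsub>Y\<^esub> y') p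
    (code_to_path Y id r y y' (path_to_code Y E r y y' p)) (code_retraction Y E id r y y' p)))
    (ePair (\<Lambda> p\<in>y =\<^bsub>Y\<^esub> y'. path_to_code Y E r y y' p) (\<Lambda> e\<in>E \<cdot> y \<cdot> y'. pE \<cdot> y \<cdot> y' \<cdot> path_to_code Y
    E r y y' (code_to_path Y id r y y' e) \<cdot> e)))))"

lemma code_locally_small: "\<langle>\<A>\<rangle> [] \<tturnstile> code_locally_small_T k j 0"
  by (rule holds_check[OF ctx_Nil list_all_Nil, of full "code_locally_small_p k j 0"])
    (simp only: expr_eval, simp only: check_eval cong: check_cong)

definition [expr_eval]: "isProp_isSet_T i = (\<Pi> A\<in>\<U> i. isProp A \<rightarrow> isSet A)"

text \<open>The code criterion applies with \<open>A\<close> itself as the code of every pair of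
  points.\<close>

definition [expr_eval]: "isProp_isSet_p i code_isSet = (\<Lambda> A\<in>\<U> i. \<Lambda> f\<in>isProp A. code_isSet \<cdot> A \<cdot> (\<Lambda>
    x\<in>A. \<Lambda> y\<in>A. A) \<cdot> (\<Lambda> x\<in>A. \<Lambda> y\<in>A. f) \<cdot> (\<Lambda> x\<in>A. x) \<cdot> (\<Lambda> x\<in>A. \<Lambda> y\<in>A. \<Lambda> z\<in>A. f \<cdot> x \<cdot> y))"

lemma isProp_isSet: "\<langle>\<A>\<rangle> [] \<tturnstile> isProp_isSet_T i 0"
  by (rule holds_check[OF ctx_Nil list_all_ConsI[OF code_isSet[of i i] list_all_Nil], of full
    "isProp_isSet_p i (bound 0) 1"]) (simp only: expr_eval, simp only: check_eval cong: check_cong)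

definition [expr_eval]: "isProp_Pi_T i j = (\<Pi> A\<in>\<U> i. \<Pi> B\<in>A \<rightarrow> \<U> j. (\<Pi> a\<in>A. isProp (B \<cdot> a)) \<rightarrow> isProp
    (\<Pi> a\<in>A. B \<cdot> a))"

definition [expr_eval]: "isProp_Pi_p i j fun_eq = (\<Lambda> A\<in>\<U> i. \<Lambda> B\<in>A \<rightarrow> \<U> j. \<Lambda> pB\<in>(\<Pi> a\<in>A. isProp (B \<cdot>
    a)). \<Lambda> f\<in>(\<Pi> a\<in>A. B \<cdot> a). \<Lambda> g\<in>(\<Pi> a\<in>A. B \<cdot> a). fun_eq \<cdot> A \<cdot> B \<cdot> f \<cdot> g \<cdot> (\<Lambda> a\<in>A. pB \<cdot> a \<cdot> (f \<cdot> a) \<cdot>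
    (g \<cdot> a)))"

lemma isProp_Pi: "\<langle>\<A>\<rangle> [] \<tturnstile> isProp_Pi_T i j 0"
  by (rule holds_check[OF ctx_Nil list_all_ConsI[OF fun_eq[of i j] list_all_Nil], of full
    "isProp_Pi_p i j (bound 0) 1"]) (simp only: expr_eval, simp only: check_eval cong: check_cong)

definition [expr_eval]: "isProp_Prod_T i j = (\<Pi> A\<in>\<U> i. \<Pi> B\<in>\<U> j. isProp A \<rightarrow> isProp B \<rightarrow> isProp (A \<otimes>
    B))"

definition [expr_eval]: "isProp_Prod_p i j sig_eq = (\<Lambda> A\<in>\<U> i. \<Lambda> B\<in>\<U> j. \<Lambda> pA\<in>isProp A. \<Lambda> pB\<in>isProp B.
    \<Lambda> w\<in>A \<otimes> B. \<Lambda> w'\<in>A \<otimes> B. sig_eq \<cdot> A \<cdot> (\<Lambda> x\<in>A. B) \<cdot> (\<Lambda> x\<in>A. pB) \<cdot> w \<cdot> w' \<cdot> (pA \<cdot> fst_of A B w \<cdot>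
    fst_of A B w'))"

lemma isProp_Prod: "\<langle>\<A>\<rangle> [] \<tturnstile> isProp_Prod_T i j 0"
  by (rule holds_check[OF ctx_Nil list_all_ConsI[OF sig_eq[of i j] list_all_Nil], of full
    "isProp_Prod_p i j (bound 0) 1"]) (simp only: expr_eval, simp only: check_eval cong: check_cong)

definition [expr_eval]: "isProp_isProp_T i = (\<Pi> A\<in>\<U> i. isProp (isProp A))"

text \<open>Two proofs are compared pointwise; their values are parallel paths in \<open>A\<close>,
  which is a set because \<open>f\<close> makes it a proposition.\<close>

definition [expr_eval]: "isProp_isProp_p i fun_eq isProp_isSet = (\<Lambda> A\<in>\<U> i. \<Lambda> f\<in>isProp A. \<Lambda> g\<in>isProp
    A. fun_eq \<cdot> A \<cdot> (\<Lambda> x\<in>A. \<Pi> y\<in>A. x =\<^bsub>A\<^esub> y) \<cdot> f \<cdot> g \<cdot> (\<Lambda> x\<in>A. fun_eq \<cdot> A \<cdot> (\<Lambda> y\<in>A. x =\<^bsub>A\<^esub> y) \<cdot> (f \<cdot>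
    x) \<cdot> (g \<cdot> x) \<cdot> (\<Lambda> y\<in>A. isProp_isSet \<cdot> A \<cdot> f \<cdot> x \<cdot> y \<cdot> (f \<cdot> x \<cdot> y) \<cdot> (g \<cdot> x \<cdot> y))))"

lemma isProp_isProp: "\<langle>\<A>\<rangle> [] \<tturnstile> isProp_isProp_T i 0"
  by (rule holds_check[OF ctx_Nil list_all_ConsI[OF fun_eq[of i i] list_all_ConsI[OF isProp_isSet[of
    i] list_all_Nil]], of full "isProp_isProp_p i (bound 0) (bound 1) 2"])
    (simp only: expr_eval, simp only: check_eval cong: check_cong)

definition [expr_eval]: "isProp_Acc_T i = (\<Pi> A\<in>\<U> i. \<Pi> R\<in>A \<rightarrow> A \<rightarrow> \<U> i. \<Pi> a\<in>A. isProp (eAcc A R a))"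

text \<open>The outer induction brings the first proof into the form \<open>eAccI x h\<close>, the
  inner one the second into the form \<open>eAccI x k\<close>. The inner motive quantifies over
  \<open>h\<close> and its hypothesis because the point varies with that induction too. Then
  \<open>h\<close> and \<open>k\<close> agree by function extensionality.\<close>

definition [expr_eval]: "isProp_Acc_p i fun_eq = (\<Lambda> A\<in>\<U> i. \<Lambda> R\<in>A \<rightarrow> A \<rightarrow> \<U> i. \<Lambda> a\<in>A. \<Lambda> p\<in>eAcc A R a.
    eIndAcc A R (\<Lambda> x\<in>A. \<Lambda> p\<in>eAcc A R x. \<Pi> q\<in>eAcc A R x. p =\<^bsub>eAcc A R x\<^esub> q) (\<Lambda> x\<in>A. \<Lambda> h\<in>preds_acc A R
    x. \<Lambda> ih\<in>(\<Pi> y\<in>A. \<Pi> r\<in>R \<cdot> y \<cdot> x. \<Pi> q\<in>eAcc A R y. h \<cdot> y \<cdot> r =\<^bsub>eAcc A R y\<^esub> q). \<Lambda> q\<in>eAcc A R x.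
    eIndAcc A R (\<Lambda> x\<in>A. \<Lambda> q\<in>eAcc A R x. \<Pi> h\<in>preds_acc A R x. (\<Pi> y\<in>A. \<Pi> r\<in>R \<cdot> y \<cdot> x. \<Pi> q\<in>eAcc A R y.
    h \<cdot> y \<cdot> r =\<^bsub>eAcc A R y\<^esub> q) \<rightarrow> eAccI x h =\<^bsub>eAcc A R x\<^esub> q) (\<Lambda> x\<in>A. \<Lambda> k\<in>preds_acc A R x. \<Lambda> u\<in>(\<Pi> y\<in>A.
    \<Pi> r\<in>R \<cdot> y \<cdot> x. \<Pi> h\<in>preds_acc A R y. (\<Pi> z\<in>A. \<Pi> s\<in>R \<cdot> z \<cdot> y. \<Pi> q\<in>eAcc A R z. h \<cdot> z \<cdot> s =\<^bsub>eAcc A R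
    z\<^esub> q) \<rightarrow> eAccI y h =\<^bsub>eAcc A R y\<^esub> k \<cdot> y \<cdot> r). \<Lambda> h\<in>preds_acc A R x. \<Lambda> ih\<in>(\<Pi> y\<in>A. \<Pi> r\<in>R \<cdot> y \<cdot> x. \<Pi>
    q\<in>eAcc A R y. h \<cdot> y \<cdot> r =\<^bsub>eAcc A R y\<^esub> q). transport (preds_acc A R x) h (\<lambda>k. eAccI x h =\<^bsub>eAcc A
    R x\<^esub> eAccI x k) (eRefl (eAccI x h)) k (fun_eq \<cdot> A \<cdot> (\<Lambda> y\<in>A. R \<cdot> y \<cdot> x \<rightarrow> eAcc A R y) \<cdot> h \<cdot> k \<cdot> (\<Lambda>
    y\<in>A. fun_eq \<cdot> (R \<cdot> y \<cdot> x) \<cdot> (\<Lambda> r\<in>R \<cdot> y \<cdot> x. eAcc A R y) \<cdot> (h \<cdot> y) \<cdot> (k \<cdot> y) \<cdot> (\<Lambda> r\<in>R \<cdot> y \<cdot> x. ih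
    \<cdot> y \<cdot> r \<cdot> (k \<cdot> y \<cdot> r))))) x q \<cdot> h \<cdot> ih) a p)"

lemma isProp_Acc: "\<langle>\<A>\<rangle> [] \<tturnstile> isProp_Acc_T i 0"
  by (rule holds_check[OF ctx_Nil list_all_ConsI[OF fun_eq[of i i] list_all_Nil], of full
    "isProp_Acc_p i (bound 0) 1"]) (simp only: expr_eval, simp only: check_eval cong: check_cong)

text \<open>This turns truncated lifts into actual ones: \<open>Lifts\<close> asks for an element of
  such a fibre, and for an injective map into a set a predecessor known only up to truncation can be
  extracted.\<close>

definition [expr_eval]: "isProp_fibre_T i = (\<Pi> A\<in>\<U> i. \<Pi> B\<in>\<U> i. \<Pi> r\<in>A \<rightarrow> \<U> i. \<Pi> f\<in>A \<rightarrow> B. (\<Pi> a\<in>A.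
    isProp (r \<cdot> a)) \<rightarrow> (\<Pi> a\<in>A. \<Pi> b\<in>A. f \<cdot> a =\<^bsub>B\<^esub> f \<cdot> b \<rightarrow> a =\<^bsub>A\<^esub> b) \<rightarrow> isSet B \<rightarrow> (\<Pi> y\<in>B. isProp (\<Sigma> a\<in>A.
    r \<cdot> a \<otimes> f \<cdot> a =\<^bsub>B\<^esub> y)))"

definition [expr_eval]: "isProp_fibre_p i sig_eq isProp_Prod = (\<Lambda> A\<in>\<U> i. \<Lambda> B\<in>\<U> i. \<Lambda> r\<in>A \<rightarrow> \<U> i. \<Lambda> f\<in>A
    \<rightarrow> B. \<Lambda> pr\<in>(\<Pi> a\<in>A. isProp (r \<cdot> a)). \<Lambda> inj\<in>(\<Pi> a\<in>A. \<Pi> b\<in>A. f \<cdot> a =\<^bsub>B\<^esub> f \<cdot> b \<rightarrow> a =\<^bsub>A\<^esub> b). \<Lambda> sB\<in>isSet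
    B. \<Lambda> y\<in>B. \<Lambda> w\<in>(\<Sigma> a\<in>A. r \<cdot> a \<otimes> f \<cdot> a =\<^bsub>B\<^esub> y). \<Lambda> w'\<in>(\<Sigma> a\<in>A. r \<cdot> a \<otimes> f \<cdot> a =\<^bsub>B\<^esub> y). sig_eq \<cdot> A \<cdot> (\<Lambda>
    a\<in>A. r \<cdot> a \<otimes> f \<cdot> a =\<^bsub>B\<^esub> y) \<cdot> (\<Lambda> a\<in>A. isProp_Prod \<cdot> (r \<cdot> a) \<cdot> (f \<cdot> a =\<^bsub>B\<^esub> y) \<cdot> (pr \<cdot> a) \<cdot> (sB \<cdot>
    (f \<cdot> a) \<cdot> y)) \<cdot> w \<cdot> w' \<cdot> (inj \<cdot> proj1 A (\<lambda>a. r \<cdot> a \<otimes> f \<cdot> a =\<^bsub>B\<^esub> y) w \<cdot> proj1 A (\<lambda>a. r \<cdot> a \<otimes> f \<cdot>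
    a =\<^bsub>B\<^esub> y) w' \<cdot> comp_path B (f \<cdot> proj1 A (\<lambda>a. r \<cdot> a \<otimes> f \<cdot> a =\<^bsub>B\<^esub> y) w) y (f \<cdot> proj1 A (\<lambda>a. r \<cdot> a
    \<otimes> f \<cdot> a =\<^bsub>B\<^esub> y) w') (snd_of (r \<cdot> proj1 A (\<lambda>a. r \<cdot> a \<otimes> f \<cdot> a =\<^bsub>B\<^esub> y) w) (f \<cdot> proj1 A (\<lambda>a. r \<cdot> a \<otimes>
    f \<cdot> a =\<^bsub>B\<^esub> y) w =\<^bsub>B\<^esub> y) (proj2 A (\<lambda>a. r \<cdot> a \<otimes> f \<cdot> a =\<^bsub>B\<^esub> y) w)) (inv_path B (f \<cdot> proj1 A (\<lambda>a. r
    \<cdot> a \<otimes> f \<cdot> a =\<^bsub>B\<^esub> y) w') y (snd_of (r \<cdot> proj1 A (\<lambda>a. r \<cdot> a \<otimes> f \<cdot> a =\<^bsub>B\<^esub> y) w') (f \<cdot> proj1 A (\<lambda>a.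
    r \<cdot> a \<otimes> f \<cdot> a =\<^bsub>B\<^esub> y) w' =\<^bsub>B\<^esub> y) (proj2 A (\<lambda>a. r \<cdot> a \<otimes> f \<cdot> a =\<^bsub>B\<^esub> y) w')))))"

lemma isProp_fibre: "\<langle>\<A>\<rangle> [] \<tturnstile> isProp_fibre_T i 0"
  by (rule holds_check[OF ctx_Nil list_all_ConsI[OF sig_eq[of i i] list_all_ConsI[OF isProp_Prod[of
    i i] list_all_Nil]], of full "isProp_fibre_p i (bound 0) (bound 1) 2"])
    (simp only: expr_eval, simp only: check_eval cong: check_cong)

section \<open>Subsets of a small type\<close>

definition [expr_eval]: "hProp = (\<Sigma> P\<in>\<U> v. isProp P)"

definition [expr_eval]: "prop_of w = proj1 (\<U> v) (\<lambda>P. isProp P) w"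

definition [expr_eval]: "prop_of_isProp w = proj2 (\<U> v) (\<lambda>P. isProp P) w"

definition [expr_eval]: "hProp_eq_T = (\<Pi> a\<in>hProp. \<Pi> b\<in>hProp. (prop_of a \<rightarrow> prop_of b) \<rightarrow> (prop_of b \<rightarrow>
    prop_of a) \<rightarrow> a =\<^bsub>hProp\<^esub> b)"

text \<open>Being a proposition is itself a proposition, so only the underlying types have to be
  identified, and propositional extensionality does that.\<close>

definition [expr_eval]: "hProp_eq_p se isProp_isProp pe = (\<Lambda> a\<in>hProp. \<Lambda> b\<in>hProp. \<Lambda> f\<in>prop_of a \<rightarrow>
    prop_of b. \<Lambda> g\<in>prop_of b \<rightarrow> prop_of a. se \<cdot> \<U> v \<cdot> (\<Lambda> P\<in>\<U> v. isProp P) \<cdot> (\<Lambda> P\<in>\<U> v. isProp_isProp \<cdot>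
    P) \<cdot> a \<cdot> b \<cdot> (pe \<cdot> prop_of a \<cdot> prop_of b \<cdot> prop_of_isProp a \<cdot> prop_of_isProp b \<cdot> f \<cdot> g))"

lemma hProp_eq: "\<langle>\<A>\<rangle> [] \<tturnstile> hProp_eq_T 0"
  by (rule holds_check[OF ctx_Nil list_all_ConsI[OF sig_eq[of "Suc v" v] list_all_ConsI[OF
    isProp_isProp[of v] list_all_ConsI[OF propext_holds[of v] list_all_Nil]]], of full "hProp_eq_p
    (bound 0) (bound 1) (bound 2) 3"])
    (simp only: expr_eval, simp only: check_eval cong: check_cong)

definition [expr_eval]: "subsets S = S \<rightarrow> hProp"

text \<open>The code for equality of subsets. For \<open>S\<close> in \<open>\<U> v\<close> it lives
  in \<open>\<U> v\<close>, whereas the type of subsets and its identity types live in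
  \<open>\<U> (Suc v)\<close>.\<close>

definition [expr_eval]: "same_members S f g = (\<Pi> t\<in>S. (prop_of (f \<cdot> t) \<rightarrow> prop_of (g \<cdot> t)) \<otimes> (prop_of
    (g \<cdot> t) \<rightarrow> prop_of (f \<cdot> t)))"

definition [expr_eval]: "same_members_isProp_T = (\<Pi> S\<in>\<U> v. \<Pi> f\<in>subsets S. \<Pi> g\<in>subsets S. isProp
    (same_members S f g))"

definition [expr_eval]: "same_members_isProp_p isProp_Pi isProp_Prod = (\<Lambda> S\<in>\<U> v. \<Lambda> f\<in>subsets S. \<Lambda>
    g\<in>subsets S. isProp_Pi \<cdot> S \<cdot> (\<Lambda> t\<in>S. (prop_of (f \<cdot> t) \<rightarrow> prop_of (g \<cdot> t)) \<otimes> (prop_of (g \<cdot> t) \<rightarrow>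
    prop_of (f \<cdot> t))) \<cdot> (\<Lambda> t\<in>S. isProp_Prod \<cdot> (prop_of (f \<cdot> t) \<rightarrow> prop_of (g \<cdot> t)) \<cdot> (prop_of (g \<cdot> t)
    \<rightarrow> prop_of (f \<cdot> t)) \<cdot> (isProp_Pi \<cdot> prop_of (f \<cdot> t) \<cdot> (\<Lambda> x\<in>prop_of (f \<cdot> t). prop_of (g \<cdot> t)) \<cdot> (\<Lambda>
    x\<in>prop_of (f \<cdot> t). prop_of_isProp (g \<cdot> t))) \<cdot> (isProp_Pi \<cdot> prop_of (g \<cdot> t) \<cdot> (\<Lambda> x\<in>prop_of (g \<cdot>
    t). prop_of (f \<cdot> t)) \<cdot> (\<Lambda> x\<in>prop_of (g \<cdot> t). prop_of_isProp (f \<cdot> t)))))"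

lemma same_members_isProp: "\<langle>\<A>\<rangle> [] \<tturnstile> same_members_isProp_T 0"
  by (rule holds_check[OF ctx_Nil list_all_ConsI[OF isProp_Pi[of v v] list_all_ConsI[OF
    isProp_Prod[of v v] list_all_Nil]], of full "same_members_isProp_p (bound 0) (bound 1) 2"])
    (simp only: expr_eval, simp only: check_eval cong: check_cong)

definition [expr_eval]: "same_members_refl_T = (\<Pi> S\<in>\<U> v. \<Pi> f\<in>subsets S. same_members S f f)"

definition [expr_eval]: "same_members_refl_p = (\<Lambda> S\<in>\<U> v. \<Lambda> f\<in>subsets S. \<Lambda> t\<in>S. ePair (\<Lambda> x\<in>prop_of (f
    \<cdot> t). x) (\<Lambda> x\<in>prop_of (f \<cdot> t). x))"

lemma same_members_refl: "\<langle>\<A>\<rangle> [] \<tturnstile> same_members_refl_T 0"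
  by (rule holds_check[OF ctx_Nil list_all_Nil, of full "same_members_refl_p 0"])
    (simp only: expr_eval, simp only: check_eval cong: check_cong)

definition [expr_eval]: "same_members_eq_T = (\<Pi> S\<in>\<U> v. \<Pi> f\<in>subsets S. \<Pi> g\<in>subsets S. same_members S
    f g \<rightarrow> f =\<^bsub>subsets S\<^esub> g)"

definition [expr_eval]: "same_members_eq_p fo hProp_eq = (\<Lambda> S\<in>\<U> v. \<Lambda> f\<in>subsets S. \<Lambda> g\<in>subsets S. \<Lambda>
    e\<in>same_members S f g. fo \<cdot> S \<cdot> (\<Lambda> t\<in>S. hProp) \<cdot> f \<cdot> g \<cdot> (\<Lambda> t\<in>S. hProp_eq \<cdot> (f \<cdot> t) \<cdot> (g \<cdot> t) \<cdot>
    fst_of (prop_of (f \<cdot> t) \<rightarrow> prop_of (g \<cdot> t)) (prop_of (g \<cdot> t) \<rightarrow> prop_of (f \<cdot> t)) (e \<cdot> t) \<cdot> snd_of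
    (prop_of (f \<cdot> t) \<rightarrow> prop_of (g \<cdot> t)) (prop_of (g \<cdot> t) \<rightarrow> prop_of (f \<cdot> t)) (e \<cdot> t)))"

lemma same_members_eq: "\<langle>\<A>\<rangle> [] \<tturnstile> same_members_eq_T 0"
  by (rule holds_check[OF ctx_Nil list_all_ConsI[OF fun_eq[of v "Suc v"] list_all_ConsI[OF hProp_eq
    list_all_Nil]], of full "same_members_eq_p (bound 0) (bound 1) 2"])
    (simp only: expr_eval, simp only: check_eval cong: check_cong)

definition [expr_eval]: "subsets_isSet_T = (\<Pi> S\<in>\<U> v. isSet (subsets S))"

definition [expr_eval]: "subsets_isSet_p hs same_members_isProp same_members_refl same_members_eq =
    (\<Lambda> S\<in>\<U> v. hs \<cdot> subsets S \<cdot> (\<Lambda> f\<in>subsets S. \<Lambda> g\<in>subsets S. same_members S f g) \<cdot>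
    (same_members_isProp \<cdot> S) \<cdot> (same_members_refl \<cdot> S) \<cdot> (same_members_eq \<cdot> S))"

lemma subsets_isSet: "\<langle>\<A>\<rangle> [] \<tturnstile> subsets_isSet_T 0"
  by (rule holds_check[OF ctx_Nil list_all_ConsI[OF code_isSet[of "Suc v" v] list_all_ConsI[OF
    same_members_isProp list_all_ConsI[OF same_members_refl list_all_ConsI[OF same_members_eq
    list_all_Nil]]]], of full "subsets_isSet_p (bound 0) (bound 1) (bound 2) (bound 3) 4"])
    (simp only: expr_eval, simp only: check_eval cong: check_cong)

definition [expr_eval]: "subsets_locally_small_T = (\<Pi> S\<in>\<U> v. locally_small v (subsets S))"

definition [expr_eval]: "subsets_locally_small_p hl same_members_isProp same_members_refl
    same_members_eq = (\<Lambda> S\<in>\<U> v. hl \<cdot> subsets S \<cdot> (\<Lambda> f\<in>subsets S. \<Lambda> g\<in>subsets S. same_members S f g)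
    \<cdot> (same_members_isProp \<cdot> S) \<cdot> (same_members_refl \<cdot> S) \<cdot> (same_members_eq \<cdot> S))"

lemma subsets_locally_small: "\<langle>\<A>\<rangle> [] \<tturnstile> subsets_locally_small_T 0"
  by (rule holds_check[OF ctx_Nil list_all_ConsI[OF code_locally_small[of "Suc v" v]
    list_all_ConsI[OF same_members_isProp list_all_ConsI[OF same_members_refl list_all_ConsI[OF
    same_members_eq list_all_Nil]]]], of full "subsets_locally_small_p (bound 0) (bound 1) (bound 2)
    (bound 3) 4"]) (simp only: expr_eval, simp only: check_eval cong: check_cong)

definition [expr_eval]: "image_small_T = (\<Pi> S\<in>\<U> v. \<Pi> f\<in>S \<rightarrow> subsets S. small v (image S (subsets S)
    f))"

definition [expr_eval]: "image_small_p setrep subsets_isSet subsets_locally_small = (\<Lambda> S\<in>\<U> v. \<Lambda> f\<in>S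
    \<rightarrow> subsets S. setrep \<cdot> S \<cdot> subsets S \<cdot> f \<cdot> ePair S (idEquiv S) \<cdot> (subsets_isSet \<cdot> S) \<cdot>
    (subsets_locally_small \<cdot> S))"

text \<open>In the instance of set replacement, level \<open>v\<close> bounds the source and the
  identity types, and only the target lives at \<open>Suc v\<close>; the image therefore comes down
  to \<open>\<U> v\<close>.\<close>

lemma image_small: "\<langle>\<A>\<rangle> [] \<tturnstile> image_small_T 0"
  by (rule holds_check[OF ctx_Nil list_all_ConsI[OF set_replacement_holds[of v v v "Suc v"]
    list_all_ConsI[OF subsets_isSet list_all_ConsI[OF subsets_locally_small list_all_Nil]]], of full
    "image_small_p (bound 0) (bound 1) (bound 2) 3"])
    (simp only: expr_eval, simp only: check_eval cong: check_cong)

section \<open>The quotient carried by the small image\<close>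

definition [expr_eval]: "comprehension S L pL = (\<Lambda> s\<in>S. \<Lambda> t\<in>S. annotate hProp (ePair (L \<cdot> s \<cdot> t) (pL
    \<cdot> s \<cdot> t)))"

text \<open>
  Hypotheses shared by several lemmas form a context. A subscript on a variable is the initial of the
  context that declares it (\<open>E\<close> for \<open>Bis_ctx\<close>).
\<close>

abbreviation "S\<^sub>I \<equiv> bound 0"
abbreviation "L\<^sub>I \<equiv> bound 1"
abbreviation "pL\<^sub>I \<equiv> bound 2"
abbreviation "Z\<^sub>I \<equiv> bound 3"
abbreviation "enc\<^sub>I \<equiv> bound 4"
abbreviation "dec\<^sub>I \<equiv> bound 5"
abbreviation "sec\<^sub>I \<equiv> bound 6"
abbreviation "rtr\<^sub>I \<equiv> bound 7"
abbreviation "ret\<^sub>I \<equiv> bound 8"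

text \<open>\<open>Z\<^sub>I\<close> is a small copy of the image. The equivalence is given by the
  map \<open>enc\<^sub>I\<close>, its section \<open>dec\<^sub>I\<close> and an independent
  retraction \<open>rtr\<^sub>I\<close>, as \<open>isEquiv\<close> provides them. Dependencies run
  from the bottom of the list upward.\<close>

definition Img_ctx :: "tm list" where [expr_eval]: "Img_ctx = [
    (\<Pi> z\<in>Z\<^sub>I. rtr\<^sub>I \<cdot> (enc\<^sub>I \<cdot> z) =\<^bsub>Z\<^sub>I\<^esub> z) 8,
    (image S\<^sub>I (subsets S\<^sub>I) (comprehension S\<^sub>I L\<^sub>I pL\<^sub>I) \<rightarrow> Z\<^sub>I) 7,
    (\<Pi> y\<in>image S\<^sub>I (subsets S\<^sub>I) (comprehension S\<^sub>I L\<^sub>I pL\<^sub>I). enc\<^sub>I \<cdot> (dec\<^sub>I \<cdot> y) =\<^bsub>image S\<^sub>I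
      (subsets S\<^sub>I) (comprehension S\<^sub>I L\<^sub>I pL\<^sub>I)\<^esub> y) 6,
    (image S\<^sub>I (subsets S\<^sub>I) (comprehension S\<^sub>I L\<^sub>I pL\<^sub>I) \<rightarrow> Z\<^sub>I) 5,
    (Z\<^sub>I \<rightarrow> image S\<^sub>I (subsets S\<^sub>I) (comprehension S\<^sub>I L\<^sub>I pL\<^sub>I)) 4,
    (\<U> v) 3,
    (\<Pi> s\<in>S\<^sub>I. \<Pi> t\<in>S\<^sub>I. isProp (L\<^sub>I \<cdot> s \<cdot> t)) 2,
    (S\<^sub>I \<rightarrow> S\<^sub>I \<rightarrow> \<U> v) 1,
    (\<U> v) 0] @ []"

lemma Img_ctx_ok: "\<langle>\<A>\<rangle> \<turnstile> Img_ctx"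
  unfolding Img_ctx_def
  by (rule ctx_okD[OF ctx_Nil, where n = full])
    (simp only: expr_eval, simp only: check_eval cong: check_cong)

definition [expr_eval]: "subset_map = comprehension S\<^sub>I L\<^sub>I pL\<^sub>I"

definition [expr_eval]: "preimage y = (\<Sigma> s\<in>S\<^sub>I. subset_map \<cdot> s =\<^bsub>subsets S\<^sub>I\<^esub> y)"

definition [expr_eval]: "subset_image = image S\<^sub>I (subsets S\<^sub>I) subset_map"

definition [expr_eval]: "image_point s = ePair (subset_map \<cdot> s) (eTrI (ePair s (eRefl (subset_map \<cdot>
    s))))"

definition [expr_eval]: "members w = proj1 (subsets S\<^sub>I) (\<lambda>y. \<parallel>preimage y\<parallel>) w"

definition [expr_eval]: "class_of s = dec\<^sub>I \<cdot> image_point s"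

definition [expr_eval]: "member_of z t = prop_of (members (enc\<^sub>I \<cdot> z) \<cdot> t)"

definition [expr_eval]: "enc_inj_T = (\<Pi> z\<in>Z\<^sub>I. \<Pi> w\<in>Z\<^sub>I. members (enc\<^sub>I \<cdot> z) =\<^bsub>subsets S\<^sub>I\<^esub> members
    (enc\<^sub>I \<cdot> w) \<rightarrow> z =\<^bsub>Z\<^sub>I\<^esub> w)"

text \<open>Image points with equal subsets are equal, their second components being truncated, and
  \<open>rtr\<^sub>I\<close> carries this equality back to \<open>Z\<^sub>I\<close>.\<close>

definition [expr_eval]: "enc_inj_p se = (\<Lambda> z\<in>Z\<^sub>I. \<Lambda> w\<in>Z\<^sub>I. \<Lambda> p\<in>members (enc\<^sub>I \<cdot> z) =\<^bsub>subsets S\<^sub>I\<^esub>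
    members (enc\<^sub>I \<cdot> w). comp_path Z\<^sub>I z (rtr\<^sub>I \<cdot> (enc\<^sub>I \<cdot> z)) w (inv_path Z\<^sub>I (rtr\<^sub>I \<cdot> (enc\<^sub>I \<cdot> z))
    z (ret\<^sub>I \<cdot> z)) (comp_path Z\<^sub>I (rtr\<^sub>I \<cdot> (enc\<^sub>I \<cdot> z)) (rtr\<^sub>I \<cdot> (enc\<^sub>I \<cdot> w)) w (ap_path
    subset_image Z\<^sub>I (\<lambda>y. rtr\<^sub>I \<cdot> y) (enc\<^sub>I \<cdot> z) (enc\<^sub>I \<cdot> w) (se \<cdot> subsets S\<^sub>I \<cdot> (\<Lambda> y\<in>subsets S\<^sub>I.
    \<parallel>preimage y\<parallel>) \<cdot> (\<Lambda> y\<in>subsets S\<^sub>I. \<Lambda> a\<in>\<parallel>preimage y\<parallel>. \<Lambda> b\<in>\<parallel>preimage y\<parallel>. eTrEq a b) \<cdot> (enc\<^sub>I \<cdot> z) \<cdot>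
    (enc\<^sub>I \<cdot> w) \<cdot> p)) (ret\<^sub>I \<cdot> w)))"

lemma enc_inj: "\<langle>\<A>\<rangle> Img_ctx \<tturnstile> enc_inj_T 9"
  by (rule holds_check[OF Img_ctx_ok list_all_ConsI[OF holds_closed[OF sig_eq[of "Suc v" "Suc v"]
    Img_ctx_ok] list_all_Nil], of full "enc_inj_p (bound 9) 10"])
    (simp only: expr_eval, simp only: check_eval cong: check_cong)

definition [expr_eval]: "cls_surj_T = (\<Pi> z\<in>Z\<^sub>I. \<Pi> K\<in>\<U> v. isProp K \<rightarrow> (\<Pi> s\<in>S\<^sub>I. class_of s =\<^bsub>Z\<^sub>I\<^esub> z \<rightarrow>
    K) \<rightarrow> K)"

text \<open>The truncated preimage stored in \<open>enc\<^sub>I \<cdot> z\<close> supplies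
  \<open>s\<close> together with a path between subsets. As
  \<open>enc\<^sub>I \<cdot> class_of s\<close> is the image point of \<open>s\<close>, this becomes
  a path between members, and \<open>enc_inj\<close> pulls it back to
  \<open>Z\<^sub>I\<close>.\<close>

definition [expr_eval]: "cls_surj_p enc_inj = (\<Lambda> z\<in>Z\<^sub>I. \<Lambda> K\<in>\<U> v. \<Lambda> pK\<in>isProp K. \<Lambda> k\<in>(\<Pi> s\<in>S\<^sub>I.
    class_of s =\<^bsub>Z\<^sub>I\<^esub> z \<rightarrow> K). eRecTr K pK (\<Lambda> u\<in>preimage (members (enc\<^sub>I \<cdot> z)). sig_elim S\<^sub>I (\<lambda>s.
    subset_map \<cdot> s =\<^bsub>subsets S\<^sub>I\<^esub> members (enc\<^sub>I \<cdot> z)) (\<lambda>u. K) (\<lambda>s p. k \<cdot> s \<cdot> (enc_inj \<cdot> class_of s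
    \<cdot> z \<cdot> comp_path (subsets S\<^sub>I) (members (enc\<^sub>I \<cdot> class_of s)) (subset_map \<cdot> s) (members (enc\<^sub>I \<cdot>
    z)) (ap_path subset_image (subsets S\<^sub>I) (\<lambda>w. members w) (enc\<^sub>I \<cdot> class_of s) (image_point s)
    (sec\<^sub>I \<cdot> image_point s)) p)) u) (proj2 (subsets S\<^sub>I) (\<lambda>y. \<parallel>preimage y\<parallel>) (enc\<^sub>I \<cdot> z)))"

lemma cls_surj: "\<langle>\<A>\<rangle> Img_ctx \<tturnstile> cls_surj_T 9"
  by (rule holds_check[OF Img_ctx_ok list_all_ConsI[OF enc_inj list_all_Nil], of full "cls_surj_p
    (bound 9) 10"]) (simp only: expr_eval, simp only: check_eval cong: check_cong)

definition [expr_eval]: "mem_clsD_T = (\<Pi> s\<in>S\<^sub>I. \<Pi> t\<in>S\<^sub>I. member_of (class_of s) t \<rightarrow> L\<^sub>I \<cdot> s \<cdot> t)"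

text \<open>The members of \<open>image_point s\<close> reduce to the comprehension for
  \<open>s\<close>, so membership in a class is \<open>L\<^sub>I\<close> up to the section
  path.\<close>

definition [expr_eval]: "mem_clsD_p = (\<Lambda> s\<in>S\<^sub>I. \<Lambda> t\<in>S\<^sub>I. \<Lambda> x\<in>member_of (class_of s) t. transport
    subset_image (enc\<^sub>I \<cdot> class_of s) (\<lambda>w. prop_of (members w \<cdot> t)) x (image_point s) (sec\<^sub>I \<cdot>
    image_point s))"

lemma mem_clsD: "\<langle>\<A>\<rangle> Img_ctx \<tturnstile> mem_clsD_T 9"
  by (rule holds_check[OF Img_ctx_ok list_all_Nil, of full "mem_clsD_p 9"])
    (simp only: expr_eval, simp only: check_eval cong: check_cong)

definition [expr_eval]: "mem_clsI_T = (\<Pi> s\<in>S\<^sub>I. \<Pi> t\<in>S\<^sub>I. L\<^sub>I \<cdot> s \<cdot> t \<rightarrow> member_of (class_of s) t)"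

definition [expr_eval]: "mem_clsI_p = (\<Lambda> s\<in>S\<^sub>I. \<Lambda> t\<in>S\<^sub>I. \<Lambda> x\<in>L\<^sub>I \<cdot> s \<cdot> t. transport subset_image
    (image_point s) (\<lambda>w. prop_of (members w \<cdot> t)) x (enc\<^sub>I \<cdot> class_of s) (inv_path subset_image
    (enc\<^sub>I \<cdot> class_of s) (image_point s) (sec\<^sub>I \<cdot> image_point s)))"

lemma mem_clsI: "\<langle>\<A>\<rangle> Img_ctx \<tturnstile> mem_clsI_T 9"
  by (rule holds_check[OF Img_ctx_ok list_all_Nil, of full "mem_clsI_p 9"])
    (simp only: expr_eval, simp only: check_eval cong: check_cong)

definition [expr_eval]: "mem_ext_T = (\<Pi> z\<in>Z\<^sub>I. \<Pi> w\<in>Z\<^sub>I. (\<Pi> t\<in>S\<^sub>I. member_of z t \<rightarrow> member_of w t) \<rightarrow>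
    (\<Pi> t\<in>S\<^sub>I. member_of w t \<rightarrow> member_of z t) \<rightarrow> z =\<^bsub>Z\<^sub>I\<^esub> w)"

definition [expr_eval]: "mem_ext_p same_members_eq enc_inj = (\<Lambda> z\<in>Z\<^sub>I. \<Lambda> w\<in>Z\<^sub>I. \<Lambda> a\<in>(\<Pi> t\<in>S\<^sub>I.
    member_of z t \<rightarrow> member_of w t). \<Lambda> b\<in>(\<Pi> t\<in>S\<^sub>I. member_of w t \<rightarrow> member_of z t). enc_inj \<cdot> z \<cdot> w \<cdot>
    (same_members_eq \<cdot> S\<^sub>I \<cdot> members (enc\<^sub>I \<cdot> z) \<cdot> members (enc\<^sub>I \<cdot> w) \<cdot> (\<Lambda> t\<in>S\<^sub>I. ePair (a \<cdot> t) (b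
    \<cdot> t))))"

lemma mem_ext: "\<langle>\<A>\<rangle> Img_ctx \<tturnstile> mem_ext_T 9"
  by (rule holds_check[OF Img_ctx_ok list_all_ConsI[OF holds_closed[OF same_members_eq Img_ctx_ok]
    list_all_ConsI[OF enc_inj list_all_Nil]], of full "mem_ext_p (bound 9) (bound 10) 11"])
    (simp only: expr_eval, simp only: check_eval cong: check_cong)

definition [expr_eval]: "mem_isProp_T = (\<Pi> z\<in>Z\<^sub>I. \<Pi> t\<in>S\<^sub>I. isProp (member_of z t))"

definition [expr_eval]: "mem_isProp_p = (\<Lambda> z\<in>Z\<^sub>I. \<Lambda> t\<in>S\<^sub>I. prop_of_isProp (members (enc\<^sub>I \<cdot> z) \<cdot>
    t))"

lemma mem_isProp: "\<langle>\<A>\<rangle> Img_ctx \<tturnstile> mem_isProp_T 9"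
  by (rule holds_check[OF Img_ctx_ok list_all_Nil, of full "mem_isProp_p 9"])
    (simp only: expr_eval, simp only: check_eval cong: check_cong)

definition [expr_eval]: "quot_surj S Z q = (\<Pi> z\<in>Z. \<Pi> K\<in>\<U> v. isProp K \<rightarrow> (\<Pi> s\<in>S. q \<cdot> s =\<^bsub>Z\<^esub> z \<rightarrow> K) \<rightarrow>
    K)"

text \<open>The interface of the quotient in continuation form. In the end \<open>C\<close> will be
  a \<open>\<Sigma>\<close> over the type of ordinals, which is why the users of this interface take
  it at level \<open>Suc v\<close>.\<close>

definition [expr_eval]: "quotient_cont S L C = (\<Pi> Z\<in>\<U> v. \<Pi> q\<in>S \<rightarrow> Z. \<Pi> m\<in>Z \<rightarrow> S \<rightarrow> \<U> v. quot_prop S Z m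
    \<rightarrow> quot_surj S Z q \<rightarrow> quot_elim S L Z q m \<rightarrow> quot_intro S L Z q m \<rightarrow> quot_ext S Z m \<rightarrow> C)"

definition [expr_eval]: "image_quotient_T = (\<Pi> C\<in>\<U> (Suc v). quotient_cont S\<^sub>I L\<^sub>I C \<rightarrow> C)"

definition [expr_eval]: "image_quotient_p mem_isProp cls_surj mem_clsD mem_clsI mem_ext = (\<Lambda> C\<in>\<U>
    (Suc v). \<Lambda> k\<in>quotient_cont S\<^sub>I L\<^sub>I C. k \<cdot> Z\<^sub>I \<cdot> (\<Lambda> s\<in>S\<^sub>I. class_of s) \<cdot> (\<Lambda> z\<in>Z\<^sub>I. \<Lambda> t\<in>S\<^sub>I.
    member_of z t) \<cdot> mem_isProp \<cdot> cls_surj \<cdot> mem_clsD \<cdot> mem_clsI \<cdot> mem_ext)"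

lemma image_quotient: "\<langle>\<A>\<rangle> Img_ctx \<tturnstile> image_quotient_T 9"
  by (rule holds_check[OF Img_ctx_ok list_all_ConsI[OF mem_isProp list_all_ConsI[OF cls_surj
    list_all_ConsI[OF mem_clsD list_all_ConsI[OF mem_clsI list_all_ConsI[OF mem_ext
    list_all_Nil]]]]], of full "image_quotient_p (bound 9) (bound 10) (bound 11) (bound 12) (bound
    13) 14"]) (simp only: expr_eval, simp only: check_eval cong: check_cong)

definition [expr_eval]: "quotient_exists_T = (\<Pi> S\<in>\<U> v. \<Pi> L\<in>S \<rightarrow> S \<rightarrow> \<U> v. \<Pi> pL\<in>(\<Pi> s\<in>S. \<Pi> t\<in>S. isProp
    (L \<cdot> s \<cdot> t)). \<Pi> C\<in>\<U> (Suc v). quotient_cont S L C \<rightarrow> C)"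

lemmas image_quotient_closed = image_quotient[unfolded Img_ctx_def append.simps, THEN holds_Pi, THEN
    holds_Pi, THEN holds_Pi, THEN holds_Pi, THEN holds_Pi, THEN holds_Pi, THEN holds_Pi, THEN
    holds_Pi, THEN holds_Pi]

text \<open>Takes the smallness of the image apart, layer by layer, into the data of
  \<open>Img_ctx\<close>. The motives are constantly \<open>C\<close>, so none of the pieces
  survives in the type of the result.\<close>

definition [expr_eval]: "quotient_exists_p iq image_small = (\<Lambda> S\<in>\<U> v. \<Lambda> L\<in>S \<rightarrow> S \<rightarrow> \<U> v. \<Lambda> pL\<in>(\<Pi> s\<in>S.
    \<Pi> t\<in>S. isProp (L \<cdot> s \<cdot> t)). \<Lambda> C\<in>\<U> (Suc v). \<Lambda> k\<in>quotient_cont S L C. sig_elim (\<U> v) (\<lambda>Z. Equiv Z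
    (image S (subsets S) (comprehension S L pL))) (\<lambda>u. C) (\<lambda>Z e. sig_elim (Z \<rightarrow> image S (subsets S)
    (comprehension S L pL)) (\<lambda>f. isEquiv Z (image S (subsets S) (comprehension S L pL)) f) (\<lambda>u. C)
    (\<lambda>f h. sig_elim (\<Sigma> g\<in>image S (subsets S) (comprehension S L pL) \<rightarrow> Z. \<Pi> y\<in>image S (subsets S)
    (comprehension S L pL). f \<cdot> (g \<cdot> y) =\<^bsub>image S (subsets S) (comprehension S L pL)\<^esub> y) (\<lambda>u. \<Sigma>
    h\<in>image S (subsets S) (comprehension S L pL) \<rightarrow> Z. \<Pi> x\<in>Z. h \<cdot> (f \<cdot> x) =\<^bsub>Z\<^esub> x) (\<lambda>u. C) (\<lambda>a b.
    sig_elim (image S (subsets S) (comprehension S L pL) \<rightarrow> Z) (\<lambda>g. \<Pi> y\<in>image S (subsets S)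
    (comprehension S L pL). f \<cdot> (g \<cdot> y) =\<^bsub>image S (subsets S) (comprehension S L pL)\<^esub> y) (\<lambda>u. C) (\<lambda>g
    s. sig_elim (image S (subsets S) (comprehension S L pL) \<rightarrow> Z) (\<lambda>h. \<Pi> x\<in>Z. h \<cdot> (f \<cdot> x) =\<^bsub>Z\<^esub> x)
    (\<lambda>u. C) (\<lambda>h r. iq \<cdot> S \<cdot> L \<cdot> pL \<cdot> Z \<cdot> f \<cdot> g \<cdot> s \<cdot> h \<cdot> r \<cdot> C \<cdot> k) b) a) h) e) (image_small \<cdot> S \<cdot>
    comprehension S L pL))"

lemma quotient_exists: "\<langle>\<A>\<rangle> [] \<tturnstile> quotient_exists_T 0"
  by (rule holds_check[OF ctx_Nil list_all_ConsI[OF image_quotient_closed list_all_ConsI[OF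
    image_small list_all_Nil]], of full "quotient_exists_p (bound 0) (bound 1) 2"])
    (simp only: expr_eval, simp only: check_eval cong: check_cong)

section \<open>Bisimilarity\<close>

abbreviation "I\<^sub>F \<equiv> bound 0"
abbreviation "X\<^sub>F \<equiv> bound 1"
abbreviation "R\<^sub>F \<equiv> bound 2"
abbreviation "pv\<^sub>F \<equiv> bound 3"
abbreviation "tr\<^sub>F \<equiv> bound 4"
abbreviation "ex\<^sub>F \<equiv> bound 5"
abbreviation "wf\<^sub>F \<equiv> bound 6"

definition Fam_ctx :: "tm list" where [expr_eval]: "Fam_ctx = [
    (\<Pi> i\<in>I\<^sub>F. well_founded (X\<^sub>F \<cdot> i) (R\<^sub>F \<cdot> i)) 6,
    (\<Pi> i\<in>I\<^sub>F. extensional (X\<^sub>F \<cdot> i) (R\<^sub>F \<cdot> i)) 5,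
    (\<Pi> i\<in>I\<^sub>F. transitive (X\<^sub>F \<cdot> i) (R\<^sub>F \<cdot> i)) 4,
    (\<Pi> i\<in>I\<^sub>F. prop_valued (X\<^sub>F \<cdot> i) (R\<^sub>F \<cdot> i)) 3,
    (\<Pi> i\<in>I\<^sub>F. X\<^sub>F \<cdot> i \<rightarrow> X\<^sub>F \<cdot> i \<rightarrow> \<U> v) 2,
    (I\<^sub>F \<rightarrow> \<U> v) 1,
    (\<U> v) 0] @ []"

lemma Fam_ctx_ok: "\<langle>\<A>\<rangle> \<turnstile> Fam_ctx"
  unfolding Fam_ctx_def
  by (rule ctx_okD[OF ctx_Nil, where n = full])
    (simp only: expr_eval, simp only: check_eval cong: check_cong)

definition [expr_eval]: "Rel = (\<Pi> i\<in>I\<^sub>F. X\<^sub>F \<cdot> i \<rightarrow> (\<Pi> j\<in>I\<^sub>F. X\<^sub>F \<cdot> j \<rightarrow> \<U> v))"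

text \<open>Truncated existence of a predecessor of \<open>y\<close> related to \<open>x0\<close>,
  encoded by elimination into propositions; \<open>bwdE\<close> is the mirror image for predecessors
  of \<open>x\<close>.\<close>

definition [expr_eval]: "fwdE E i x0 j y = (\<Pi> K\<in>\<U> v. isProp K \<rightarrow> (\<Pi> y0\<in>X\<^sub>F \<cdot> j. R\<^sub>F \<cdot> j \<cdot> y0 \<cdot> y \<rightarrow> E
    \<cdot> i \<cdot> x0 \<cdot> j \<cdot> y0 \<rightarrow> K) \<rightarrow> K)"

definition [expr_eval]: "bwdE E i x j y0 = (\<Pi> K\<in>\<U> v. isProp K \<rightarrow> (\<Pi> x0\<in>X\<^sub>F \<cdot> i. R\<^sub>F \<cdot> i \<cdot> x0 \<cdot> x \<rightarrow> E
    \<cdot> i \<cdot> x0 \<cdot> j \<cdot> y0 \<rightarrow> K) \<rightarrow> K)"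

definition [expr_eval]: "Forth E = (\<Pi> i\<in>I\<^sub>F. \<Pi> x\<in>X\<^sub>F \<cdot> i. \<Pi> j\<in>I\<^sub>F. \<Pi> y\<in>X\<^sub>F \<cdot> j. E \<cdot> i \<cdot> x \<cdot> j \<cdot> y \<rightarrow>
    (\<Pi> x0\<in>X\<^sub>F \<cdot> i. R\<^sub>F \<cdot> i \<cdot> x0 \<cdot> x \<rightarrow> fwdE E i x0 j y))"

definition [expr_eval]: "Back E = (\<Pi> i\<in>I\<^sub>F. \<Pi> x\<in>X\<^sub>F \<cdot> i. \<Pi> j\<in>I\<^sub>F. \<Pi> y\<in>X\<^sub>F \<cdot> j. E \<cdot> i \<cdot> x \<cdot> j \<cdot> y \<rightarrow>
    (\<Pi> y0\<in>X\<^sub>F \<cdot> j. R\<^sub>F \<cdot> j \<cdot> y0 \<cdot> y \<rightarrow> bwdE E i x j y0))"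

definition [expr_eval]: "Mk E = (\<Pi> i\<in>I\<^sub>F. \<Pi> x\<in>X\<^sub>F \<cdot> i. \<Pi> j\<in>I\<^sub>F. \<Pi> y\<in>X\<^sub>F \<cdot> j. (\<Pi> x0\<in>X\<^sub>F \<cdot> i. R\<^sub>F \<cdot> i
    \<cdot> x0 \<cdot> x \<rightarrow> fwdE E i x0 j y) \<rightarrow> (\<Pi> y0\<in>X\<^sub>F \<cdot> j. R\<^sub>F \<cdot> j \<cdot> y0 \<cdot> y \<rightarrow> bwdE E i x j y0) \<rightarrow> E \<cdot> i \<cdot> x \<cdot> j
    \<cdot> y)"

text \<open>\<open>rec\<close> takes the proof \<open>r\<close> because recursion on accessibility
  offers its values along with such proofs. For the same reason \<open>stepB\<close> has to carry
  \<open>r\<close> in a \<open>\<Sigma>\<close>.\<close>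

definition [expr_eval]: "stepF i x rec j y = (\<Pi> x0\<in>X\<^sub>F \<cdot> i. \<Pi> r\<in>R\<^sub>F \<cdot> i \<cdot> x0 \<cdot> x. \<parallel>\<Sigma> y0\<in>X\<^sub>F \<cdot> j. R\<^sub>F
    \<cdot> j \<cdot> y0 \<cdot> y \<otimes> rec \<cdot> x0 \<cdot> r \<cdot> j \<cdot> y0\<parallel>)"

definition [expr_eval]: "stepB i x rec j y = (\<Pi> y0\<in>X\<^sub>F \<cdot> j. R\<^sub>F \<cdot> j \<cdot> y0 \<cdot> y \<rightarrow> \<parallel>\<Sigma> x0\<in>X\<^sub>F \<cdot> i. \<Sigma>
    r\<in>R\<^sub>F \<cdot> i \<cdot> x0 \<cdot> x. rec \<cdot> x0 \<cdot> r \<cdot> j \<cdot> y0\<parallel>)"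

text \<open>The recursion descends along \<open>x\<close> only. Its value is a relation to every
  point of every member of the family, so \<open>y\<close> may change freely in the recursive calls.
  The motive takes values in functions into \<open>\<U> v\<close>, a large elimination that
  \<open>ty_IndAcc\<close> permits.\<close>

definition [expr_eval]: "bis_at i x p = eIndAcc (X\<^sub>F \<cdot> i) (R\<^sub>F \<cdot> i) (\<Lambda> x\<in>X\<^sub>F \<cdot> i. \<Lambda> p\<in>eAcc (X\<^sub>F \<cdot> i)
    (R\<^sub>F \<cdot> i) x. \<Pi> j\<in>I\<^sub>F. X\<^sub>F \<cdot> j \<rightarrow> \<U> v) (\<Lambda> x\<in>X\<^sub>F \<cdot> i. \<Lambda> h\<in>preds_acc (X\<^sub>F \<cdot> i) (R\<^sub>F \<cdot> i) x. \<Lambda> rec\<in>(\<Pi>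
    x0\<in>X\<^sub>F \<cdot> i. R\<^sub>F \<cdot> i \<cdot> x0 \<cdot> x \<rightarrow> (\<Pi> j\<in>I\<^sub>F. X\<^sub>F \<cdot> j \<rightarrow> \<U> v)). \<Lambda> j\<in>I\<^sub>F. \<Lambda> y\<in>X\<^sub>F \<cdot> j. stepF i x rec j
    y \<otimes> stepB i x rec j y) x p"

definition [expr_eval]: "bis = (\<Lambda> i\<in>I\<^sub>F. \<Lambda> x\<in>X\<^sub>F \<cdot> i. bis_at i x (wf\<^sub>F \<cdot> i \<cdot> x))"

text \<open>An accessibility proof in constructor form whose subproofs are the ones used in
  \<open>bis\<close>. At this proof \<open>bis_at\<close> computes to one unfolding with
  \<open>bis\<close> in the recursive places; since accessibility is a proposition, transport moves
  the unfolding to \<open>wf\<^sub>F\<close>.\<close>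

definition [expr_eval]: "acc_intro i x = eAccI x (\<Lambda> x0\<in>X\<^sub>F \<cdot> i. \<Lambda> r\<in>R\<^sub>F \<cdot> i \<cdot> x0 \<cdot> x. wf\<^sub>F \<cdot> i \<cdot>
    x0)"

definition [expr_eval]: "someF E i x j y = (\<Pi> x0\<in>X\<^sub>F \<cdot> i. R\<^sub>F \<cdot> i \<cdot> x0 \<cdot> x \<rightarrow> \<parallel>\<Sigma> y0\<in>X\<^sub>F \<cdot> j. R\<^sub>F \<cdot> j
    \<cdot> y0 \<cdot> y \<otimes> E \<cdot> i \<cdot> x0 \<cdot> j \<cdot> y0\<parallel>)"

definition [expr_eval]: "someB E i x j y = (\<Pi> y0\<in>X\<^sub>F \<cdot> j. R\<^sub>F \<cdot> j \<cdot> y0 \<cdot> y \<rightarrow> \<parallel>\<Sigma> x0\<in>X\<^sub>F \<cdot> i. R\<^sub>F \<cdot> i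
    \<cdot> x0 \<cdot> x \<otimes> E \<cdot> i \<cdot> x0 \<cdot> j \<cdot> y0\<parallel>)"

definition [expr_eval]: "Unfold E = (\<Pi> i\<in>I\<^sub>F. \<Pi> x\<in>X\<^sub>F \<cdot> i. \<Pi> j\<in>I\<^sub>F. \<Pi> y\<in>X\<^sub>F \<cdot> j. E \<cdot> i \<cdot> x \<cdot> j \<cdot> y \<rightarrow>
    someF E i x j y \<otimes> someB E i x j y)"

definition [expr_eval]: "Fold E = (\<Pi> i\<in>I\<^sub>F. \<Pi> x\<in>X\<^sub>F \<cdot> i. \<Pi> j\<in>I\<^sub>F. \<Pi> y\<in>X\<^sub>F \<cdot> j. someF E i x j y \<otimes>
    someB E i x j y \<rightarrow> E \<cdot> i \<cdot> x \<cdot> j \<cdot> y)"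

definition [expr_eval]: "bis_unfold_T = Unfold bis"

definition [expr_eval]: "bis_unfold_p isProp_Acc = (\<Lambda> i\<in>I\<^sub>F. \<Lambda> x\<in>X\<^sub>F \<cdot> i. \<Lambda> j\<in>I\<^sub>F. \<Lambda> y\<in>X\<^sub>F \<cdot> j. \<Lambda>
    e\<in>bis \<cdot> i \<cdot> x \<cdot> j \<cdot> y. transport (eAcc (X\<^sub>F \<cdot> i) (R\<^sub>F \<cdot> i) x) (wf\<^sub>F \<cdot> i \<cdot> x) (\<lambda>p. bis_at i x p \<cdot>
    j \<cdot> y) e (acc_intro i x) (isProp_Acc \<cdot> (X\<^sub>F \<cdot> i) \<cdot> (R\<^sub>F \<cdot> i) \<cdot> x \<cdot> (wf\<^sub>F \<cdot> i \<cdot> x) \<cdot> acc_intro i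
    x))"

lemma bis_unfold: "\<langle>\<A>\<rangle> Fam_ctx \<tturnstile> bis_unfold_T 7"
  by (rule holds_check[OF Fam_ctx_ok list_all_ConsI[OF holds_closed[OF isProp_Acc[of v] Fam_ctx_ok]
    list_all_Nil], of full "bis_unfold_p (bound 7) 8"])
    (simp only: expr_eval, simp only: check_eval cong: check_cong)

definition [expr_eval]: "bis_fold_T = Fold bis"

definition [expr_eval]: "bis_fold_p isProp_Acc = (\<Lambda> i\<in>I\<^sub>F. \<Lambda> x\<in>X\<^sub>F \<cdot> i. \<Lambda> j\<in>I\<^sub>F. \<Lambda> y\<in>X\<^sub>F \<cdot> j. \<Lambda>
    e\<in>someF bis i x j y \<otimes> someB bis i x j y. transport (eAcc (X\<^sub>F \<cdot> i) (R\<^sub>F \<cdot> i) x) (acc_intro i x)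
    (\<lambda>p. bis_at i x p \<cdot> j \<cdot> y) e (wf\<^sub>F \<cdot> i \<cdot> x) (isProp_Acc \<cdot> (X\<^sub>F \<cdot> i) \<cdot> (R\<^sub>F \<cdot> i) \<cdot> x \<cdot> acc_intro
    i x \<cdot> (wf\<^sub>F \<cdot> i \<cdot> x)))"

lemma bis_fold: "\<langle>\<A>\<rangle> Fam_ctx \<tturnstile> bis_fold_T 7"
  by (rule holds_check[OF Fam_ctx_ok list_all_ConsI[OF holds_closed[OF isProp_Acc[of v] Fam_ctx_ok]
    list_all_Nil], of full "bis_fold_p (bound 7) 8"])
    (simp only: expr_eval, simp only: check_eval cong: check_cong)

abbreviation "B\<^sub>U \<equiv> bound 7"
abbreviation "unfB\<^sub>U \<equiv> bound 8"
abbreviation "fldB\<^sub>U \<equiv> bound 9"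

text \<open>The recursively defined relation is replaced by a variable with its two unfolding laws,
  so that the lemmas over this context never meet the recursion.\<close>

definition Unf_ctx :: "tm list" where [expr_eval]: "Unf_ctx = [
    (Fold B\<^sub>U) 9,
    (Unfold B\<^sub>U) 8,
    (Rel) 7] @ Fam_ctx"

lemma Unf_ctx_ok: "\<langle>\<A>\<rangle> \<turnstile> Unf_ctx"
  unfolding Unf_ctx_def
  by (rule ctx_okD[OF Fam_ctx_ok, where n = full])
    (simp only: expr_eval, simp only: check_eval cong: check_cong)

definition [expr_eval]: "bis_forth_T = Forth B\<^sub>U"

definition [expr_eval]: "bis_forth_p = (\<Lambda> i\<in>I\<^sub>F. \<Lambda> x\<in>X\<^sub>F \<cdot> i. \<Lambda> j\<in>I\<^sub>F. \<Lambda> y\<in>X\<^sub>F \<cdot> j. \<Lambda> e\<in>B\<^sub>U \<cdot> i \<cdot> x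
    \<cdot> j \<cdot> y. \<Lambda> x0\<in>X\<^sub>F \<cdot> i. \<Lambda> r\<in>R\<^sub>F \<cdot> i \<cdot> x0 \<cdot> x. \<Lambda> K\<in>\<U> v. \<Lambda> pK\<in>isProp K. \<Lambda> k\<in>(\<Pi> y0\<in>X\<^sub>F \<cdot> j. R\<^sub>F \<cdot> j
    \<cdot> y0 \<cdot> y \<rightarrow> B\<^sub>U \<cdot> i \<cdot> x0 \<cdot> j \<cdot> y0 \<rightarrow> K). eRecTr K pK (\<Lambda> u\<in>(\<Sigma> y0\<in>X\<^sub>F \<cdot> j. R\<^sub>F \<cdot> j \<cdot> y0 \<cdot> y \<otimes> B\<^sub>U \<cdot>
    i \<cdot> x0 \<cdot> j \<cdot> y0). sig_elim (X\<^sub>F \<cdot> j) (\<lambda>y0. R\<^sub>F \<cdot> j \<cdot> y0 \<cdot> y \<otimes> B\<^sub>U \<cdot> i \<cdot> x0 \<cdot> j \<cdot> y0) (\<lambda>u. K)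
    (\<lambda>y0 p. k \<cdot> y0 \<cdot> fst_of (R\<^sub>F \<cdot> j \<cdot> y0 \<cdot> y) (B\<^sub>U \<cdot> i \<cdot> x0 \<cdot> j \<cdot> y0) p \<cdot> snd_of (R\<^sub>F \<cdot> j \<cdot> y0 \<cdot> y)
    (B\<^sub>U \<cdot> i \<cdot> x0 \<cdot> j \<cdot> y0) p) u) (fst_of (someF B\<^sub>U i x j y) (someB B\<^sub>U i x j y) (unfB\<^sub>U \<cdot> i \<cdot> x \<cdot>
    j \<cdot> y \<cdot> e) \<cdot> x0 \<cdot> r))"

lemma bis_forth: "\<langle>\<A>\<rangle> Unf_ctx \<tturnstile> bis_forth_T 10"
  by (rule holds_check[OF Unf_ctx_ok list_all_Nil, of full "bis_forth_p 10"])
    (simp only: expr_eval, simp only: check_eval cong: check_cong)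

definition [expr_eval]: "bis_back_T = Back B\<^sub>U"

definition [expr_eval]: "bis_back_p = (\<Lambda> i\<in>I\<^sub>F. \<Lambda> x\<in>X\<^sub>F \<cdot> i. \<Lambda> j\<in>I\<^sub>F. \<Lambda> y\<in>X\<^sub>F \<cdot> j. \<Lambda> e\<in>B\<^sub>U \<cdot> i \<cdot> x \<cdot>
    j \<cdot> y. \<Lambda> y0\<in>X\<^sub>F \<cdot> j. \<Lambda> s\<in>R\<^sub>F \<cdot> j \<cdot> y0 \<cdot> y. \<Lambda> K\<in>\<U> v. \<Lambda> pK\<in>isProp K. \<Lambda> k\<in>(\<Pi> x0\<in>X\<^sub>F \<cdot> i. R\<^sub>F \<cdot> i \<cdot>
    x0 \<cdot> x \<rightarrow> B\<^sub>U \<cdot> i \<cdot> x0 \<cdot> j \<cdot> y0 \<rightarrow> K). eRecTr K pK (\<Lambda> u\<in>(\<Sigma> x0\<in>X\<^sub>F \<cdot> i. R\<^sub>F \<cdot> i \<cdot> x0 \<cdot> x \<otimes> B\<^sub>U \<cdot> i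
    \<cdot> x0 \<cdot> j \<cdot> y0). sig_elim (X\<^sub>F \<cdot> i) (\<lambda>x0. R\<^sub>F \<cdot> i \<cdot> x0 \<cdot> x \<otimes> B\<^sub>U \<cdot> i \<cdot> x0 \<cdot> j \<cdot> y0) (\<lambda>u. K) (\<lambda>x0
    p. k \<cdot> x0 \<cdot> fst_of (R\<^sub>F \<cdot> i \<cdot> x0 \<cdot> x) (B\<^sub>U \<cdot> i \<cdot> x0 \<cdot> j \<cdot> y0) p \<cdot> snd_of (R\<^sub>F \<cdot> i \<cdot> x0 \<cdot> x) (B\<^sub>U
    \<cdot> i \<cdot> x0 \<cdot> j \<cdot> y0) p) u) (snd_of (someF B\<^sub>U i x j y) (someB B\<^sub>U i x j y) (unfB\<^sub>U \<cdot> i \<cdot> x \<cdot> j \<cdot> y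
    \<cdot> e) \<cdot> y0 \<cdot> s))"

lemma bis_back: "\<langle>\<A>\<rangle> Unf_ctx \<tturnstile> bis_back_T 10"
  by (rule holds_check[OF Unf_ctx_ok list_all_Nil, of full "bis_back_p 10"])
    (simp only: expr_eval, simp only: check_eval cong: check_cong)

definition [expr_eval]: "bis_intro_T = Mk B\<^sub>U"

text \<open>The elimination forms are applied with the truncated types themselves as
  \<open>K\<close>, which recovers the truncated existence that the fold law expects.\<close>

definition [expr_eval]: "bis_intro_p = (\<Lambda> i\<in>I\<^sub>F. \<Lambda> x\<in>X\<^sub>F \<cdot> i. \<Lambda> j\<in>I\<^sub>F. \<Lambda> y\<in>X\<^sub>F \<cdot> j. \<Lambda> f\<in>(\<Pi> x0\<in>X\<^sub>F \<cdot>
    i. R\<^sub>F \<cdot> i \<cdot> x0 \<cdot> x \<rightarrow> fwdE B\<^sub>U i x0 j y). \<Lambda> b\<in>(\<Pi> y0\<in>X\<^sub>F \<cdot> j. R\<^sub>F \<cdot> j \<cdot> y0 \<cdot> y \<rightarrow> bwdE B\<^sub>U i x j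
    y0). fldB\<^sub>U \<cdot> i \<cdot> x \<cdot> j \<cdot> y \<cdot> ePair (\<Lambda> x0\<in>X\<^sub>F \<cdot> i. \<Lambda> r\<in>R\<^sub>F \<cdot> i \<cdot> x0 \<cdot> x. f \<cdot> x0 \<cdot> r \<cdot> \<parallel>\<Sigma> y0\<in>X\<^sub>F
    \<cdot> j. R\<^sub>F \<cdot> j \<cdot> y0 \<cdot> y \<otimes> B\<^sub>U \<cdot> i \<cdot> x0 \<cdot> j \<cdot> y0\<parallel> \<cdot> (\<Lambda> a\<in>\<parallel>\<Sigma> y0\<in>X\<^sub>F \<cdot> j. R\<^sub>F \<cdot> j \<cdot> y0 \<cdot> y \<otimes> B\<^sub>U \<cdot> i
    \<cdot> x0 \<cdot> j \<cdot> y0\<parallel>. \<Lambda> b\<in>\<parallel>\<Sigma> y0\<in>X\<^sub>F \<cdot> j. R\<^sub>F \<cdot> j \<cdot> y0 \<cdot> y \<otimes> B\<^sub>U \<cdot> i \<cdot> x0 \<cdot> j \<cdot> y0\<parallel>. eTrEq a b) \<cdot> (\<Lambda>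
    y0\<in>X\<^sub>F \<cdot> j. \<Lambda> s\<in>R\<^sub>F \<cdot> j \<cdot> y0 \<cdot> y. \<Lambda> e\<in>B\<^sub>U \<cdot> i \<cdot> x0 \<cdot> j \<cdot> y0. eTrI (ePair y0 (ePair s e)))) (\<Lambda>
    y0\<in>X\<^sub>F \<cdot> j. \<Lambda> s\<in>R\<^sub>F \<cdot> j \<cdot> y0 \<cdot> y. b \<cdot> y0 \<cdot> s \<cdot> \<parallel>\<Sigma> x0\<in>X\<^sub>F \<cdot> i. R\<^sub>F \<cdot> i \<cdot> x0 \<cdot> x \<otimes> B\<^sub>U \<cdot> i \<cdot> x0 \<cdot>
    j \<cdot> y0\<parallel> \<cdot> (\<Lambda> a\<in>\<parallel>\<Sigma> x0\<in>X\<^sub>F \<cdot> i. R\<^sub>F \<cdot> i \<cdot> x0 \<cdot> x \<otimes> B\<^sub>U \<cdot> i \<cdot> x0 \<cdot> j \<cdot> y0\<parallel>. \<Lambda> b\<in>\<parallel>\<Sigma> x0\<in>X\<^sub>F \<cdot> i. R\<^sub>F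
    \<cdot> i \<cdot> x0 \<cdot> x \<otimes> B\<^sub>U \<cdot> i \<cdot> x0 \<cdot> j \<cdot> y0\<parallel>. eTrEq a b) \<cdot> (\<Lambda> x0\<in>X\<^sub>F \<cdot> i. \<Lambda> r\<in>R\<^sub>F \<cdot> i \<cdot> x0 \<cdot> x. \<Lambda> e\<in>B\<^sub>U
    \<cdot> i \<cdot> x0 \<cdot> j \<cdot> y0. eTrI (ePair x0 (ePair r e)))))"

lemma bis_intro: "\<langle>\<A>\<rangle> Unf_ctx \<tturnstile> bis_intro_T 10"
  by (rule holds_check[OF Unf_ctx_ok list_all_Nil, of full "bis_intro_p 10"])
    (simp only: expr_eval, simp only: check_eval cong: check_cong)

definition [expr_eval]: "RelCont C = (\<Pi> E\<in>Rel. Forth E \<rightarrow> Back E \<rightarrow> Mk E \<rightarrow> C)"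

definition [expr_eval]: "bisimilarity_of_unfold_T = (\<Pi> C\<in>\<U> (Suc v). RelCont C \<rightarrow> C)"

definition [expr_eval]: "bisimilarity_of_unfold_p bis_forth bis_back bis_intro = (\<Lambda> C\<in>\<U> (Suc v). \<Lambda>
    k\<in>RelCont C. k \<cdot> B\<^sub>U \<cdot> bis_forth \<cdot> bis_back \<cdot> bis_intro)"

lemma bisimilarity_of_unfold: "\<langle>\<A>\<rangle> Unf_ctx \<tturnstile> bisimilarity_of_unfold_T 10"
  by (rule holds_check[OF Unf_ctx_ok list_all_ConsI[OF bis_forth list_all_ConsI[OF bis_back
    list_all_ConsI[OF bis_intro list_all_Nil]]], of full "bisimilarity_of_unfold_p (bound 10) (bound
    11) (bound 12) 13"]) (simp only: expr_eval, simp only: check_eval cong: check_cong)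

definition [expr_eval]: "bisimilarity_exists_T = (\<Pi> C\<in>\<U> (Suc v). RelCont C \<rightarrow> C)"

lemmas bisimilarity_of_unfold_Fam = bisimilarity_of_unfold[unfolded Unf_ctx_def append.simps, THEN
    holds_Pi, THEN holds_Pi, THEN holds_Pi]

definition [expr_eval]: "bisimilarity_exists_p bis_unfold bis_fold ue = ue \<cdot> bis \<cdot> bis_unfold \<cdot>
    bis_fold"

lemma bisimilarity_exists: "\<langle>\<A>\<rangle> Fam_ctx \<tturnstile> bisimilarity_exists_T 7"
  by (rule holds_check[OF Fam_ctx_ok list_all_ConsI[OF bis_unfold list_all_ConsI[OF bis_fold
    list_all_ConsI[OF bisimilarity_of_unfold_Fam list_all_Nil]]], of full "bisimilarity_exists_p
    (bound 7) (bound 8) (bound 9) 10"])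
    (simp only: expr_eval, simp only: check_eval cong: check_cong)

abbreviation "E\<^sub>E \<equiv> bound 7"
abbreviation "forth\<^sub>E \<equiv> bound 8"
abbreviation "back\<^sub>E \<equiv> bound 9"
abbreviation "mkE\<^sub>E \<equiv> bound 10"

text \<open>The relation is abstract: only the two zigzag conditions and the corresponding
  introduction rule are known of it.\<close>

definition Bis_ctx :: "tm list" where [expr_eval]: "Bis_ctx = [
    (Mk E\<^sub>E) 10,
    (Back E\<^sub>E) 9,
    (Forth E\<^sub>E) 8,
    (Rel) 7] @ Fam_ctx"

lemma Bis_ctx_ok: "\<langle>\<A>\<rangle> \<turnstile> Bis_ctx"
  unfolding Bis_ctx_def
  by (rule ctx_okD[OF Fam_ctx_ok, where n = full])
    (simp only: expr_eval, simp only: check_eval cong: check_cong)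

definition [expr_eval]: "wfInd i M st x = eIndAcc (X\<^sub>F \<cdot> i) (R\<^sub>F \<cdot> i) (\<Lambda> x\<in>X\<^sub>F \<cdot> i. \<Lambda> p\<in>eAcc (X\<^sub>F \<cdot>
    i) (R\<^sub>F \<cdot> i) x. M x) (\<Lambda> x\<in>X\<^sub>F \<cdot> i. \<Lambda> h\<in>preds_acc (X\<^sub>F \<cdot> i) (R\<^sub>F \<cdot> i) x. \<Lambda> ih\<in>(\<Pi> x0\<in>X\<^sub>F \<cdot> i. R\<^sub>F
    \<cdot> i \<cdot> x0 \<cdot> x \<rightarrow> M x0). st x ih) x (wf\<^sub>F \<cdot> i \<cdot> x)"

definition [expr_eval]: "fwdI i x0 j y y0 s e = (\<Lambda> K\<in>\<U> v. \<Lambda> pK\<in>isProp K. \<Lambda> k\<in>(\<Pi> y0\<in>X\<^sub>F \<cdot> j. R\<^sub>F \<cdot> j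
    \<cdot> y0 \<cdot> y \<rightarrow> E\<^sub>E \<cdot> i \<cdot> x0 \<cdot> j \<cdot> y0 \<rightarrow> K). k \<cdot> y0 \<cdot> s \<cdot> e)"

definition [expr_eval]: "bwdI i x j y0 x0 r e = (\<Lambda> K\<in>\<U> v. \<Lambda> pK\<in>isProp K. \<Lambda> k\<in>(\<Pi> x0\<in>X\<^sub>F \<cdot> i. R\<^sub>F \<cdot> i
    \<cdot> x0 \<cdot> x \<rightarrow> E\<^sub>E \<cdot> i \<cdot> x0 \<cdot> j \<cdot> y0 \<rightarrow> K). k \<cdot> x0 \<cdot> r \<cdot> e)"

definition [expr_eval]: "E_refl_T = (\<Pi> i\<in>I\<^sub>F. \<Pi> x\<in>X\<^sub>F \<cdot> i. E\<^sub>E \<cdot> i \<cdot> x \<cdot> i \<cdot> x)"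

definition [expr_eval]: "E_refl_p = (\<Lambda> i\<in>I\<^sub>F. \<Lambda> x\<in>X\<^sub>F \<cdot> i. wfInd i (\<lambda>x. E\<^sub>E \<cdot> i \<cdot> x \<cdot> i \<cdot> x) (\<lambda>x ih.
    mkE\<^sub>E \<cdot> i \<cdot> x \<cdot> i \<cdot> x \<cdot> (\<Lambda> x0\<in>X\<^sub>F \<cdot> i. \<Lambda> r\<in>R\<^sub>F \<cdot> i \<cdot> x0 \<cdot> x. fwdI i x0 i x x0 r (ih \<cdot> x0 \<cdot> r)) \<cdot>
    (\<Lambda> x0\<in>X\<^sub>F \<cdot> i. \<Lambda> r\<in>R\<^sub>F \<cdot> i \<cdot> x0 \<cdot> x. bwdI i x i x0 x0 r (ih \<cdot> x0 \<cdot> r))) x)"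

lemma E_refl: "\<langle>\<A>\<rangle> Bis_ctx \<tturnstile> E_refl_T 11"
  by (rule holds_check[OF Bis_ctx_ok list_all_Nil, of full "E_refl_p 11"])
    (simp only: expr_eval, simp only: check_eval cong: check_cong)

definition [expr_eval]: "E_sym_T = (\<Pi> i\<in>I\<^sub>F. \<Pi> x\<in>X\<^sub>F \<cdot> i. \<Pi> j\<in>I\<^sub>F. \<Pi> y\<in>X\<^sub>F \<cdot> j. E\<^sub>E \<cdot> i \<cdot> x \<cdot> j \<cdot> y
    \<rightarrow> E\<^sub>E \<cdot> j \<cdot> y \<cdot> i \<cdot> x)"

text \<open>Induction on \<open>x\<close> with \<open>y\<close> arbitrary. The conditions trade
  places: \<open>back\<^sub>E\<close> at the given pair serves the forth condition of the reversed
  pair, and conversely.\<close>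

definition [expr_eval]: "E_sym_p = (\<Lambda> i\<in>I\<^sub>F. \<Lambda> x\<in>X\<^sub>F \<cdot> i. wfInd i (\<lambda>x. \<Pi> j\<in>I\<^sub>F. \<Pi> y\<in>X\<^sub>F \<cdot> j. E\<^sub>E \<cdot> i
    \<cdot> x \<cdot> j \<cdot> y \<rightarrow> E\<^sub>E \<cdot> j \<cdot> y \<cdot> i \<cdot> x) (\<lambda>x ih. \<Lambda> j\<in>I\<^sub>F. \<Lambda> y\<in>X\<^sub>F \<cdot> j. \<Lambda> e\<in>E\<^sub>E \<cdot> i \<cdot> x \<cdot> j \<cdot> y. mkE\<^sub>E
    \<cdot> j \<cdot> y \<cdot> i \<cdot> x \<cdot> (\<Lambda> y0\<in>X\<^sub>F \<cdot> j. \<Lambda> s\<in>R\<^sub>F \<cdot> j \<cdot> y0 \<cdot> y. \<Lambda> K\<in>\<U> v. \<Lambda> pK\<in>isProp K. \<Lambda> k\<in>(\<Pi> x0\<in>X\<^sub>F \<cdot>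
    i. R\<^sub>F \<cdot> i \<cdot> x0 \<cdot> x \<rightarrow> E\<^sub>E \<cdot> j \<cdot> y0 \<cdot> i \<cdot> x0 \<rightarrow> K). back\<^sub>E \<cdot> i \<cdot> x \<cdot> j \<cdot> y \<cdot> e \<cdot> y0 \<cdot> s \<cdot> K \<cdot> pK \<cdot>
    (\<Lambda> x0\<in>X\<^sub>F \<cdot> i. \<Lambda> r\<in>R\<^sub>F \<cdot> i \<cdot> x0 \<cdot> x. \<Lambda> d\<in>E\<^sub>E \<cdot> i \<cdot> x0 \<cdot> j \<cdot> y0. k \<cdot> x0 \<cdot> r \<cdot> (ih \<cdot> x0 \<cdot> r \<cdot> j \<cdot>
    y0 \<cdot> d))) \<cdot> (\<Lambda> x0\<in>X\<^sub>F \<cdot> i. \<Lambda> r\<in>R\<^sub>F \<cdot> i \<cdot> x0 \<cdot> x. \<Lambda> K\<in>\<U> v. \<Lambda> pK\<in>isProp K. \<Lambda> k\<in>(\<Pi> y0\<in>X\<^sub>F \<cdot> j. R\<^sub>F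
    \<cdot> j \<cdot> y0 \<cdot> y \<rightarrow> E\<^sub>E \<cdot> j \<cdot> y0 \<cdot> i \<cdot> x0 \<rightarrow> K). forth\<^sub>E \<cdot> i \<cdot> x \<cdot> j \<cdot> y \<cdot> e \<cdot> x0 \<cdot> r \<cdot> K \<cdot> pK \<cdot> (\<Lambda>
    y0\<in>X\<^sub>F \<cdot> j. \<Lambda> s\<in>R\<^sub>F \<cdot> j \<cdot> y0 \<cdot> y. \<Lambda> d\<in>E\<^sub>E \<cdot> i \<cdot> x0 \<cdot> j \<cdot> y0. k \<cdot> y0 \<cdot> s \<cdot> (ih \<cdot> x0 \<cdot> r \<cdot> j \<cdot> y0
    \<cdot> d)))) x)"

lemma E_sym: "\<langle>\<A>\<rangle> Bis_ctx \<tturnstile> E_sym_T 11"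
  by (rule holds_check[OF Bis_ctx_ok list_all_Nil, of full "E_sym_p 11"])
    (simp only: expr_eval, simp only: check_eval cong: check_cong)

definition [expr_eval]: "E_trans_T = (\<Pi> i\<in>I\<^sub>F. \<Pi> x\<in>X\<^sub>F \<cdot> i. \<Pi> j\<in>I\<^sub>F. \<Pi> y\<in>X\<^sub>F \<cdot> j. \<Pi> k\<in>I\<^sub>F. \<Pi> z\<in>X\<^sub>F \<cdot>
    k. E\<^sub>E \<cdot> i \<cdot> x \<cdot> j \<cdot> y \<rightarrow> E\<^sub>E \<cdot> j \<cdot> y \<cdot> k \<cdot> z \<rightarrow> E\<^sub>E \<cdot> i \<cdot> x \<cdot> k \<cdot> z)"

text \<open>Induction on the first point only. The forth condition follows a predecessor of
  \<open>x\<close> through \<open>y\<close> to \<open>z\<close>; the back condition runs the other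
  way.\<close>

definition [expr_eval]: "E_trans_p = (\<Lambda> i\<in>I\<^sub>F. \<Lambda> x\<in>X\<^sub>F \<cdot> i. wfInd i (\<lambda>x. \<Pi> j\<in>I\<^sub>F. \<Pi> y\<in>X\<^sub>F \<cdot> j. \<Pi>
    k\<in>I\<^sub>F. \<Pi> z\<in>X\<^sub>F \<cdot> k. E\<^sub>E \<cdot> i \<cdot> x \<cdot> j \<cdot> y \<rightarrow> E\<^sub>E \<cdot> j \<cdot> y \<cdot> k \<cdot> z \<rightarrow> E\<^sub>E \<cdot> i \<cdot> x \<cdot> k \<cdot> z) (\<lambda>x ih. \<Lambda>
    j\<in>I\<^sub>F. \<Lambda> y\<in>X\<^sub>F \<cdot> j. \<Lambda> k\<in>I\<^sub>F. \<Lambda> z\<in>X\<^sub>F \<cdot> k. \<Lambda> e\<in>E\<^sub>E \<cdot> i \<cdot> x \<cdot> j \<cdot> y. \<Lambda> f\<in>E\<^sub>E \<cdot> j \<cdot> y \<cdot> k \<cdot> z.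
    mkE\<^sub>E \<cdot> i \<cdot> x \<cdot> k \<cdot> z \<cdot> (\<Lambda> x0\<in>X\<^sub>F \<cdot> i. \<Lambda> r\<in>R\<^sub>F \<cdot> i \<cdot> x0 \<cdot> x. \<Lambda> K\<in>\<U> v. \<Lambda> pK\<in>isProp K. \<Lambda> c\<in>(\<Pi>
    z0\<in>X\<^sub>F \<cdot> k. R\<^sub>F \<cdot> k \<cdot> z0 \<cdot> z \<rightarrow> E\<^sub>E \<cdot> i \<cdot> x0 \<cdot> k \<cdot> z0 \<rightarrow> K). forth\<^sub>E \<cdot> i \<cdot> x \<cdot> j \<cdot> y \<cdot> e \<cdot> x0 \<cdot> r
    \<cdot> K \<cdot> pK \<cdot> (\<Lambda> y0\<in>X\<^sub>F \<cdot> j. \<Lambda> s\<in>R\<^sub>F \<cdot> j \<cdot> y0 \<cdot> y. \<Lambda> d\<in>E\<^sub>E \<cdot> i \<cdot> x0 \<cdot> j \<cdot> y0. forth\<^sub>E \<cdot> j \<cdot> y \<cdot> k \<cdot>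
    z \<cdot> f \<cdot> y0 \<cdot> s \<cdot> K \<cdot> pK \<cdot> (\<Lambda> z0\<in>X\<^sub>F \<cdot> k. \<Lambda> t\<in>R\<^sub>F \<cdot> k \<cdot> z0 \<cdot> z. \<Lambda> g\<in>E\<^sub>E \<cdot> j \<cdot> y0 \<cdot> k \<cdot> z0. c \<cdot> z0
    \<cdot> t \<cdot> (ih \<cdot> x0 \<cdot> r \<cdot> j \<cdot> y0 \<cdot> k \<cdot> z0 \<cdot> d \<cdot> g)))) \<cdot> (\<Lambda> z0\<in>X\<^sub>F \<cdot> k. \<Lambda> t\<in>R\<^sub>F \<cdot> k \<cdot> z0 \<cdot> z. \<Lambda> K\<in>\<U> v.
    \<Lambda> pK\<in>isProp K. \<Lambda> c\<in>(\<Pi> x0\<in>X\<^sub>F \<cdot> i. R\<^sub>F \<cdot> i \<cdot> x0 \<cdot> x \<rightarrow> E\<^sub>E \<cdot> i \<cdot> x0 \<cdot> k \<cdot> z0 \<rightarrow> K). back\<^sub>E \<cdot> j \<cdot> y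
    \<cdot> k \<cdot> z \<cdot> f \<cdot> z0 \<cdot> t \<cdot> K \<cdot> pK \<cdot> (\<Lambda> y0\<in>X\<^sub>F \<cdot> j. \<Lambda> s\<in>R\<^sub>F \<cdot> j \<cdot> y0 \<cdot> y. \<Lambda> g\<in>E\<^sub>E \<cdot> j \<cdot> y0 \<cdot> k \<cdot> z0.
    back\<^sub>E \<cdot> i \<cdot> x \<cdot> j \<cdot> y \<cdot> e \<cdot> y0 \<cdot> s \<cdot> K \<cdot> pK \<cdot> (\<Lambda> x0\<in>X\<^sub>F \<cdot> i. \<Lambda> r\<in>R\<^sub>F \<cdot> i \<cdot> x0 \<cdot> x. \<Lambda> d\<in>E\<^sub>E \<cdot> i
    \<cdot> x0 \<cdot> j \<cdot> y0. c \<cdot> x0 \<cdot> r \<cdot> (ih \<cdot> x0 \<cdot> r \<cdot> j \<cdot> y0 \<cdot> k \<cdot> z0 \<cdot> d \<cdot> g))))) x)"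

lemma E_trans: "\<langle>\<A>\<rangle> Bis_ctx \<tturnstile> E_trans_T 11"
  by (rule holds_check[OF Bis_ctx_ok list_all_Nil, of full "E_trans_p 11"])
    (simp only: expr_eval, simp only: check_eval cong: check_cong)

definition [expr_eval]: "E_inj_T = (\<Pi> i\<in>I\<^sub>F. \<Pi> x\<in>X\<^sub>F \<cdot> i. \<Pi> y\<in>X\<^sub>F \<cdot> i. E\<^sub>E \<cdot> i \<cdot> x \<cdot> i \<cdot> y \<rightarrow> x =\<^bsub>X\<^sub>F
    \<cdot> i\<^esub> y)"

text \<open>Extensionality reduces the claim to equality of predecessors. A predecessor
  \<open>z\<close> of \<open>x\<close> is related to some \<open>y0\<close> below \<open>y\<close>,
  and the induction hypothesis identifies \<open>z\<close> with \<open>y0\<close>. The elimination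
  is allowed because the relation is proposition-valued.\<close>

definition [expr_eval]: "E_inj_p = (\<Lambda> i\<in>I\<^sub>F. \<Lambda> x\<in>X\<^sub>F \<cdot> i. wfInd i (\<lambda>x. \<Pi> y\<in>X\<^sub>F \<cdot> i. E\<^sub>E \<cdot> i \<cdot> x \<cdot> i
    \<cdot> y \<rightarrow> x =\<^bsub>X\<^sub>F \<cdot> i\<^esub> y) (\<lambda>x ih. \<Lambda> y\<in>X\<^sub>F \<cdot> i. \<Lambda> e\<in>E\<^sub>E \<cdot> i \<cdot> x \<cdot> i \<cdot> y. ex\<^sub>F \<cdot> i \<cdot> x \<cdot> y \<cdot> (\<Lambda> z\<in>X\<^sub>F
    \<cdot> i. ePair (\<Lambda> r\<in>R\<^sub>F \<cdot> i \<cdot> z \<cdot> x. forth\<^sub>E \<cdot> i \<cdot> x \<cdot> i \<cdot> y \<cdot> e \<cdot> z \<cdot> r \<cdot> (R\<^sub>F \<cdot> i \<cdot> z \<cdot> y) \<cdot> (pv\<^sub>F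
    \<cdot> i \<cdot> z \<cdot> y) \<cdot> (\<Lambda> y0\<in>X\<^sub>F \<cdot> i. \<Lambda> s\<in>R\<^sub>F \<cdot> i \<cdot> y0 \<cdot> y. \<Lambda> d\<in>E\<^sub>E \<cdot> i \<cdot> z \<cdot> i \<cdot> y0. transport (X\<^sub>F \<cdot>
    i) y0 (\<lambda>w. R\<^sub>F \<cdot> i \<cdot> w \<cdot> y) s z (inv_path (X\<^sub>F \<cdot> i) z y0 (ih \<cdot> z \<cdot> r \<cdot> y0 \<cdot> d)))) (\<Lambda> s\<in>R\<^sub>F \<cdot> i \<cdot>
    z \<cdot> y. back\<^sub>E \<cdot> i \<cdot> x \<cdot> i \<cdot> y \<cdot> e \<cdot> z \<cdot> s \<cdot> (R\<^sub>F \<cdot> i \<cdot> z \<cdot> x) \<cdot> (pv\<^sub>F \<cdot> i \<cdot> z \<cdot> x) \<cdot> (\<Lambda> x0\<in>X\<^sub>F \<cdot>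
    i. \<Lambda> r\<in>R\<^sub>F \<cdot> i \<cdot> x0 \<cdot> x. \<Lambda> d\<in>E\<^sub>E \<cdot> i \<cdot> x0 \<cdot> i \<cdot> z. transport (X\<^sub>F \<cdot> i) x0 (\<lambda>w. R\<^sub>F \<cdot> i \<cdot> w \<cdot> x)
    r z (ih \<cdot> x0 \<cdot> r \<cdot> z \<cdot> d))))) x)"

lemma E_inj: "\<langle>\<A>\<rangle> Bis_ctx \<tturnstile> E_inj_T 11"
  by (rule holds_check[OF Bis_ctx_ok list_all_Nil, of full "E_inj_p 11"])
    (simp only: expr_eval, simp only: check_eval cong: check_cong)

definition [expr_eval]: "Below i x j y = \<parallel>\<Sigma> x0\<in>X\<^sub>F \<cdot> i. R\<^sub>F \<cdot> i \<cdot> x0 \<cdot> x \<otimes> E\<^sub>E \<cdot> j \<cdot> y \<cdot> i \<cdot> x0\<parallel>"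

section \<open>Classes of bisimilar points\<close>

abbreviation "Z\<^sub>C \<equiv> bound 11"
abbreviation "q\<^sub>C \<equiv> bound 12"
abbreviation "m\<^sub>C \<equiv> bound 13"
abbreviation "mProp\<^sub>C \<equiv> bound 14"
abbreviation "qSurj\<^sub>C \<equiv> bound 15"
abbreviation "mElim\<^sub>C \<equiv> bound 16"
abbreviation "mIntro\<^sub>C \<equiv> bound 17"
abbreviation "mExt\<^sub>C \<equiv> bound 18"

text \<open>The interface of the quotient for \<open>Below\<close>, with each point given by index
  and element separately, so that no projections occur in later types.\<close>

definition Cls_ctx :: "tm list" where [expr_eval]: "Cls_ctx = [
    (\<Pi> z\<in>Z\<^sub>C. \<Pi> w\<in>Z\<^sub>C. (\<Pi> j\<in>I\<^sub>F. \<Pi> y\<in>X\<^sub>F \<cdot> j. m\<^sub>C \<cdot> z \<cdot> j \<cdot> y \<rightarrow> m\<^sub>C \<cdot> w \<cdot> j \<cdot> y) \<rightarrow> (\<Pi> j\<in>I\<^sub>F. \<Pi> y\<in>X\<^sub>F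
      \<cdot> j. m\<^sub>C \<cdot> w \<cdot> j \<cdot> y \<rightarrow> m\<^sub>C \<cdot> z \<cdot> j \<cdot> y) \<rightarrow> z =\<^bsub>Z\<^sub>C\<^esub> w) 18,
    (\<Pi> i\<in>I\<^sub>F. \<Pi> x\<in>X\<^sub>F \<cdot> i. \<Pi> j\<in>I\<^sub>F. \<Pi> y\<in>X\<^sub>F \<cdot> j. Below i x j y \<rightarrow> m\<^sub>C \<cdot> (q\<^sub>C \<cdot> i \<cdot> x) \<cdot> j \<cdot> y) 17,
    (\<Pi> i\<in>I\<^sub>F. \<Pi> x\<in>X\<^sub>F \<cdot> i. \<Pi> j\<in>I\<^sub>F. \<Pi> y\<in>X\<^sub>F \<cdot> j. m\<^sub>C \<cdot> (q\<^sub>C \<cdot> i \<cdot> x) \<cdot> j \<cdot> y \<rightarrow> Below i x j y) 16,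
    (\<Pi> z\<in>Z\<^sub>C. \<Pi> K\<in>\<U> v. isProp K \<rightarrow> (\<Pi> i\<in>I\<^sub>F. \<Pi> x\<in>X\<^sub>F \<cdot> i. q\<^sub>C \<cdot> i \<cdot> x =\<^bsub>Z\<^sub>C\<^esub> z \<rightarrow> K) \<rightarrow> K) 15,
    (\<Pi> z\<in>Z\<^sub>C. \<Pi> j\<in>I\<^sub>F. \<Pi> y\<in>X\<^sub>F \<cdot> j. isProp (m\<^sub>C \<cdot> z \<cdot> j \<cdot> y)) 14,
    (Z\<^sub>C \<rightarrow> (\<Pi> j\<in>I\<^sub>F. X\<^sub>F \<cdot> j \<rightarrow> \<U> v)) 13,
    (\<Pi> i\<in>I\<^sub>F. X\<^sub>F \<cdot> i \<rightarrow> Z\<^sub>C) 12,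
    (\<U> v) 11] @ Bis_ctx"

lemma Cls_ctx_ok: "\<langle>\<A>\<rangle> \<turnstile> Cls_ctx"
  unfolding Cls_ctx_def
  by (rule ctx_okD[OF Bis_ctx_ok, where n = full])
    (simp only: expr_eval, simp only: check_eval cong: check_cong)

definition [expr_eval]: "m_elim_T = (\<Pi> i\<in>I\<^sub>F. \<Pi> x\<in>X\<^sub>F \<cdot> i. \<Pi> j\<in>I\<^sub>F. \<Pi> y\<in>X\<^sub>F \<cdot> j. m\<^sub>C \<cdot> (q\<^sub>C \<cdot> i \<cdot> x)
    \<cdot> j \<cdot> y \<rightarrow> (\<Pi> K\<in>\<U> v. isProp K \<rightarrow> (\<Pi> x0\<in>X\<^sub>F \<cdot> i. R\<^sub>F \<cdot> i \<cdot> x0 \<cdot> x \<rightarrow> E\<^sub>E \<cdot> j \<cdot> y \<cdot> i \<cdot> x0 \<rightarrow> K) \<rightarrow>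
    K))"

definition [expr_eval]: "m_elim_p = (\<Lambda> i\<in>I\<^sub>F. \<Lambda> x\<in>X\<^sub>F \<cdot> i. \<Lambda> j\<in>I\<^sub>F. \<Lambda> y\<in>X\<^sub>F \<cdot> j. \<Lambda> p\<in>m\<^sub>C \<cdot> (q\<^sub>C \<cdot> i
    \<cdot> x) \<cdot> j \<cdot> y. \<Lambda> K\<in>\<U> v. \<Lambda> pK\<in>isProp K. \<Lambda> k\<in>(\<Pi> x0\<in>X\<^sub>F \<cdot> i. R\<^sub>F \<cdot> i \<cdot> x0 \<cdot> x \<rightarrow> E\<^sub>E \<cdot> j \<cdot> y \<cdot> i \<cdot> x0
    \<rightarrow> K). eRecTr K pK (\<Lambda> u\<in>(\<Sigma> x0\<in>X\<^sub>F \<cdot> i. R\<^sub>F \<cdot> i \<cdot> x0 \<cdot> x \<otimes> E\<^sub>E \<cdot> j \<cdot> y \<cdot> i \<cdot> x0). sig_elim (X\<^sub>F \<cdot>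
    i) (\<lambda>x0. R\<^sub>F \<cdot> i \<cdot> x0 \<cdot> x \<otimes> E\<^sub>E \<cdot> j \<cdot> y \<cdot> i \<cdot> x0) (\<lambda>u. K) (\<lambda>x0 t. k \<cdot> x0 \<cdot> fst_of (R\<^sub>F \<cdot> i \<cdot> x0
    \<cdot> x) (E\<^sub>E \<cdot> j \<cdot> y \<cdot> i \<cdot> x0) t \<cdot> snd_of (R\<^sub>F \<cdot> i \<cdot> x0 \<cdot> x) (E\<^sub>E \<cdot> j \<cdot> y \<cdot> i \<cdot> x0) t) u) (mElim\<^sub>C
    \<cdot> i \<cdot> x \<cdot> j \<cdot> y \<cdot> p))"

lemma m_elim: "\<langle>\<A>\<rangle> Cls_ctx \<tturnstile> m_elim_T 19"
  by (rule holds_check[OF Cls_ctx_ok list_all_Nil, of full "m_elim_p 19"])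
    (simp only: expr_eval, simp only: check_eval cong: check_cong)

definition [expr_eval]: "m_intro_T = (\<Pi> i\<in>I\<^sub>F. \<Pi> x\<in>X\<^sub>F \<cdot> i. \<Pi> j\<in>I\<^sub>F. \<Pi> y\<in>X\<^sub>F \<cdot> j. \<Pi> x0\<in>X\<^sub>F \<cdot> i. R\<^sub>F
    \<cdot> i \<cdot> x0 \<cdot> x \<rightarrow> E\<^sub>E \<cdot> j \<cdot> y \<cdot> i \<cdot> x0 \<rightarrow> m\<^sub>C \<cdot> (q\<^sub>C \<cdot> i \<cdot> x) \<cdot> j \<cdot> y)"

definition [expr_eval]: "m_intro_p = (\<Lambda> i\<in>I\<^sub>F. \<Lambda> x\<in>X\<^sub>F \<cdot> i. \<Lambda> j\<in>I\<^sub>F. \<Lambda> y\<in>X\<^sub>F \<cdot> j. \<Lambda> x0\<in>X\<^sub>F \<cdot> i. \<Lambda>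
    r\<in>R\<^sub>F \<cdot> i \<cdot> x0 \<cdot> x. \<Lambda> e\<in>E\<^sub>E \<cdot> j \<cdot> y \<cdot> i \<cdot> x0. mIntro\<^sub>C \<cdot> i \<cdot> x \<cdot> j \<cdot> y \<cdot> eTrI (ePair x0 (ePair r
    e)))"

lemma m_intro: "\<langle>\<A>\<rangle> Cls_ctx \<tturnstile> m_intro_T 19"
  by (rule holds_check[OF Cls_ctx_ok list_all_Nil, of full "m_intro_p 19"])
    (simp only: expr_eval, simp only: check_eval cong: check_cong)

definition [expr_eval]: "q_eqI_T = (\<Pi> i\<in>I\<^sub>F. \<Pi> x\<in>X\<^sub>F \<cdot> i. \<Pi> j\<in>I\<^sub>F. \<Pi> y\<in>X\<^sub>F \<cdot> j. E\<^sub>E \<cdot> i \<cdot> x \<cdot> j \<cdot> y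
    \<rightarrow> q\<^sub>C \<cdot> i \<cdot> x =\<^bsub>Z\<^sub>C\<^esub> q\<^sub>C \<cdot> j \<cdot> y)"

lemma Cls_weaken_Bis: "\<langle>\<A>\<rangle> Bis_ctx \<tturnstile> T \<Longrightarrow> \<langle>\<A>\<rangle> Cls_ctx \<tturnstile> ren (shift 8) T"
  by (rule holds_weaken_by[OF _ Cls_ctx_ok]) (simp_all add: Cls_ctx_def)

text \<open>By \<open>mExt\<^sub>C\<close> it suffices to compare members. A member of the class of
  \<open>x\<close> is related to some \<open>x0\<close> below \<open>x\<close>, hence to a matching
  \<open>y0\<close> below \<open>y\<close>.\<close>

definition [expr_eval]: "q_eqI_p m_elim m_intro E_sym E_trans = (\<Lambda> i\<in>I\<^sub>F. \<Lambda> x\<in>X\<^sub>F \<cdot> i. \<Lambda> j\<in>I\<^sub>F. \<Lambda>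
    y\<in>X\<^sub>F \<cdot> j. \<Lambda> e\<in>E\<^sub>E \<cdot> i \<cdot> x \<cdot> j \<cdot> y. mExt\<^sub>C \<cdot> (q\<^sub>C \<cdot> i \<cdot> x) \<cdot> (q\<^sub>C \<cdot> j \<cdot> y) \<cdot> (\<Lambda> k\<in>I\<^sub>F. \<Lambda> w\<in>X\<^sub>F \<cdot>
    k. \<Lambda> p\<in>m\<^sub>C \<cdot> (q\<^sub>C \<cdot> i \<cdot> x) \<cdot> k \<cdot> w. m_elim \<cdot> i \<cdot> x \<cdot> k \<cdot> w \<cdot> p \<cdot> (m\<^sub>C \<cdot> (q\<^sub>C \<cdot> j \<cdot> y) \<cdot> k \<cdot> w) \<cdot>
    (mProp\<^sub>C \<cdot> (q\<^sub>C \<cdot> j \<cdot> y) \<cdot> k \<cdot> w) \<cdot> (\<Lambda> x0\<in>X\<^sub>F \<cdot> i. \<Lambda> r\<in>R\<^sub>F \<cdot> i \<cdot> x0 \<cdot> x. \<Lambda> d\<in>E\<^sub>E \<cdot> k \<cdot> w \<cdot> i \<cdot>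
    x0. forth\<^sub>E \<cdot> i \<cdot> x \<cdot> j \<cdot> y \<cdot> e \<cdot> x0 \<cdot> r \<cdot> (m\<^sub>C \<cdot> (q\<^sub>C \<cdot> j \<cdot> y) \<cdot> k \<cdot> w) \<cdot> (mProp\<^sub>C \<cdot> (q\<^sub>C \<cdot> j \<cdot>
    y) \<cdot> k \<cdot> w) \<cdot> (\<Lambda> y0\<in>X\<^sub>F \<cdot> j. \<Lambda> s\<in>R\<^sub>F \<cdot> j \<cdot> y0 \<cdot> y. \<Lambda> f\<in>E\<^sub>E \<cdot> i \<cdot> x0 \<cdot> j \<cdot> y0. m_intro \<cdot> j \<cdot> y \<cdot>
    k \<cdot> w \<cdot> y0 \<cdot> s \<cdot> (E_trans \<cdot> k \<cdot> w \<cdot> i \<cdot> x0 \<cdot> j \<cdot> y0 \<cdot> d \<cdot> f)))) \<cdot> (\<Lambda> k\<in>I\<^sub>F. \<Lambda> w\<in>X\<^sub>F \<cdot> k. \<Lambda> p\<in>m\<^sub>C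
    \<cdot> (q\<^sub>C \<cdot> j \<cdot> y) \<cdot> k \<cdot> w. m_elim \<cdot> j \<cdot> y \<cdot> k \<cdot> w \<cdot> p \<cdot> (m\<^sub>C \<cdot> (q\<^sub>C \<cdot> i \<cdot> x) \<cdot> k \<cdot> w) \<cdot> (mProp\<^sub>C \<cdot>
    (q\<^sub>C \<cdot> i \<cdot> x) \<cdot> k \<cdot> w) \<cdot> (\<Lambda> y0\<in>X\<^sub>F \<cdot> j. \<Lambda> s\<in>R\<^sub>F \<cdot> j \<cdot> y0 \<cdot> y. \<Lambda> d\<in>E\<^sub>E \<cdot> k \<cdot> w \<cdot> j \<cdot> y0. back\<^sub>E \<cdot>
    i \<cdot> x \<cdot> j \<cdot> y \<cdot> e \<cdot> y0 \<cdot> s \<cdot> (m\<^sub>C \<cdot> (q\<^sub>C \<cdot> i \<cdot> x) \<cdot> k \<cdot> w) \<cdot> (mProp\<^sub>C \<cdot> (q\<^sub>C \<cdot> i \<cdot> x) \<cdot> k \<cdot> w) \<cdot>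
    (\<Lambda> x0\<in>X\<^sub>F \<cdot> i. \<Lambda> r\<in>R\<^sub>F \<cdot> i \<cdot> x0 \<cdot> x. \<Lambda> f\<in>E\<^sub>E \<cdot> i \<cdot> x0 \<cdot> j \<cdot> y0. m_intro \<cdot> i \<cdot> x \<cdot> k \<cdot> w \<cdot> x0 \<cdot> r
    \<cdot> (E_trans \<cdot> k \<cdot> w \<cdot> j \<cdot> y0 \<cdot> i \<cdot> x0 \<cdot> d \<cdot> (E_sym \<cdot> i \<cdot> x0 \<cdot> j \<cdot> y0 \<cdot> f))))))"

lemma q_eqI: "\<langle>\<A>\<rangle> Cls_ctx \<tturnstile> q_eqI_T 19"
  by (rule holds_check[OF Cls_ctx_ok list_all_ConsI[OF m_elim list_all_ConsI[OF m_intro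
    list_all_ConsI[OF Cls_weaken_Bis[OF E_sym] list_all_ConsI[OF Cls_weaken_Bis[OF E_trans]
    list_all_Nil]]]], of full "q_eqI_p (bound 19) (bound 20) (bound 21) (bound 22) 23"])
    (simp only: expr_eval, simp only: check_eval cong: check_cong)

definition [expr_eval]: "q_eqD_T = (\<Pi> i\<in>I\<^sub>F. \<Pi> x\<in>X\<^sub>F \<cdot> i. \<Pi> j\<in>I\<^sub>F. \<Pi> y\<in>X\<^sub>F \<cdot> j. q\<^sub>C \<cdot> i \<cdot> x =\<^bsub>Z\<^sub>C\<^esub>
    q\<^sub>C \<cdot> j \<cdot> y \<rightarrow> E\<^sub>E \<cdot> i \<cdot> x \<cdot> j \<cdot> y)"

text \<open>By reflexivity a predecessor \<open>x0\<close> of \<open>x\<close> is a member of the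
  class of \<open>x\<close>, hence of that of \<open>y\<close>, so it is related to a predecessor of
  \<open>y\<close>. This is the forth condition; the back condition uses the inverse path.\<close>

definition [expr_eval]: "q_eqD_p m_elim m_intro E_refl E_sym = (\<Lambda> i\<in>I\<^sub>F. \<Lambda> x\<in>X\<^sub>F \<cdot> i. \<Lambda> j\<in>I\<^sub>F. \<Lambda>
    y\<in>X\<^sub>F \<cdot> j. \<Lambda> e\<in>q\<^sub>C \<cdot> i \<cdot> x =\<^bsub>Z\<^sub>C\<^esub> q\<^sub>C \<cdot> j \<cdot> y. mkE\<^sub>E \<cdot> i \<cdot> x \<cdot> j \<cdot> y \<cdot> (\<Lambda> x0\<in>X\<^sub>F \<cdot> i. \<Lambda> r\<in>R\<^sub>F \<cdot>
    i \<cdot> x0 \<cdot> x. \<Lambda> K\<in>\<U> v. \<Lambda> pK\<in>isProp K. \<Lambda> k\<in>(\<Pi> y0\<in>X\<^sub>F \<cdot> j. R\<^sub>F \<cdot> j \<cdot> y0 \<cdot> y \<rightarrow> E\<^sub>E \<cdot> i \<cdot> x0 \<cdot> j \<cdot> y0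
    \<rightarrow> K). m_elim \<cdot> j \<cdot> y \<cdot> i \<cdot> x0 \<cdot> transport Z\<^sub>C (q\<^sub>C \<cdot> i \<cdot> x) (\<lambda>z. m\<^sub>C \<cdot> z \<cdot> i \<cdot> x0) (m_intro \<cdot> i
    \<cdot> x \<cdot> i \<cdot> x0 \<cdot> x0 \<cdot> r \<cdot> (E_refl \<cdot> i \<cdot> x0)) (q\<^sub>C \<cdot> j \<cdot> y) e \<cdot> K \<cdot> pK \<cdot> k) \<cdot> (\<Lambda> y0\<in>X\<^sub>F \<cdot> j. \<Lambda>
    s\<in>R\<^sub>F \<cdot> j \<cdot> y0 \<cdot> y. \<Lambda> K\<in>\<U> v. \<Lambda> pK\<in>isProp K. \<Lambda> k\<in>(\<Pi> x0\<in>X\<^sub>F \<cdot> i. R\<^sub>F \<cdot> i \<cdot> x0 \<cdot> x \<rightarrow> E\<^sub>E \<cdot> i \<cdot> x0 \<cdot>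
    j \<cdot> y0 \<rightarrow> K). m_elim \<cdot> i \<cdot> x \<cdot> j \<cdot> y0 \<cdot> transport Z\<^sub>C (q\<^sub>C \<cdot> j \<cdot> y) (\<lambda>z. m\<^sub>C \<cdot> z \<cdot> j \<cdot> y0)
    (m_intro \<cdot> j \<cdot> y \<cdot> j \<cdot> y0 \<cdot> y0 \<cdot> s \<cdot> (E_refl \<cdot> j \<cdot> y0)) (q\<^sub>C \<cdot> i \<cdot> x) (inv_path Z\<^sub>C (q\<^sub>C \<cdot> i \<cdot>
    x) (q\<^sub>C \<cdot> j \<cdot> y) e) \<cdot> K \<cdot> pK \<cdot> (\<Lambda> x0\<in>X\<^sub>F \<cdot> i. \<Lambda> r\<in>R\<^sub>F \<cdot> i \<cdot> x0 \<cdot> x. \<Lambda> d\<in>E\<^sub>E \<cdot> j \<cdot> y0 \<cdot> i \<cdot> x0. k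
    \<cdot> x0 \<cdot> r \<cdot> (E_sym \<cdot> j \<cdot> y0 \<cdot> i \<cdot> x0 \<cdot> d))))"

lemma q_eqD: "\<langle>\<A>\<rangle> Cls_ctx \<tturnstile> q_eqD_T 19"
  by (rule holds_check[OF Cls_ctx_ok list_all_ConsI[OF m_elim list_all_ConsI[OF m_intro
    list_all_ConsI[OF Cls_weaken_Bis[OF E_refl] list_all_ConsI[OF Cls_weaken_Bis[OF E_sym]
    list_all_Nil]]]], of full "q_eqD_p (bound 19) (bound 20) (bound 21) (bound 22) 23"])
    (simp only: expr_eval, simp only: check_eval cong: check_cong)

definition [expr_eval]: "m_resp_T = (\<Pi> i\<in>I\<^sub>F. \<Pi> x\<in>X\<^sub>F \<cdot> i. \<Pi> j\<in>I\<^sub>F. \<Pi> y\<in>X\<^sub>F \<cdot> j. \<Pi> z\<in>Z\<^sub>C. q\<^sub>C \<cdot> i \<cdot>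
    x =\<^bsub>Z\<^sub>C\<^esub> q\<^sub>C \<cdot> j \<cdot> y \<rightarrow> m\<^sub>C \<cdot> z \<cdot> i \<cdot> x \<rightarrow> m\<^sub>C \<cdot> z \<cdot> j \<cdot> y)"

text \<open>Surjectivity replaces \<open>z\<close> by the class of some \<open>w\<close>, where
  membership is visible as a relation to a predecessor of \<open>w\<close> and transitivity
  applies.\<close>

definition [expr_eval]: "m_resp_p m_elim m_intro q_eqD E_trans = (\<Lambda> i\<in>I\<^sub>F. \<Lambda> x\<in>X\<^sub>F \<cdot> i. \<Lambda> j\<in>I\<^sub>F. \<Lambda>
    y\<in>X\<^sub>F \<cdot> j. \<Lambda> z\<in>Z\<^sub>C. \<Lambda> e\<in>q\<^sub>C \<cdot> i \<cdot> x =\<^bsub>Z\<^sub>C\<^esub> q\<^sub>C \<cdot> j \<cdot> y. \<Lambda> p\<in>m\<^sub>C \<cdot> z \<cdot> i \<cdot> x. qSurj\<^sub>C \<cdot> z \<cdot> (m\<^sub>C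
    \<cdot> z \<cdot> j \<cdot> y) \<cdot> (mProp\<^sub>C \<cdot> z \<cdot> j \<cdot> y) \<cdot> (\<Lambda> k\<in>I\<^sub>F. \<Lambda> w\<in>X\<^sub>F \<cdot> k. \<Lambda> f\<in>q\<^sub>C \<cdot> k \<cdot> w =\<^bsub>Z\<^sub>C\<^esub> z. m_elim \<cdot>
    k \<cdot> w \<cdot> i \<cdot> x \<cdot> transport Z\<^sub>C z (\<lambda>z. m\<^sub>C \<cdot> z \<cdot> i \<cdot> x) p (q\<^sub>C \<cdot> k \<cdot> w) (inv_path Z\<^sub>C (q\<^sub>C \<cdot> k \<cdot>
    w) z f) \<cdot> (m\<^sub>C \<cdot> z \<cdot> j \<cdot> y) \<cdot> (mProp\<^sub>C \<cdot> z \<cdot> j \<cdot> y) \<cdot> (\<Lambda> w0\<in>X\<^sub>F \<cdot> k. \<Lambda> t\<in>R\<^sub>F \<cdot> k \<cdot> w0 \<cdot> w. \<Lambda>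
    d\<in>E\<^sub>E \<cdot> i \<cdot> x \<cdot> k \<cdot> w0. transport Z\<^sub>C (q\<^sub>C \<cdot> k \<cdot> w) (\<lambda>z. m\<^sub>C \<cdot> z \<cdot> j \<cdot> y) (m_intro \<cdot> k \<cdot> w \<cdot> j \<cdot>
    y \<cdot> w0 \<cdot> t \<cdot> (E_trans \<cdot> j \<cdot> y \<cdot> i \<cdot> x \<cdot> k \<cdot> w0 \<cdot> (q_eqD \<cdot> j \<cdot> y \<cdot> i \<cdot> x \<cdot> inv_path Z\<^sub>C (q\<^sub>C \<cdot> i
    \<cdot> x) (q\<^sub>C \<cdot> j \<cdot> y) e) \<cdot> d)) z f)))"

lemma m_resp: "\<langle>\<A>\<rangle> Cls_ctx \<tturnstile> m_resp_T 19"
  by (rule holds_check[OF Cls_ctx_ok list_all_ConsI[OF m_elim list_all_ConsI[OF m_intro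
    list_all_ConsI[OF q_eqD list_all_ConsI[OF Cls_weaken_Bis[OF E_trans] list_all_Nil]]]], of full
    "m_resp_p (bound 19) (bound 20) (bound 21) (bound 22) 23"])
    (simp only: expr_eval, simp only: check_eval cong: check_cong)

text \<open>The order on classes: some representative of \<open>z\<close> is a member of
  \<open>w\<close>. The truncation makes it a proposition although one class may be represented in
  several members of the family.\<close>

definition [expr_eval]: "Low z w = \<parallel>\<Sigma> i\<in>I\<^sub>F. \<Sigma> x\<in>X\<^sub>F \<cdot> i. q\<^sub>C \<cdot> i \<cdot> x =\<^bsub>Z\<^sub>C\<^esub> z \<otimes> m\<^sub>C \<cdot> w \<cdot> i \<cdot> x\<parallel>"

definition [expr_eval]: "LowE z w K pK k u = eRecTr K pK (\<Lambda> u\<in>(\<Sigma> i\<in>I\<^sub>F. \<Sigma> x\<in>X\<^sub>F \<cdot> i. q\<^sub>C \<cdot> i \<cdot> x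
    =\<^bsub>Z\<^sub>C\<^esub> z \<otimes> m\<^sub>C \<cdot> w \<cdot> i \<cdot> x). sig_elim I\<^sub>F (\<lambda>i. \<Sigma> x\<in>X\<^sub>F \<cdot> i. q\<^sub>C \<cdot> i \<cdot> x =\<^bsub>Z\<^sub>C\<^esub> z \<otimes> m\<^sub>C \<cdot> w \<cdot> i \<cdot>
    x) (\<lambda>u. K) (\<lambda>i u. sig_elim (X\<^sub>F \<cdot> i) (\<lambda>x. q\<^sub>C \<cdot> i \<cdot> x =\<^bsub>Z\<^sub>C\<^esub> z \<otimes> m\<^sub>C \<cdot> w \<cdot> i \<cdot> x) (\<lambda>u. K) (\<lambda>x p.
    sig_elim (q\<^sub>C \<cdot> i \<cdot> x =\<^bsub>Z\<^sub>C\<^esub> z) (\<lambda>e. m\<^sub>C \<cdot> w \<cdot> i \<cdot> x) (\<lambda>u. K) (\<lambda>e p. k i x e p) p) u) u) u"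

definition [expr_eval]: "Low_mono_T = (\<Pi> i\<in>I\<^sub>F. \<Pi> x\<in>X\<^sub>F \<cdot> i. \<Pi> x0\<in>X\<^sub>F \<cdot> i. R\<^sub>F \<cdot> i \<cdot> x0 \<cdot> x \<rightarrow> Low
    (q\<^sub>C \<cdot> i \<cdot> x0) (q\<^sub>C \<cdot> i \<cdot> x))"

definition [expr_eval]: "Low_mono_p m_intro E_refl = (\<Lambda> i\<in>I\<^sub>F. \<Lambda> x\<in>X\<^sub>F \<cdot> i. \<Lambda> x0\<in>X\<^sub>F \<cdot> i. \<Lambda> r\<in>R\<^sub>F \<cdot>
    i \<cdot> x0 \<cdot> x. eTrI (ePair i (ePair x0 (ePair (eRefl (q\<^sub>C \<cdot> i \<cdot> x0)) (m_intro \<cdot> i \<cdot> x \<cdot> i \<cdot> x0 \<cdot> x0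
    \<cdot> r \<cdot> (E_refl \<cdot> i \<cdot> x0))))))"

lemma Low_mono: "\<langle>\<A>\<rangle> Cls_ctx \<tturnstile> Low_mono_T 19"
  by (rule holds_check[OF Cls_ctx_ok list_all_ConsI[OF m_intro list_all_ConsI[OF Cls_weaken_Bis[OF
    E_refl] list_all_Nil]], of full "Low_mono_p (bound 19) (bound 20) 21"])
    (simp only: expr_eval, simp only: check_eval cong: check_cong)

definition [expr_eval]: "Low_elim_T = (\<Pi> z\<in>Z\<^sub>C. \<Pi> i\<in>I\<^sub>F. \<Pi> x\<in>X\<^sub>F \<cdot> i. Low z (q\<^sub>C \<cdot> i \<cdot> x) \<rightarrow> (\<Pi> K\<in>\<U>
    v. isProp K \<rightarrow> (\<Pi> x0\<in>X\<^sub>F \<cdot> i. R\<^sub>F \<cdot> i \<cdot> x0 \<cdot> x \<rightarrow> q\<^sub>C \<cdot> i \<cdot> x0 =\<^bsub>Z\<^sub>C\<^esub> z \<rightarrow> K) \<rightarrow> K))"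

text \<open>Whatever representative witnesses that \<open>z\<close> is below the class of
  \<open>x\<close>, it is related to a predecessor of \<open>x\<close> in the same ordinal. So each
  \<open>q\<^sub>C \<cdot> i\<close> covers an initial segment, which is the source of the lifting
  property.\<close>

definition [expr_eval]: "Low_elim_p m_elim q_eqI E_sym = (\<Lambda> z\<in>Z\<^sub>C. \<Lambda> i\<in>I\<^sub>F. \<Lambda> x\<in>X\<^sub>F \<cdot> i. \<Lambda> u\<in>Low z
    (q\<^sub>C \<cdot> i \<cdot> x). \<Lambda> K\<in>\<U> v. \<Lambda> pK\<in>isProp K. \<Lambda> k\<in>(\<Pi> x0\<in>X\<^sub>F \<cdot> i. R\<^sub>F \<cdot> i \<cdot> x0 \<cdot> x \<rightarrow> q\<^sub>C \<cdot> i \<cdot> x0 =\<^bsub>Z\<^sub>C\<^esub>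
    z \<rightarrow> K). LowE z (q\<^sub>C \<cdot> i \<cdot> x) K pK (\<lambda>j y e p. m_elim \<cdot> i \<cdot> x \<cdot> j \<cdot> y \<cdot> p \<cdot> K \<cdot> pK \<cdot> (\<Lambda> x0\<in>X\<^sub>F \<cdot>
    i. \<Lambda> r\<in>R\<^sub>F \<cdot> i \<cdot> x0 \<cdot> x. \<Lambda> d\<in>E\<^sub>E \<cdot> j \<cdot> y \<cdot> i \<cdot> x0. k \<cdot> x0 \<cdot> r \<cdot> comp_path Z\<^sub>C (q\<^sub>C \<cdot> i \<cdot> x0)
    (q\<^sub>C \<cdot> j \<cdot> y) z (q_eqI \<cdot> i \<cdot> x0 \<cdot> j \<cdot> y \<cdot> (E_sym \<cdot> j \<cdot> y \<cdot> i \<cdot> x0 \<cdot> d)) e)) u)"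

lemma Low_elim: "\<langle>\<A>\<rangle> Cls_ctx \<tturnstile> Low_elim_T 19"
  by (rule holds_check[OF Cls_ctx_ok list_all_ConsI[OF m_elim list_all_ConsI[OF q_eqI
    list_all_ConsI[OF Cls_weaken_Bis[OF E_sym] list_all_Nil]]], of full "Low_elim_p (bound 19)
    (bound 20) (bound 21) 22"]) (simp only: expr_eval, simp only: check_eval cong: check_cong)

definition [expr_eval]: "Low_mem_T = (\<Pi> z\<in>Z\<^sub>C. \<Pi> i\<in>I\<^sub>F. \<Pi> x\<in>X\<^sub>F \<cdot> i. Low (q\<^sub>C \<cdot> i \<cdot> x) z \<rightarrow> m\<^sub>C \<cdot> z \<cdot>
    i \<cdot> x)"

definition [expr_eval]: "Low_mem_p m_resp = (\<Lambda> z\<in>Z\<^sub>C. \<Lambda> i\<in>I\<^sub>F. \<Lambda> x\<in>X\<^sub>F \<cdot> i. \<Lambda> u\<in>Low (q\<^sub>C \<cdot> i \<cdot> x) z.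
    LowE (q\<^sub>C \<cdot> i \<cdot> x) z (m\<^sub>C \<cdot> z \<cdot> i \<cdot> x) (mProp\<^sub>C \<cdot> z \<cdot> i \<cdot> x) (\<lambda>j y e p. m_resp \<cdot> j \<cdot> y \<cdot> i \<cdot> x \<cdot>
    z \<cdot> e \<cdot> p) u)"

lemma Low_mem: "\<langle>\<A>\<rangle> Cls_ctx \<tturnstile> Low_mem_T 19"
  by (rule holds_check[OF Cls_ctx_ok list_all_ConsI[OF m_resp list_all_Nil], of full "Low_mem_p
    (bound 19) 20"]) (simp only: expr_eval, simp only: check_eval cong: check_cong)

definition [expr_eval]: "Low_ext_T = (\<Pi> z\<in>Z\<^sub>C. \<Pi> w\<in>Z\<^sub>C. (\<Pi> u\<in>Z\<^sub>C. (Low u z \<rightarrow> Low u w) \<otimes> (Low u w \<rightarrow>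
    Low u z)) \<rightarrow> z =\<^bsub>Z\<^sub>C\<^esub> w)"

text \<open>A point is a member of \<open>z\<close> exactly when its class is below
  \<open>z\<close>; so members are recovered by using the hypothesis at
  \<open>u = q\<^sub>C \<cdot> j \<cdot> y\<close>.\<close>

definition [expr_eval]: "Low_ext_p Low_mem = (\<Lambda> z\<in>Z\<^sub>C. \<Lambda> w\<in>Z\<^sub>C. \<Lambda> e\<in>(\<Pi> u\<in>Z\<^sub>C. (Low u z \<rightarrow> Low u w) \<otimes>
    (Low u w \<rightarrow> Low u z)). mExt\<^sub>C \<cdot> z \<cdot> w \<cdot> (\<Lambda> j\<in>I\<^sub>F. \<Lambda> y\<in>X\<^sub>F \<cdot> j. \<Lambda> p\<in>m\<^sub>C \<cdot> z \<cdot> j \<cdot> y. Low_mem \<cdot> w \<cdot>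
    j \<cdot> y \<cdot> (fst_of (Low (q\<^sub>C \<cdot> j \<cdot> y) z \<rightarrow> Low (q\<^sub>C \<cdot> j \<cdot> y) w) (Low (q\<^sub>C \<cdot> j \<cdot> y) w \<rightarrow> Low (q\<^sub>C \<cdot> j
    \<cdot> y) z) (e \<cdot> (q\<^sub>C \<cdot> j \<cdot> y)) \<cdot> eTrI (ePair j (ePair y (ePair (eRefl (q\<^sub>C \<cdot> j \<cdot> y)) p))))) \<cdot> (\<Lambda>
    j\<in>I\<^sub>F. \<Lambda> y\<in>X\<^sub>F \<cdot> j. \<Lambda> p\<in>m\<^sub>C \<cdot> w \<cdot> j \<cdot> y. Low_mem \<cdot> z \<cdot> j \<cdot> y \<cdot> (snd_of (Low (q\<^sub>C \<cdot> j \<cdot> y) z \<rightarrow>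
    Low (q\<^sub>C \<cdot> j \<cdot> y) w) (Low (q\<^sub>C \<cdot> j \<cdot> y) w \<rightarrow> Low (q\<^sub>C \<cdot> j \<cdot> y) z) (e \<cdot> (q\<^sub>C \<cdot> j \<cdot> y)) \<cdot> eTrI
    (ePair j (ePair y (ePair (eRefl (q\<^sub>C \<cdot> j \<cdot> y)) p))))))"

lemma Low_ext: "\<langle>\<A>\<rangle> Cls_ctx \<tturnstile> Low_ext_T 19"
  by (rule holds_check[OF Cls_ctx_ok list_all_ConsI[OF Low_mem list_all_Nil], of full "Low_ext_p
    (bound 19) 20"]) (simp only: expr_eval, simp only: check_eval cong: check_cong)

definition [expr_eval]: "q_inj_T = (\<Pi> i\<in>I\<^sub>F. \<Pi> x\<in>X\<^sub>F \<cdot> i. \<Pi> y\<in>X\<^sub>F \<cdot> i. q\<^sub>C \<cdot> i \<cdot> x =\<^bsub>Z\<^sub>C\<^esub> q\<^sub>C \<cdot> i \<cdot>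
    y \<rightarrow> x =\<^bsub>X\<^sub>F \<cdot> i\<^esub> y)"

definition [expr_eval]: "q_inj_p q_eqD E_inj = (\<Lambda> i\<in>I\<^sub>F. \<Lambda> x\<in>X\<^sub>F \<cdot> i. \<Lambda> y\<in>X\<^sub>F \<cdot> i. \<Lambda> e\<in>q\<^sub>C \<cdot> i \<cdot> x
    =\<^bsub>Z\<^sub>C\<^esub> q\<^sub>C \<cdot> i \<cdot> y. E_inj \<cdot> i \<cdot> x \<cdot> y \<cdot> (q_eqD \<cdot> i \<cdot> x \<cdot> i \<cdot> y \<cdot> e))"

lemma q_inj: "\<langle>\<A>\<rangle> Cls_ctx \<tturnstile> q_inj_T 19"
  by (rule holds_check[OF Cls_ctx_ok list_all_ConsI[OF q_eqD list_all_ConsI[OF Cls_weaken_Bis[OF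
    E_inj] list_all_Nil]], of full "q_inj_p (bound 19) (bound 20) 21"])
    (simp only: expr_eval, simp only: check_eval cong: check_cong)

text \<open>The four notions from here on, with propositionality and extensionality of the order,
  are the interface between the quotient and the rest of the argument: a carrier \<open>W\<close>,
  an order \<open>lt\<close>, and maps \<open>c\<close> that are jointly surjective and separately
  injective.\<close>

definition [expr_eval]: "LtElim W lt c = (\<Pi> z\<in>W. \<Pi> i\<in>I\<^sub>F. \<Pi> x\<in>X\<^sub>F \<cdot> i. lt \<cdot> z \<cdot> (c \<cdot> i \<cdot> x) \<rightarrow> (\<Pi> K\<in>\<U>
    v. isProp K \<rightarrow> (\<Pi> x0\<in>X\<^sub>F \<cdot> i. R\<^sub>F \<cdot> i \<cdot> x0 \<cdot> x \<rightarrow> c \<cdot> i \<cdot> x0 =\<^bsub>W\<^esub> z \<rightarrow> K) \<rightarrow> K))"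

definition [expr_eval]: "LtMono W lt c = (\<Pi> i\<in>I\<^sub>F. \<Pi> x\<in>X\<^sub>F \<cdot> i. \<Pi> x0\<in>X\<^sub>F \<cdot> i. R\<^sub>F \<cdot> i \<cdot> x0 \<cdot> x \<rightarrow> lt
    \<cdot> (c \<cdot> i \<cdot> x0) \<cdot> (c \<cdot> i \<cdot> x))"

definition [expr_eval]: "ClInj W c = (\<Pi> i\<in>I\<^sub>F. \<Pi> x\<in>X\<^sub>F \<cdot> i. \<Pi> y\<in>X\<^sub>F \<cdot> i. c \<cdot> i \<cdot> x =\<^bsub>W\<^esub> c \<cdot> i \<cdot> y \<rightarrow>
    x =\<^bsub>X\<^sub>F \<cdot> i\<^esub> y)"

definition [expr_eval]: "ClSurj W c = (\<Pi> z\<in>W. \<Pi> K\<in>\<U> v. isProp K \<rightarrow> (\<Pi> i\<in>I\<^sub>F. \<Pi> x\<in>X\<^sub>F \<cdot> i. c \<cdot> i \<cdot> x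
    =\<^bsub>W\<^esub> z \<rightarrow> K) \<rightarrow> K)"

section \<open>The least upper bound\<close>

abbreviation "W\<^sub>S \<equiv> bound 7"
abbreviation "lt\<^sub>S \<equiv> bound 8"
abbreviation "c\<^sub>S \<equiv> bound 9"
abbreviation "ltp\<^sub>S \<equiv> bound 10"
abbreviation "ltm\<^sub>S \<equiv> bound 11"
abbreviation "lte\<^sub>S \<equiv> bound 12"
abbreviation "ltx\<^sub>S \<equiv> bound 13"
abbreviation "cin\<^sub>S \<equiv> bound 14"
abbreviation "csu\<^sub>S \<equiv> bound 15"

definition Sup_ctx :: "tm list" where [expr_eval]: "Sup_ctx = [
    (ClSurj W\<^sub>S c\<^sub>S) 15,
    (ClInj W\<^sub>S c\<^sub>S) 14,
    (extensional W\<^sub>S lt\<^sub>S) 13,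
    (LtElim W\<^sub>S lt\<^sub>S c\<^sub>S) 12,
    (LtMono W\<^sub>S lt\<^sub>S c\<^sub>S) 11,
    (prop_valued W\<^sub>S lt\<^sub>S) 10,
    (\<Pi> i\<in>I\<^sub>F. X\<^sub>F \<cdot> i \<rightarrow> W\<^sub>S) 9,
    (W\<^sub>S \<rightarrow> W\<^sub>S \<rightarrow> \<U> v) 8,
    (\<U> v) 7] @ Fam_ctx"

lemma Sup_ctx_ok: "\<langle>\<A>\<rangle> \<turnstile> Sup_ctx"
  unfolding Sup_ctx_def
  by (rule ctx_okD[OF Fam_ctx_ok, where n = full])
    (simp only: expr_eval, simp only: check_eval cong: check_cong)

definition [expr_eval]: "lt_transitive_T = transitive W\<^sub>S lt\<^sub>S"

text \<open>Everything is pulled back into one ordinal that represents the largest point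
  \<open>u\<close>: \<open>lte\<^sub>S\<close> finds representatives of \<open>w\<close> and then of
  \<open>z\<close> below it, and \<open>tr\<^sub>F\<close> applies there.\<close>

definition [expr_eval]: "lt_transitive_p = (\<Lambda> z\<in>W\<^sub>S. \<Lambda> w\<in>W\<^sub>S. \<Lambda> u\<in>W\<^sub>S. \<Lambda> a\<in>lt\<^sub>S \<cdot> z \<cdot> w. \<Lambda> b\<in>lt\<^sub>S \<cdot>
    w \<cdot> u. csu\<^sub>S \<cdot> u \<cdot> (lt\<^sub>S \<cdot> z \<cdot> u) \<cdot> (ltp\<^sub>S \<cdot> z \<cdot> u) \<cdot> (\<Lambda> i\<in>I\<^sub>F. \<Lambda> x\<in>X\<^sub>F \<cdot> i. \<Lambda> e\<in>c\<^sub>S \<cdot> i \<cdot> x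
    =\<^bsub>W\<^sub>S\<^esub> u. lte\<^sub>S \<cdot> w \<cdot> i \<cdot> x \<cdot> transport W\<^sub>S u (\<lambda>u. lt\<^sub>S \<cdot> w \<cdot> u) b (c\<^sub>S \<cdot> i \<cdot> x) (inv_path W\<^sub>S
    (c\<^sub>S \<cdot> i \<cdot> x) u e) \<cdot> (lt\<^sub>S \<cdot> z \<cdot> u) \<cdot> (ltp\<^sub>S \<cdot> z \<cdot> u) \<cdot> (\<Lambda> x1\<in>X\<^sub>F \<cdot> i. \<Lambda> r\<in>R\<^sub>F \<cdot> i \<cdot> x1 \<cdot> x. \<Lambda>
    f\<in>c\<^sub>S \<cdot> i \<cdot> x1 =\<^bsub>W\<^sub>S\<^esub> w. lte\<^sub>S \<cdot> z \<cdot> i \<cdot> x1 \<cdot> transport W\<^sub>S w (\<lambda>w. lt\<^sub>S \<cdot> z \<cdot> w) a (c\<^sub>S \<cdot> i \<cdot>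
    x1) (inv_path W\<^sub>S (c\<^sub>S \<cdot> i \<cdot> x1) w f) \<cdot> (lt\<^sub>S \<cdot> z \<cdot> u) \<cdot> (ltp\<^sub>S \<cdot> z \<cdot> u) \<cdot> (\<Lambda> x2\<in>X\<^sub>F \<cdot> i. \<Lambda>
    s\<in>R\<^sub>F \<cdot> i \<cdot> x2 \<cdot> x1. \<Lambda> g\<in>c\<^sub>S \<cdot> i \<cdot> x2 =\<^bsub>W\<^sub>S\<^esub> z. transport W\<^sub>S (c\<^sub>S \<cdot> i \<cdot> x) (\<lambda>u. lt\<^sub>S \<cdot> z \<cdot> u)
    (transport W\<^sub>S (c\<^sub>S \<cdot> i \<cdot> x2) (\<lambda>z. lt\<^sub>S \<cdot> z \<cdot> (c\<^sub>S \<cdot> i \<cdot> x)) (ltm\<^sub>S \<cdot> i \<cdot> x \<cdot> x2 \<cdot> (tr\<^sub>F \<cdot> i \<cdot>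
    x2 \<cdot> x1 \<cdot> x \<cdot> s \<cdot> r)) z g) u e))))"

lemma lt_transitive: "\<langle>\<A>\<rangle> Sup_ctx \<tturnstile> lt_transitive_T 16"
  by (rule holds_check[OF Sup_ctx_ok list_all_Nil, of full "lt_transitive_p 16"])
    (simp only: expr_eval, simp only: check_eval cong: check_cong)

definition [expr_eval]: "lt_acc_T = (\<Pi> i\<in>I\<^sub>F. \<Pi> x\<in>X\<^sub>F \<cdot> i. eAcc W\<^sub>S lt\<^sub>S (c\<^sub>S \<cdot> i \<cdot> x))"

text \<open>Every predecessor of \<open>c\<^sub>S \<cdot> i \<cdot> x\<close> is the image of a
  predecessor of \<open>x\<close>, so accessibility is inherited by induction; the elimination is
  legitimate because accessibility is a proposition.\<close>

definition [expr_eval]: "lt_acc_p isProp_Acc = (\<Lambda> i\<in>I\<^sub>F. \<Lambda> x\<in>X\<^sub>F \<cdot> i. wfInd i (\<lambda>x. eAcc W\<^sub>S lt\<^sub>S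
    (c\<^sub>S \<cdot> i \<cdot> x)) (\<lambda>x ih. eAccI (c\<^sub>S \<cdot> i \<cdot> x) (\<Lambda> z\<in>W\<^sub>S. \<Lambda> a\<in>lt\<^sub>S \<cdot> z \<cdot> (c\<^sub>S \<cdot> i \<cdot> x). lte\<^sub>S \<cdot> z \<cdot> i
    \<cdot> x \<cdot> a \<cdot> eAcc W\<^sub>S lt\<^sub>S z \<cdot> (isProp_Acc \<cdot> W\<^sub>S \<cdot> lt\<^sub>S \<cdot> z) \<cdot> (\<Lambda> x0\<in>X\<^sub>F \<cdot> i. \<Lambda> r\<in>R\<^sub>F \<cdot> i \<cdot> x0 \<cdot> x.
    \<Lambda> e\<in>c\<^sub>S \<cdot> i \<cdot> x0 =\<^bsub>W\<^sub>S\<^esub> z. transport W\<^sub>S (c\<^sub>S \<cdot> i \<cdot> x0) (\<lambda>z. eAcc W\<^sub>S lt\<^sub>S z) (ih \<cdot> x0 \<cdot> r) z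
    e))) x)"

lemma lt_acc: "\<langle>\<A>\<rangle> Sup_ctx \<tturnstile> lt_acc_T 16"
  by (rule holds_check[OF Sup_ctx_ok list_all_ConsI[OF holds_closed[OF isProp_Acc[of v] Sup_ctx_ok]
    list_all_Nil], of full "lt_acc_p (bound 16) 17"])
    (simp only: expr_eval, simp only: check_eval cong: check_cong)

definition [expr_eval]: "lt_well_founded_T = well_founded W\<^sub>S lt\<^sub>S"

definition [expr_eval]: "lt_well_founded_p isProp_Acc lt_acc = (\<Lambda> z\<in>W\<^sub>S. csu\<^sub>S \<cdot> z \<cdot> eAcc W\<^sub>S lt\<^sub>S z
    \<cdot> (isProp_Acc \<cdot> W\<^sub>S \<cdot> lt\<^sub>S \<cdot> z) \<cdot> (\<Lambda> i\<in>I\<^sub>F. \<Lambda> x\<in>X\<^sub>F \<cdot> i. \<Lambda> e\<in>c\<^sub>S \<cdot> i \<cdot> x =\<^bsub>W\<^sub>S\<^esub> z. transport W\<^sub>S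
    (c\<^sub>S \<cdot> i \<cdot> x) (\<lambda>z. eAcc W\<^sub>S lt\<^sub>S z) (lt_acc \<cdot> i \<cdot> x) z e))"

lemma lt_well_founded: "\<langle>\<A>\<rangle> Sup_ctx \<tturnstile> lt_well_founded_T 16"
  by (rule holds_check[OF Sup_ctx_ok list_all_ConsI[OF holds_closed[OF isProp_Acc[of v] Sup_ctx_ok]
    list_all_ConsI[OF lt_acc list_all_Nil]], of full "lt_well_founded_p (bound 16) (bound 17) 18"])
    (simp only: expr_eval, simp only: check_eval cong: check_cong)

definition [expr_eval]: "extensional_isSet_T = (\<Pi> A\<in>\<U> v. \<Pi> S\<in>A \<rightarrow> A \<rightarrow> \<U> v. prop_valued A S \<rightarrow>
    extensional A S \<rightarrow> isSet A)"

text \<open>The code criterion again: \<open>BelowEq\<close> is a reflexive family of propositions,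
  and extensionality is its decoding map.\<close>

definition [expr_eval]: "extensional_isSet_p code_isSet isProp_Pi isProp_Prod = (\<Lambda> A\<in>\<U> v. \<Lambda> S\<in>A \<rightarrow> A
    \<rightarrow> \<U> v. \<Lambda> p\<in>prop_valued A S. \<Lambda> e\<in>extensional A S. code_isSet \<cdot> A \<cdot> (\<Lambda> x\<in>A. \<Lambda> y\<in>A. BelowEq A S x
    y) \<cdot> (\<Lambda> x\<in>A. \<Lambda> y\<in>A. isProp_Pi \<cdot> A \<cdot> (\<Lambda> z\<in>A. (S \<cdot> z \<cdot> x \<rightarrow> S \<cdot> z \<cdot> y) \<otimes> (S \<cdot> z \<cdot> y \<rightarrow> S \<cdot> z \<cdot> x)) \<cdot>
    (\<Lambda> z\<in>A. isProp_Prod \<cdot> (S \<cdot> z \<cdot> x \<rightarrow> S \<cdot> z \<cdot> y) \<cdot> (S \<cdot> z \<cdot> y \<rightarrow> S \<cdot> z \<cdot> x) \<cdot> (isProp_Pi \<cdot> (S \<cdot> z \<cdot>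
    x) \<cdot> (\<Lambda> u\<in>S \<cdot> z \<cdot> x. S \<cdot> z \<cdot> y) \<cdot> (\<Lambda> u\<in>S \<cdot> z \<cdot> x. p \<cdot> z \<cdot> y)) \<cdot> (isProp_Pi \<cdot> (S \<cdot> z \<cdot> y) \<cdot> (\<Lambda>
    u\<in>S \<cdot> z \<cdot> y. S \<cdot> z \<cdot> x) \<cdot> (\<Lambda> u\<in>S \<cdot> z \<cdot> y. p \<cdot> z \<cdot> x)))) \<cdot> (\<Lambda> x\<in>A. \<Lambda> z\<in>A. ePair (\<Lambda> u\<in>S \<cdot> z \<cdot> x.
    u) (\<Lambda> u\<in>S \<cdot> z \<cdot> x. u)) \<cdot> e)"

lemma extensional_isSet: "\<langle>\<A>\<rangle> [] \<tturnstile> extensional_isSet_T 0"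
  by (rule holds_check[OF ctx_Nil list_all_ConsI[OF code_isSet[of v v] list_all_ConsI[OF
    isProp_Pi[of v v] list_all_ConsI[OF isProp_Prod[of v v] list_all_Nil]]], of full
    "extensional_isSet_p (bound 0) (bound 1) (bound 2) 3"])
    (simp only: expr_eval, simp only: check_eval cong: check_cong)

definition [expr_eval]: "lt_is_ordinal_T = is_ordinal W\<^sub>S lt\<^sub>S"

definition [expr_eval]: "lt_is_ordinal_p lt_transitive lt_well_founded = ePair ltp\<^sub>S (ePair
    lt_transitive (ePair ltx\<^sub>S lt_well_founded))"

lemma lt_is_ordinal: "\<langle>\<A>\<rangle> Sup_ctx \<tturnstile> lt_is_ordinal_T 16"
  by (rule holds_check[OF Sup_ctx_ok list_all_ConsI[OF lt_transitive list_all_ConsI[OF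
    lt_well_founded list_all_Nil]], of full "lt_is_ordinal_p (bound 16) (bound 17) 18"])
    (simp only: expr_eval, simp only: check_eval cong: check_cong)

definition [expr_eval]: "upper_bound_T = (\<Pi> i\<in>I\<^sub>F. Sim (X\<^sub>F \<cdot> i) (R\<^sub>F \<cdot> i) W\<^sub>S lt\<^sub>S)"

text \<open>\<open>lte\<^sub>S\<close> yields a lift only under elimination into propositions;
  \<open>cin\<^sub>S\<close> makes the required fibre one.\<close>

definition [expr_eval]: "upper_bound_p isProp_fibre extensional_isSet = (\<Lambda> i\<in>I\<^sub>F. ePair (c\<^sub>S \<cdot> i)
    (ePair (\<Lambda> x\<in>X\<^sub>F \<cdot> i. \<Lambda> x'\<in>X\<^sub>F \<cdot> i. \<Lambda> r\<in>R\<^sub>F \<cdot> i \<cdot> x \<cdot> x'. ltm\<^sub>S \<cdot> i \<cdot> x' \<cdot> x \<cdot> r) (\<Lambda> x\<in>X\<^sub>F \<cdot> i. \<Lambda>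
    y\<in>W\<^sub>S. \<Lambda> a\<in>lt\<^sub>S \<cdot> y \<cdot> (c\<^sub>S \<cdot> i \<cdot> x). lte\<^sub>S \<cdot> y \<cdot> i \<cdot> x \<cdot> a \<cdot> (\<Sigma> x'\<in>X\<^sub>F \<cdot> i. R\<^sub>F \<cdot> i \<cdot> x' \<cdot> x \<otimes>
    c\<^sub>S \<cdot> i \<cdot> x' =\<^bsub>W\<^sub>S\<^esub> y) \<cdot> (isProp_fibre \<cdot> (X\<^sub>F \<cdot> i) \<cdot> W\<^sub>S \<cdot> (\<Lambda> x'\<in>X\<^sub>F \<cdot> i. R\<^sub>F \<cdot> i \<cdot> x' \<cdot> x) \<cdot>
    (c\<^sub>S \<cdot> i) \<cdot> (\<Lambda> x'\<in>X\<^sub>F \<cdot> i. pv\<^sub>F \<cdot> i \<cdot> x' \<cdot> x) \<cdot> (cin\<^sub>S \<cdot> i) \<cdot> (extensional_isSet \<cdot> W\<^sub>S \<cdot> lt\<^sub>S \<cdot>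
    ltp\<^sub>S \<cdot> ltx\<^sub>S) \<cdot> y) \<cdot> (\<Lambda> x0\<in>X\<^sub>F \<cdot> i. \<Lambda> r\<in>R\<^sub>F \<cdot> i \<cdot> x0 \<cdot> x. \<Lambda> e\<in>c\<^sub>S \<cdot> i \<cdot> x0 =\<^bsub>W\<^sub>S\<^esub> y. ePair x0
    (ePair r e)))))"

lemma upper_bound: "\<langle>\<A>\<rangle> Sup_ctx \<tturnstile> upper_bound_T 16"
  by (rule holds_check[OF Sup_ctx_ok list_all_ConsI[OF holds_closed[OF isProp_fibre[of v]
    Sup_ctx_ok] list_all_ConsI[OF holds_closed[OF extensional_isSet Sup_ctx_ok] list_all_Nil]], of
    full "upper_bound_p (bound 16) (bound 17) 18"])
    (simp only: expr_eval, simp only: check_eval cong: check_cong)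

section \<open>The comparison map into an arbitrary upper bound\<close>

abbreviation "B\<^sub>B \<equiv> bound 16"
abbreviation "T\<^sub>B \<equiv> bound 17"
abbreviation "Tp\<^sub>B \<equiv> bound 18"
abbreviation "Tx\<^sub>B \<equiv> bound 19"
abbreviation "g\<^sub>B \<equiv> bound 20"
abbreviation "gm\<^sub>B \<equiv> bound 21"
abbreviation "gl\<^sub>B \<equiv> bound 22"

definition Bound_ctx :: "tm list" where [expr_eval]: "Bound_ctx = [
    (\<Pi> i\<in>I\<^sub>F. Lifts (X\<^sub>F \<cdot> i) (R\<^sub>F \<cdot> i) B\<^sub>B T\<^sub>B (g\<^sub>B \<cdot> i)) 22,
    (\<Pi> i\<in>I\<^sub>F. Preserves (X\<^sub>F \<cdot> i) (R\<^sub>F \<cdot> i) B\<^sub>B T\<^sub>B (g\<^sub>B \<cdot> i)) 21,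
    (\<Pi> i\<in>I\<^sub>F. X\<^sub>F \<cdot> i \<rightarrow> B\<^sub>B) 20,
    (extensional B\<^sub>B T\<^sub>B) 19,
    (prop_valued B\<^sub>B T\<^sub>B) 18,
    (B\<^sub>B \<rightarrow> B\<^sub>B \<rightarrow> \<U> v) 17,
    (\<U> v) 16] @ Sup_ctx"

lemma Bound_ctx_ok: "\<langle>\<A>\<rangle> \<turnstile> Bound_ctx"
  unfolding Bound_ctx_def
  by (rule ctx_okD[OF Sup_ctx_ok, where n = full])
    (simp only: expr_eval, simp only: check_eval cong: check_cong)

definition [expr_eval]: "LiftE i x y K k u = sig_elim (X\<^sub>F \<cdot> i) (\<lambda>x'. R\<^sub>F \<cdot> i \<cdot> x' \<cdot> x \<otimes> g\<^sub>B \<cdot> i \<cdot>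
    x' =\<^bsub>B\<^sub>B\<^esub> y) (\<lambda>u. K) (\<lambda>x' p. sig_elim (R\<^sub>F \<cdot> i \<cdot> x' \<cdot> x) (\<lambda>r. g\<^sub>B \<cdot> i \<cdot> x' =\<^bsub>B\<^sub>B\<^esub> y) (\<lambda>u. K) (\<lambda>r
    e. k x' r e) p) u"

definition [expr_eval]: "g_resp_T = (\<Pi> i\<in>I\<^sub>F. \<Pi> x\<in>X\<^sub>F \<cdot> i. \<Pi> j\<in>I\<^sub>F. \<Pi> y\<in>X\<^sub>F \<cdot> j. c\<^sub>S \<cdot> i \<cdot> x =\<^bsub>W\<^sub>S\<^esub>
    c\<^sub>S \<cdot> j \<cdot> y \<rightarrow> g\<^sub>B \<cdot> i \<cdot> x =\<^bsub>B\<^sub>B\<^esub> g\<^sub>B \<cdot> j \<cdot> y)"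

text \<open>Extensionality of \<open>T\<^sub>B\<close>, by induction on \<open>x\<close>. A point
  \<open>b\<close> below the value at \<open>x\<close> lifts to some \<open>x0\<close> below
  \<open>x\<close>; the class of \<open>x0\<close> is below that of \<open>y\<close>, so it has a
  representative \<open>y0\<close> below \<open>y\<close>. By the induction hypothesis
  \<open>y0\<close> also has the value \<open>b\<close>, which is thus below the value at
  \<open>y\<close>. The other half is symmetric.\<close>

definition [expr_eval]: "g_resp_p = (\<Lambda> i\<in>I\<^sub>F. \<Lambda> x\<in>X\<^sub>F \<cdot> i. wfInd i (\<lambda>x. \<Pi> j\<in>I\<^sub>F. \<Pi> y\<in>X\<^sub>F \<cdot> j. c\<^sub>S \<cdot>
    i \<cdot> x =\<^bsub>W\<^sub>S\<^esub> c\<^sub>S \<cdot> j \<cdot> y \<rightarrow> g\<^sub>B \<cdot> i \<cdot> x =\<^bsub>B\<^sub>B\<^esub> g\<^sub>B \<cdot> j \<cdot> y) (\<lambda>x ih. \<Lambda> j\<in>I\<^sub>F. \<Lambda> y\<in>X\<^sub>F \<cdot> j. \<Lambda> e\<in>c\<^sub>S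
    \<cdot> i \<cdot> x =\<^bsub>W\<^sub>S\<^esub> c\<^sub>S \<cdot> j \<cdot> y. Tx\<^sub>B \<cdot> (g\<^sub>B \<cdot> i \<cdot> x) \<cdot> (g\<^sub>B \<cdot> j \<cdot> y) \<cdot> (\<Lambda> b\<in>B\<^sub>B. ePair (\<Lambda> a\<in>T\<^sub>B \<cdot> b
    \<cdot> (g\<^sub>B \<cdot> i \<cdot> x). LiftE i x b (T\<^sub>B \<cdot> b \<cdot> (g\<^sub>B \<cdot> j \<cdot> y)) (\<lambda>x0 r f. lte\<^sub>S \<cdot> (c\<^sub>S \<cdot> i \<cdot> x0) \<cdot> j \<cdot> y
    \<cdot> transport W\<^sub>S (c\<^sub>S \<cdot> i \<cdot> x) (\<lambda>w. lt\<^sub>S \<cdot> (c\<^sub>S \<cdot> i \<cdot> x0) \<cdot> w) (ltm\<^sub>S \<cdot> i \<cdot> x \<cdot> x0 \<cdot> r) (c\<^sub>S \<cdot> j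
    \<cdot> y) e \<cdot> (T\<^sub>B \<cdot> b \<cdot> (g\<^sub>B \<cdot> j \<cdot> y)) \<cdot> (Tp\<^sub>B \<cdot> b \<cdot> (g\<^sub>B \<cdot> j \<cdot> y)) \<cdot> (\<Lambda> y0\<in>X\<^sub>F \<cdot> j. \<Lambda> s\<in>R\<^sub>F \<cdot> j \<cdot>
    y0 \<cdot> y. \<Lambda> h\<in>c\<^sub>S \<cdot> j \<cdot> y0 =\<^bsub>W\<^sub>S\<^esub> c\<^sub>S \<cdot> i \<cdot> x0. transport B\<^sub>B (g\<^sub>B \<cdot> j \<cdot> y0) (\<lambda>b. T\<^sub>B \<cdot> b \<cdot> (g\<^sub>B \<cdot>
    j \<cdot> y)) (gm\<^sub>B \<cdot> j \<cdot> y0 \<cdot> y \<cdot> s) b (comp_path B\<^sub>B (g\<^sub>B \<cdot> j \<cdot> y0) (g\<^sub>B \<cdot> i \<cdot> x0) b (inv_path B\<^sub>B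
    (g\<^sub>B \<cdot> i \<cdot> x0) (g\<^sub>B \<cdot> j \<cdot> y0) (ih \<cdot> x0 \<cdot> r \<cdot> j \<cdot> y0 \<cdot> inv_path W\<^sub>S (c\<^sub>S \<cdot> j \<cdot> y0) (c\<^sub>S \<cdot> i \<cdot> x0)
    h)) f))) (gl\<^sub>B \<cdot> i \<cdot> x \<cdot> b \<cdot> a)) (\<Lambda> a\<in>T\<^sub>B \<cdot> b \<cdot> (g\<^sub>B \<cdot> j \<cdot> y). LiftE j y b (T\<^sub>B \<cdot> b \<cdot> (g\<^sub>B \<cdot> i \<cdot>
    x)) (\<lambda>y0 s f. lte\<^sub>S \<cdot> (c\<^sub>S \<cdot> j \<cdot> y0) \<cdot> i \<cdot> x \<cdot> transport W\<^sub>S (c\<^sub>S \<cdot> j \<cdot> y) (\<lambda>w. lt\<^sub>S \<cdot> (c\<^sub>S \<cdot> j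
    \<cdot> y0) \<cdot> w) (ltm\<^sub>S \<cdot> j \<cdot> y \<cdot> y0 \<cdot> s) (c\<^sub>S \<cdot> i \<cdot> x) (inv_path W\<^sub>S (c\<^sub>S \<cdot> i \<cdot> x) (c\<^sub>S \<cdot> j \<cdot> y) e) \<cdot>
    (T\<^sub>B \<cdot> b \<cdot> (g\<^sub>B \<cdot> i \<cdot> x)) \<cdot> (Tp\<^sub>B \<cdot> b \<cdot> (g\<^sub>B \<cdot> i \<cdot> x)) \<cdot> (\<Lambda> x0\<in>X\<^sub>F \<cdot> i. \<Lambda> r\<in>R\<^sub>F \<cdot> i \<cdot> x0 \<cdot> x. \<Lambda>
    h\<in>c\<^sub>S \<cdot> i \<cdot> x0 =\<^bsub>W\<^sub>S\<^esub> c\<^sub>S \<cdot> j \<cdot> y0. transport B\<^sub>B (g\<^sub>B \<cdot> i \<cdot> x0) (\<lambda>b. T\<^sub>B \<cdot> b \<cdot> (g\<^sub>B \<cdot> i \<cdot> x))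
    (gm\<^sub>B \<cdot> i \<cdot> x0 \<cdot> x \<cdot> r) b (comp_path B\<^sub>B (g\<^sub>B \<cdot> i \<cdot> x0) (g\<^sub>B \<cdot> j \<cdot> y0) b (ih \<cdot> x0 \<cdot> r \<cdot> j \<cdot> y0 \<cdot>
    h) f))) (gl\<^sub>B \<cdot> j \<cdot> y \<cdot> b \<cdot> a)))) x)"

lemma g_resp: "\<langle>\<A>\<rangle> Bound_ctx \<tturnstile> g_resp_T 23"
  by (rule holds_check[OF Bound_ctx_ok list_all_Nil, of full "g_resp_p 23"])
    (simp only: expr_eval, simp only: check_eval cong: check_cong)

definition [expr_eval]: "g_reflect_T = (\<Pi> i\<in>I\<^sub>F. \<Pi> x\<in>X\<^sub>F \<cdot> i. \<Pi> j\<in>I\<^sub>F. \<Pi> y\<in>X\<^sub>F \<cdot> j. g\<^sub>B \<cdot> i \<cdot> x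
    =\<^bsub>B\<^sub>B\<^esub> g\<^sub>B \<cdot> j \<cdot> y \<rightarrow> c\<^sub>S \<cdot> i \<cdot> x =\<^bsub>W\<^sub>S\<^esub> c\<^sub>S \<cdot> j \<cdot> y)"

text \<open>The mirror image of \<open>g_resp\<close>: extensionality of \<open>lt\<^sub>S\<close>
  is used instead, and \<open>lte\<^sub>S\<close> and \<open>gl\<^sub>B\<close> are applied in the
  opposite order.\<close>

definition [expr_eval]: "g_reflect_p = (\<Lambda> i\<in>I\<^sub>F. \<Lambda> x\<in>X\<^sub>F \<cdot> i. wfInd i (\<lambda>x. \<Pi> j\<in>I\<^sub>F. \<Pi> y\<in>X\<^sub>F \<cdot> j. g\<^sub>B
    \<cdot> i \<cdot> x =\<^bsub>B\<^sub>B\<^esub> g\<^sub>B \<cdot> j \<cdot> y \<rightarrow> c\<^sub>S \<cdot> i \<cdot> x =\<^bsub>W\<^sub>S\<^esub> c\<^sub>S \<cdot> j \<cdot> y) (\<lambda>x ih. \<Lambda> j\<in>I\<^sub>F. \<Lambda> y\<in>X\<^sub>F \<cdot> j. \<Lambda>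
    e\<in>g\<^sub>B \<cdot> i \<cdot> x =\<^bsub>B\<^sub>B\<^esub> g\<^sub>B \<cdot> j \<cdot> y. ltx\<^sub>S \<cdot> (c\<^sub>S \<cdot> i \<cdot> x) \<cdot> (c\<^sub>S \<cdot> j \<cdot> y) \<cdot> (\<Lambda> z\<in>W\<^sub>S. ePair (\<Lambda>
    a\<in>lt\<^sub>S \<cdot> z \<cdot> (c\<^sub>S \<cdot> i \<cdot> x). lte\<^sub>S \<cdot> z \<cdot> i \<cdot> x \<cdot> a \<cdot> (lt\<^sub>S \<cdot> z \<cdot> (c\<^sub>S \<cdot> j \<cdot> y)) \<cdot> (ltp\<^sub>S \<cdot> z \<cdot>
    (c\<^sub>S \<cdot> j \<cdot> y)) \<cdot> (\<Lambda> x0\<in>X\<^sub>F \<cdot> i. \<Lambda> r\<in>R\<^sub>F \<cdot> i \<cdot> x0 \<cdot> x. \<Lambda> f\<in>c\<^sub>S \<cdot> i \<cdot> x0 =\<^bsub>W\<^sub>S\<^esub> z. LiftE j y (g\<^sub>B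
    \<cdot> i \<cdot> x0) (lt\<^sub>S \<cdot> z \<cdot> (c\<^sub>S \<cdot> j \<cdot> y)) (\<lambda>y0 s h. transport W\<^sub>S (c\<^sub>S \<cdot> j \<cdot> y0) (\<lambda>z. lt\<^sub>S \<cdot> z \<cdot> (c\<^sub>S
    \<cdot> j \<cdot> y)) (ltm\<^sub>S \<cdot> j \<cdot> y \<cdot> y0 \<cdot> s) z (comp_path W\<^sub>S (c\<^sub>S \<cdot> j \<cdot> y0) (c\<^sub>S \<cdot> i \<cdot> x0) z (inv_path
    W\<^sub>S (c\<^sub>S \<cdot> i \<cdot> x0) (c\<^sub>S \<cdot> j \<cdot> y0) (ih \<cdot> x0 \<cdot> r \<cdot> j \<cdot> y0 \<cdot> inv_path B\<^sub>B (g\<^sub>B \<cdot> j \<cdot> y0) (g\<^sub>B \<cdot> i \<cdot>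
    x0) h)) f)) (gl\<^sub>B \<cdot> j \<cdot> y \<cdot> (g\<^sub>B \<cdot> i \<cdot> x0) \<cdot> transport B\<^sub>B (g\<^sub>B \<cdot> i \<cdot> x) (\<lambda>b. T\<^sub>B \<cdot> (g\<^sub>B \<cdot> i \<cdot>
    x0) \<cdot> b) (gm\<^sub>B \<cdot> i \<cdot> x0 \<cdot> x \<cdot> r) (g\<^sub>B \<cdot> j \<cdot> y) e))) (\<Lambda> a\<in>lt\<^sub>S \<cdot> z \<cdot> (c\<^sub>S \<cdot> j \<cdot> y). lte\<^sub>S \<cdot> z \<cdot> j
    \<cdot> y \<cdot> a \<cdot> (lt\<^sub>S \<cdot> z \<cdot> (c\<^sub>S \<cdot> i \<cdot> x)) \<cdot> (ltp\<^sub>S \<cdot> z \<cdot> (c\<^sub>S \<cdot> i \<cdot> x)) \<cdot> (\<Lambda> y0\<in>X\<^sub>F \<cdot> j. \<Lambda> s\<in>R\<^sub>F \<cdot> j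
    \<cdot> y0 \<cdot> y. \<Lambda> f\<in>c\<^sub>S \<cdot> j \<cdot> y0 =\<^bsub>W\<^sub>S\<^esub> z. LiftE i x (g\<^sub>B \<cdot> j \<cdot> y0) (lt\<^sub>S \<cdot> z \<cdot> (c\<^sub>S \<cdot> i \<cdot> x)) (\<lambda>x0 r
    h. transport W\<^sub>S (c\<^sub>S \<cdot> i \<cdot> x0) (\<lambda>z. lt\<^sub>S \<cdot> z \<cdot> (c\<^sub>S \<cdot> i \<cdot> x)) (ltm\<^sub>S \<cdot> i \<cdot> x \<cdot> x0 \<cdot> r) z
    (comp_path W\<^sub>S (c\<^sub>S \<cdot> i \<cdot> x0) (c\<^sub>S \<cdot> j \<cdot> y0) z (ih \<cdot> x0 \<cdot> r \<cdot> j \<cdot> y0 \<cdot> h) f)) (gl\<^sub>B \<cdot> i \<cdot> x \<cdot>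
    (g\<^sub>B \<cdot> j \<cdot> y0) \<cdot> transport B\<^sub>B (g\<^sub>B \<cdot> j \<cdot> y) (\<lambda>b. T\<^sub>B \<cdot> (g\<^sub>B \<cdot> j \<cdot> y0) \<cdot> b) (gm\<^sub>B \<cdot> j \<cdot> y0 \<cdot> y \<cdot>
    s) (g\<^sub>B \<cdot> i \<cdot> x) (inv_path B\<^sub>B (g\<^sub>B \<cdot> i \<cdot> x) (g\<^sub>B \<cdot> j \<cdot> y) e)))))) x)"

lemma g_reflect: "\<langle>\<A>\<rangle> Bound_ctx \<tturnstile> g_reflect_T 23"
  by (rule holds_check[OF Bound_ctx_ok list_all_Nil, of full "g_reflect_p 23"])
    (simp only: expr_eval, simp only: check_eval cong: check_cong)

text \<open>A value together with the proof that every representative of \<open>z\<close> takes it.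
  Uniqueness makes this a proposition, so a map can be defined although representatives exist only
  up to truncation: the maps \<open>g\<^sub>B\<close> factor through the joint surjection
  \<open>c\<^sub>S\<close>.\<close>

definition [expr_eval]: "value_at z = (\<Sigma> b\<in>B\<^sub>B. \<Pi> i\<in>I\<^sub>F. \<Pi> x\<in>X\<^sub>F \<cdot> i. c\<^sub>S \<cdot> i \<cdot> x =\<^bsub>W\<^sub>S\<^esub> z \<rightarrow> g\<^sub>B \<cdot> i
    \<cdot> x =\<^bsub>B\<^sub>B\<^esub> b)"

definition [expr_eval]: "value_of z p = proj1 B\<^sub>B (\<lambda>b. \<Pi> i\<in>I\<^sub>F. \<Pi> x\<in>X\<^sub>F \<cdot> i. c\<^sub>S \<cdot> i \<cdot> x =\<^bsub>W\<^sub>S\<^esub> z \<rightarrow>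
    g\<^sub>B \<cdot> i \<cdot> x =\<^bsub>B\<^sub>B\<^esub> b) p"

definition [expr_eval]: "value_eq z p = proj2 B\<^sub>B (\<lambda>b. \<Pi> i\<in>I\<^sub>F. \<Pi> x\<in>X\<^sub>F \<cdot> i. c\<^sub>S \<cdot> i \<cdot> x =\<^bsub>W\<^sub>S\<^esub> z \<rightarrow>
    g\<^sub>B \<cdot> i \<cdot> x =\<^bsub>B\<^sub>B\<^esub> b) p"

definition [expr_eval]: "value_isProp_T = (\<Pi> z\<in>W\<^sub>S. isProp (value_at z))"

text \<open>Equality of two values is a proposition because \<open>B\<^sub>B\<close> is a set, so a
  representative of \<open>z\<close> may be chosen to compare them.\<close>

definition [expr_eval]: "value_isProp_p sig_eq isProp_Pi extensional_isSet = (\<Lambda> z\<in>W\<^sub>S. \<Lambda> p\<in>value_at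
    z. \<Lambda> p'\<in>value_at z. sig_eq \<cdot> B\<^sub>B \<cdot> (\<Lambda> b\<in>B\<^sub>B. \<Pi> i\<in>I\<^sub>F. \<Pi> x\<in>X\<^sub>F \<cdot> i. c\<^sub>S \<cdot> i \<cdot> x =\<^bsub>W\<^sub>S\<^esub> z \<rightarrow> g\<^sub>B \<cdot>
    i \<cdot> x =\<^bsub>B\<^sub>B\<^esub> b) \<cdot> (\<Lambda> b\<in>B\<^sub>B. isProp_Pi \<cdot> I\<^sub>F \<cdot> (\<Lambda> i\<in>I\<^sub>F. \<Pi> x\<in>X\<^sub>F \<cdot> i. c\<^sub>S \<cdot> i \<cdot> x =\<^bsub>W\<^sub>S\<^esub> z \<rightarrow> g\<^sub>B
    \<cdot> i \<cdot> x =\<^bsub>B\<^sub>B\<^esub> b) \<cdot> (\<Lambda> i\<in>I\<^sub>F. isProp_Pi \<cdot> (X\<^sub>F \<cdot> i) \<cdot> (\<Lambda> x\<in>X\<^sub>F \<cdot> i. c\<^sub>S \<cdot> i \<cdot> x =\<^bsub>W\<^sub>S\<^esub> z \<rightarrow> g\<^sub>B \<cdot>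
    i \<cdot> x =\<^bsub>B\<^sub>B\<^esub> b) \<cdot> (\<Lambda> x\<in>X\<^sub>F \<cdot> i. isProp_Pi \<cdot> (c\<^sub>S \<cdot> i \<cdot> x =\<^bsub>W\<^sub>S\<^esub> z) \<cdot> (\<Lambda> e\<in>c\<^sub>S \<cdot> i \<cdot> x =\<^bsub>W\<^sub>S\<^esub> z.
    g\<^sub>B \<cdot> i \<cdot> x =\<^bsub>B\<^sub>B\<^esub> b) \<cdot> (\<Lambda> e\<in>c\<^sub>S \<cdot> i \<cdot> x =\<^bsub>W\<^sub>S\<^esub> z. extensional_isSet \<cdot> B\<^sub>B \<cdot> T\<^sub>B \<cdot> Tp\<^sub>B \<cdot> Tx\<^sub>B \<cdot>
    (g\<^sub>B \<cdot> i \<cdot> x) \<cdot> b)))) \<cdot> p \<cdot> p' \<cdot> (csu\<^sub>S \<cdot> z \<cdot> (value_of z p =\<^bsub>B\<^sub>B\<^esub> value_of z p') \<cdot>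
    (extensional_isSet \<cdot> B\<^sub>B \<cdot> T\<^sub>B \<cdot> Tp\<^sub>B \<cdot> Tx\<^sub>B \<cdot> value_of z p \<cdot> value_of z p') \<cdot> (\<Lambda> i\<in>I\<^sub>F. \<Lambda> x\<in>X\<^sub>F
    \<cdot> i. \<Lambda> e\<in>c\<^sub>S \<cdot> i \<cdot> x =\<^bsub>W\<^sub>S\<^esub> z. comp_path B\<^sub>B (value_of z p) (g\<^sub>B \<cdot> i \<cdot> x) (value_of z p')
    (inv_path B\<^sub>B (g\<^sub>B \<cdot> i \<cdot> x) (value_of z p) (value_eq z p \<cdot> i \<cdot> x \<cdot> e)) (value_eq z p' \<cdot> i \<cdot> x \<cdot>
    e))))"

lemma value_isProp: "\<langle>\<A>\<rangle> Bound_ctx \<tturnstile> value_isProp_T 23"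
  by (rule holds_check[OF Bound_ctx_ok list_all_ConsI[OF holds_closed[OF sig_eq[of v v]
    Bound_ctx_ok] list_all_ConsI[OF holds_closed[OF isProp_Pi[of v v] Bound_ctx_ok]
    list_all_ConsI[OF holds_closed[OF extensional_isSet Bound_ctx_ok] list_all_Nil]]], of full
    "value_isProp_p (bound 23) (bound 24) (bound 25) 26"])
    (simp only: expr_eval, simp only: check_eval cong: check_cong)

definition [expr_eval]: "value_exists_T = (\<Pi> z\<in>W\<^sub>S. value_at z)"

definition [expr_eval]: "value_exists_p value_isProp g_resp = (\<Lambda> z\<in>W\<^sub>S. csu\<^sub>S \<cdot> z \<cdot> value_at z \<cdot>
    (value_isProp \<cdot> z) \<cdot> (\<Lambda> i\<in>I\<^sub>F. \<Lambda> x\<in>X\<^sub>F \<cdot> i. \<Lambda> e\<in>c\<^sub>S \<cdot> i \<cdot> x =\<^bsub>W\<^sub>S\<^esub> z. ePair (g\<^sub>B \<cdot> i \<cdot> x) (\<Lambda>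
    j\<in>I\<^sub>F. \<Lambda> y\<in>X\<^sub>F \<cdot> j. \<Lambda> f\<in>c\<^sub>S \<cdot> j \<cdot> y =\<^bsub>W\<^sub>S\<^esub> z. g_resp \<cdot> j \<cdot> y \<cdot> i \<cdot> x \<cdot> comp_path W\<^sub>S (c\<^sub>S \<cdot> j \<cdot>
    y) z (c\<^sub>S \<cdot> i \<cdot> x) f (inv_path W\<^sub>S (c\<^sub>S \<cdot> i \<cdot> x) z e))))"

lemma value_exists: "\<langle>\<A>\<rangle> Bound_ctx \<tturnstile> value_exists_T 23"
  by (rule holds_check[OF Bound_ctx_ok list_all_ConsI[OF value_isProp list_all_ConsI[OF g_resp
    list_all_Nil]], of full "value_exists_p (bound 23) (bound 24) 25"])
    (simp only: expr_eval, simp only: check_eval cong: check_cong)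

definition [expr_eval]: "MapEq f = (\<Pi> i\<in>I\<^sub>F. \<Pi> x\<in>X\<^sub>F \<cdot> i. f \<cdot> (c\<^sub>S \<cdot> i \<cdot> x) =\<^bsub>B\<^sub>B\<^esub> g\<^sub>B \<cdot> i \<cdot> x)"

definition [expr_eval]: "map_exists_T = (\<Pi> C\<in>\<U> v. (\<Pi> f\<in>W\<^sub>S \<rightarrow> B\<^sub>B. MapEq f \<rightarrow> C) \<rightarrow> C)"

definition [expr_eval]: "map_exists_p value_exists = (\<Lambda> C\<in>\<U> v. \<Lambda> k\<in>(\<Pi> f\<in>W\<^sub>S \<rightarrow> B\<^sub>B. MapEq f \<rightarrow> C). k \<cdot>
    (\<Lambda> z\<in>W\<^sub>S. value_of z (value_exists \<cdot> z)) \<cdot> (\<Lambda> i\<in>I\<^sub>F. \<Lambda> x\<in>X\<^sub>F \<cdot> i. inv_path B\<^sub>B (g\<^sub>B \<cdot> i \<cdot> x)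
    (value_of (c\<^sub>S \<cdot> i \<cdot> x) (value_exists \<cdot> (c\<^sub>S \<cdot> i \<cdot> x))) (value_eq (c\<^sub>S \<cdot> i \<cdot> x) (value_exists \<cdot>
    (c\<^sub>S \<cdot> i \<cdot> x)) \<cdot> i \<cdot> x \<cdot> eRefl (c\<^sub>S \<cdot> i \<cdot> x))))"

lemma map_exists: "\<langle>\<A>\<rangle> Bound_ctx \<tturnstile> map_exists_T 23"
  by (rule holds_check[OF Bound_ctx_ok list_all_ConsI[OF value_exists list_all_Nil], of full
    "map_exists_p (bound 23) 24"]) (simp only: expr_eval, simp only: check_eval cong: check_cong)

abbreviation "f\<^sub>M \<equiv> bound 23"
abbreviation "fc\<^sub>M \<equiv> bound 24"

text \<open>The factored map is kept abstract; only its values on representatives are known.\<close>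

definition Map_ctx :: "tm list" where [expr_eval]: "Map_ctx = [
    (MapEq f\<^sub>M) 24,
    (W\<^sub>S \<rightarrow> B\<^sub>B) 23] @ Bound_ctx"

lemma Map_ctx_ok: "\<langle>\<A>\<rangle> \<turnstile> Map_ctx"
  unfolding Map_ctx_def
  by (rule ctx_okD[OF Bound_ctx_ok, where n = full])
    (simp only: expr_eval, simp only: check_eval cong: check_cong)

definition [expr_eval]: "f_preserves_T = Preserves W\<^sub>S lt\<^sub>S B\<^sub>B T\<^sub>B f\<^sub>M"

text \<open>Both points get representatives in the same ordinal, where \<open>gm\<^sub>B\<close>
  applies. The nested transports rewrite values of \<open>g\<^sub>B\<close> as values of
  \<open>f\<^sub>M\<close> and then return from the representatives to \<open>z\<close> and
  \<open>w\<close>.\<close>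

definition [expr_eval]: "f_preserves_p = (\<Lambda> z\<in>W\<^sub>S. \<Lambda> w\<in>W\<^sub>S. \<Lambda> a\<in>lt\<^sub>S \<cdot> z \<cdot> w. csu\<^sub>S \<cdot> w \<cdot> (T\<^sub>B \<cdot>
    (f\<^sub>M \<cdot> z) \<cdot> (f\<^sub>M \<cdot> w)) \<cdot> (Tp\<^sub>B \<cdot> (f\<^sub>M \<cdot> z) \<cdot> (f\<^sub>M \<cdot> w)) \<cdot> (\<Lambda> i\<in>I\<^sub>F. \<Lambda> x\<in>X\<^sub>F \<cdot> i. \<Lambda> e\<in>c\<^sub>S \<cdot> i \<cdot> x
    =\<^bsub>W\<^sub>S\<^esub> w. lte\<^sub>S \<cdot> z \<cdot> i \<cdot> x \<cdot> transport W\<^sub>S w (\<lambda>w. lt\<^sub>S \<cdot> z \<cdot> w) a (c\<^sub>S \<cdot> i \<cdot> x) (inv_path W\<^sub>S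
    (c\<^sub>S \<cdot> i \<cdot> x) w e) \<cdot> (T\<^sub>B \<cdot> (f\<^sub>M \<cdot> z) \<cdot> (f\<^sub>M \<cdot> w)) \<cdot> (Tp\<^sub>B \<cdot> (f\<^sub>M \<cdot> z) \<cdot> (f\<^sub>M \<cdot> w)) \<cdot> (\<Lambda> x0\<in>X\<^sub>F
    \<cdot> i. \<Lambda> r\<in>R\<^sub>F \<cdot> i \<cdot> x0 \<cdot> x. \<Lambda> d\<in>c\<^sub>S \<cdot> i \<cdot> x0 =\<^bsub>W\<^sub>S\<^esub> z. transport W\<^sub>S (c\<^sub>S \<cdot> i \<cdot> x) (\<lambda>w. T\<^sub>B \<cdot>
    (f\<^sub>M \<cdot> z) \<cdot> (f\<^sub>M \<cdot> w)) (transport W\<^sub>S (c\<^sub>S \<cdot> i \<cdot> x0) (\<lambda>z. T\<^sub>B \<cdot> (f\<^sub>M \<cdot> z) \<cdot> (f\<^sub>M \<cdot> (c\<^sub>S \<cdot> i \<cdot>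
    x))) (transport B\<^sub>B (g\<^sub>B \<cdot> i \<cdot> x) (\<lambda>b. T\<^sub>B \<cdot> (f\<^sub>M \<cdot> (c\<^sub>S \<cdot> i \<cdot> x0)) \<cdot> b) (transport B\<^sub>B (g\<^sub>B \<cdot> i
    \<cdot> x0) (\<lambda>b. T\<^sub>B \<cdot> b \<cdot> (g\<^sub>B \<cdot> i \<cdot> x)) (gm\<^sub>B \<cdot> i \<cdot> x0 \<cdot> x \<cdot> r) (f\<^sub>M \<cdot> (c\<^sub>S \<cdot> i \<cdot> x0)) (inv_path B\<^sub>B
    (f\<^sub>M \<cdot> (c\<^sub>S \<cdot> i \<cdot> x0)) (g\<^sub>B \<cdot> i \<cdot> x0) (fc\<^sub>M \<cdot> i \<cdot> x0))) (f\<^sub>M \<cdot> (c\<^sub>S \<cdot> i \<cdot> x)) (inv_path B\<^sub>B (f\<^sub>M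
    \<cdot> (c\<^sub>S \<cdot> i \<cdot> x)) (g\<^sub>B \<cdot> i \<cdot> x) (fc\<^sub>M \<cdot> i \<cdot> x))) z d) w e)))"

lemma f_preserves: "\<langle>\<A>\<rangle> Map_ctx \<tturnstile> f_preserves_T 25"
  by (rule holds_check[OF Map_ctx_ok list_all_Nil, of full "f_preserves_p 25"])
    (simp only: expr_eval, simp only: check_eval cong: check_cong)

definition [expr_eval]: "f_inj_T = (\<Pi> z\<in>W\<^sub>S. \<Pi> w\<in>W\<^sub>S. f\<^sub>M \<cdot> z =\<^bsub>B\<^sub>B\<^esub> f\<^sub>M \<cdot> w \<rightarrow> z =\<^bsub>W\<^sub>S\<^esub> w)"

lemma Map_weaken_Bound: "\<langle>\<A>\<rangle> Bound_ctx \<tturnstile> T \<Longrightarrow> \<langle>\<A>\<rangle> Map_ctx \<tturnstile> ren (shift 2) T"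
  by (rule holds_weaken_by[OF _ Map_ctx_ok]) (simp_all add: Map_ctx_def)

text \<open>Representatives reduce the claim to \<open>g_reflect\<close>. Injectivity is what
  \<open>isProp_fibre\<close> asks for when \<open>f_lifts\<close> extracts its lift.\<close>

definition [expr_eval]: "f_inj_p g_reflect extensional_isSet = (\<Lambda> z\<in>W\<^sub>S. \<Lambda> w\<in>W\<^sub>S. \<Lambda> e\<in>f\<^sub>M \<cdot> z =\<^bsub>B\<^sub>B\<^esub>
    f\<^sub>M \<cdot> w. csu\<^sub>S \<cdot> z \<cdot> (z =\<^bsub>W\<^sub>S\<^esub> w) \<cdot> (extensional_isSet \<cdot> W\<^sub>S \<cdot> lt\<^sub>S \<cdot> ltp\<^sub>S \<cdot> ltx\<^sub>S \<cdot> z \<cdot> w) \<cdot>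
    (\<Lambda> i\<in>I\<^sub>F. \<Lambda> x\<in>X\<^sub>F \<cdot> i. \<Lambda> d\<in>c\<^sub>S \<cdot> i \<cdot> x =\<^bsub>W\<^sub>S\<^esub> z. csu\<^sub>S \<cdot> w \<cdot> (z =\<^bsub>W\<^sub>S\<^esub> w) \<cdot> (extensional_isSet \<cdot>
    W\<^sub>S \<cdot> lt\<^sub>S \<cdot> ltp\<^sub>S \<cdot> ltx\<^sub>S \<cdot> z \<cdot> w) \<cdot> (\<Lambda> j\<in>I\<^sub>F. \<Lambda> y\<in>X\<^sub>F \<cdot> j. \<Lambda> h\<in>c\<^sub>S \<cdot> j \<cdot> y =\<^bsub>W\<^sub>S\<^esub> w. comp_path
    W\<^sub>S z (c\<^sub>S \<cdot> i \<cdot> x) w (inv_path W\<^sub>S (c\<^sub>S \<cdot> i \<cdot> x) z d) (comp_path W\<^sub>S (c\<^sub>S \<cdot> i \<cdot> x) (c\<^sub>S \<cdot> j \<cdot>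
    y) w (g_reflect \<cdot> i \<cdot> x \<cdot> j \<cdot> y \<cdot> comp_path B\<^sub>B (g\<^sub>B \<cdot> i \<cdot> x) (f\<^sub>M \<cdot> (c\<^sub>S \<cdot> i \<cdot> x)) (g\<^sub>B \<cdot> j \<cdot>
    y) (inv_path B\<^sub>B (f\<^sub>M \<cdot> (c\<^sub>S \<cdot> i \<cdot> x)) (g\<^sub>B \<cdot> i \<cdot> x) (fc\<^sub>M \<cdot> i \<cdot> x)) (comp_path B\<^sub>B (f\<^sub>M \<cdot> (c\<^sub>S
    \<cdot> i \<cdot> x)) (f\<^sub>M \<cdot> z) (g\<^sub>B \<cdot> j \<cdot> y) (ap_path W\<^sub>S B\<^sub>B (\<lambda>z. f\<^sub>M \<cdot> z) (c\<^sub>S \<cdot> i \<cdot> x) z d) (comp_path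
    B\<^sub>B (f\<^sub>M \<cdot> z) (f\<^sub>M \<cdot> w) (g\<^sub>B \<cdot> j \<cdot> y) e (comp_path B\<^sub>B (f\<^sub>M \<cdot> w) (f\<^sub>M \<cdot> (c\<^sub>S \<cdot> j \<cdot> y)) (g\<^sub>B \<cdot> j
    \<cdot> y) (inv_path B\<^sub>B (f\<^sub>M \<cdot> (c\<^sub>S \<cdot> j \<cdot> y)) (f\<^sub>M \<cdot> w) (ap_path W\<^sub>S B\<^sub>B (\<lambda>z. f\<^sub>M \<cdot> z) (c\<^sub>S \<cdot> j \<cdot> y)
    w h)) (fc\<^sub>M \<cdot> j \<cdot> y))))) h))))"

lemma f_inj: "\<langle>\<A>\<rangle> Map_ctx \<tturnstile> f_inj_T 25"
  by (rule holds_check[OF Map_ctx_ok list_all_ConsI[OF Map_weaken_Bound[OF g_reflect]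
    list_all_ConsI[OF holds_closed[OF extensional_isSet Map_ctx_ok] list_all_Nil]], of full "f_inj_p
    (bound 25) (bound 26) 27"]) (simp only: expr_eval, simp only: check_eval cong: check_cong)

definition [expr_eval]: "f_lifts_T = Lifts W\<^sub>S lt\<^sub>S B\<^sub>B T\<^sub>B f\<^sub>M"

definition [expr_eval]: "f_lifts_p f_inj isProp_fibre extensional_isSet = (\<Lambda> z\<in>W\<^sub>S. \<Lambda> b\<in>B\<^sub>B. \<Lambda> a\<in>T\<^sub>B
    \<cdot> b \<cdot> (f\<^sub>M \<cdot> z). csu\<^sub>S \<cdot> z \<cdot> (\<Sigma> z'\<in>W\<^sub>S. lt\<^sub>S \<cdot> z' \<cdot> z \<otimes> f\<^sub>M \<cdot> z' =\<^bsub>B\<^sub>B\<^esub> b) \<cdot> (isProp_fibre \<cdot> W\<^sub>S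
    \<cdot> B\<^sub>B \<cdot> (\<Lambda> z'\<in>W\<^sub>S. lt\<^sub>S \<cdot> z' \<cdot> z) \<cdot> f\<^sub>M \<cdot> (\<Lambda> z'\<in>W\<^sub>S. ltp\<^sub>S \<cdot> z' \<cdot> z) \<cdot> f_inj \<cdot>
    (extensional_isSet \<cdot> B\<^sub>B \<cdot> T\<^sub>B \<cdot> Tp\<^sub>B \<cdot> Tx\<^sub>B) \<cdot> b) \<cdot> (\<Lambda> i\<in>I\<^sub>F. \<Lambda> x\<in>X\<^sub>F \<cdot> i. \<Lambda> e\<in>c\<^sub>S \<cdot> i \<cdot> x
    =\<^bsub>W\<^sub>S\<^esub> z. LiftE i x b (\<Sigma> z'\<in>W\<^sub>S. lt\<^sub>S \<cdot> z' \<cdot> z \<otimes> f\<^sub>M \<cdot> z' =\<^bsub>B\<^sub>B\<^esub> b) (\<lambda>x0 r d. ePair (c\<^sub>S \<cdot> i \<cdot>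
    x0) (ePair (transport W\<^sub>S (c\<^sub>S \<cdot> i \<cdot> x) (\<lambda>z. lt\<^sub>S \<cdot> (c\<^sub>S \<cdot> i \<cdot> x0) \<cdot> z) (ltm\<^sub>S \<cdot> i \<cdot> x \<cdot> x0 \<cdot> r)
    z e) (comp_path B\<^sub>B (f\<^sub>M \<cdot> (c\<^sub>S \<cdot> i \<cdot> x0)) (g\<^sub>B \<cdot> i \<cdot> x0) b (fc\<^sub>M \<cdot> i \<cdot> x0) d))) (gl\<^sub>B \<cdot> i \<cdot> x \<cdot>
    b \<cdot> transport B\<^sub>B (f\<^sub>M \<cdot> (c\<^sub>S \<cdot> i \<cdot> x)) (\<lambda>y. T\<^sub>B \<cdot> b \<cdot> y) (transport W\<^sub>S z (\<lambda>z. T\<^sub>B \<cdot> b \<cdot> (f\<^sub>M \<cdot>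
    z)) a (c\<^sub>S \<cdot> i \<cdot> x) (inv_path W\<^sub>S (c\<^sub>S \<cdot> i \<cdot> x) z e)) (g\<^sub>B \<cdot> i \<cdot> x) (fc\<^sub>M \<cdot> i \<cdot> x))))"

lemma f_lifts: "\<langle>\<A>\<rangle> Map_ctx \<tturnstile> f_lifts_T 25"
  by (rule holds_check[OF Map_ctx_ok list_all_ConsI[OF f_inj list_all_ConsI[OF holds_closed[OF
    isProp_fibre[of v] Map_ctx_ok] list_all_ConsI[OF holds_closed[OF extensional_isSet Map_ctx_ok]
    list_all_Nil]]], of full "f_lifts_p (bound 25) (bound 26) (bound 27) 28"])
    (simp only: expr_eval, simp only: check_eval cong: check_cong)

definition [expr_eval]: "f_sim_T = Sim W\<^sub>S lt\<^sub>S B\<^sub>B T\<^sub>B"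

definition [expr_eval]: "f_sim_p f_preserves f_lifts = ePair f\<^sub>M (ePair f_preserves f_lifts)"

lemma f_sim: "\<langle>\<A>\<rangle> Map_ctx \<tturnstile> f_sim_T 25"
  by (rule holds_check[OF Map_ctx_ok list_all_ConsI[OF f_preserves list_all_ConsI[OF f_lifts
    list_all_Nil]], of full "f_sim_p (bound 25) (bound 26) 27"])
    (simp only: expr_eval, simp only: check_eval cong: check_cong)

definition [expr_eval]: "least_bound_T = Sim W\<^sub>S lt\<^sub>S B\<^sub>B T\<^sub>B"

lemmas f_sim_Bound = f_sim[unfolded Map_ctx_def append.simps, THEN holds_Pi, THEN holds_Pi]

definition [expr_eval]: "least_bound_p map_exists m = map_exists \<cdot> Sim W\<^sub>S lt\<^sub>S B\<^sub>B T\<^sub>B \<cdot> m"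

lemma least_bound: "\<langle>\<A>\<rangle> Bound_ctx \<tturnstile> least_bound_T 23"
  by (rule holds_check[OF Bound_ctx_ok list_all_ConsI[OF map_exists list_all_ConsI[OF f_sim_Bound
    list_all_Nil]], of full "least_bound_p (bound 23) (bound 24) 25"])
    (simp only: expr_eval, simp only: check_eval cong: check_cong)

section \<open>Assembling the supremum of a family\<close>

definition [expr_eval]: "IsSup W lt = (\<Pi> B\<in>\<U> v. \<Pi> T\<in>B \<rightarrow> B \<rightarrow> \<U> v. is_ordinal B T \<rightarrow> (\<Pi> i\<in>I\<^sub>F. Sim (X\<^sub>F
    \<cdot> i) (R\<^sub>F \<cdot> i) B T) \<rightarrow> Sim W lt B T)"

definition [expr_eval]: "simF i B T s = proj1 (X\<^sub>F \<cdot> i \<rightarrow> B) (\<lambda>f. IsSim (X\<^sub>F \<cdot> i) (R\<^sub>F \<cdot> i) B T f) s"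

definition [expr_eval]: "simP i B T s = proj2 (X\<^sub>F \<cdot> i \<rightarrow> B) (\<lambda>f. IsSim (X\<^sub>F \<cdot> i) (R\<^sub>F \<cdot> i) B T f) s"

definition [expr_eval]: "is_sup_T = IsSup W\<^sub>S lt\<^sub>S"

lemmas least_bound_Sup = least_bound[unfolded Bound_ctx_def append.simps, THEN holds_Pi, THEN
    holds_Pi, THEN holds_Pi, THEN holds_Pi, THEN holds_Pi, THEN holds_Pi, THEN holds_Pi]

definition [expr_eval]: "is_sup_p l = (\<Lambda> B\<in>\<U> v. \<Lambda> T\<in>B \<rightarrow> B \<rightarrow> \<U> v. \<Lambda> od\<in>is_ordinal B T. \<Lambda> s\<in>(\<Pi> i\<in>I\<^sub>F.
    Sim (X\<^sub>F \<cdot> i) (R\<^sub>F \<cdot> i) B T). sig_elim (prop_valued B T) (\<lambda>u. transitive B T \<otimes> extensional B T \<otimes>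
    well_founded B T) (\<lambda>u. Sim W\<^sub>S lt\<^sub>S B T) (\<lambda>Tp od. sig_elim (transitive B T) (\<lambda>u. extensional B T
    \<otimes> well_founded B T) (\<lambda>u. Sim W\<^sub>S lt\<^sub>S B T) (\<lambda>Tt od. sig_elim (extensional B T) (\<lambda>u. well_founded
    B T) (\<lambda>u. Sim W\<^sub>S lt\<^sub>S B T) (\<lambda>Tx od. l \<cdot> B \<cdot> T \<cdot> Tp \<cdot> Tx \<cdot> (\<Lambda> i\<in>I\<^sub>F. simF i B T (s \<cdot> i)) \<cdot> (\<Lambda>
    i\<in>I\<^sub>F. fst_of (Preserves (X\<^sub>F \<cdot> i) (R\<^sub>F \<cdot> i) B T (simF i B T (s \<cdot> i))) (Lifts (X\<^sub>F \<cdot> i) (R\<^sub>F \<cdot>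
    i) B T (simF i B T (s \<cdot> i))) (simP i B T (s \<cdot> i))) \<cdot> (\<Lambda> i\<in>I\<^sub>F. snd_of (Preserves (X\<^sub>F \<cdot> i) (R\<^sub>F
    \<cdot> i) B T (simF i B T (s \<cdot> i))) (Lifts (X\<^sub>F \<cdot> i) (R\<^sub>F \<cdot> i) B T (simF i B T (s \<cdot> i))) (simP i B T
    (s \<cdot> i)))) od) od) od)"

lemma is_sup: "\<langle>\<A>\<rangle> Sup_ctx \<tturnstile> is_sup_T 16"
  by (rule holds_check[OF Sup_ctx_ok list_all_ConsI[OF least_bound_Sup list_all_Nil], of full
    "is_sup_p (bound 16) 17"]) (simp only: expr_eval, simp only: check_eval cong: check_cong)

definition [expr_eval]: "SupCont C = (\<Pi> W\<in>\<U> v. \<Pi> lt\<in>W \<rightarrow> W \<rightarrow> \<U> v. is_ordinal W lt \<rightarrow> (\<Pi> i\<in>I\<^sub>F. Sim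
    (X\<^sub>F \<cdot> i) (R\<^sub>F \<cdot> i) W lt) \<rightarrow> IsSup W lt \<rightarrow> C)"

text \<open>\<open>SupCont\<close> consumes a finished supremum, \<open>SupStr\<close> the raw data
  of \<open>Sup_ctx\<close>. Turning the first into the second lets each construction feed the
  next.\<close>

definition [expr_eval]: "SupStr C = (\<Pi> W\<in>\<U> v. \<Pi> lt\<in>W \<rightarrow> W \<rightarrow> \<U> v. \<Pi> c\<in>(\<Pi> i\<in>I\<^sub>F. X\<^sub>F \<cdot> i \<rightarrow> W).
    prop_valued W lt \<rightarrow> LtMono W lt c \<rightarrow> LtElim W lt c \<rightarrow> extensional W lt \<rightarrow> ClInj W c \<rightarrow> ClSurj W c \<rightarrow>
    C)"

definition [expr_eval]: "sup_of_structure_T = (\<Pi> C\<in>\<U> (Suc v). SupCont C \<rightarrow> SupStr C)"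

lemmas lt_is_ordinal_Fam = lt_is_ordinal[unfolded Sup_ctx_def append.simps, THEN holds_Pi, THEN
    holds_Pi, THEN holds_Pi, THEN holds_Pi, THEN holds_Pi, THEN holds_Pi, THEN holds_Pi, THEN
    holds_Pi, THEN holds_Pi]

lemmas upper_bound_Fam = upper_bound[unfolded Sup_ctx_def append.simps, THEN holds_Pi, THEN
    holds_Pi, THEN holds_Pi, THEN holds_Pi, THEN holds_Pi, THEN holds_Pi, THEN holds_Pi, THEN
    holds_Pi, THEN holds_Pi]

lemmas is_sup_Fam = is_sup[unfolded Sup_ctx_def append.simps, THEN holds_Pi, THEN holds_Pi, THEN
    holds_Pi, THEN holds_Pi, THEN holds_Pi, THEN holds_Pi, THEN holds_Pi, THEN holds_Pi, THEN
    holds_Pi]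

definition [expr_eval]: "sup_of_structure_p od ub ls = (\<Lambda> C\<in>\<U> (Suc v). \<Lambda> k\<in>SupCont C. \<Lambda> W\<in>\<U> v. \<Lambda>
    lt\<in>W \<rightarrow> W \<rightarrow> \<U> v. \<Lambda> c\<in>(\<Pi> i\<in>I\<^sub>F. X\<^sub>F \<cdot> i \<rightarrow> W). \<Lambda> p\<in>prop_valued W lt. \<Lambda> m\<in>LtMono W lt c. \<Lambda> e\<in>LtElim
    W lt c. \<Lambda> x\<in>extensional W lt. \<Lambda> j\<in>ClInj W c. \<Lambda> s\<in>ClSurj W c. k \<cdot> W \<cdot> lt \<cdot> (od \<cdot> W \<cdot> lt \<cdot> c \<cdot> p \<cdot>
    m \<cdot> e \<cdot> x \<cdot> j \<cdot> s) \<cdot> (ub \<cdot> W \<cdot> lt \<cdot> c \<cdot> p \<cdot> m \<cdot> e \<cdot> x \<cdot> j \<cdot> s) \<cdot> (ls \<cdot> W \<cdot> lt \<cdot> c \<cdot> p \<cdot> m \<cdot> e \<cdot>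
    x \<cdot> j \<cdot> s))"

lemma sup_of_structure: "\<langle>\<A>\<rangle> Fam_ctx \<tturnstile> sup_of_structure_T 7"
  by (rule holds_check[OF Fam_ctx_ok list_all_ConsI[OF lt_is_ordinal_Fam list_all_ConsI[OF
    upper_bound_Fam list_all_ConsI[OF is_sup_Fam list_all_Nil]]], of full "sup_of_structure_p (bound
    7) (bound 8) (bound 9) 10"]) (simp only: expr_eval, simp only: check_eval cong: check_cong)

definition [expr_eval]: "structure_of_classes_T = (\<Pi> C\<in>\<U> (Suc v). SupStr C \<rightarrow> C)"

definition [expr_eval]: "structure_of_classes_p Low_mono Low_elim Low_ext q_inj = (\<Lambda> C\<in>\<U> (Suc v). \<Lambda>
    k\<in>SupStr C. k \<cdot> Z\<^sub>C \<cdot> (\<Lambda> z\<in>Z\<^sub>C. \<Lambda> w\<in>Z\<^sub>C. Low z w) \<cdot> q\<^sub>C \<cdot> (\<Lambda> z\<in>Z\<^sub>C. \<Lambda> w\<in>Z\<^sub>C. \<Lambda> a\<in>Low z w. \<Lambda>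
    b\<in>Low z w. eTrEq a b) \<cdot> Low_mono \<cdot> Low_elim \<cdot> Low_ext \<cdot> q_inj \<cdot> qSurj\<^sub>C)"

lemma structure_of_classes: "\<langle>\<A>\<rangle> Cls_ctx \<tturnstile> structure_of_classes_T 19"
  by (rule holds_check[OF Cls_ctx_ok list_all_ConsI[OF Low_mono list_all_ConsI[OF Low_elim
    list_all_ConsI[OF Low_ext list_all_ConsI[OF q_inj list_all_Nil]]]], of full
    "structure_of_classes_p (bound 19) (bound 20) (bound 21) (bound 22) 23"])
    (simp only: expr_eval, simp only: check_eval cong: check_cong)

definition [expr_eval]: "points = (\<Sigma> i\<in>I\<^sub>F. X\<^sub>F \<cdot> i)"

definition [expr_eval]: "index_of s = proj1 I\<^sub>F (\<lambda>i. X\<^sub>F \<cdot> i) s"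

definition [expr_eval]: "point_of s = proj2 I\<^sub>F (\<lambda>i. X\<^sub>F \<cdot> i) s"

definition [expr_eval]: "below_pt = (\<Lambda> s\<in>points. \<Lambda> t\<in>points. Below (index_of s) (point_of s)
    (index_of t) (point_of t))"

definition [expr_eval]: "structure_of_bisimilarity_T = (\<Pi> C\<in>\<U> (Suc v). SupStr C \<rightarrow> C)"

lemmas structure_of_classes_Bis = structure_of_classes[unfolded Cls_ctx_def append.simps, THEN
    holds_Pi, THEN holds_Pi, THEN holds_Pi, THEN holds_Pi, THEN holds_Pi, THEN holds_Pi, THEN
    holds_Pi, THEN holds_Pi]

text \<open>Curries the quotient of \<open>points\<close>. Projections of an explicit pair compute,
  so \<open>below_pt\<close> at two such pairs is convertible to \<open>Below\<close> at their
  components, and the membership laws transfer as they are.\<close>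

definition [expr_eval]: "structure_of_bisimilarity_p st quotient_exists = (\<Lambda> C\<in>\<U> (Suc v). \<Lambda> k\<in>SupStr
    C. quotient_exists \<cdot> points \<cdot> below_pt \<cdot> (\<Lambda> s\<in>points. \<Lambda> t\<in>points. \<Lambda> a\<in>below_pt \<cdot> s \<cdot> t. \<Lambda>
    b\<in>below_pt \<cdot> s \<cdot> t. eTrEq a b) \<cdot> C \<cdot> (\<Lambda> Z\<in>\<U> v. \<Lambda> q\<in>points \<rightarrow> Z. \<Lambda> m\<in>Z \<rightarrow> points \<rightarrow> \<U> v. \<Lambda>
    p\<in>quot_prop points Z m. \<Lambda> s\<in>quot_surj points Z q. \<Lambda> e\<in>quot_elim points below_pt Z q m. \<Lambda>
    i\<in>quot_intro points below_pt Z q m. \<Lambda> x\<in>quot_ext points Z m. st \<cdot> Z \<cdot> (\<Lambda> i\<in>I\<^sub>F. \<Lambda> x\<in>X\<^sub>F \<cdot> i. q \<cdot>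
    ePair i x) \<cdot> (\<Lambda> z\<in>Z. \<Lambda> i\<in>I\<^sub>F. \<Lambda> x\<in>X\<^sub>F \<cdot> i. m \<cdot> z \<cdot> ePair i x) \<cdot> (\<Lambda> z\<in>Z. \<Lambda> i\<in>I\<^sub>F. \<Lambda> x\<in>X\<^sub>F \<cdot> i. p
    \<cdot> z \<cdot> ePair i x) \<cdot> (\<Lambda> z\<in>Z. \<Lambda> K\<in>\<U> v. \<Lambda> pK\<in>isProp K. \<Lambda> k\<in>(\<Pi> i\<in>I\<^sub>F. \<Pi> x\<in>X\<^sub>F \<cdot> i. q \<cdot> ePair i x =\<^bsub>Z\<^esub>
    z \<rightarrow> K). s \<cdot> z \<cdot> K \<cdot> pK \<cdot> (\<Lambda> s\<in>points. sig_elim I\<^sub>F (\<lambda>i. X\<^sub>F \<cdot> i) (\<lambda>s. q \<cdot> s =\<^bsub>Z\<^esub> z \<rightarrow> K) (\<lambda>i x. k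
    \<cdot> i \<cdot> x) s)) \<cdot> (\<Lambda> i\<in>I\<^sub>F. \<Lambda> x\<in>X\<^sub>F \<cdot> i. \<Lambda> j\<in>I\<^sub>F. \<Lambda> y\<in>X\<^sub>F \<cdot> j. e \<cdot> ePair i x \<cdot> ePair j y) \<cdot> (\<Lambda>
    j\<in>I\<^sub>F. \<Lambda> x\<in>X\<^sub>F \<cdot> j. \<Lambda> l\<in>I\<^sub>F. \<Lambda> y\<in>X\<^sub>F \<cdot> l. i \<cdot> ePair j x \<cdot> ePair l y) \<cdot> (\<Lambda> z\<in>Z. \<Lambda> w\<in>Z. \<Lambda> a\<in>(\<Pi>
    j\<in>I\<^sub>F. \<Pi> y\<in>X\<^sub>F \<cdot> j. m \<cdot> z \<cdot> ePair j y \<rightarrow> m \<cdot> w \<cdot> ePair j y). \<Lambda> b\<in>(\<Pi> j\<in>I\<^sub>F. \<Pi> y\<in>X\<^sub>F \<cdot> j. m \<cdot> w \<cdot>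
    ePair j y \<rightarrow> m \<cdot> z \<cdot> ePair j y). x \<cdot> z \<cdot> w \<cdot> (\<Lambda> s\<in>points. sig_elim I\<^sub>F (\<lambda>i. X\<^sub>F \<cdot> i) (\<lambda>s. m \<cdot> z \<cdot>
    s \<rightarrow> m \<cdot> w \<cdot> s) (\<lambda>i y. a \<cdot> i \<cdot> y) s) \<cdot> (\<Lambda> s\<in>points. sig_elim I\<^sub>F (\<lambda>i. X\<^sub>F \<cdot> i) (\<lambda>s. m \<cdot> w \<cdot> s \<rightarrow> m
    \<cdot> z \<cdot> s) (\<lambda>i y. b \<cdot> i \<cdot> y) s)) \<cdot> C \<cdot> k))"

lemma structure_of_bisimilarity: "\<langle>\<A>\<rangle> Bis_ctx \<tturnstile> structure_of_bisimilarity_T 11"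
  by (rule holds_check[OF Bis_ctx_ok list_all_ConsI[OF structure_of_classes_Bis list_all_ConsI[OF
    holds_closed[OF quotient_exists Bis_ctx_ok] list_all_Nil]], of full "structure_of_bisimilarity_p
    (bound 11) (bound 12) 13"]) (simp only: expr_eval, simp only: check_eval cong: check_cong)

definition [expr_eval]: "sup_of_family_T = (\<Pi> C\<in>\<U> (Suc v). SupCont C \<rightarrow> C)"

lemmas structure_of_bisimilarity_Fam = structure_of_bisimilarity[unfolded Bis_ctx_def append.simps,
    THEN holds_Pi, THEN holds_Pi, THEN holds_Pi, THEN holds_Pi]

definition [expr_eval]: "sup_of_family_p bisimilarity_exists sb so = (\<Lambda> C\<in>\<U> (Suc v). \<Lambda> k\<in>SupCont C.
    bisimilarity_exists \<cdot> C \<cdot> (\<Lambda> E\<in>Rel. \<Lambda> a\<in>Forth E. \<Lambda> b\<in>Back E. \<Lambda> d\<in>Mk E. sb \<cdot> E \<cdot> a \<cdot> b \<cdot> d \<cdot> C \<cdot>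
    (so \<cdot> C \<cdot> k)))"

lemma sup_of_family: "\<langle>\<A>\<rangle> Fam_ctx \<tturnstile> sup_of_family_T 7"
  by (rule holds_check[OF Fam_ctx_ok list_all_ConsI[OF bisimilarity_exists list_all_ConsI[OF
    structure_of_bisimilarity_Fam list_all_ConsI[OF sup_of_structure list_all_Nil]]], of full
    "sup_of_family_p (bound 7) (bound 8) (bound 9) 10"])
    (simp only: expr_eval, simp only: check_eval cong: check_cong)

section \<open>Suprema over an abstract type of ordinals\<close>

definition [expr_eval]: "relof W s = proj1 (W \<rightarrow> W \<rightarrow> \<U> v) (\<lambda>R. is_ordinal W R) s"

definition [expr_eval]: "prfof W s = proj2 (W \<rightarrow> W \<rightarrow> \<U> v) (\<lambda>R. is_ordinal W R) s"

abbreviation "On\<^sub>O \<equiv> bound 0"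
abbreviation "car\<^sub>O \<equiv> bound 1"
abbreviation "rel\<^sub>O \<equiv> bound 2"
abbreviation "prf\<^sub>O \<equiv> bound 3"
abbreviation "mkO\<^sub>O \<equiv> bound 4"
abbreviation "simTo\<^sub>O \<equiv> bound 5"
abbreviation "simFrom\<^sub>O \<equiv> bound 6"

text \<open>For the actual type of ordinals, carrier and relation of a newly formed ordinal compute
  to the given \<open>W\<close> and \<open>lt\<close>. Variables do not compute, so the two
  consequences that the argument uses are assumed instead: \<open>simTo\<^sub>O\<close> and
  \<open>simFrom\<^sub>O\<close> transfer simulations into and out of \<open>W\<close>.\<close>

definition Ords_ctx :: "tm list" where [expr_eval]: "Ords_ctx = [
    (\<Pi> W\<in>\<U> v. \<Pi> lt\<in>W \<rightarrow> W \<rightarrow> \<U> v. \<Pi> p\<in>is_ordinal W lt. \<Pi> a\<in>On\<^sub>O. Sim W lt (car\<^sub>O \<cdot> a) (rel\<^sub>O \<cdot> a) \<rightarrow>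
      Sim (car\<^sub>O \<cdot> (mkO\<^sub>O \<cdot> W \<cdot> lt \<cdot> p)) (rel\<^sub>O \<cdot> (mkO\<^sub>O \<cdot> W \<cdot> lt \<cdot> p)) (car\<^sub>O \<cdot> a) (rel\<^sub>O \<cdot> a)) 6,
    (\<Pi> W\<in>\<U> v. \<Pi> lt\<in>W \<rightarrow> W \<rightarrow> \<U> v. \<Pi> p\<in>is_ordinal W lt. \<Pi> a\<in>On\<^sub>O. Sim (car\<^sub>O \<cdot> a) (rel\<^sub>O \<cdot> a) W lt \<rightarrow>
      Sim (car\<^sub>O \<cdot> a) (rel\<^sub>O \<cdot> a) (car\<^sub>O \<cdot> (mkO\<^sub>O \<cdot> W \<cdot> lt \<cdot> p)) (rel\<^sub>O \<cdot> (mkO\<^sub>O \<cdot> W \<cdot> lt \<cdot> p))) 5,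
    (\<Pi> W\<in>\<U> v. \<Pi> lt\<in>W \<rightarrow> W \<rightarrow> \<U> v. is_ordinal W lt \<rightarrow> On\<^sub>O) 4,
    (\<Pi> a\<in>On\<^sub>O. is_ordinal (car\<^sub>O \<cdot> a) (rel\<^sub>O \<cdot> a)) 3,
    (\<Pi> a\<in>On\<^sub>O. car\<^sub>O \<cdot> a \<rightarrow> car\<^sub>O \<cdot> a \<rightarrow> \<U> v) 2,
    (On\<^sub>O \<rightarrow> \<U> v) 1,
    (\<U> (Suc v)) 0] @ []"

lemma Ords_ctx_ok: "\<langle>\<A>\<rangle> \<turnstile> Ords_ctx"
  unfolding Ords_ctx_def
  by (rule ctx_okD[OF ctx_Nil, where n = full])
    (simp only: expr_eval, simp only: check_eval cong: check_cong)

definition [expr_eval]: "sup_of_ordinals_T = (\<Pi> J\<in>\<U> v. \<Pi> X\<in>J \<rightarrow> \<U> v. \<Pi> R\<in>(\<Pi> i\<in>J. X \<cdot> i \<rightarrow> X \<cdot> i \<rightarrow> \<U>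
    v). (\<Pi> i\<in>J. is_ordinal (X \<cdot> i) (R \<cdot> i)) \<rightarrow> (\<Pi> C\<in>\<U> (Suc v). (\<Pi> W\<in>\<U> v. \<Pi> lt\<in>W \<rightarrow> W \<rightarrow> \<U> v. is_ordinal
    W lt \<rightarrow> (\<Pi> i\<in>J. Sim (X \<cdot> i) (R \<cdot> i) W lt) \<rightarrow> (\<Pi> B\<in>\<U> v. \<Pi> T\<in>B \<rightarrow> B \<rightarrow> \<U> v. is_ordinal B T \<rightarrow> (\<Pi> i\<in>J.
    Sim (X \<cdot> i) (R \<cdot> i) B T) \<rightarrow> Sim W lt B T) \<rightarrow> C) \<rightarrow> C))"

lemmas sup_of_family_closed = sup_of_family[unfolded Fam_ctx_def append.simps, THEN holds_Pi, THEN
    holds_Pi, THEN holds_Pi, THEN holds_Pi, THEN holds_Pi, THEN holds_Pi, THEN holds_Pi]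

definition [expr_eval]: "sup_of_ordinals_p sf = (\<Lambda> J\<in>\<U> v. \<Lambda> X\<in>J \<rightarrow> \<U> v. \<Lambda> R\<in>(\<Pi> i\<in>J. X \<cdot> i \<rightarrow> X \<cdot> i \<rightarrow> \<U>
    v). \<Lambda> p\<in>(\<Pi> i\<in>J. is_ordinal (X \<cdot> i) (R \<cdot> i)). sf \<cdot> J \<cdot> X \<cdot> R \<cdot> (\<Lambda> i\<in>J. ord_prop (X \<cdot> i) (R \<cdot> i)
    (p \<cdot> i)) \<cdot> (\<Lambda> i\<in>J. ord_trans (X \<cdot> i) (R \<cdot> i) (p \<cdot> i)) \<cdot> (\<Lambda> i\<in>J. ord_ext (X \<cdot> i) (R \<cdot> i) (p \<cdot> i))
    \<cdot> (\<Lambda> i\<in>J. ord_wf (X \<cdot> i) (R \<cdot> i) (p \<cdot> i)))"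

lemma sup_of_ordinals: "\<langle>\<A>\<rangle> [] \<tturnstile> sup_of_ordinals_T 0"
  by (rule holds_check[OF ctx_Nil list_all_ConsI[OF sup_of_family_closed list_all_Nil], of full
    "sup_of_ordinals_p (bound 0) 1"]) (simp only: expr_eval, simp only: check_eval cong: check_cong)

definition [expr_eval]: "is_upper J al s = (\<Pi> j\<in>J. Sim (car\<^sub>O \<cdot> (al \<cdot> j)) (rel\<^sub>O \<cdot> (al \<cdot> j)) (car\<^sub>O
    \<cdot> s) (rel\<^sub>O \<cdot> s))"

definition [expr_eval]: "sup_type J al = (\<Sigma> s\<in>On\<^sub>O. is_upper J al s \<otimes> (\<Pi> b\<in>On\<^sub>O. is_upper J al b \<rightarrow>
    Sim (car\<^sub>O \<cdot> s) (rel\<^sub>O \<cdot> s) (car\<^sub>O \<cdot> b) (rel\<^sub>O \<cdot> b)))"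

definition [expr_eval]: "Ord_sup_T = (\<Pi> J\<in>\<U> v. \<Pi> al\<in>J \<rightarrow> On\<^sub>O. sup_type J al)"

definition [expr_eval]: "Ord_sup_p oc = (\<Lambda> J\<in>\<U> v. \<Lambda> al\<in>J \<rightarrow> On\<^sub>O. oc \<cdot> J \<cdot> (\<Lambda> i\<in>J. car\<^sub>O \<cdot> (al \<cdot> i))
    \<cdot> (\<Lambda> i\<in>J. rel\<^sub>O \<cdot> (al \<cdot> i)) \<cdot> (\<Lambda> i\<in>J. prf\<^sub>O \<cdot> (al \<cdot> i)) \<cdot> sup_type J al \<cdot> (\<Lambda> W\<in>\<U> v. \<Lambda> lt\<in>W \<rightarrow> W \<rightarrow>
    \<U> v. \<Lambda> w\<in>is_ordinal W lt. \<Lambda> u\<in>(\<Pi> i\<in>J. Sim (car\<^sub>O \<cdot> (al \<cdot> i)) (rel\<^sub>O \<cdot> (al \<cdot> i)) W lt). \<Lambda> l\<in>(\<Pi>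
    B\<in>\<U> v. \<Pi> T\<in>B \<rightarrow> B \<rightarrow> \<U> v. is_ordinal B T \<rightarrow> (\<Pi> i\<in>J. Sim (car\<^sub>O \<cdot> (al \<cdot> i)) (rel\<^sub>O \<cdot> (al \<cdot> i)) B T)
    \<rightarrow> Sim W lt B T). ePair (mkO\<^sub>O \<cdot> W \<cdot> lt \<cdot> w) (ePair (\<Lambda> j\<in>J. simTo\<^sub>O \<cdot> W \<cdot> lt \<cdot> w \<cdot> (al \<cdot> j) \<cdot> (u
    \<cdot> j)) (\<Lambda> b\<in>On\<^sub>O. \<Lambda> h\<in>is_upper J al b. simFrom\<^sub>O \<cdot> W \<cdot> lt \<cdot> w \<cdot> b \<cdot> (l \<cdot> (car\<^sub>O \<cdot> b) \<cdot> (rel\<^sub>O \<cdot>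
    b) \<cdot> (prf\<^sub>O \<cdot> b) \<cdot> h)))))"

lemma Ord_sup: "\<langle>\<A>\<rangle> Ords_ctx \<tturnstile> Ord_sup_T 7"
  by (rule holds_check[OF Ords_ctx_ok list_all_ConsI[OF holds_closed[OF sup_of_ordinals Ords_ctx_ok]
    list_all_Nil], of full "Ord_sup_p (bound 7) 8"])
    (simp only: expr_eval, simp only: check_eval cong: check_cong)

section \<open>Instantiation at the type of ordinals\<close>

text \<open>
  The supremum was derived for an abstract type \<open>On\<close> of ordinals, so that the checker compares
  variables where it would otherwise compare copies of \<open>Ord v\<close>. The abstract data are now replaced by
  closed terms.
\<close>

lemmas ord_eval = ordinal_structure_def Ord_def

abbreviation OrdT :: tm where "OrdT \<equiv> Ord v 0"

text \<open>These are open terms with one free variable per parameter. Every use of the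
  corresponding named operation is a substitution instance, so typing and conversion are settled
  once and carried over by \<open>sub\<close>.\<close>

definition carT :: tm where "carT = carrier v (bound 0) (Suc 0)"
definition strT :: tm where "strT = proj2 (\<U> v) (ordinal_structure v) (bound 0) (Suc 0)"
definition relT :: tm where "relT = relof (bound 0) (bound 1) 2"
definition simT :: tm where "simT = Sim (bound 0) (bound 1) (bound 2) (bound 3) 4"

lemma OrdT_typed: "\<langle>\<A>\<rangle> [] \<turnstile> OrdT \<^bold>: Univ (Suc v)"
  by (rule check_typing[OF ctx_Nil, of full]) (simp only: expr_eval ord_eval, simp only: check_eval cong: check_cong)

lemma Ord_eq: "Ord v n = OrdT"
  by (simp only: expr_eval ord_eval Suc_minus)

lemma carT_typed: "\<langle>\<A>\<rangle> [OrdT] \<turnstile> carT \<^bold>: Univ v"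
  by (rule check_typing[OF typed_ctx[OF typedI[OF OrdT_typed]], of full])
    (simp only: expr_eval ord_eval carT_def carrier_def, simp only: check_eval cong: check_cong)

lemma strT_typed: "\<langle>\<A>\<rangle> [OrdT] \<turnstile> strT \<^bold>: ordinal_structure v (carrier v (bound 0)) (Suc 0)"
  by (rule check_typing[OF typed_ctx[OF typedI[OF OrdT_typed]], of full])
    (simp only: expr_eval ord_eval strT_def carrier_def, simp only: check_eval cong: check_cong)

lemma carrier_eq: "carrier v a n = inst carT (a n)"
  by (simp only: carT_def carrier_def expr_eval ord_eval Suc_minus sub.simps)

lemma str_eq: "proj2 (\<U> v) (ordinal_structure v) a n = inst strT (a n)"
  by (simp only: strT_def carrier_def expr_eval ord_eval Suc_minus sub.simps)

lemma relof_eq: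
  assumes "stable X n" "stable S n"
  shows "relof X S n = inst2 relT (X n) (S n)"
  by (simp add: relT_def relof_def expr_eval Suc_minus sub.simps stableD[OF assms(1)] stableD[OF assms(2)] del: One_nat_def)

lemma Sim_eq:
  assumes "stable A n" "stable R n" "stable B n" "stable S n"
  shows "Sim A R B S n = sub (case_nat (S n) (case_nat (B n) (case_nat (R n) (case_nat (A n) Var)))) simT"
  by (simp add: simT_def expr_eval Suc_minus sub.simps stableD[OF assms(1)] stableD[OF assms(2)] stableD[OF assms(3)] stableD[OF assms(4)])

lemma OrdT_closed: "sub s OrdT = OrdT" "ren r OrdT = OrdT"
  using closed_sub[OF OrdT_typed] closed_ren[OF OrdT_typed] .

definition ostT :: tm where "ostT = ordinal_structure v (bound 0) (Suc 0)"
definition isoT :: tm where "isoT = is_ordinal (bound 0) (bound 1) 2"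
definition prfT :: tm where "prfT = prfof (bound 0) (bound 1) 2"

lemma Univ_ctx: "\<langle>\<A>\<rangle> \<turnstile> [Univ v]"
  by (rule typed_ctx[OF typed_Univ[OF ctx_Nil]])

lemma ostT_typed: "\<langle>\<A>\<rangle> [Univ v] \<turnstile> ostT \<^bold>: Univ (Suc v)"
  by (rule check_typing[OF Univ_ctx, of full]) (simp only: expr_eval ord_eval ostT_def, simp only: check_eval cong: check_cong)

lemma ostT_ctx: "\<langle>\<A>\<rangle> \<turnstile> [ostT, Univ v]"
  by (rule typed_ctx[OF typedI[OF ostT_typed]])

lemma relT_typed: "\<langle>\<A>\<rangle> [ostT, Univ v] \<turnstile> relT \<^bold>: Arr (Var 1) (Arr (Var 1) (Univ v))"
  by (rule check_typing[OF ostT_ctx, of full]) (simp only: expr_eval ord_eval ostT_def relT_def, simp only: check_eval cong: check_cong)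

lemma prfT_typed: "\<langle>\<A>\<rangle> [ostT, Univ v] \<turnstile> prfT \<^bold>: is_ordinal (bound 0) (relof (bound 0) (bound 1)) 2"
  by (rule check_typing[OF ostT_ctx, of full]) (simp only: expr_eval ord_eval ostT_def prfT_def, simp only: check_eval cong: check_cong)

lemma sim_ctx: "\<langle>\<A>\<rangle> \<turnstile> [Arr (Var 0) (Arr (Var 0) (Univ v)), Univ v, Arr (Var 0) (Arr (Var 0) (Univ v)), Univ v] @ []"
  by (rule ctx_okD[OF ctx_Nil, of full]) (simp only: check_eval cong: check_cong)

lemma simT_typed: "\<langle>\<A>\<rangle> [Arr (Var 0) (Arr (Var 0) (Univ v)), Univ v, Arr (Var 0) (Arr (Var 0) (Univ v)), Univ v] \<turnstile> simT \<^bold>: Univ v"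
  by (rule check_typing[OF sim_ctx[unfolded append_Nil2], of full]) (simp only: expr_eval simT_def, simp only: check_eval cong: check_cong)

lemma scopedT:
  "scoped (Suc 0) carT" "scoped (Suc 0) strT" "scoped (Suc 0) ostT" "scoped (Suc (Suc 0)) relT"
  "scoped (Suc (Suc 0)) prfT" "scoped (Suc (Suc (Suc (Suc 0)))) simT" "scoped (Suc (Suc 0)) isoT"
  using typing_scoped(2)[OF carT_typed] typing_scoped(2)[OF strT_typed] typing_scoped(2)[OF ostT_typed]
    typing_scoped(2)[OF relT_typed] typing_scoped(2)[OF prfT_typed] typing_scoped(2)[OF simT_typed]
  by (simp_all add: isoT_def expr_eval)

text \<open>\<open>Sim\<close> as a function of four terms that stays folded: \<open>sub_sim\<close>
  and \<open>sim_conv\<close> let substitution and conversion act on the arguments alone.\<close>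

definition sim :: "tm \<Rightarrow> tm \<Rightarrow> tm \<Rightarrow> tm \<Rightarrow> tm" where
  "sim A R B S = sub (case_nat S (case_nat B (case_nat R (case_nat A Var)))) simT"

lemma sub_sim: "sub s (sim A R B S) = sim (sub s A) (sub s R) (sub s B) (sub s S)"
  unfolding sim_def by (rule sub_scoped[OF scopedT(6)]) (auto simp: less_Suc_eq)

lemma sim_conv: "A \<cong> A' \<Longrightarrow> R \<cong> R' \<Longrightarrow> B \<cong> B' \<Longrightarrow> S \<cong> S' \<Longrightarrow> sim A R B S \<cong> sim A' R' B' S'"
  unfolding sim_def by (rule conv_sub_cong) (auto intro: conv.conv_refl split: nat.split)

lemma inst_conv: "a \<cong> b \<Longrightarrow> inst t a \<cong> inst t b"
  by (rule conv_sub_cong) (auto intro: conv.conv_refl split: nat.split)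

lemma inst2_conv_args: "a \<cong> a' \<Longrightarrow> b \<cong> b' \<Longrightarrow> inst2 t a b \<cong> inst2 t a' b'"
  by (rule conv_sub_cong) (auto intro: conv.conv_refl split: nat.split)

lemma carrier_stable: "stable a n \<Longrightarrow> stable (carrier v a) n"
  by (simp add: stable_def carrier_eq lift_inst_scoped[OF scopedT(1)])

lemma str_stable: "stable a n \<Longrightarrow> stable (proj2 (\<U> v) (ordinal_structure v) a) n"
  by (simp add: stable_def str_eq lift_inst_scoped[OF scopedT(2)])

lemma ord_rel_relof: "ord_rel v a = relof (carrier v a) (proj2 (\<U> v) (ordinal_structure v) a)"
  by (simp add: ord_rel_def relof_def)

lemma ord_rel_eq: "stable a n \<Longrightarrow> ord_rel v a n = inst2 relT (inst carT (a n)) (inst strT (a n))"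
  by (simp add: ord_rel_relof relof_eq carrier_stable str_stable carrier_eq str_eq)

lemma ord_rel_stable: "stable a n \<Longrightarrow> stable (ord_rel v a) n"
  unfolding stable_def[of "ord_rel v a"]
  by (auto simp: ord_rel_eq[OF stable_le] stableD lift_inst2_scoped[OF scopedT(4)]
      lift_inst_scoped[OF scopedT(1)] lift_inst_scoped[OF scopedT(2)])

lemma ord_le_Sim: "ord_le v a b = Sim (carrier v a) (ord_rel v a) (carrier v b) (ord_rel v b)"
  by (simp add: ord_le_def is_simulation_def Sim_def IsSim_def Preserves_def Lifts_def)

lemma ord_le_eq: "stable a n \<Longrightarrow> stable b n \<Longrightarrow>
    ord_le v a b n = sim (carrier v a n) (ord_rel v a n) (carrier v b n) (ord_rel v b n)"
  by (simp add: ord_le_Sim Sim_eq sim_def carrier_stable ord_rel_stable)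

lemma ostT_eq: "stable X n \<Longrightarrow> ordinal_structure v X n = inst ostT (X n)"
  by (simp add: ostT_def ordinal_structure_def expr_eval Suc_minus stableD)

lemma isoT_eq: "stable X n \<Longrightarrow> stable S n \<Longrightarrow> is_ordinal X S n = inst2 isoT (X n) (S n)"
  by (simp add: isoT_def expr_eval Suc_minus stableD)

lemma ctx_sub_Ord: "\<langle>\<A>\<rangle> \<Gamma> \<turnstile> t \<^bold>: OrdT \<Longrightarrow> ctx_sub \<A> \<Gamma> (case_nat t Var) [OrdT]"
  by (rule ctx_sub_snoc[OF ctx_sub_Nil]) (simp add: OrdT_closed)

lemma inst_Var0: "scoped (Suc 0) t \<Longrightarrow> inst t (Var 0) = t"
  using scoped_sub_cong[of "Suc 0" t "case_nat (Var 0) Var" Var] by (simp add: sub_Var)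

lemma carrier_typed:
  assumes "\<langle>\<A>\<rangle> \<Gamma> \<turnstile> a n \<^bold>: OrdT"
  shows "\<langle>\<A>\<rangle> \<Gamma> \<turnstile> carrier v a n \<^bold>: Univ v"
  using typing_sub[OF carT_typed typing_ctx[OF assms] ctx_sub_Ord[OF assms]] by (simp add: carrier_eq)

lemma str_typed:
  assumes "\<langle>\<A>\<rangle> \<Gamma> \<turnstile> a n \<^bold>: OrdT"
  shows "\<langle>\<A>\<rangle> \<Gamma> \<turnstile> inst strT (a n) \<^bold>: inst ostT (carrier v a n)"
proof -
  have "ordinal_structure v (carrier v (bound 0)) (Suc 0) = inst ostT (carrier v (bound 0) (Suc 0))"
    by (intro ostT_eq carrier_stable stable_bound) simp
  moreover have "inst (inst ostT (carrier v (bound 0) (Suc 0))) (a n) = inst ostT (carrier v a n)"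
    by (rule sub_scoped[OF scopedT(3)]) (simp add: carrier_eq bound_def inst_Var0[OF scopedT(1)])
  ultimately show ?thesis
    using typing_sub[OF strT_typed typing_ctx[OF assms] ctx_sub_Ord[OF assms]] by simp
qed

lemma ctx_sub_str:
  assumes "\<langle>\<A>\<rangle> \<Gamma> \<turnstile> a n \<^bold>: OrdT"
  shows "ctx_sub \<A> \<Gamma> (case_nat (inst strT (a n)) (case_nat (carrier v a n) Var)) [ostT, Univ v]"
proof (intro ctx_sub_snoc ctx_sub_Nil)
  show "\<langle>\<A>\<rangle> \<Gamma> \<turnstile> carrier v a n \<^bold>: sub Var (Univ v)" using carrier_typed[of \<Gamma> a n] assms by simp
  show "\<langle>\<A>\<rangle> \<Gamma> \<turnstile> inst strT (a n) \<^bold>: inst ostT (carrier v a n)" using str_typed[of \<Gamma> a n] assms .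
qed

lemma ord_rel_typed:
  assumes "\<langle>\<A>\<rangle> \<Gamma> \<turnstile> a n \<^bold>: OrdT" "stable a n"
  shows "\<langle>\<A>\<rangle> \<Gamma> \<turnstile> ord_rel v a n \<^bold>: Arr (carrier v a n) (Arr (carrier v a n) (Univ v))"
  using typing_sub[OF relT_typed typing_ctx[OF assms(1)] ctx_sub_str[of \<Gamma> a n, OF assms(1)]]
  by (simp add: ord_rel_eq[OF assms(2)] carrier_eq sub_ups_lift)

lemma ord_le_typed:
  assumes a: "\<langle>\<A>\<rangle> \<Gamma> \<turnstile> a n \<^bold>: OrdT" "stable a n" and b: "\<langle>\<A>\<rangle> \<Gamma> \<turnstile> b n \<^bold>: OrdT" "stable b n"
  shows "\<langle>\<A>\<rangle> \<Gamma> \<turnstile> ord_le v a b n \<^bold>: Univ v"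
proof -
  let ?T = "Arr (Var 0) (Arr (Var 0) (Univ v))"
  note c = carrier_typed[of \<Gamma> a n, OF a(1)] carrier_typed[of \<Gamma> b n, OF b(1)]
    ord_rel_typed[of \<Gamma> a n, OF a, simplified] ord_rel_typed[of \<Gamma> b n, OF b, simplified]
  have "ctx_sub \<A> \<Gamma> (case_nat (carrier v a n) Var) [Univ v]"
    by (rule ctx_sub_snoc[OF ctx_sub_Nil]) (simp add: c(1))
  then have "ctx_sub \<A> \<Gamma> (case_nat (ord_rel v a n) (case_nat (carrier v a n) Var)) [?T, Univ v]"
    by (rule ctx_sub_snoc) (simp add: c(3) sub_ups_lift)
  then have "ctx_sub \<A> \<Gamma> (case_nat (carrier v b n) (case_nat (ord_rel v a n) (case_nat (carrier v a n) Var))) [Univ v, ?T, Univ v]"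
    by (rule ctx_sub_snoc) (simp add: c(2))
  then have "ctx_sub \<A> \<Gamma> (case_nat (ord_rel v b n) (case_nat (carrier v b n) (case_nat (ord_rel v a n) (case_nat (carrier v a n) Var))))
      [?T, Univ v, ?T, Univ v]"
    by (rule ctx_sub_snoc) (simp add: c(4) sub_ups_lift)
  from typing_sub[OF simT_typed typing_ctx[OF a(1)] this] show ?thesis
    unfolding ord_le_eq[OF a(2) b(2)] sim_def by (simp only: sub.simps)
qed

lemma bound_var: "bound m n = Var (n - Suc m)"
  by (simp add: bound_def)

section \<open>The statement as a well-formed type\<close>

definition supT :: tm where "supT = closed (Ord_has_small_suprema v)"

lemma supT_eq: "supT = Pi (Univ v) (Pi (Pi (Var 0) OrdT) (Sig OrdT
    (Sig (Pi (Var 2) (ord_le v (bound 1 \<cdot> bound 3) (bound 2) 4))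
      (Pi OrdT (Pi (Pi (Var 4) (ord_le v (bound 1 \<cdot> bound 5) (bound 4) 6)) (ord_le v (bound 2) (bound 4) 6))))))"
  by (simp add: supT_def closed_def Ord_has_small_suprema_def expr_apply eArr_def eProd_def Ord_eq[of "Suc n" for n] numeral_eq_Suc)

text \<open>Built by hand from \<open>ord_le_typed\<close>, so that the definition of ordinals is
  not unfolded at each occurrence. The auxiliary facts \<open>V\<close>, \<open>VO\<close> and
  \<open>VA\<close> type the index type, an ordinal variable and a member of the family.\<close>

lemma supT_typed: "typed \<A> [] supT"
proof -
  have G1: "\<langle>\<A>\<rangle> \<turnstile> [Univ v]" using Univ_ctx .
  have O: "\<langle>\<A>\<rangle> \<Gamma> \<turnstile> OrdT \<^bold>: Univ (Suc v)" if "\<langle>\<A>\<rangle> \<turnstile> \<Gamma>" for \<Gamma>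
    using typing_ren[OF OrdT_typed that, of "\<lambda>k. k"] by (simp add: ctx_ren_def OrdT_closed)
  have OC: "\<langle>\<A>\<rangle> \<turnstile> OrdT # \<Gamma>" if "\<langle>\<A>\<rangle> \<turnstile> \<Gamma>" for \<Gamma>
    using O[OF that] that by (rule ctx_typing.ctx_Cons[rotated])
  have V: "typed \<A> \<Gamma> (Var n)" if "\<langle>\<A>\<rangle> \<turnstile> \<Gamma>" "n < length \<Gamma>" "\<Gamma> ! n = Univ v" for \<Gamma> n
    using ctx_typing.ty_Var[OF that(1,2)] that(3) by (auto intro: typedI)
  have VO: "\<langle>\<A>\<rangle> \<Gamma> \<turnstile> Var n \<^bold>: OrdT" if "\<langle>\<A>\<rangle> \<turnstile> \<Gamma>" "n < length \<Gamma>" "\<Gamma> ! n = OrdT" for \<Gamma> n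
    using ctx_typing.ty_Var[OF that(1,2)] that(3) by (simp add: OrdT_closed)
  \<comment> \<open>The arithmetic condition says that the type of \<open>Var m\<close>, weakened to
    \<open>\<Gamma>\<close>, is the same variable as the domain of \<open>Var n\<close>.\<close>
  have VA: "\<langle>\<A>\<rangle> \<Gamma> \<turnstile> App (Var n) (Var m) \<^bold>: OrdT"
    if "\<langle>\<A>\<rangle> \<turnstile> \<Gamma>" "n < length \<Gamma>" "\<Gamma> ! n = Pi (Var 0) OrdT" "m < length \<Gamma>" "\<Gamma> ! m = Var k" "Suc m + k = Suc n" for \<Gamma> n m k
  proof -
    have "\<langle>\<A>\<rangle> \<Gamma> \<turnstile> Var n \<^bold>: Pi (Var (Suc n)) OrdT"
      using ctx_typing.ty_Var[OF that(1,2)] that(3) by (simp add: OrdT_closed)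
    moreover have "\<langle>\<A>\<rangle> \<Gamma> \<turnstile> Var m \<^bold>: Var (Suc n)"
      using ctx_typing.ty_Var[OF that(1,4)] that(5,6) by simp
    ultimately show ?thesis using ctx_typing.ty_App by (fastforce simp: OrdT_closed)
  qed
  let ?G2 = "[Pi (Var 0) OrdT, Univ v]"
  let ?G3 = "OrdT # ?G2"
  have t2: "typed \<A> [Univ v] (Pi (Var 0) OrdT)"
  proof (rule typed_Pi)
    show v: "typed \<A> [Univ v] (Var 0)" using V[OF G1, of 0] by simp
    show "typed \<A> [Var 0, Univ v] OrdT" using O[OF typed_ctx[OF v]] by (rule typedI)
  qed
  have G2: "\<langle>\<A>\<rangle> \<turnstile> ?G2" using typed_ctx[OF t2] .
  have G3: "\<langle>\<A>\<rangle> \<turnstile> ?G3" using OC[OF G2] .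
  have v2: "typed \<A> ?G3 (Var 2)" using V[OF G3, of 2] by simp
  have G4: "\<langle>\<A>\<rangle> \<turnstile> Var 2 # ?G3" using typed_ctx[OF v2] .
  have "\<langle>\<A>\<rangle> Var 2 # ?G3 \<turnstile> ord_le v (bound 1 \<cdot> bound 3) (bound 2) 4 \<^bold>: Univ v"
    by (rule ord_le_typed) (auto simp: expr_apply(5) bound_var intro!: VA[OF G4] VO[OF G4] stable_App stable_bound)
  then have p1: "typed \<A> ?G3 (Pi (Var 2) (ord_le v (bound 1 \<cdot> bound 3) (bound 2) 4))"
    by (rule typed_Pi[OF v2 typedI])
  let ?P1 = "Pi (Var 2) (ord_le v (bound 1 \<cdot> bound 3) (bound 2) 4)"
  have G4': "\<langle>\<A>\<rangle> \<turnstile> ?P1 # ?G3" using typed_ctx[OF p1] .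
  have G5: "\<langle>\<A>\<rangle> \<turnstile> OrdT # ?P1 # ?G3" using OC[OF G4'] .
  have v4: "typed \<A> (OrdT # ?P1 # ?G3) (Var 4)" using V[OF G5, of 4] by simp
  have G6: "\<langle>\<A>\<rangle> \<turnstile> Var 4 # OrdT # ?P1 # ?G3" using typed_ctx[OF v4] .
  have "\<langle>\<A>\<rangle> Var 4 # OrdT # ?P1 # ?G3 \<turnstile> ord_le v (bound 1 \<cdot> bound 5) (bound 4) 6 \<^bold>: Univ v"
    by (rule ord_le_typed) (auto simp: expr_apply(5) bound_var intro!: VA[OF G6[simplified]] VO[OF G6[simplified]] stable_App stable_bound)
  then have p2: "typed \<A> (OrdT # ?P1 # ?G3) (Pi (Var 4) (ord_le v (bound 1 \<cdot> bound 5) (bound 4) 6))"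
    by (rule typed_Pi[OF v4 typedI])
  let ?P2 = "Pi (Var 4) (ord_le v (bound 1 \<cdot> bound 5) (bound 4) 6)"
  have G6': "\<langle>\<A>\<rangle> \<turnstile> ?P2 # OrdT # ?P1 # ?G3" using typed_ctx[OF p2] .
  have "\<langle>\<A>\<rangle> ?P2 # OrdT # ?P1 # ?G3 \<turnstile> ord_le v (bound 2) (bound 4) 6 \<^bold>: Univ v"
    by (rule ord_le_typed) (auto simp: bound_var intro!: VO[OF G6'[simplified]] stable_bound)
  then have "typed \<A> (?P1 # ?G3) (Pi OrdT (Pi ?P2 (ord_le v (bound 2) (bound 4) 6)))"
    by (intro typed_Pi[OF typedI[OF O[OF G4']]] typed_Pi[OF p2 typedI])
  then have "typed \<A> ?G2 (Sig OrdT (Sig ?P1 (Pi OrdT (Pi ?P2 (ord_le v (bound 2) (bound 4) 6)))))"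
    by (intro typed_Sig[OF typedI[OF O[OF G2]]] typed_Sig[OF p1])
  then show ?thesis
    unfolding supT_eq by (intro typed_Pi[OF typed_Univ[OF ctx_Nil]] typed_Pi[OF t2])
qed

section \<open>Closed terms for the abstract data\<close>

definition cart :: tm where "cart = Lam OrdT carT"
definition relt :: tm where "relt = Lam OrdT (ord_rel v (bound 0) (Suc 0))"
definition prft :: tm where "prft = Lam OrdT (inst2 prfT carT strT)"
definition mkt :: tm where
  "mkt = (\<Lambda> W\<in>\<U> v. \<Lambda> lt\<in>W \<rightarrow> W \<rightarrow> \<U> v. \<Lambda> p\<in>is_ordinal W lt. ePair W (ePair lt p)) 0"

lemma Ord_ctx: "\<langle>\<A>\<rangle> \<turnstile> [OrdT]"
  by (rule typed_ctx[OF typedI[OF OrdT_typed]])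

lemma Var_Ord: "\<langle>\<A>\<rangle> [OrdT] \<turnstile> bound 0 (Suc 0) \<^bold>: OrdT"
  using ctx_typing.ty_Var[OF Ord_ctx, of 0] by (simp add: bound_def OrdT_closed)

lemma carT_alt: "carT = carrier v (bound 0) (Suc 0)"
  by (simp add: carT_def)

lemma cart_typed: "\<langle>\<A>\<rangle> [] \<turnstile> cart \<^bold>: Pi OrdT (Univ v)"
  unfolding cart_def by (rule ctx_typing.ty_Lam[OF OrdT_typed carT_typed])

lemma relt_typed: "\<langle>\<A>\<rangle> [] \<turnstile> relt \<^bold>: Pi OrdT (Arr carT (Arr carT (Univ v)))"
  unfolding relt_def carT_alt
  by (rule ctx_typing.ty_Lam[OF OrdT_typed ord_rel_typed[of _ "bound 0" "Suc 0", OF Var_Ord stable_bound]]) simp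

lemma prft_typed: "\<langle>\<A>\<rangle> [] \<turnstile> prft \<^bold>: Pi OrdT (inst2 isoT carT (ord_rel v (bound 0) (Suc 0)))"
proof -
  have s: "stable (bound 0) (Suc 0)" by (simp add: stable_bound)
  have c: "ctx_sub \<A> [OrdT] (case_nat strT (case_nat carT Var)) [ostT, Univ v]"
    using ctx_sub_str[of _ "bound 0" "Suc 0", OF Var_Ord] by (simp add: carrier_eq bound_var inst_Var0[OF scopedT(1)] inst_Var0[OF scopedT(2)])
  have e: "is_ordinal (bound 0) (relof (bound 0) (bound 1)) 2 = inst2 isoT (Var 1) relT"
  proof -
    have sr: "stable (relof (bound 0) (bound 1)) 2"
      unfolding stable_def
      by (auto simp: relof_eq[OF stable_bound stable_bound] bound_var lift_inst2_scoped[OF scopedT(4)] Suc_diff_Suc)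
    have "is_ordinal (bound 0) (relof (bound 0) (bound 1)) 2 = inst2 isoT (bound 0 2) (relof (bound 0) (bound 1) 2)"
      by (intro isoT_eq sr stable_bound) simp
    then show ?thesis by (simp add: relT_def bound_var)
  qed
  have "sub (case_nat strT (case_nat carT Var)) (inst2 isoT (Var 1) relT) = inst2 isoT carT (ord_rel v (bound 0) (Suc 0))"
    by (rule sub_scoped[OF scopedT(7)])
      (auto simp: less_Suc_eq ord_rel_eq[OF s] bound_var inst_Var0[OF scopedT(1)] inst_Var0[OF scopedT(2)])
  then have "\<langle>\<A>\<rangle> [OrdT] \<turnstile> inst2 prfT carT strT \<^bold>: inst2 isoT carT (ord_rel v (bound 0) (Suc 0))"
    using typing_sub[OF prfT_typed[unfolded e] Ord_ctx c] by simp
  then show ?thesis unfolding prft_def by (rule ctx_typing.ty_Lam[OF OrdT_typed])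
qed

lemma mkt_typed: "\<langle>\<A>\<rangle> [] \<turnstile> mkt \<^bold>: (\<Pi> W\<in>\<U> v. \<Pi> lt\<in>W \<rightarrow> W \<rightarrow> \<U> v. is_ordinal W lt \<rightarrow> Ord v) 0"
  by (rule check_typing[OF ctx_Nil, of full])
    (simp only: expr_eval ord_eval mkt_def, simp only: check_eval cong: check_cong)

lemma closedT: "sub s cart = cart" "ren r cart = cart" "sub s relt = relt" "ren r relt = relt"
  "sub s prft = prft" "ren r prft = prft" "sub s mkt = mkt" "ren r mkt = mkt"
  using closed_sub closed_ren cart_typed relt_typed prft_typed mkt_typed by blast+

lemma cart_app: "App cart (a n) \<cong> carrier v a n"
  unfolding cart_def carrier_eq by (rule conv.beta)

lemma relt_app: "stable a n \<Longrightarrow> App relt (a n) \<cong> ord_rel v a n"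
proof -
  assume a: "stable a n"
  have "inst (inst2 relT carT strT) (a n) = inst2 relT (inst carT (a n)) (inst strT (a n))"
    by (rule sub_scoped[OF scopedT(4)]) (auto simp: less_Suc_eq)
  moreover have "ord_rel v (bound 0) (Suc 0) = inst2 relT carT strT"
    using ord_rel_eq[OF stable_bound, of 0 "Suc 0"] by (simp add: bound_var inst_Var0[OF scopedT(1)] inst_Var0[OF scopedT(2)])
  ultimately show ?thesis using conv.beta[of OrdT "ord_rel v (bound 0) (Suc 0)" "a n"]
    by (simp add: relt_def ord_rel_eq[OF a])
qed

lemma carT_Pair: "inst carT (Pair a b) \<cong> a"
proof -
  obtain C B where "inst carT (Pair a b) = IndSig C (Lam (Univ v) (Lam B (Var 1))) (Pair a b)"
    by (simp add: carT_def carrier_def expr_eval)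
  then show ?thesis using conv.comp_Sig App2_fst by (metis conv.conv_trans)
qed

lemma strT_Pair: "inst strT (Pair a b) \<cong> b"
proof -
  obtain C B where "inst strT (Pair a b) = IndSig C (Lam (Univ v) (Lam B (Var 0))) (Pair a b)"
    by (simp add: strT_def expr_eval)
  then show ?thesis using conv.comp_Sig App2_snd by (metis conv.conv_trans)
qed

lemma relT_Pair: "inst2 relT W (Pair a b) \<cong> a"
proof -
  obtain C A B where "inst2 relT W (Pair a b) = IndSig C (Lam A (Lam B (Var 1))) (Pair a b)"
    by (simp add: relT_def relof_def expr_eval)
  then show ?thesis using conv.comp_Sig App2_fst by (metis conv.conv_trans)
qed

lemma mkt_app: "App3 mkt W l p \<cong> Pair W (Pair l p)"
proof -
  obtain A B C where "mkt = Lam A (Lam B (Lam C (Pair (Var 2) (Pair (Var 1) (Var 0)))))"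
    by (simp add: mkt_def expr_eval numeral_2_eq_2)
  then show ?thesis using App3_triple by simp
qed

text \<open>This and \<open>relt_mkt\<close> are why the two transfer principles of
  \<open>Ords_ctx\<close> become identity functions.\<close>

lemma cart_mkt: "App cart (App3 mkt W l p) \<cong> W"
  unfolding cart_def
  using conv.beta inst_conv[OF mkt_app] carT_Pair by (blast intro: conv.conv_trans)

lemma relt_mkt: "App relt (App3 mkt W l p) \<cong> l"
proof -
  let ?t = "App3 mkt W l p"
  \<comment> \<open>\<open>relt_app\<close> speaks of an \<open>expr\<close>; weakening
    \<open>?t\<close> by the depth turns the term into a stable one.\<close>
  have "App relt ((\<lambda>n. ren (shift n) ?t) 0) \<cong> ord_rel v (\<lambda>n. ren (shift n) ?t) 0"
    by (rule relt_app) (simp add: stable_def ren_ren)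
  moreover have "ord_rel v (\<lambda>n. ren (shift n) ?t) 0 = inst2 relT (inst carT ?t) (inst strT ?t)"
    by (subst ord_rel_eq) (simp_all add: stable_def ren_ren ren_id)
  moreover have "inst2 relT (inst carT ?t) (inst strT ?t) \<cong> inst2 relT W (Pair l p)"
    using inst_conv[OF mkt_app] carT_Pair strT_Pair by (intro inst2_conv_args) (blast intro: conv.conv_trans)+
  ultimately show ?thesis using relT_Pair by (simp add: ren_id) (blast intro: conv.conv_trans)
qed

lemma Sim_sim:
  "stable A n \<Longrightarrow> stable R n \<Longrightarrow> stable B n \<Longrightarrow> stable S n \<Longrightarrow> Sim A R B S n = sim (A n) (R n) (B n) (S n)"
  by (simp add: Sim_eq sim_def)

lemma sub_iso: "sub s (inst2 isoT a b) = inst2 isoT (sub s a) (sub s b)"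
  by (rule sub_scoped[OF scopedT(7)]) (auto simp: less_Suc_eq)

lemma ren_sim: "ren r (sim A R B S) = sim (ren r A) (ren r R) (ren r B) (ren r S)"
  by (simp add: ren_eq_sub sub_sim)

text \<open>Written with \<open>isoT\<close> and \<open>sim\<close>, so that substituting into an
  entry only touches their arguments.\<close>

lemma Ords_ctx_eq: "Ords_ctx = [
  Pi (Univ v) (Pi (Pi (Var 0) (Pi (Var 1) (Univ v))) (Pi (inst2 isoT (Var 1) (Var 0)) (Pi (Var 8)
    (Pi (sim (Var 3) (Var 2) (App (Var 8) (Var 0)) (App (Var 7) (Var 0)))
        (sim (App (Var 9) (App3 (Var 6) (Var 4) (Var 3) (Var 2))) (App (Var 8) (App3 (Var 6) (Var 4) (Var 3) (Var 2)))
          (App (Var 9) (Var 1)) (App (Var 8) (Var 1))))))),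
  Pi (Univ v) (Pi (Pi (Var 0) (Pi (Var 1) (Univ v))) (Pi (inst2 isoT (Var 1) (Var 0)) (Pi (Var 7)
    (Pi (sim (App (Var 7) (Var 0)) (App (Var 6) (Var 0)) (Var 3) (Var 2))
        (sim (App (Var 8) (Var 1)) (App (Var 7) (Var 1))
          (App (Var 8) (App3 (Var 5) (Var 4) (Var 3) (Var 2))) (App (Var 7) (App3 (Var 5) (Var 4) (Var 3) (Var 2)))))))),
  Pi (Univ v) (Pi (Pi (Var 0) (Pi (Var 1) (Univ v))) (Pi (inst2 isoT (Var 1) (Var 0)) (Var 6))),
  Pi (Var 2) (inst2 isoT (App (Var 2) (Var 0)) (App (Var 1) (Var 0))),
  Pi (Var 1) (Pi (App (Var 1) (Var 0)) (Pi (App (Var 2) (Var 1)) (Univ v))),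
  Pi (Var 0) (Univ v),
  Univ (Suc v)]"
  unfolding Ords_ctx_def
  by (simp add: expr_apply eArr_def Sim_sim isoT_eq stable_App stable_bound)

lemma Ord_sup_T_eq: "Ord_sup_T 7 = Pi (Univ v) (Pi (Pi (Var 0) (Var 8)) (Sig (Var 8)
  (Sig (Pi (Var 2) (sim (App (Var 9) (App (Var 2) (Var 0))) (App (Var 8) (App (Var 2) (Var 0))) (App (Var 9) (Var 1)) (App (Var 8) (Var 1))))
    (Pi (Var 10) (Pi (Pi (Var 4) (sim (App (Var 11) (App (Var 4) (Var 0))) (App (Var 10) (App (Var 4) (Var 0))) (App (Var 11) (Var 1)) (App (Var 10) (Var 1))))
      (sim (App (Var 11) (Var 3)) (App (Var 10) (Var 3)) (App (Var 11) (Var 1)) (App (Var 10) (Var 1))))))))"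
  by (simp add: Ord_sup_T_def sup_type_def is_upper_def eProd_def expr_apply eArr_def Sim_sim stable_App stable_bound)

lemma ord_le_conv:
  assumes "stable a n" "stable b n"
  shows "sim (App cart (a n)) (App relt (a n)) (App cart (b n)) (App relt (b n)) \<cong> ord_le v a b n"
  unfolding ord_le_eq[OF assms] by (intro sim_conv cart_app relt_app assms)

lemma Ords_ctxD:
  "\<langle>\<A>\<rangle> \<turnstile> drop n Ords_ctx"
proof -
  have "\<langle>\<A>\<rangle> \<turnstile> drop n \<Gamma>" if "\<langle>\<A>\<rangle> \<turnstile> \<Gamma>" for \<Gamma>
    using that
  proof (induction n arbitrary: \<Gamma>)
    case (Suc n)
    then show ?case by (cases \<Gamma>) (auto dest: ctx_ConsD)
  qed simp
  then show ?thesis using Ords_ctx_ok by blast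
qed

text \<open>The context is instantiated from its oldest variable on. The values at 0 and 1 remain
  existential: they are identity functions up to conversion, and \<open>Ord_sup_T\<close> does not
  mention them.\<close>

lemma Ords_sub:
  obtains s where "ctx_sub \<A> [] s Ords_ctx"
    "s 2 = mkt" "s 3 = prft" "s 4 = relt" "s 5 = cart" "s 6 = OrdT"
proof -
  note c = Ords_ctxD[unfolded Ords_ctx_eq]
  let ?s2 = "case_nat cart (case_nat OrdT Var)"
  let ?s3 = "case_nat relt ?s2"
  let ?s4 = "case_nat prft ?s3"
  let ?s5 = "case_nat mkt ?s4"
  have carT: "carT \<cong> App cart (Var 0)"
    using conv.conv_sym[OF cart_app[of "bound 0" "Suc 0"]] by (simp add: bound_var carT_def)
  have relT: "ord_rel v (bound 0) (Suc 0) \<cong> App relt (Var 0)"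
    using conv.conv_sym[OF relt_app[of "bound 0" "Suc 0"]] by (simp add: bound_var stable_bound)
  have "ctx_sub \<A> [] (case_nat OrdT Var) (drop 6 Ords_ctx)"
    unfolding Ords_ctx_eq by (simp add: ctx_sub_snoc[OF ctx_sub_Nil] OrdT_typed)
  then have s2: "ctx_sub \<A> [] ?s2 (drop 5 Ords_ctx)"
    unfolding Ords_ctx_eq by (simp add: ctx_sub_snoc cart_typed)
  have "Pi OrdT (Arr carT (Arr carT (Univ v))) \<cong> sub ?s2 (Ords_ctx ! 4)"
    unfolding Ords_ctx_eq using carT conv_ren[OF carT, of Suc]
    by (auto simp: numeral_2_eq_2 closedT OrdT_closed intro!: conv.cong_Pi conv.conv_refl)
  from ctx_sub_step[OF _ s2 relt_typed this] c[of 4] have s3: "ctx_sub \<A> [] ?s3 (drop 4 Ords_ctx)"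
    unfolding Ords_ctx_eq by simp
  have "Pi OrdT (inst2 isoT carT (ord_rel v (bound 0) (Suc 0))) \<cong> sub ?s3 (Ords_ctx ! 3)"
    unfolding Ords_ctx_eq using carT relT
    by (auto simp: numeral_2_eq_2 closedT OrdT_closed sub_iso intro!: conv.cong_Pi conv.conv_refl inst2_conv_args)
  from ctx_sub_step[OF _ s3 prft_typed this] c[of 3] have s4: "ctx_sub \<A> [] ?s4 (drop 3 Ords_ctx)"
    unfolding Ords_ctx_eq by simp
  have "(\<Pi> W\<in>\<U> v. \<Pi> lt\<in>W \<rightarrow> W \<rightarrow> \<U> v. is_ordinal W lt \<rightarrow> Ord v) 0 \<cong> sub ?s4 (Ords_ctx ! 2)"
    unfolding Ords_ctx_eq
    by (simp add: expr_apply eArr_def isoT_eq stable_bound sub_iso OrdT_closed Ord_eq[of "Suc n" for n]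
        conv.conv_refl numeral_eq_Suc)
  from ctx_sub_step[OF _ s4 mkt_typed this] c[of 2] have s5: "ctx_sub \<A> [] ?s5 (drop 2 Ords_ctx)"
    unfolding Ords_ctx_eq by simp
  obtain a where s6: "ctx_sub \<A> [] (case_nat a ?s5) (drop 1 Ords_ctx)"
  proof (rule ctx_sub_exists[OF _ ctx_Nil s5, where A = "Ords_ctx ! 1"])
    show "\<langle>\<A>\<rangle> \<turnstile> Ords_ctx ! 1 # drop 2 Ords_ctx" using c[of 1] unfolding Ords_ctx_eq by simp
    show "\<exists>t. \<langle>\<A>\<rangle> [] \<turnstile> t \<^bold>: sub ?s5 (Ords_ctx ! 1)" if "typed \<A> [] (sub ?s5 (Ords_ctx ! 1))"
      using that unfolding Ords_ctx_eq
      by (simp add: sub_sim sub_iso closedT OrdT_closed numeral_eq_Suc)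
        (erule exists_id5, auto simp: ren_sim closedT intro!: sim_conv conv.conv_refl conv.conv_sym[OF cart_mkt] conv.conv_sym[OF relt_mkt])
  qed (simp add: Ords_ctx_eq)
  obtain b where "ctx_sub \<A> [] (case_nat b (case_nat a ?s5)) Ords_ctx"
  proof (rule ctx_sub_exists[OF _ ctx_Nil s6, where A = "Ords_ctx ! 0"])
    show "\<langle>\<A>\<rangle> \<turnstile> Ords_ctx ! 0 # drop 1 Ords_ctx" using c[of 0] unfolding Ords_ctx_eq by simp
    show "\<exists>t. \<langle>\<A>\<rangle> [] \<turnstile> t \<^bold>: sub (case_nat a ?s5) (Ords_ctx ! 0)"
      if "typed \<A> [] (sub (case_nat a ?s5) (Ords_ctx ! 0))"
      using that unfolding Ords_ctx_eq
      by (simp add: sub_sim sub_iso closedT OrdT_closed numeral_eq_Suc)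
        (erule exists_id5, auto simp: ren_sim closedT intro!: sim_conv conv.conv_refl conv.conv_sym[OF cart_mkt] conv.conv_sym[OF relt_mkt])
  qed (simp add: Ords_ctx_eq)
  then show thesis by (rule that) (simp_all add: eval_nat_numeral)
qed

text \<open>The two types are not syntactically equal: \<open>cart\<close> and \<open>relt\<close>
  are abstractions still to be applied, while the statement contains the projections
  themselves.\<close>

lemma sup_conv:
  assumes "s 5 = cart" "s 4 = relt" "s 6 = OrdT"
  shows "sub s (Ord_sup_T 7) \<cong> supT"
proof -
  have "s (Suc (Suc (Suc (Suc 0)))) = relt" "s (Suc (Suc (Suc (Suc (Suc 0))))) = cart" "s (Suc (Suc (Suc (Suc (Suc (Suc 0)))))) = OrdT"
    using assms by (simp_all add: eval_nat_numeral)
  moreover have "sim (App cart (App (Var 2) (Var 0))) (App relt (App (Var 2) (Var 0))) (App cart (Var 1)) (App relt (Var 1))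
      \<cong> ord_le v (bound 1 \<cdot> bound 3) (bound 2) 4"
    using ord_le_conv[of "bound 1 \<cdot> bound 3" 4 "bound 2"] by (simp add: stable_App stable_bound expr_apply)
  moreover have "sim (App cart (App (Var 4) (Var 0))) (App relt (App (Var 4) (Var 0))) (App cart (Var 1)) (App relt (Var 1))
      \<cong> ord_le v (bound 1 \<cdot> bound 5) (bound 4) 6"
    using ord_le_conv[of "bound 1 \<cdot> bound 5" 6 "bound 4"] by (simp add: stable_App stable_bound expr_apply)
  moreover have "sim (App cart (Var 3)) (App relt (Var 3)) (App cart (Var 1)) (App relt (Var 1)) \<cong> ord_le v (bound 2) (bound 4) 6"
    using ord_le_conv[of "bound 2" 6 "bound 4"] by (simp add: stable_bound bound_var)
  ultimately show ?thesis
    unfolding supT_eq Ord_sup_T_eq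
    by (auto simp: sub_sim closedT OrdT_closed numeral_eq_Suc intro!: conv.cong_Pi conv.cong_Sig conv.conv_refl)
qed

lemma Ord_suprema: "\<langle>\<A>\<rangle> \<tturnstile> Ord_has_small_suprema v"
proof -
  obtain s where s: "ctx_sub \<A> [] s Ords_ctx" "s 4 = relt" "s 5 = cart" "s 6 = OrdT" using Ords_sub by blast
  obtain t where "\<langle>\<A>\<rangle> Ords_ctx \<turnstile> t \<^bold>: Ord_sup_T 7" using Ord_sup by (auto simp: holds_def)
  from typing_sub[OF this ctx_Nil s(1)] show ?thesis
    using typed_conv[OF _ sup_conv[OF s(3,2,4)] supT_typed] unfolding inhabited_def supT_def by blast
qed

end

theorem theorem5p13:
  fixes \<A> :: "tm set" and v :: nat
  assumes function_extensionality: "\<And>i j. \<langle>\<A>\<rangle> \<tturnstile> funext i j"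
    and propositional_extensionality: "\<And>i. \<langle>\<A>\<rangle> \<tturnstile> propext i"
    and set_replacement: "\<And>u w k l. \<langle>\<A>\<rangle> \<tturnstile> set_replacement u w k l"
    and univalence: "\<langle>\<A>\<rangle> \<tturnstile> univalent v"
  shows "\<langle>\<A>\<rangle> \<tturnstile> Ord_has_small_suprema v"
proof -
  interpret extensional_type_theory \<A> v
    by unfold_locales (fact function_extensionality propositional_extensionality set_replacement)+
  show ?thesis by (rule Ord_suprema)
qed

end
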